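(* Let $n\ge2$. The group $\mathrm{Aut}(K\rtimes\mathcal{B}_n)$ is generated by the inner automorphisms and the automorphism $\epsilon_n$. Thus $$\mathrm{Aut}(K\rtimes\mathcal{B}_n)=\mathrm{Inn}(K\rtimes\mathcal{B}_n)\rtimes\langle\epsilon_n\rangle\cong\big((K\rtimes\mathcal{B}_n)/Z(K\rtimes\mathcal{B}_n)\big)\rtimes C_2,$$ where $Z(K\rtimes\mathcal{B}_n)$ denotes the centre of $K\rtimes\mathcal{B}_n$. In particular, $\mathrm{Out}(K\rtimes\mathcal{B}_n)\cong C_2$.
   Context: $\mathcal{B}_n$ is the $n$-string braid group with standard generators $\alpha_1,\dots,\alpha_{n-1}$ (relations $\alpha_i\alpha_{i+1}\alpha_i=\alpha_{i+1}\alpha_i\alpha_{i+1}$, and $\alpha_i\alpha_j=\alpha_j\alpha_i$ for $|i-j|\ge2$). $K=\langle x_1,\dots,x_n\mid x_i^2=1,\ 1\le i\le n\rangle$ is the free product of $n$ copies of the group $C_2$ of order 2. The semidirect product $K\rtimes\mathcal{B}_n$ is formed via the representation $\rho^+:\mathcal{B}_n\to\mathrm{Aut}(K)$ for which $\alpha_i$ sends $x_i\mapsto x_{i+1}$, $x_{i+1}\mapsto x_{i+1}x_ix_{i+1}$, $x_j\mapsto x_j$ for $j\notin\{i,i+1\}$; so $\gamma k\gamma^{-1}=\rho^+(\gamma)(k)$ for $\gamma\in\mathcal{B}_n$, $k\in K$. $\epsilon_n$ is the (well-defined) automorphism of $K\rtimes\mathcal{B}_n$ determined by $\epsilon_n(x_1)=x_1$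 and $\epsilon_n(\alpha_i)=\alpha_i^{-1}$ for $1\le i\le n-1$. *)

theory Defs
  imports "HOL-Algebra.Algebra"
begin

section \<open>Groups given by generators and relations\<close>

text \<open>A letter \<open>(a, True)\<close> stands for the generator \<open>a\<close> and \<open>(a, False)\<close> for its formal inverse.
  A relation \<open>l = r\<close> is a pair of words; the presented group consists of the words in the
  generators modulo the congruence generated by free cancellation and the relations.\<close>

type_synonym 'a word = "('a \<times> bool) list"

abbreviation words :: "'a set \<Rightarrow> 'a word set" where
  "words S \<equiv> lists (S \<times> UNIV)"

inductive_set pres_rel :: "'a set \<Rightarrow> ('a word \<times> 'a word) set \<Rightarrow> ('a word \<times> 'a word) set"
  for S R where
    refl: "w \<in> words S \<Longrightarrow> (w, w) \<in> pres_rel S R"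
  | sym: "(v, w) \<in> pres_rel S R \<Longrightarrow> (w, v) \<in> pres_rel S R"
  | trans: "(u, v) \<in> pres_rel S R \<Longrightarrow> (v, w) \<in> pres_rel S R \<Longrightarrow> (u, w) \<in> pres_rel S R"
  | cancel: "u \<in> words S \<Longrightarrow> v \<in> words S \<Longrightarrow> a \<in> S \<Longrightarrow>
      (u @ [(a, e), (a, \<not> e)] @ v, u @ v) \<in> pres_rel S R"
  | relation: "u \<in> words S \<Longrightarrow> v \<in> words S \<Longrightarrow> (l, r) \<in> R \<Longrightarrow> l \<in> words S \<Longrightarrow> r \<in> words S \<Longrightarrow>
      (u @ l @ v, u @ r @ v) \<in> pres_rel S R"

definition presented_group :: "'a set \<Rightarrow> ('a word \<times> 'a word) set \<Rightarrow> 'a word set monoid" where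
  "presented_group S R =
    \<lparr>carrier = words S // pres_rel S R,
     monoid.mult = (\<lambda>A B. \<Union>a\<in>A. \<Union>b\<in>B. pres_rel S R `` {a @ b}),
     monoid.one = pres_rel S R `` {[]}\<rparr>"

definition pres_gen :: "'a set \<Rightarrow> ('a word \<times> 'a word) set \<Rightarrow> 'a \<Rightarrow> 'a word set" where
  "pres_gen S R a = pres_rel S R `` {[(a, True)]}"

fun word_eval :: "('g, 'm) monoid_scheme \<Rightarrow> ('a \<Rightarrow> 'g) \<Rightarrow> 'a word \<Rightarrow> 'g" where
  "word_eval H f [] = \<one>\<^bsub>H\<^esub>"
| "word_eval H f ((a, e) # w) = (if e then f a else inv\<^bsub>H\<^esub> f a) \<otimes>\<^bsub>H\<^esub> word_eval H f w"

text \<open>The homomorphism from the presented group to \<open>H\<close> which sends each generator \<open>a\<close> to \<open>f a\<close>;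
  it is meaningful when \<open>f\<close> respects the relations (see \<open>pres_lift_hom\<close>).\<close>

definition pres_lift ::
  "'a set \<Rightarrow> ('a word \<times> 'a word) set \<Rightarrow> ('g, 'm) monoid_scheme \<Rightarrow> ('a \<Rightarrow> 'g) \<Rightarrow> 'a word set \<Rightarrow> 'g" where
  "pres_lift S R H f = (\<lambda>A\<in>carrier (presented_group S R). the_elem (word_eval H f ` A))"

lemma pres_rel_words: "(v, w) \<in> pres_rel S R \<Longrightarrow> v \<in> words S \<and> w \<in> words S"
  by (induction rule: pres_rel.induct) auto

lemma equiv_pres_rel: "equiv (words S) (pres_rel S R)"
proof (rule equivI)
  show "pres_rel S R \<subseteq> words S \<times> words S" by (auto simp del: in_lists_conv_set in_listsD dest: pres_rel_words)
  show "refl_on (words S) (pres_rel S R)" by (auto intro!: refl_onI pres_rel.refl)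
  show "sym (pres_rel S R)" by (auto intro: symI pres_rel.sym)
  show "trans (pres_rel S R)" by (auto intro: transI pres_rel.trans)
qed

lemma pres_rel_context:
  "(v, w) \<in> pres_rel S R \<Longrightarrow> p \<in> words S \<Longrightarrow> q \<in> words S \<Longrightarrow> (p @ v @ q, p @ w @ q) \<in> pres_rel S R"
proof (induction rule: pres_rel.induct)
  case (refl w) then show ?case by (intro pres_rel.refl) auto
next
  case (sym v w) then show ?case by (blast intro: pres_rel.sym)
next
  case (trans u v w) then show ?case by (blast intro: pres_rel.trans)
next
  case (cancel u v a e)
  then show ?case using pres_rel.cancel[of "p @ u" S "v @ q" a e R] by auto
next
  case (relation u v l r)
  then show ?case using pres_rel.relation[of "p @ u" S "v @ q" l r R] by auto
qed

lemma pres_rel_append: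
  assumes "(v, v') \<in> pres_rel S R" "(w, w') \<in> pres_rel S R"
  shows "(v @ w, v' @ w') \<in> pres_rel S R"
proof -
  have "(v @ w, v' @ w) \<in> pres_rel S R"
    using pres_rel_context[OF assms(1), of "[]" w] pres_rel_words[OF assms(2)] by simp
  moreover have "(v' @ w, v' @ w') \<in> pres_rel S R"
    using pres_rel_context[OF assms(2), of v' "[]"] pres_rel_words[OF assms(1)] by simp
  ultimately show ?thesis by (rule pres_rel.trans)
qed

lemma pres_mult:
  assumes "v \<in> words S" "w \<in> words S"
  shows "pres_rel S R `` {v} \<otimes>\<^bsub>presented_group S R\<^esub> pres_rel S R `` {w} = pres_rel S R `` {v @ w}"
proof -
  have "pres_rel S R `` {a @ b} = pres_rel S R `` {v @ w}"
    if "a \<in> pres_rel S R `` {v}" "b \<in> pres_rel S R `` {w}" for a b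
    using that pres_rel_append[of v a S R w b] equiv_class_eq[OF equiv_pres_rel] by force
  moreover have "v \<in> pres_rel S R `` {v}" "w \<in> pres_rel S R `` {w}"
    using assms by (auto intro: pres_rel.refl)
  ultimately have "(\<Union>a\<in>pres_rel S R `` {v}. \<Union>b\<in>pres_rel S R `` {w}. pres_rel S R `` {a @ b})
      = pres_rel S R `` {v @ w}"
    by blast
  then show ?thesis by (simp add: presented_group_def)
qed

lemma pres_carrier: "carrier (presented_group S R) = (\<lambda>w. pres_rel S R `` {w}) ` words S"
  by (auto simp: presented_group_def quotient_def)

lemma pres_one: "\<one>\<^bsub>presented_group S R\<^esub> = pres_rel S R `` {[]}"
  by (simp add: presented_group_def)

lemma pres_letter_cancel:
  assumes "a \<in> S"
  shows "pres_rel S R `` {[(a, e)]} \<otimes>\<^bsub>presented_group S R\<^esub> pres_rel S R `` {[(a, \<not> e)]}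
    = \<one>\<^bsub>presented_group S R\<^esub>"
proof -
  have "([(a, e), (a, \<not> e)], []) \<in> pres_rel S R"
    using pres_rel.cancel[of "[]" S "[]" a e R] assms by simp
  then show ?thesis
    using assms by (simp add: pres_mult pres_one equiv_class_eq[OF equiv_pres_rel])
qed

lemma group_presented_group: "group (presented_group S R)"
proof (rule groupI)
  let ?G = "presented_group S R"
  fix x assume "x \<in> carrier ?G"
  then obtain w where w: "w \<in> words S" "x = pres_rel S R `` {w}" by (auto simp: pres_carrier)
  have "\<exists>v\<in>words S. pres_rel S R `` {v} \<otimes>\<^bsub>?G\<^esub> pres_rel S R `` {w} = \<one>\<^bsub>?G\<^esub>"
    using w(1)
  proof (induction w)
    case Nil
    show ?case by (rule bexI[of _ "[]"]) (auto simp: pres_mult pres_one)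
  next
    case (Cons l w)
    obtain a e where l: "l = (a, e)" "a \<in> S" using Cons by (cases l) auto
    obtain v where v: "v \<in> words S" "pres_rel S R `` {v} \<otimes>\<^bsub>?G\<^esub> pres_rel S R `` {w} = \<one>\<^bsub>?G\<^esub>"
      using Cons by auto
    have "(v @ [(a, \<not> e), (a, \<not> \<not> e)] @ w, v @ w) \<in> pres_rel S R"
      using v l Cons by (intro pres_rel.cancel) auto
    then have "pres_rel S R `` {v @ [(a, \<not> e)]} \<otimes>\<^bsub>?G\<^esub> pres_rel S R `` {l # w} = \<one>\<^bsub>?G\<^esub>"
      using v l Cons by (simp add: pres_mult equiv_class_eq[OF equiv_pres_rel])
    then show ?case using v l by (intro bexI[of _ "v @ [(a, \<not> e)]"]) auto
  qed
  then show "\<exists>y\<in>carrier ?G. y \<otimes>\<^bsub>?G\<^esub> x = \<one>\<^bsub>?G\<^esub>" using w by (auto simp: pres_carrier)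
  show "\<one>\<^bsub>?G\<^esub> \<otimes>\<^bsub>?G\<^esub> x = x" using w by (simp add: pres_one pres_mult)
next
  let ?G = "presented_group S R"
  fix x y assume "x \<in> carrier ?G" "y \<in> carrier ?G"
  then show "x \<otimes>\<^bsub>?G\<^esub> y \<in> carrier ?G"
    unfolding pres_carrier by (elim imageE) (simp add: pres_mult del: in_lists_conv_set)
next
  let ?G = "presented_group S R"
  fix x y z assume "x \<in> carrier ?G" "y \<in> carrier ?G" "z \<in> carrier ?G"
  then show "x \<otimes>\<^bsub>?G\<^esub> y \<otimes>\<^bsub>?G\<^esub> z = x \<otimes>\<^bsub>?G\<^esub> (y \<otimes>\<^bsub>?G\<^esub> z)"
    unfolding pres_carrier by (elim imageE) (simp add: pres_mult del: in_lists_conv_set)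
qed (simp add: pres_carrier pres_one)

lemma pres_gen_closed: "a \<in> S \<Longrightarrow> pres_gen S R a \<in> carrier (presented_group S R)"
  by (auto simp: pres_gen_def pres_carrier)

lemma pres_gen_inv:
  assumes "a \<in> S"
  shows "inv\<^bsub>presented_group S R\<^esub> pres_gen S R a = pres_rel S R `` {[(a, False)]}"
proof -
  have "pres_rel S R `` {[(a, False)]} \<in> carrier (presented_group S R)"
    using assms by (auto simp: pres_carrier)
  then show ?thesis
    using pres_letter_cancel[OF assms, of R False] assms
    by (intro group.inv_equality[OF group_presented_group]) (auto simp: pres_gen_def pres_gen_closed[unfolded pres_gen_def])
qed

lemma pres_generated:
  "carrier (presented_group S R) = generate (presented_group S R) (pres_gen S R ` S)"
proof
  let ?G = "presented_group S R"
  have "pres_rel S R `` {w} \<in> generate ?G (pres_gen S R ` S)" if "w \<in> words S" for w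
    using that
  proof (induction w)
    case Nil
    show ?case using generate.one[of ?G] by (simp add: pres_one)
  next
    case (Cons l w)
    obtain a e where l: "l = (a, e)" "a \<in> S" using Cons by (cases l) auto
    have "pres_rel S R `` {[(a, e)]} \<in> generate ?G (pres_gen S R ` S)"
      using l generate.incl[of "pres_gen S R a" "pres_gen S R ` S" ?G]
        generate.inv[of "pres_gen S R a" "pres_gen S R ` S" ?G] pres_gen_inv[of a S R]
      by (cases e) (auto simp: pres_gen_def)
    then show ?case
      using Cons l generate.eng[of "pres_rel S R `` {[(a, e)]}" ?G _ "pres_rel S R `` {w}"]
      by (simp add: pres_mult)
  qed
  then show "carrier ?G \<subseteq> generate ?G (pres_gen S R ` S)" by (auto simp: pres_carrier)
  show "generate ?G (pres_gen S R ` S) \<subseteq> carrier ?G"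
    by (intro group.generate_incl[OF group_presented_group]) (auto intro: pres_gen_closed)
qed

lemma word_eval_closed:
  assumes "group H" "f \<in> S \<rightarrow> carrier H" "w \<in> words S"
  shows "word_eval H f w \<in> carrier H"
proof -
  interpret H: group H by fact
  show ?thesis using assms(3)
  proof (induction w)
    case (Cons l w)
    obtain a e where "l = (a, e)" "a \<in> S" using Cons by (cases l) auto
    moreover from this have "f a \<in> carrier H" using assms(2) by auto
    ultimately show ?case using Cons by auto
  qed simp
qed

lemma word_eval_append:
  assumes "group H" "f \<in> S \<rightarrow> carrier H" "v \<in> words S" "w \<in> words S"
  shows "word_eval H f (v @ w) = word_eval H f v \<otimes>\<^bsub>H\<^esub> word_eval H f w"
proof -
  interpret H: group H by fact
  show ?thesis using assms(3)
  proof (induction v)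
    case Nil
    then show ?case using word_eval_closed[OF assms(1,2,4)] by simp
  next
    case (Cons l v)
    obtain a e where "l = (a, e)" "a \<in> S" using Cons by (cases l) auto
    moreover from this have "f a \<in> carrier H" using assms(2) by auto
    moreover have "word_eval H f v \<in> carrier H" using Cons word_eval_closed[OF assms(1,2)] by simp
    ultimately show ?case using Cons word_eval_closed[OF assms(1,2,4)] by (auto simp: H.m_assoc)
  qed
qed

lemma word_eval_respects:
  assumes "group H" "f \<in> S \<rightarrow> carrier H"
    and rel: "\<And>l r. (l, r) \<in> R \<Longrightarrow> l \<in> words S \<Longrightarrow> r \<in> words S \<Longrightarrow> word_eval H f l = word_eval H f r"
    and "(v, w) \<in> pres_rel S R"
  shows "word_eval H f v = word_eval H f w"
  using assms(4)
proof (induction rule: pres_rel.induct)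
  interpret H: group H by fact
  case (cancel u v a e)
  have "f a \<in> carrier H" using cancel assms(2) by auto
  then have "word_eval H f ([(a, e), (a, \<not> e)] @ v) = word_eval H f v"
    using word_eval_closed[OF assms(1,2) cancel(2)] by (cases e) (auto simp: H.m_assoc[symmetric])
  then show ?case
    using cancel word_eval_append[OF assms(1,2), of u "[(a, e), (a, \<not> e)] @ v"]
      word_eval_append[OF assms(1,2), of u v] by auto
next
  case (relation u v l r)
  then show ?case using rel[of l r]
    word_eval_append[OF assms(1,2), of u "l @ v"] word_eval_append[OF assms(1,2), of l v]
    word_eval_append[OF assms(1,2), of u "r @ v"] word_eval_append[OF assms(1,2), of r v] by auto
qed auto

lemma
  assumes "group H" "f \<in> S \<rightarrow> carrier H"
    and rel: "\<And>l r. (l, r) \<in> R \<Longrightarrow> l \<in> words S \<Longrightarrow> r \<in> words S \<Longrightarrow> word_eval H f l = word_eval H f r"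
  shows pres_lift_hom: "pres_lift S R H f \<in> hom (presented_group S R) H"
    and pres_lift_gen: "a \<in> S \<Longrightarrow> pres_lift S R H f (pres_gen S R a) = f a"
proof -
  interpret H: group H by fact
  have cl: "pres_lift S R H f (pres_rel S R `` {w}) = word_eval H f w" if w: "w \<in> words S" for w
  proof -
    have "word_eval H f ` (pres_rel S R `` {w}) = {word_eval H f w}"
      using word_eval_respects[OF assms] pres_rel.refl[OF w] by (auto simp: image_iff)
    then show ?thesis using w by (auto simp: pres_lift_def pres_carrier)
  qed
  show "pres_lift S R H f \<in> hom (presented_group S R) H"
    unfolding pres_carrier
    by (intro homI; unfold pres_carrier; elim imageE)
      (simp_all add: cl word_eval_closed[OF assms(1,2)] pres_mult word_eval_append[OF assms(1,2)]
        del: in_lists_conv_set)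
  show "pres_lift S R H f (pres_gen S R a) = f a" if a: "a \<in> S"
  proof -
    have "f a \<in> carrier H" using assms(2) a by auto
    then show ?thesis using a by (simp add: pres_gen_def cl)
  qed
qed


section \<open>Automorphisms, centre and semidirect products\<close>

definition inner_auts :: "('a, 'm) monoid_scheme \<Rightarrow> ('a \<Rightarrow> 'a) set" where
  "inner_auts G = {\<lambda>x\<in>carrier G. g \<otimes>\<^bsub>G\<^esub> x \<otimes>\<^bsub>G\<^esub> inv\<^bsub>G\<^esub> g | g. g \<in> carrier G}"

definition OutGroup :: "('a, 'm) monoid_scheme \<Rightarrow> ('a \<Rightarrow> 'a) set monoid" where
  "OutGroup G = AutoGroup G Mod inner_auts G"

definition centre :: "('a, 'm) monoid_scheme \<Rightarrow> 'a set" where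
  "centre G = {z \<in> carrier G. \<forall>g\<in>carrier G. z \<otimes>\<^bsub>G\<^esub> g = g \<otimes>\<^bsub>G\<^esub> z}"

text \<open>The (external) semidirect product of \<open>N\<close> by \<open>H\<close> along \<open>\<rho> : H \<rightarrow> Aut N\<close>.\<close>

definition semidirect ::
  "('a, 'm) monoid_scheme \<Rightarrow> ('b, 'k) monoid_scheme \<Rightarrow> ('b \<Rightarrow> 'a \<Rightarrow> 'a) \<Rightarrow> ('a \<times> 'b) monoid" where
  "semidirect N H \<rho> =
    \<lparr>carrier = carrier N \<times> carrier H,
     monoid.mult = (\<lambda>(k, g) (k', g'). (k \<otimes>\<^bsub>N\<^esub> \<rho> g k', g \<otimes>\<^bsub>H\<^esub> g')),
     monoid.one = (\<one>\<^bsub>N\<^esub>, \<one>\<^bsub>H\<^esub>)\<rparr>"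

text \<open>The group \<open>G\<close> is the (internal) semidirect product of its normal subgroup \<open>N\<close> and its
  subgroup \<open>H\<close>.\<close>

definition is_semidirect :: "('a, 'm) monoid_scheme \<Rightarrow> 'a set \<Rightarrow> 'a set \<Rightarrow> bool" where
  "is_semidirect G N H \<longleftrightarrow>
    N \<lhd> G \<and> subgroup H G \<and> N \<inter> H = {\<one>\<^bsub>G\<^esub>} \<and> N <#>\<^bsub>G\<^esub> H = carrier G"

lemma AutoGroup_carrier: "carrier (AutoGroup G) = auto G"
  by (simp add: AutoGroup_def)

lemma auto_hom: "h \<in> auto G \<Longrightarrow> h \<in> hom G G"
  by (simp add: auto_def)

lemma auto_bij: "h \<in> auto G \<Longrightarrow> bij_betw h (carrier G) (carrier G)"
  by (simp add: auto_def Bij_def)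

lemma auto_ext: "h \<in> auto G \<Longrightarrow> h \<in> extensional (carrier G)"
  by (simp add: auto_def Bij_def)

lemma auto_mult_apply:
  "f \<in> auto G \<Longrightarrow> g \<in> auto G \<Longrightarrow> x \<in> carrier G \<Longrightarrow> (f \<otimes>\<^bsub>AutoGroup G\<^esub> g) x = f (g x)"
  by (simp add: AutoGroup_def BijGroup_def auto_def compose_def)

lemma auto_one_apply: "x \<in> carrier G \<Longrightarrow> \<one>\<^bsub>AutoGroup G\<^esub> x = x"
  by (simp add: AutoGroup_def BijGroup_def)

lemma auto_mult_closed:
  assumes "group G" "f \<in> auto G" "g \<in> auto G"
  shows "f \<otimes>\<^bsub>AutoGroup G\<^esub> g \<in> auto G"
  using group.subgroup_self[OF group.AutoGroup[OF assms(1)]] assms(2,3)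
  by (metis AutoGroup_carrier subgroup.m_closed)

lemma group_semidirect:
  assumes "group N" "group H" "\<rho> \<in> hom H (AutoGroup N)"
  shows "group (semidirect N H \<rho>)"
proof -
  interpret N: group N by fact
  interpret H: group H by fact
  interpret A: group "AutoGroup N" by (rule N.AutoGroup)
  have au: "\<rho> g \<in> auto N" if "g \<in> carrier H" for g
    using assms(3) that by (auto simp: hom_def AutoGroup_carrier)
  have cl: "\<rho> g k \<in> carrier N" if "g \<in> carrier H" "k \<in> carrier N" for g k
    using auto_hom[OF au[OF that(1)]] that(2) by (auto simp: hom_def)
  have hm: "\<rho> g (k \<otimes>\<^bsub>N\<^esub> k') = \<rho> g k \<otimes>\<^bsub>N\<^esub> \<rho> g k'"
    if "g \<in> carrier H" "k \<in> carrier N" "k' \<in> carrier N" for g k k'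
    using auto_hom[OF au[OF that(1)]] that(2,3) by (auto simp: hom_def)
  have co: "\<rho> (g \<otimes>\<^bsub>H\<^esub> g') k = \<rho> g (\<rho> g' k)"
    if "g \<in> carrier H" "g' \<in> carrier H" "k \<in> carrier N" for g g' k
    using assms(3) that au by (simp add: hom_def auto_mult_apply)
  have o: "\<rho> \<one>\<^bsub>H\<^esub> k = k" if "k \<in> carrier N" for k
    using hom_one[OF assms(3,2) A.is_group] that by (simp add: auto_one_apply)
  show ?thesis
  proof (rule groupI)
    fix x assume "x \<in> carrier (semidirect N H \<rho>)"
    then obtain k g where x: "x = (k, g)" "k \<in> carrier N" "g \<in> carrier H"
      by (auto simp: semidirect_def)
    let ?y = "(\<rho> (inv\<^bsub>H\<^esub> g) (inv\<^bsub>N\<^esub> k), inv\<^bsub>H\<^esub> g)"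
    have "\<rho> (inv\<^bsub>H\<^esub> g) (inv\<^bsub>N\<^esub> k) \<otimes>\<^bsub>N\<^esub> \<rho> (inv\<^bsub>H\<^esub> g) k = \<rho> (inv\<^bsub>H\<^esub> g) (inv\<^bsub>N\<^esub> k \<otimes>\<^bsub>N\<^esub> k)"
      using x hm[of "inv\<^bsub>H\<^esub> g" "inv\<^bsub>N\<^esub> k" k] by simp
    also have "\<dots> = \<one>\<^bsub>N\<^esub>"
      using x hom_one[OF auto_hom[OF au[of "inv\<^bsub>H\<^esub> g"]] N.is_group N.is_group] by simp
    finally have "?y \<otimes>\<^bsub>semidirect N H \<rho>\<^esub> x = \<one>\<^bsub>semidirect N H \<rho>\<^esub>"
      using x by (simp add: semidirect_def)
    moreover have "?y \<in> carrier (semidirect N H \<rho>)" using x by (simp add: semidirect_def cl)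
    ultimately show "\<exists>y\<in>carrier (semidirect N H \<rho>). y \<otimes>\<^bsub>semidirect N H \<rho>\<^esub> x = \<one>\<^bsub>semidirect N H \<rho>\<^esub>"
      by blast
  qed (auto simp: semidirect_def cl hm co o N.m_assoc H.m_assoc)
qed

lemma hom_eq_on_generate:
  assumes "group G" "group H" "f \<in> hom G H" "g \<in> hom G H" "T \<subseteq> carrier G"
    and "\<And>x. x \<in> T \<Longrightarrow> f x = g x" and "y \<in> generate G T"
  shows "f y = g y"
proof -
  interpret G: group G by fact
  interpret F: group_hom G H f using assms by (simp add: group_hom_def group_hom_axioms_def)
  interpret K: group_hom G H g using assms by (simp add: group_hom_def group_hom_axioms_def)
  from assms(7) show ?thesis
  proof (induction rule: generate.induct)
    case (inv h) then show ?case using assms(5,6) by (metis F.hom_inv K.hom_inv subsetD)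
  next
    case (eng h1 h2) then show ?case
      using G.generate_in_carrier[OF assms(5)] by simp
  qed (use assms(6) in auto)
qed

lemma pres_hom_eq:
  assumes "group H" "f \<in> hom (presented_group S R) H" "g \<in> hom (presented_group S R) H"
    and "\<And>a. a \<in> S \<Longrightarrow> f (pres_gen S R a) = g (pres_gen S R a)" "y \<in> carrier (presented_group S R)"
  shows "f y = g y"
  using hom_eq_on_generate[OF group_presented_group assms(1-3), of "pres_gen S R ` S" y]
    assms(4,5) pres_gen_closed[of _ S R] unfolding pres_generated[symmetric]
  by blast

lemma pres_eval_gen:
  "w \<in> words S \<Longrightarrow> word_eval (presented_group S R) (pres_gen S R) w = pres_rel S R `` {w}"
proof (induction w)
  case (Cons l w)
  obtain a e where l: "l = (a, e)" "a \<in> S" using Cons by (cases l) auto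
  have "(if e then pres_gen S R a else inv\<^bsub>presented_group S R\<^esub> pres_gen S R a) = pres_rel S R `` {[(a, e)]}"
    using l pres_gen_inv[of a S R] by (simp add: pres_gen_def)
  then show ?case using Cons l by (simp add: pres_mult)
qed (simp add: pres_one)

lemma pres_relation:
  assumes "(l, r) \<in> R" "l \<in> words S" "r \<in> words S"
  shows "word_eval (presented_group S R) (pres_gen S R) l = word_eval (presented_group S R) (pres_gen S R) r"
  using pres_rel.relation[of "[]" S "[]" l r R] assms
  by (simp add: pres_eval_gen equiv_class_eq[OF equiv_pres_rel])

lemma autoI:
  assumes "f \<in> hom G G" "g \<in> hom G G" "f \<in> extensional (carrier G)"
    and "\<And>x. x \<in> carrier G \<Longrightarrow> f (g x) = x" "\<And>x. x \<in> carrier G \<Longrightarrow> g (f x) = x"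
  shows "f \<in> auto G"
proof -
  have "bij_betw f (carrier G) (carrier G)"
    by (rule bij_betw_byWitness[of _ g]) (use assms in \<open>auto simp: hom_def\<close>)
  then show ?thesis using assms by (simp add: auto_def Bij_def)
qed

section \<open>Braid groups acting on a free product of copies of the group of order 2\<close>

definition braid_rels :: "nat \<Rightarrow> (nat word \<times> nat word) set" where
  "braid_rels n =
    {([(i, True), (i + 1, True), (i, True)], [(i + 1, True), (i, True), (i + 1, True)])
      | i. 1 \<le> i \<and> i + 1 < n} \<union>
    {([(i, True), (j, True)], [(j, True), (i, True)])
      | i j. i \<in> {1..<n} \<and> j \<in> {1..<n} \<and> (i + 2 \<le> j \<or> j + 2 \<le> i)}"

definition braid_group :: "nat \<Rightarrow> nat word set monoid" where
  "braid_group n = presented_group {1..<n} (braid_rels n)"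

definition braid_gen :: "nat \<Rightarrow> nat \<Rightarrow> nat word set" where
  "braid_gen n i = pres_gen {1..<n} (braid_rels n) i"

definition K_rels :: "nat \<Rightarrow> (nat word \<times> nat word) set" where
  "K_rels n = {([(i, True), (i, True)], []) | i. i \<in> {1..n}}"

definition K_group :: "nat \<Rightarrow> nat word set monoid" where
  "K_group n = presented_group {1..n} (K_rels n)"

definition K_gen :: "nat \<Rightarrow> nat \<Rightarrow> nat word set" where
  "K_gen n i = pres_gen {1..n} (K_rels n) i"

text \<open>The automorphism of \<open>K\<close> by which the \<open>i\<close>-th braid generator acts.\<close>

definition braid_act :: "nat \<Rightarrow> nat \<Rightarrow> nat word set \<Rightarrow> nat word set" where
  "braid_act n i = pres_lift {1..n} (K_rels n) (K_group n)
    (\<lambda>j. if j = i then K_gen n (i + 1)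
         else if j = i + 1 then
           K_gen n (i + 1) \<otimes>\<^bsub>K_group n\<^esub> K_gen n i \<otimes>\<^bsub>K_group n\<^esub> K_gen n (i + 1)
         else K_gen n j)"

definition rho_plus :: "nat \<Rightarrow> nat word set \<Rightarrow> nat word set \<Rightarrow> nat word set" where
  "rho_plus n = pres_lift {1..<n} (braid_rels n) (AutoGroup (K_group n)) (braid_act n)"

definition KB_group :: "nat \<Rightarrow> (nat word set \<times> nat word set) monoid" where
  "KB_group n = semidirect (K_group n) (braid_group n) (rho_plus n)"

text \<open>The generators \<open>x\<^sub>i\<close> and \<open>\<alpha>\<^sub>i\<close> regarded as elements of the semidirect product.\<close>

definition xgen :: "nat \<Rightarrow> nat \<Rightarrow> nat word set \<times> nat word set" where
  "xgen n i = (K_gen n i, \<one>\<^bsub>braid_group n\<^esub>)"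

definition agen :: "nat \<Rightarrow> nat \<Rightarrow> nat word set \<times> nat word set" where
  "agen n i = (\<one>\<^bsub>K_group n\<^esub>, braid_gen n i)"


declare One_nat_def [simp del]

lemma group_K: "group (K_group n)"
  by (simp add: K_group_def group_presented_group)

lemma group_braid: "group (braid_group n)"
  by (simp add: braid_group_def group_presented_group)

lemma K_gen_closed: "j \<in> {1..n} \<Longrightarrow> K_gen n j \<in> carrier (K_group n)"
  unfolding K_gen_def K_group_def by (rule pres_gen_closed)

lemma braid_gen_closed: "i \<in> {1..<n} \<Longrightarrow> braid_gen n i \<in> carrier (braid_group n)"
  unfolding braid_gen_def braid_group_def by (rule pres_gen_closed)

lemma K_gen_sq:
  assumes "j \<in> {1..n}"
  shows "K_gen n j \<otimes>\<^bsub>K_group n\<^esub> K_gen n j = \<one>\<^bsub>K_group n\<^esub>"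
proof -
  interpret K: group "K_group n" by (rule group_K)
  have "([(j, True), (j, True)], []) \<in> K_rels n" using assms by (auto simp: K_rels_def)
  from pres_relation[OF this, of "{1..n}"] show ?thesis
    using assms K_gen_closed[OF assms] by (simp add: K_group_def[symmetric] K_gen_def[symmetric])
qed

lemma K_gen_cancel:
  assumes "j \<in> {1..n}" "v \<in> carrier (K_group n)"
  shows "K_gen n j \<otimes>\<^bsub>K_group n\<^esub> (K_gen n j \<otimes>\<^bsub>K_group n\<^esub> v) = v"
proof -
  interpret K: group "K_group n" by (rule group_K)
  show ?thesis using assms K_gen_closed K_gen_sq by (simp add: K.m_assoc[symmetric])
qed

lemma K_lift:
  assumes "group H" "f \<in> {1..n} \<rightarrow> carrier H" "\<And>j. j \<in> {1..n} \<Longrightarrow> f j \<otimes>\<^bsub>H\<^esub> f j = \<one>\<^bsub>H\<^esub>"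
  shows "pres_lift {1..n} (K_rels n) H f \<in> hom (K_group n) H"
    and "j \<in> {1..n} \<Longrightarrow> pres_lift {1..n} (K_rels n) H f (K_gen n j) = f j"
proof -
  interpret H: group H by fact
  have "word_eval H f l = word_eval H f r" if lr: "(l, r) \<in> K_rels n" for l r
  proof -
    obtain j where j: "l = [(j, True), (j, True)]" "r = []" "j \<in> {1..n}"
      using lr by (auto simp: K_rels_def)
    moreover have "f j \<in> carrier H" using j assms(2) by auto
    ultimately show ?thesis using assms(3) by simp
  qed
  from pres_lift_hom[OF assms(1,2), of "K_rels n"] pres_lift_gen[OF assms(1,2), of "K_rels n" j] this
  show "pres_lift {1..n} (K_rels n) H f \<in> hom (K_group n) H"
    and "j \<in> {1..n} \<Longrightarrow> pres_lift {1..n} (K_rels n) H f (K_gen n j) = f j"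
    by (auto simp: K_group_def K_gen_def)
qed

lemma K_hom_eq:
  assumes "group H" "f \<in> hom (K_group n) H" "g \<in> hom (K_group n) H"
    and "\<And>j. j \<in> {1..n} \<Longrightarrow> f (K_gen n j) = g (K_gen n j)" "k \<in> carrier (K_group n)"
  shows "f k = g k"
  using pres_hom_eq[of H f "{1..n}" "K_rels n" g k] assms unfolding K_group_def K_gen_def by auto

lemma
  assumes i: "i \<in> {1..<n}"
  shows braid_act_hom: "braid_act n i \<in> hom (K_group n) (K_group n)"
    and braid_act_gen: "j \<in> {1..n} \<Longrightarrow> braid_act n i (K_gen n j) =
      (if j = i then K_gen n (i + 1)
       else if j = i + 1 then
         K_gen n (i + 1) \<otimes>\<^bsub>K_group n\<^esub> K_gen n i \<otimes>\<^bsub>K_group n\<^esub> K_gen n (i + 1)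
       else K_gen n j)"
proof -
  interpret K: group "K_group n" by (rule group_K)
  let ?f = "\<lambda>j. if j = i then K_gen n (i + 1)
       else if j = i + 1 then
         K_gen n (i + 1) \<otimes>\<^bsub>K_group n\<^esub> K_gen n i \<otimes>\<^bsub>K_group n\<^esub> K_gen n (i + 1)
       else K_gen n j"
  have 1: "?f \<in> {1..n} \<rightarrow> carrier (K_group n)" using i by (auto simp: K_gen_closed)
  have 2: "?f j \<otimes>\<^bsub>K_group n\<^esub> ?f j = \<one>\<^bsub>K_group n\<^esub>" if "j \<in> {1..n}" for j
    using i that by (auto simp: K_gen_closed K_gen_sq K_gen_cancel K.m_assoc)
  show "braid_act n i \<in> hom (K_group n) (K_group n)"
    unfolding braid_act_def by (rule K_lift(1)[OF group_K 1 2])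
  show "braid_act n i (K_gen n j) = ?f j" if "j \<in> {1..n}"
    unfolding braid_act_def by (rule K_lift(2)[OF group_K 1 2 that])
qed

lemma braid_act_auto:
  assumes i: "i \<in> {1..<n}"
  shows "braid_act n i \<in> auto (K_group n)"
proof -
  interpret K: group "K_group n" by (rule group_K)
  let ?f = "\<lambda>j. if j = i then K_gen n i \<otimes>\<^bsub>K_group n\<^esub> K_gen n (i + 1) \<otimes>\<^bsub>K_group n\<^esub> K_gen n i
       else if j = i + 1 then K_gen n i else K_gen n j"
  let ?g = "pres_lift {1..n} (K_rels n) (K_group n) ?f"
  have 1: "?f \<in> {1..n} \<rightarrow> carrier (K_group n)" using i by (auto simp: K_gen_closed)
  have 2: "?f j \<otimes>\<^bsub>K_group n\<^esub> ?f j = \<one>\<^bsub>K_group n\<^esub>" if "j \<in> {1..n}" for j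
    using i that by (auto simp: K_gen_closed K_gen_sq K_gen_cancel K.m_assoc)
  have g: "?g \<in> hom (K_group n) (K_group n)" by (rule K_lift(1)[OF group_K 1 2])
  have gg: "?g (K_gen n j) = ?f j" if "j \<in> {1..n}" for j by (rule K_lift(2)[OF group_K 1 2 that])
  note a = braid_act_hom[OF i]
  have id: "(\<lambda>x. x) \<in> hom (K_group n) (K_group n)" by (simp add: hom_def)
  show ?thesis
  proof (rule autoI[OF a g])
    show "braid_act n i \<in> extensional (carrier (K_group n))"
      by (simp add: braid_act_def pres_lift_def K_group_def)
    fix x assume x: "x \<in> carrier (K_group n)"
    show "braid_act n i (?g x) = x"
      by (rule K_hom_eq[OF group_K hom_compose[OF g a, unfolded comp_def] id _ x])
        (use i in \<open>auto simp: gg braid_act_gen[OF i] hom_mult[OF a] K_gen_closed K_gen_sq K_gen_cancel K.m_assoc del: equalityI subsetI\<close>)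
    show "?g (braid_act n i x) = x"
      by (rule K_hom_eq[OF group_K hom_compose[OF a g, unfolded comp_def] id _ x])
        (use i in \<open>auto simp: gg braid_act_gen[OF i] hom_mult[OF g] K_gen_closed K_gen_sq K_gen_cancel K.m_assoc del: equalityI subsetI\<close>)
  qed
qed

lemma K_auto_eq:
  assumes "f \<in> auto (K_group n)" "g \<in> auto (K_group n)"
    and "\<And>j. j \<in> {1..n} \<Longrightarrow> f (K_gen n j) = g (K_gen n j)"
  shows "f = g"
proof (rule extensionalityI[OF auto_ext[OF assms(1)] auto_ext[OF assms(2)]])
  fix x assume "x \<in> carrier (K_group n)"
  then show "f x = g x"
    using K_hom_eq[OF group_K auto_hom[OF assms(1)] auto_hom[OF assms(2)] assms(3)] by blast
qed

lemma braid_lift: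
  assumes "group H" "f \<in> {1..<n} \<rightarrow> carrier H"
    and "\<And>i. 1 \<le> i \<Longrightarrow> i + 1 < n \<Longrightarrow>
      f i \<otimes>\<^bsub>H\<^esub> (f (i + 1) \<otimes>\<^bsub>H\<^esub> f i) = f (i + 1) \<otimes>\<^bsub>H\<^esub> (f i \<otimes>\<^bsub>H\<^esub> f (i + 1))"
    and "\<And>i j. i \<in> {1..<n} \<Longrightarrow> j \<in> {1..<n} \<Longrightarrow> i + 2 \<le> j \<or> j + 2 \<le> i \<Longrightarrow> f i \<otimes>\<^bsub>H\<^esub> f j = f j \<otimes>\<^bsub>H\<^esub> f i"
  shows "pres_lift {1..<n} (braid_rels n) H f \<in> hom (braid_group n) H"
    and "i \<in> {1..<n} \<Longrightarrow> pres_lift {1..<n} (braid_rels n) H f (braid_gen n i) = f i"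
proof -
  interpret H: group H by fact
  have fc: "f j \<in> carrier H" if "1 \<le> j" "j < n" for j using assms(2) that by auto
  have "word_eval H f l = word_eval H f r" if "(l, r) \<in> braid_rels n" for l r
    using that assms(3,4) fc unfolding braid_rels_def by auto
  from pres_lift_hom[OF assms(1,2), of "braid_rels n"] pres_lift_gen[OF assms(1,2), of "braid_rels n" i] this
  show "pres_lift {1..<n} (braid_rels n) H f \<in> hom (braid_group n) H"
    and "i \<in> {1..<n} \<Longrightarrow> pres_lift {1..<n} (braid_rels n) H f (braid_gen n i) = f i"
    by (auto simp: braid_group_def braid_gen_def)
qed

lemma
  shows rho_plus_hom: "rho_plus n \<in> hom (braid_group n) (AutoGroup (K_group n))"
    and rho_plus_gen: "i \<in> {1..<n} \<Longrightarrow> rho_plus n (braid_gen n i) = braid_act n i"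
proof -
  interpret K: group "K_group n" by (rule group_K)
  let ?A = "AutoGroup (K_group n)"
  have 1: "braid_act n \<in> {1..<n} \<rightarrow> carrier ?A" by (auto simp: AutoGroup_carrier braid_act_auto)
  note facts = braid_act_auto auto_mult_apply auto_mult_closed[OF group_K] braid_act_gen
    hom_mult[OF braid_act_hom] K_gen_closed K_gen_cancel K_gen_sq K.m_assoc
  have 2: "braid_act n i \<otimes>\<^bsub>?A\<^esub> (braid_act n (i + 1) \<otimes>\<^bsub>?A\<^esub> braid_act n i)
      = braid_act n (i + 1) \<otimes>\<^bsub>?A\<^esub> (braid_act n i \<otimes>\<^bsub>?A\<^esub> braid_act n (i + 1))"
    if "1 \<le> i" "i + 1 < n" for i
    by (rule K_auto_eq[where n = n]) (use that in \<open>auto simp: facts del: equalityI subsetI\<close>)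
  have 3: "braid_act n i \<otimes>\<^bsub>?A\<^esub> braid_act n j = braid_act n j \<otimes>\<^bsub>?A\<^esub> braid_act n i"
    if "i \<in> {1..<n}" "j \<in> {1..<n}" "i + 2 \<le> j \<or> j + 2 \<le> i" for i j
    by (rule K_auto_eq[where n = n]) (use that in \<open>auto simp: facts del: equalityI subsetI\<close>)
  note l = braid_lift[OF K.AutoGroup 1 2 3]
  show "rho_plus n \<in> hom (braid_group n) ?A" unfolding rho_plus_def by (rule l(1))
  show "i \<in> {1..<n} \<Longrightarrow> rho_plus n (braid_gen n i) = braid_act n i"
    unfolding rho_plus_def by (rule l(2))
qed

lemma group_KB: "group (KB_group n)"
  unfolding KB_group_def by (intro group_semidirect group_K group_braid rho_plus_hom)

lemma semidirect_carrier: "carrier (semidirect N H \<rho>) = carrier N \<times> carrier H"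
  by (simp add: semidirect_def)

lemma semidirect_mult:
  "(k, g) \<otimes>\<^bsub>semidirect N H \<rho>\<^esub> (k', g') = (k \<otimes>\<^bsub>N\<^esub> \<rho> g k', g \<otimes>\<^bsub>H\<^esub> g')"
  by (simp add: semidirect_def)

lemma rho_plus_auto: "g \<in> carrier (braid_group n) \<Longrightarrow> rho_plus n g \<in> auto (K_group n)"
  using rho_plus_hom[of n] by (auto simp: hom_def AutoGroup_carrier)

lemma rho_plus_one: "k \<in> carrier (K_group n) \<Longrightarrow> rho_plus n \<one>\<^bsub>braid_group n\<^esub> k = k"
  using hom_one[OF rho_plus_hom group_braid group.AutoGroup[OF group_K]] by (simp add: auto_one_apply)

lemma rho_plus_unit: "g \<in> carrier (braid_group n) \<Longrightarrow> rho_plus n g \<one>\<^bsub>K_group n\<^esub> = \<one>\<^bsub>K_group n\<^esub>"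
  by (rule hom_one[OF auto_hom[OF rho_plus_auto] group_K group_K])

lemma rho_plus_closed:
  "g \<in> carrier (braid_group n) \<Longrightarrow> k \<in> carrier (K_group n) \<Longrightarrow> rho_plus n g k \<in> carrier (K_group n)"
  using auto_hom[OF rho_plus_auto] by (rule hom_in_carrier)

lemma rho_plus_mult:
  "g \<in> carrier (braid_group n) \<Longrightarrow> h \<in> carrier (braid_group n) \<Longrightarrow> k \<in> carrier (K_group n) \<Longrightarrow>
    rho_plus n (g \<otimes>\<^bsub>braid_group n\<^esub> h) k = rho_plus n g (rho_plus n h k)"
  by (simp add: hom_mult[OF rho_plus_hom] auto_mult_apply rho_plus_auto)

lemma
  shows emb_K_hom: "(\<lambda>k. (k, \<one>\<^bsub>braid_group n\<^esub>)) \<in> hom (K_group n) (KB_group n)"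
    and emb_B_hom: "(\<lambda>g. (\<one>\<^bsub>K_group n\<^esub>, g)) \<in> hom (braid_group n) (KB_group n)"
proof -
  interpret K: group "K_group n" by (rule group_K)
  interpret B: group "braid_group n" by (rule group_braid)
  show "(\<lambda>k. (k, \<one>\<^bsub>braid_group n\<^esub>)) \<in> hom (K_group n) (KB_group n)"
    by (rule homI) (auto simp: KB_group_def semidirect_carrier semidirect_mult rho_plus_one)
  show "(\<lambda>g. (\<one>\<^bsub>K_group n\<^esub>, g)) \<in> hom (braid_group n) (KB_group n)"
    by (rule homI) (auto simp: KB_group_def semidirect_carrier semidirect_mult rho_plus_unit)
qed

lemma xgen_closed: "j \<in> {1..n} \<Longrightarrow> xgen n j \<in> carrier (KB_group n)"
  unfolding xgen_def by (rule hom_in_carrier[OF emb_K_hom K_gen_closed])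

lemma agen_closed: "i \<in> {1..<n} \<Longrightarrow> agen n i \<in> carrier (KB_group n)"
  unfolding agen_def by (rule hom_in_carrier[OF emb_B_hom braid_gen_closed])

lemma agen_conj:
  assumes "i \<in> {1..<n}" "k \<in> carrier (K_group n)"
  shows "agen n i \<otimes>\<^bsub>KB_group n\<^esub> (k, \<one>\<^bsub>braid_group n\<^esub>) \<otimes>\<^bsub>KB_group n\<^esub> inv\<^bsub>KB_group n\<^esub> agen n i
    = (braid_act n i k, \<one>\<^bsub>braid_group n\<^esub>)"
proof -
  interpret K: group "K_group n" by (rule group_K)
  interpret B: group "braid_group n" by (rule group_braid)
  interpret G: group "KB_group n" by (rule group_KB)
  have b: "braid_act n i k \<in> carrier (K_group n)"
    using assms by (rule hom_in_carrier[OF braid_act_hom])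
  have "agen n i \<otimes>\<^bsub>KB_group n\<^esub> (k, \<one>\<^bsub>braid_group n\<^esub>)
      = (braid_act n i k, \<one>\<^bsub>braid_group n\<^esub>) \<otimes>\<^bsub>KB_group n\<^esub> agen n i"
    using assms b by (simp add: agen_def KB_group_def semidirect_mult braid_gen_closed rho_plus_gen rho_plus_one)
  then show ?thesis
    using assms b agen_closed[OF assms(1)] hom_in_carrier[OF emb_K_hom, of _ n]
    by (simp add: G.m_assoc)
qed

lemma KB_generated:
  assumes "n \<ge> 2"
  shows "generate (KB_group n) (insert (xgen n 1) (agen n ` {1..<n})) = carrier (KB_group n)"
proof -
  let ?G = "KB_group n"
  interpret K: group "K_group n" by (rule group_K)
  interpret B: group "braid_group n" by (rule group_braid)
  interpret G: group ?G by (rule group_KB)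
  interpret EK: group_hom "K_group n" ?G "\<lambda>k. (k, \<one>\<^bsub>braid_group n\<^esub>)"
    using emb_K_hom by (simp add: group_hom_def group_hom_axioms_def group_K group_KB)
  interpret EB: group_hom "braid_group n" ?G "\<lambda>g. (\<one>\<^bsub>K_group n\<^esub>, g)"
    using emb_B_hom by (simp add: group_hom_def group_hom_axioms_def group_braid group_KB)
  let ?T = "insert (xgen n 1) (agen n ` {1..<n})"
  have T: "?T \<subseteq> carrier ?G" using assms xgen_closed[of 1 n] agen_closed[of _ n] by (simp add: image_subset_iff)
  note sub = G.generate_is_subgroup[OF T]
  have x: "xgen n j \<in> generate ?G ?T" if "1 \<le> j" "j \<le> n" for j
    using that
  proof (induction j rule: dec_induct)
    case base show ?case by (rule generate.incl) simp
  next
    case (step j)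
    have a: "agen n j \<in> generate ?G ?T" using step by (intro generate.incl) auto
    have "xgen n (Suc j) = agen n j \<otimes>\<^bsub>?G\<^esub> xgen n j \<otimes>\<^bsub>?G\<^esub> inv\<^bsub>?G\<^esub> agen n j"
      using step agen_conj[of j n "K_gen n j"] by (simp add: xgen_def K_gen_closed braid_act_gen Suc_eq_plus1)
    then show ?case using a step subgroup.m_inv_closed[OF sub a] by (auto intro!: generate.eng)
  qed
  have "generate ?G ((\<lambda>k. (k, \<one>\<^bsub>braid_group n\<^esub>)) ` (K_gen n ` {1..n})) \<subseteq> generate ?G ?T"
    by (rule G.generate_subgroup_incl[OF _ sub]) (use x in \<open>auto simp: xgen_def\<close>)
  then have k: "(k, \<one>\<^bsub>braid_group n\<^esub>) \<in> generate ?G ?T" if "k \<in> carrier (K_group n)" for k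
    using that pres_generated[of "{1..n}" "K_rels n"] EK.generate_img[of "K_gen n ` {1..n}"] K_gen_closed
    unfolding K_group_def[symmetric] K_gen_def[symmetric] by blast
  have "generate ?G ((\<lambda>g. (\<one>\<^bsub>K_group n\<^esub>, g)) ` (braid_gen n ` {1..<n})) \<subseteq> generate ?G ?T"
    by (rule G.generate_subgroup_incl[OF _ sub]) (auto simp: agen_def intro: generate.incl)
  then have b: "(\<one>\<^bsub>K_group n\<^esub>, g) \<in> generate ?G ?T" if "g \<in> carrier (braid_group n)" for g
    using that pres_generated[of "{1..<n}" "braid_rels n"] EB.generate_img[of "braid_gen n ` {1..<n}"] braid_gen_closed
    unfolding braid_group_def[symmetric] braid_gen_def[symmetric] by blast
  have "(k, g) \<in> generate ?G ?T" if "k \<in> carrier (K_group n)" "g \<in> carrier (braid_group n)" for k g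
    using generate.eng[OF k[OF that(1)] b[OF that(2)]] that
    by (simp add: KB_group_def semidirect_mult rho_plus_one)
  then show ?thesis
    using G.generate_incl[OF T] by (auto simp: KB_group_def semidirect_carrier)
qed

text \<open>A homomorphism on the semidirect product from compatible homomorphisms on the factors; it
  suffices to check compatibility on generators.\<close>

lemma KB_hom:
  assumes "group H" and f: "f \<in> hom (K_group n) H" and g: "g \<in> hom (braid_group n) H"
    and comp: "\<And>i j. i \<in> {1..<n} \<Longrightarrow> j \<in> {1..n} \<Longrightarrow>
      g (braid_gen n i) \<otimes>\<^bsub>H\<^esub> f (K_gen n j) = f (braid_act n i (K_gen n j)) \<otimes>\<^bsub>H\<^esub> g (braid_gen n i)"
  shows "(\<lambda>(k, b). f k \<otimes>\<^bsub>H\<^esub> g b) \<in> hom (KB_group n) H"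
proof -
  interpret H: group H by fact
  interpret K: group "K_group n" by (rule group_K)
  interpret B: group "braid_group n" by (rule group_braid)
  interpret F: group_hom "K_group n" H f
    using f by (simp add: group_hom_def group_hom_axioms_def group_K assms(1))
  interpret G: group_hom "braid_group n" H g
    using g by (simp add: group_hom_def group_hom_axioms_def group_braid assms(1))
  let ?P = "\<lambda>b. \<forall>k\<in>carrier (K_group n). g b \<otimes>\<^bsub>H\<^esub> f k = f (rho_plus n b k) \<otimes>\<^bsub>H\<^esub> g b"
  have bg: "braid_gen n ` {1..<n} \<subseteq> carrier (braid_group n)" by (auto intro: braid_gen_closed)
  have conj: "u \<otimes>\<^bsub>H\<^esub> v \<otimes>\<^bsub>H\<^esub> inv\<^bsub>H\<^esub> u = w \<longleftrightarrow> u \<otimes>\<^bsub>H\<^esub> v = w \<otimes>\<^bsub>H\<^esub> u"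
    if "u \<in> carrier H" "v \<in> carrier H" "w \<in> carrier H" for u v w
    using that H.inv_solve_right'[of w "u \<otimes>\<^bsub>H\<^esub> v" u] by auto
  have gen: "?P (braid_gen n i)" if i: "i \<in> {1..<n}" for i
  proof
    fix k assume k: "k \<in> carrier (K_group n)"
    note bc = braid_gen_closed[OF i]
    have h: "(\<lambda>k. g (braid_gen n i) \<otimes>\<^bsub>H\<^esub> f k \<otimes>\<^bsub>H\<^esub> inv\<^bsub>H\<^esub> g (braid_gen n i)) \<in> hom (K_group n) H"
    proof (rule homI)
      fix k k' assume "k \<in> carrier (K_group n)" "k' \<in> carrier (K_group n)"
      then show "g (braid_gen n i) \<otimes>\<^bsub>H\<^esub> f (k \<otimes>\<^bsub>K_group n\<^esub> k') \<otimes>\<^bsub>H\<^esub> inv\<^bsub>H\<^esub> g (braid_gen n i) =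
          g (braid_gen n i) \<otimes>\<^bsub>H\<^esub> f k \<otimes>\<^bsub>H\<^esub> inv\<^bsub>H\<^esub> g (braid_gen n i) \<otimes>\<^bsub>H\<^esub>
          (g (braid_gen n i) \<otimes>\<^bsub>H\<^esub> f k' \<otimes>\<^bsub>H\<^esub> inv\<^bsub>H\<^esub> g (braid_gen n i))"
        using bc by (simp add: H.m_assoc H.inv_solve_left' flip: H.m_assoc[of "inv\<^bsub>H\<^esub> g (braid_gen n i)"])
    qed (use bc in simp)
    have "g (braid_gen n i) \<otimes>\<^bsub>H\<^esub> f k \<otimes>\<^bsub>H\<^esub> inv\<^bsub>H\<^esub> g (braid_gen n i) = f (braid_act n i k)"
      by (rule K_hom_eq[OF assms(1) h hom_compose[OF braid_act_hom[OF i] f, unfolded comp_def] _ k])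
        (use comp[OF i] bc i in \<open>simp add: conj H.m_assoc K_gen_closed hom_in_carrier[OF braid_act_hom[OF i]]\<close>)
    then show "g (braid_gen n i) \<otimes>\<^bsub>H\<^esub> f k = f (rho_plus n (braid_gen n i) k) \<otimes>\<^bsub>H\<^esub> g (braid_gen n i)"
      using bc i k by (simp add: conj rho_plus_gen hom_in_carrier[OF braid_act_hom[OF i]])
  qed
  have "?P b" if "b \<in> generate (braid_group n) (braid_gen n ` {1..<n})" for b
    using that
  proof (induction rule: generate.induct)
    case one then show ?case by (simp add: rho_plus_one)
  next
    case (incl h) then show ?case using gen by blast
  next
    case (inv h)
    then have h: "h \<in> carrier (braid_group n)" and P: "?P h" using bg gen by blast+
    show ?case
    proof
      fix k assume k: "k \<in> carrier (K_group n)"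
      let ?k = "rho_plus n (inv\<^bsub>braid_group n\<^esub> h) k"
      have kc: "?k \<in> carrier (K_group n)" using h k by (simp add: rho_plus_closed)
      have "rho_plus n h ?k = k" using h k rho_plus_mult[of h n "inv\<^bsub>braid_group n\<^esub> h" k] by (simp add: rho_plus_one)
      then have "g h \<otimes>\<^bsub>H\<^esub> f ?k = f k \<otimes>\<^bsub>H\<^esub> g h" using P kc by simp
      then have "f ?k = inv\<^bsub>H\<^esub> g h \<otimes>\<^bsub>H\<^esub> (f k \<otimes>\<^bsub>H\<^esub> g h)"
        using h k kc by (intro H.inv_solve_left[THEN iffD2]) auto
      then have "f ?k \<otimes>\<^bsub>H\<^esub> inv\<^bsub>H\<^esub> g h = inv\<^bsub>H\<^esub> g h \<otimes>\<^bsub>H\<^esub> f k"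
        using h k by (simp add: H.m_assoc)
      then show "g (inv\<^bsub>braid_group n\<^esub> h) \<otimes>\<^bsub>H\<^esub> f k = f ?k \<otimes>\<^bsub>H\<^esub> g (inv\<^bsub>braid_group n\<^esub> h)"
        using h by simp
    qed
  next
    case (eng h1 h2)
    then have h: "h1 \<in> carrier (braid_group n)" "h2 \<in> carrier (braid_group n)"
      using B.generate_in_carrier[OF bg] by auto
    show ?case
    proof
      fix k assume k: "k \<in> carrier (K_group n)"
      have "g h1 \<otimes>\<^bsub>H\<^esub> (g h2 \<otimes>\<^bsub>H\<^esub> f k) = g h1 \<otimes>\<^bsub>H\<^esub> f (rho_plus n h2 k) \<otimes>\<^bsub>H\<^esub> g h2"
        using eng.IH(2) h k by (simp add: H.m_assoc rho_plus_closed)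
      also have "\<dots> = f (rho_plus n h1 (rho_plus n h2 k)) \<otimes>\<^bsub>H\<^esub> g h1 \<otimes>\<^bsub>H\<^esub> g h2"
      proof -
        have "rho_plus n h2 k \<in> carrier (K_group n)" using h k by (simp add: rho_plus_closed)
        then show ?thesis using eng.IH(1) by simp
      qed
      finally show "g (h1 \<otimes>\<^bsub>braid_group n\<^esub> h2) \<otimes>\<^bsub>H\<^esub> f k
          = f (rho_plus n (h1 \<otimes>\<^bsub>braid_group n\<^esub> h2) k) \<otimes>\<^bsub>H\<^esub> g (h1 \<otimes>\<^bsub>braid_group n\<^esub> h2)"
        using h k by (simp add: rho_plus_mult rho_plus_closed H.m_assoc)
    qed
  qed
  then have P: "g b \<otimes>\<^bsub>H\<^esub> f k = f (rho_plus n b k) \<otimes>\<^bsub>H\<^esub> g b"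
    if "b \<in> carrier (braid_group n)" "k \<in> carrier (K_group n)" for b k
    using that pres_generated[of "{1..<n}" "braid_rels n"]
    unfolding braid_group_def[symmetric] braid_gen_def[symmetric] by blast
  show ?thesis
  proof (rule homI)
    fix x y assume "x \<in> carrier (KB_group n)" "y \<in> carrier (KB_group n)"
    then obtain k b k' b' where x: "x = (k, b)" "y = (k', b')" "k \<in> carrier (K_group n)"
      "k' \<in> carrier (K_group n)" "b \<in> carrier (braid_group n)" "b' \<in> carrier (braid_group n)"
      by (auto simp: KB_group_def semidirect_carrier)
    have "f (rho_plus n b k') \<otimes>\<^bsub>H\<^esub> (g b \<otimes>\<^bsub>H\<^esub> g b') = g b \<otimes>\<^bsub>H\<^esub> (f k' \<otimes>\<^bsub>H\<^esub> g b')"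
      using x P[of b k'] by (simp add: rho_plus_closed flip: H.m_assoc)
    then show "(\<lambda>(k, b). f k \<otimes>\<^bsub>H\<^esub> g b) (x \<otimes>\<^bsub>KB_group n\<^esub> y)
      = (\<lambda>(k, b). f k \<otimes>\<^bsub>H\<^esub> g b) x \<otimes>\<^bsub>H\<^esub> (\<lambda>(k, b). f k \<otimes>\<^bsub>H\<^esub> g b) y"
      using x by (simp add: KB_group_def semidirect_mult rho_plus_closed H.m_assoc)
  qed (auto simp: KB_group_def semidirect_carrier)
qed

text \<open>The \<open>K\<close>-component of \<open>\<epsilon>\<^sub>n\<close> sends \<open>x\<^sub>j\<close> to
  \<open>(x\<^sub>1 \<cdots> x\<^bsub>j-1\<^esub>) x\<^sub>j (x\<^sub>1 \<cdots> x\<^bsub>j-1\<^esub>)\<^sup>-\<^sup>1\<close>.\<close>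

fun K_prefix :: "nat \<Rightarrow> nat \<Rightarrow> nat word set" where
  "K_prefix n 0 = \<one>\<^bsub>K_group n\<^esub>"
| "K_prefix n (Suc j) = K_prefix n j \<otimes>\<^bsub>K_group n\<^esub> K_gen n (Suc j)"

lemma K_prefix_closed: "j \<le> n \<Longrightarrow> K_prefix n j \<in> carrier (K_group n)"
proof (induction j)
  case 0
  interpret K: group "K_group n" by (rule group_K)
  show ?case by simp
next
  case (Suc j)
  interpret K: group "K_group n" by (rule group_K)
  show ?case using Suc K_gen_closed[of "Suc j" n] by simp
qed

lemma braid_act_K_prefix:
  assumes i: "i \<in> {1..<n}" and "j \<le> n" "j \<noteq> i"
  shows "braid_act n i (K_prefix n j) = K_prefix n j"
proof -
  interpret K: group "K_group n" by (rule group_K)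
  note a = braid_act_hom[OF i]
  have lt: "braid_act n i (K_prefix n j) = K_prefix n j" if "j < i" for j
    using that
  proof (induction j)
    case 0 show ?case using hom_one[OF a group_K group_K] by simp
  next
    case (Suc j)
    then show ?case using i
      by (simp add: hom_mult[OF a] K_prefix_closed K_gen_closed braid_act_gen[OF i])
  qed
  obtain m where m: "i = Suc m" using i by (cases i) auto
  have pc: "K_prefix n m \<in> carrier (K_group n)" using i m by (simp add: K_prefix_closed)
  have base: "braid_act n i (K_prefix n (Suc i)) = K_prefix n (Suc i)"
  proof -
    have "K_prefix n (Suc i) = K_prefix n m \<otimes>\<^bsub>K_group n\<^esub> K_gen n i \<otimes>\<^bsub>K_group n\<^esub> K_gen n (i + 1)"
      by (simp add: m One_nat_def)
    moreover have "braid_act n i (K_prefix n m) = K_prefix n m" using lt[of m] m by simp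
    ultimately show ?thesis using i pc
      by (simp add: hom_mult[OF a] K_gen_closed braid_act_gen[OF i] K.m_assoc K_gen_sq K_gen_cancel)
  qed
  have gt: "braid_act n i (K_prefix n j) = K_prefix n j" if "Suc i \<le> j" "j \<le> n" for j
    using that
  proof (induction j rule: dec_induct)
    case base show ?case by (rule \<open>braid_act n i (K_prefix n (Suc i)) = K_prefix n (Suc i)\<close>)
  next
    case (step j)
    then show ?case using i
      by (simp add: hom_mult[OF a] K_prefix_closed K_gen_closed braid_act_gen[OF i])
  qed
  show ?thesis using lt gt assms by (metis Suc_leI linorder_neqE_nat)
qed

lemma ex_eps_hom:
  assumes n: "n \<ge> 2"
  obtains \<phi> where "\<phi> \<in> hom (KB_group n) (KB_group n)" "\<phi> (xgen n 1) = xgen n 1"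
    "\<And>i. i \<in> {1..<n} \<Longrightarrow> \<phi> (agen n i) = inv\<^bsub>KB_group n\<^esub> agen n i"
proof -
  let ?K = "K_group n" and ?B = "braid_group n" and ?G = "KB_group n"
  interpret K: group ?K by (rule group_K)
  interpret B: group ?B by (rule group_braid)
  interpret G: group ?G by (rule group_KB)
  interpret EK: group_hom ?K ?G "\<lambda>k. (k, \<one>\<^bsub>?B\<^esub>)"
    using emb_K_hom by (simp add: group_hom_def group_hom_axioms_def group_K group_KB)
  define y where "y = (\<lambda>j. K_prefix n (j - 1) \<otimes>\<^bsub>?K\<^esub> K_gen n j \<otimes>\<^bsub>?K\<^esub> inv\<^bsub>?K\<^esub> K_prefix n (j - 1))"
  have inv_cancel: "inv\<^bsub>?K\<^esub> u \<otimes>\<^bsub>?K\<^esub> (u \<otimes>\<^bsub>?K\<^esub> v) = v" if "u \<in> carrier ?K" "v \<in> carrier ?K" for u v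
    using that by (simp flip: K.m_assoc)
  have pc: "K_prefix n (j - 1) \<in> carrier ?K" if "j \<in> {1..n}" for j using that by (intro K_prefix_closed) auto
  have yc: "y j \<in> carrier ?K" if "j \<in> {1..n}" for j
    using that pc[OF that] by (simp add: y_def K_gen_closed)
  have ysq: "y j \<otimes>\<^bsub>?K\<^esub> y j = \<one>\<^bsub>?K\<^esub>" if "j \<in> {1..n}" for j
    using that pc[OF that] by (simp add: y_def K_gen_closed K_gen_cancel inv_cancel K.m_assoc)
  have y: "y \<in> {1..n} \<rightarrow> carrier ?K" using yc by auto
  define f where "f = pres_lift {1..n} (K_rels n) ?K y"
  have f: "f \<in> hom ?K ?K" unfolding f_def by (rule K_lift(1)[OF group_K y ysq])
  have fg: "f (K_gen n j) = y j" if "j \<in> {1..n}" for j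
    unfolding f_def by (rule K_lift(2)[OF group_K y ysq that])
  define g where "g = pres_lift {1..<n} (braid_rels n) ?G (\<lambda>i. inv\<^bsub>?G\<^esub> agen n i)"
  have ac: "agen n i \<in> carrier ?G" if "1 \<le> i" "i < n" for i using that by (simp add: agen_closed)
  have bc: "braid_gen n i \<in> carrier ?B" if "1 \<le> i" "i < n" for i using that by (simp add: braid_gen_closed)
  interpret EB: group_hom ?B ?G "\<lambda>g. (\<one>\<^bsub>?K\<^esub>, g)"
    using emb_B_hom by (simp add: group_hom_def group_hom_axioms_def group_braid group_KB)
  have g1: "(\<lambda>i. inv\<^bsub>?G\<^esub> agen n i) \<in> {1..<n} \<rightarrow> carrier ?G" using ac by auto
  have br: "agen n i \<otimes>\<^bsub>?G\<^esub> agen n (i + 1) \<otimes>\<^bsub>?G\<^esub> agen n i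
      = agen n (i + 1) \<otimes>\<^bsub>?G\<^esub> agen n i \<otimes>\<^bsub>?G\<^esub> agen n (i + 1)"
    if "1 \<le> i" "i + 1 < n" for i
  proof -
    have "([(i, True), (i + 1, True), (i, True)], [(i + 1, True), (i, True), (i + 1, True)]) \<in> braid_rels n"
      using that unfolding braid_rels_def by blast
    from pres_relation[OF this, of "{1..<n}"] that bc[of i] bc[of "i + 1"]
    have "braid_gen n i \<otimes>\<^bsub>?B\<^esub> (braid_gen n (i + 1) \<otimes>\<^bsub>?B\<^esub> braid_gen n i)
      = braid_gen n (i + 1) \<otimes>\<^bsub>?B\<^esub> (braid_gen n i \<otimes>\<^bsub>?B\<^esub> braid_gen n (i + 1))"
      by (simp add: braid_group_def[symmetric] braid_gen_def[symmetric])
    then show ?thesis using that bc unfolding agen_def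
      by (simp add: B.m_assoc flip: EB.hom_mult)
  qed
  have cm: "agen n i \<otimes>\<^bsub>?G\<^esub> agen n j = agen n j \<otimes>\<^bsub>?G\<^esub> agen n i"
    if "i \<in> {1..<n}" "j \<in> {1..<n}" "i + 2 \<le> j \<or> j + 2 \<le> i" for i j
  proof -
    have "([(i, True), (j, True)], [(j, True), (i, True)]) \<in> braid_rels n"
      using that unfolding braid_rels_def by blast
    from pres_relation[OF this, of "{1..<n}"] that bc[of i] bc[of j]
    have "braid_gen n i \<otimes>\<^bsub>?B\<^esub> braid_gen n j = braid_gen n j \<otimes>\<^bsub>?B\<^esub> braid_gen n i"
      by (simp add: braid_group_def[symmetric] braid_gen_def[symmetric])
    then show ?thesis using that bc unfolding agen_def
      by (simp flip: EB.hom_mult)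
  qed
  have g2: "inv\<^bsub>?G\<^esub> agen n i \<otimes>\<^bsub>?G\<^esub> (inv\<^bsub>?G\<^esub> agen n (i + 1) \<otimes>\<^bsub>?G\<^esub> inv\<^bsub>?G\<^esub> agen n i)
      = inv\<^bsub>?G\<^esub> agen n (i + 1) \<otimes>\<^bsub>?G\<^esub> (inv\<^bsub>?G\<^esub> agen n i \<otimes>\<^bsub>?G\<^esub> inv\<^bsub>?G\<^esub> agen n (i + 1))"
    if "1 \<le> i" "i + 1 < n" for i
    using arg_cong[OF br[OF that], of "m_inv ?G"] that ac[of i] ac[of "i + 1"]
    by (simp add: G.inv_mult_group)
  have g3: "inv\<^bsub>?G\<^esub> agen n i \<otimes>\<^bsub>?G\<^esub> inv\<^bsub>?G\<^esub> agen n j = inv\<^bsub>?G\<^esub> agen n j \<otimes>\<^bsub>?G\<^esub> inv\<^bsub>?G\<^esub> agen n i"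
    if "i \<in> {1..<n}" "j \<in> {1..<n}" "i + 2 \<le> j \<or> j + 2 \<le> i" for i j
    using arg_cong[OF cm[OF that], of "m_inv ?G"] that ac[of i] ac[of j]
    by (simp add: G.inv_mult_group)
  have g: "g \<in> hom ?B ?G" unfolding g_def by (rule braid_lift(1)[OF group_KB g1 g2 g3])
  have gg: "g (braid_gen n i) = inv\<^bsub>?G\<^esub> agen n i" if "i \<in> {1..<n}" for i
    unfolding g_def by (rule braid_lift(2)[OF group_KB g1 g2 g3 that])
  have key: "braid_act n i (f (braid_act n i (K_gen n j))) = y j" if i: "i \<in> {1..<n}" and j: "j \<in> {1..n}" for i j
  proof -
    note a = braid_act_hom[OF i]
    interpret A: group_hom ?K ?K "braid_act n i"
      using a by (simp add: group_hom_def group_hom_axioms_def group_K)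
    obtain m where m: "i = Suc m" using i by (cases i) auto
    let ?P = "K_prefix n m"
    have P: "?P \<in> carrier ?K" using i m by (simp add: K_prefix_closed)
    have aP: "braid_act n i ?P = ?P" using i m by (intro braid_act_K_prefix) auto
    have xc: "K_gen n i \<in> carrier ?K" "K_gen n (i + 1) \<in> carrier ?K" using i by (simp_all add: K_gen_closed)
    have xi: "inv\<^bsub>?K\<^esub> K_gen n i = K_gen n i"
      using i K_gen_sq[of i n] xc by (intro K.inv_equality) auto
    have yi: "y i = ?P \<otimes>\<^bsub>?K\<^esub> K_gen n i \<otimes>\<^bsub>?K\<^esub> inv\<^bsub>?K\<^esub> ?P" by (simp add: y_def m)
    have yi1: "y (i + 1) = ?P \<otimes>\<^bsub>?K\<^esub> K_gen n i \<otimes>\<^bsub>?K\<^esub> K_gen n (i + 1) \<otimes>\<^bsub>?K\<^esub> K_gen n i \<otimes>\<^bsub>?K\<^esub> inv\<^bsub>?K\<^esub> ?P"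
      using P xc xi by (simp add: y_def m One_nat_def K.inv_mult_group K.m_assoc)
    have s1: "braid_act n i (y (i + 1)) = y i"
      using P xc i unfolding yi yi1
      by (simp add: aP braid_act_gen[OF i] K.m_assoc K_gen_closed K_gen_sq K_gen_cancel)
    have s2: "braid_act n i (y i) = ?P \<otimes>\<^bsub>?K\<^esub> K_gen n (i + 1) \<otimes>\<^bsub>?K\<^esub> inv\<^bsub>?K\<^esub> ?P"
      using P xc i unfolding yi by (simp add: aP braid_act_gen[OF i])
    consider "j = i" | "j = i + 1" | "j \<noteq> i" "j \<noteq> i + 1" by blast
    then show ?thesis
    proof cases
      case 1
      then show ?thesis using i s1 by (simp add: braid_act_gen[OF i] fg)
    next
      case 2
      have "f (braid_act n i (K_gen n j)) = y (i + 1) \<otimes>\<^bsub>?K\<^esub> y i \<otimes>\<^bsub>?K\<^esub> y (i + 1)"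
        using 2 i xc by (simp add: braid_act_gen[OF i] hom_mult[OF f] fg)
      then have "braid_act n i (f (braid_act n i (K_gen n j))) = y i \<otimes>\<^bsub>?K\<^esub> braid_act n i (y i) \<otimes>\<^bsub>?K\<^esub> y i"
        using i yc[of i] yc[of "i + 1"] s1 by simp
      also have "\<dots> = y (i + 1)"
        using P xc unfolding s2 unfolding yi yi1 by (simp add: K.m_assoc inv_cancel)
      finally show ?thesis using 2 by simp
    next
      case 3
      have "braid_act n i (K_prefix n (j - 1)) = K_prefix n (j - 1)"
        using 3 i j by (intro braid_act_K_prefix) auto
      then have "braid_act n i (y j) = y j"
        using 3 i j pc[OF j] by (simp add: y_def braid_act_gen[OF i] K_gen_closed)
      then show ?thesis using 3 i j by (simp add: braid_act_gen[OF i] fg)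
    qed
  qed
  let ?F = "\<lambda>k. (f k, \<one>\<^bsub>?B\<^esub>)"
  have F: "?F \<in> hom ?K ?G"
    using hom_compose[OF f emb_K_hom] by (simp add: comp_def)
  have comp: "g (braid_gen n i) \<otimes>\<^bsub>?G\<^esub> ?F (K_gen n j) = ?F (braid_act n i (K_gen n j)) \<otimes>\<^bsub>?G\<^esub> g (braid_gen n i)"
    if i: "i \<in> {1..<n}" and j: "j \<in> {1..n}" for i j
  proof -
    let ?k = "f (braid_act n i (K_gen n j))"
    have kc: "?k \<in> carrier ?K"
      using j by (simp add: hom_in_carrier[OF f] hom_in_carrier[OF braid_act_hom[OF i]] K_gen_closed)
    have a: "agen n i \<in> carrier ?G" using i by (rule agen_closed)
    have k1: "(?k, \<one>\<^bsub>?B\<^esub>) \<in> carrier ?G" using kc by (rule hom_in_carrier[OF emb_K_hom])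
    have "?F (K_gen n j) = agen n i \<otimes>\<^bsub>?G\<^esub> (?k, \<one>\<^bsub>?B\<^esub>) \<otimes>\<^bsub>?G\<^esub> inv\<^bsub>?G\<^esub> agen n i"
      using agen_conj[OF i kc] key[OF i j] fg[OF j] by simp
    then have "inv\<^bsub>?G\<^esub> agen n i \<otimes>\<^bsub>?G\<^esub> ?F (K_gen n j) = (?k, \<one>\<^bsub>?B\<^esub>) \<otimes>\<^bsub>?G\<^esub> inv\<^bsub>?G\<^esub> agen n i"
      using a k1 by (simp add: G.m_assoc[symmetric])
    then show ?thesis by (simp only: gg[OF i])
  qed
  let ?\<phi> = "\<lambda>(k, b). ?F k \<otimes>\<^bsub>?G\<^esub> g b"
  have "?\<phi> \<in> hom ?G ?G" by (rule KB_hom[OF group_KB F g comp])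
  moreover have "?\<phi> (xgen n 1) = xgen n 1"
    using n fg[of 1] xgen_closed[of 1 n] hom_one[OF g group_braid group_KB] K_gen_closed[of 1 n]
    by (simp add: xgen_def y_def)
  moreover have "?\<phi> (agen n i) = inv\<^bsub>?G\<^esub> agen n i" if "i \<in> {1..<n}" for i
    using that gg[OF that] agen_closed[OF that] hom_one[OF F group_K group_KB] by (simp add: agen_def)
  ultimately show ?thesis using that by blast
qed

text \<open>Existence and uniqueness of the automorphism described below is lemma \<open>ex1_eps\<close>.\<close>

definition eps :: "nat \<Rightarrow> (nat word set \<times> nat word set) \<Rightarrow> (nat word set \<times> nat word set)" where
  "eps n = (THE \<phi>. \<phi> \<in> auto (KB_group n) \<and> \<phi> (xgen n 1) = xgen n 1 \<and>
    (\<forall>i\<in>{1..<n}. \<phi> (agen n i) = inv\<^bsub>KB_group n\<^esub> agen n i))"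

text \<open>The action of the cyclic group of order 2 on \<open>(K \<rtimes> B\<^sub>n) / Z(K \<rtimes> B\<^sub>n)\<close> whose generator acts by
  the automorphism that \<open>\<epsilon>\<^sub>n\<close> induces on the quotient, \<open>gZ \<mapsto> \<epsilon>\<^sub>n(g)Z\<close>.\<close>

definition eps_action :: "nat \<Rightarrow> int \<Rightarrow>
    (nat word set \<times> nat word set) set \<Rightarrow> (nat word set \<times> nat word set) set" where
  "eps_action n = (\<lambda>k\<in>carrier (integer_mod_group 2).
    \<lambda>A\<in>carrier (KB_group n Mod centre (KB_group n)). if k = 0 then A else eps n ` A)"

lemma KB_hom_eq:
  assumes n: "n \<ge> 2" and H: "group H" "\<phi> \<in> hom (KB_group n) H" "\<psi> \<in> hom (KB_group n) H"
    and 1: "\<phi> (xgen n 1) = \<psi> (xgen n 1)" "\<And>i. i \<in> {1..<n} \<Longrightarrow> \<phi> (agen n i) = \<psi> (agen n i)"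
    and z: "z \<in> carrier (KB_group n)"
  shows "\<phi> z = \<psi> z"
proof (rule hom_eq_on_generate[OF group_KB H])
  show "insert (xgen n 1) (agen n ` {1..<n}) \<subseteq> carrier (KB_group n)"
    using n xgen_closed[of 1 n] agen_closed[of _ n] by (simp add: image_subset_iff)
  show "z \<in> generate (KB_group n) (insert (xgen n 1) (agen n ` {1..<n}))"
    using z KB_generated[OF n] by simp
qed (use 1 in blast)

lemma ex1_eps:
  assumes n: "n \<ge> 2"
  shows "\<exists>!\<phi>. \<phi> \<in> auto (KB_group n) \<and> \<phi> (xgen n 1) = xgen n 1 \<and>
    (\<forall>i\<in>{1..<n}. \<phi> (agen n i) = inv\<^bsub>KB_group n\<^esub> agen n i)"
proof -
  let ?G = "KB_group n"
  interpret G: group ?G by (rule group_KB)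
  obtain \<phi> where \<phi>: "\<phi> \<in> hom ?G ?G" "\<phi> (xgen n 1) = xgen n 1"
    "\<And>i. i \<in> {1..<n} \<Longrightarrow> \<phi> (agen n i) = inv\<^bsub>?G\<^esub> agen n i"
    using ex_eps_hom[OF n] by blast
  interpret P: group_hom ?G ?G \<phi> using \<phi> by (simp add: group_hom_def group_hom_axioms_def group_KB)
  have id: "(\<lambda>z. z) \<in> hom ?G ?G" by (simp add: hom_def)
  have inv: "\<phi> (\<phi> z) = z" if z: "z \<in> carrier ?G" for z
    by (rule KB_hom_eq[OF n group_KB hom_compose[OF \<phi>(1) \<phi>(1), unfolded comp_def] id _ _ z])
      (simp_all add: \<phi> agen_closed)
  let ?\<phi> = "restrict \<phi> (carrier ?G)"
  have x1: "xgen n 1 \<in> carrier ?G" using n by (simp add: xgen_closed)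
  have h: "?\<phi> \<in> hom ?G ?G" by (rule homI) simp_all
  show ?thesis
  proof (rule ex1I[of _ ?\<phi>])
    show "?\<phi> \<in> auto ?G \<and> ?\<phi> (xgen n 1) = xgen n 1 \<and>
        (\<forall>i\<in>{1..<n}. ?\<phi> (agen n i) = inv\<^bsub>?G\<^esub> agen n i)"
      using autoI[OF h h] inv x1 by (simp add: \<phi> agen_closed)
    fix \<psi> assume \<psi>: "\<psi> \<in> auto ?G \<and> \<psi> (xgen n 1) = xgen n 1 \<and>
        (\<forall>i\<in>{1..<n}. \<psi> (agen n i) = inv\<^bsub>?G\<^esub> agen n i)"
    show "\<psi> = ?\<phi>"
    proof (rule extensionalityI[of _ "carrier ?G"])
      show "\<psi> \<in> extensional (carrier ?G)" using \<psi> auto_ext by blast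
      fix z assume z: "z \<in> carrier ?G"
      show "\<psi> z = ?\<phi> z"
        by (rule KB_hom_eq[OF n group_KB _ h _ _ z])
          (use \<psi> in \<open>simp_all add: auto_hom x1 \<phi> agen_closed\<close>)
    qed simp
  qed
qed

lemma
  assumes "n \<ge> 2"
  shows eps_auto: "eps n \<in> auto (KB_group n)"
    and eps_xgen: "eps n (xgen n 1) = xgen n 1"
    and eps_agen: "i \<in> {1..<n} \<Longrightarrow> eps n (agen n i) = inv\<^bsub>KB_group n\<^esub> agen n i"
  using theI'[OF ex1_eps[OF assms], folded eps_def] by auto

declare One_nat_def [simp]

end

theory Submission
  imports Defs
begin

text \<open>By combing and an action recording winding numbers, the braid group acts faithfully on \<open>K\<close> and
  contains no involution; hence the involutions of the semidirect product lie in \<open>K\<close>, and an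
  automorphism maps \<open>K\<close> to itself. The boundary word \<open>x\<^sub>1 \<cdots> x\<^sub>n\<close> is fixed by the braid group, so its image
  under an automorphism has a conjugacy class which is invariant under the braid group. Full twists of
  two neighbouring strands lengthen every other cyclic word, so that such a class consists of conjugates
  of a power of the boundary word, and the exponent is \<open>1\<close> or \<open>-1\<close> because the automorphism is
  invertible. Up to \<open>\<epsilon>\<^sub>n\<close> and an inner automorphism the boundary word is therefore fixed, and by Artin's
  argument the restriction to \<open>K\<close> is a braid. It remains to treat an automorphism which is the identity
  on \<open>K\<close>. It multiplies every \<open>\<alpha>\<^sub>i\<close> by an element of the centralizer of \<open>K\<close>, whose elements are
  determined by their exponent sum in \<open>n (n - 1) \<int>\<close>. The exponent sums of the images of the \<open>\<alpha>\<^sub>i\<close> are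
  equal to \<open>1\<close>, or to \<open>-1\<close> if \<open>n = 2\<close>; in the latter case the automorphism is \<open>\<epsilon>\<^sub>2\<close> followed by the
  conjugation with \<open>x\<^sub>1\<close>.\<close>

text \<open>Elements of \<open>K_group n\<close> are classes of words, so the work is done in
  \<open>ucox\<close>, whose elements are reduced words; \<open>kemb\<close> carries
  \<open>K\<close> into it. The alphabet there is all of \<open>nat\<close>: the letter 0 lies
  outside \<open>K\<close>, is fixed by every braid, and serves as the base point of the ping-pong
  argument behind faithfulness. Involutions of the braid group are excluded by two independent
  facts. Winding numbers force the permutation of an involution to be trivial, and the braids in
  which only the last strand moves form a free group. Because the generators of \<open>K\<close> are
  involutions, two neighbouring letters generate an infinite dihedral group. Words of even length
  are rotations and commute with the full twist of the two strands, words of odd length are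
  reflections and do not. So the obstruction sees only runs of odd length; the boundary word escapes
  it because its cyclic runs in two neighbouring letters have even length. The case
  \<open>n = 2\<close> is special because an exponent that is congruent to 1 modulo
  \<open>n * (n - 1)\<close> can equal -1 only if \<open>n * (n - 1)\<close> divides 2.\<close>

declare One_nat_def [simp del]

section \<open>The universal Coxeter group\<close>

text \<open>Left multiplication by an involutive generator on reduced words. As
  \<open>rcons a\<close> undoes itself there, words act on reduced words, and the group laws follow
  without a confluence argument.\<close>

definition rcons :: "'a \<Rightarrow> 'a list \<Rightarrow> 'a list" where
  "rcons a w = (case w of [] \<Rightarrow> [a] | b # v \<Rightarrow> if a = b then v else a # w)"

abbreviation red :: "'a list \<Rightarrow> 'a list" where
  "red w \<equiv> foldr rcons w []"

lemma distinct_adj_rcons: "distinct_adj w \<Longrightarrow> distinct_adj (rcons a w)"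
  by (cases w) (auto simp: rcons_def distinct_adj_Cons)

lemma distinct_adj_foldr_rcons: "distinct_adj w \<Longrightarrow> distinct_adj (foldr rcons v w)"
  by (induction v) (auto intro: distinct_adj_rcons)

lemma rcons_rcons: "distinct_adj w \<Longrightarrow> rcons a (rcons a w) = w"
proof (cases w)
  case (Cons b v)
  assume "distinct_adj w"
  then show ?thesis using Cons by (cases v) (simp_all add: rcons_def)
qed (simp add: rcons_def)

lemma foldr_rcons_append: "distinct_adj (v @ w) \<Longrightarrow> foldr rcons v w = v @ w"
proof (induction v)
  case (Cons a v)
  then have "foldr rcons v w = v @ w" by (cases "v @ w") auto
  then have "foldr rcons (a # v) w = rcons a (v @ w)" by simp
  also have "\<dots> = a # (v @ w)" using Cons.prems by (cases "v @ w") (auto simp: rcons_def)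
  finally show ?case by simp
qed simp

lemma red_id: "distinct_adj w \<Longrightarrow> red w = w"
  using foldr_rcons_append[of w "[]"] by simp

text \<open>This becomes associativity of the product. Reducing the left factor first may drop a
  pair of equal letters, which is harmless because \<open>rcons a\<close> applied twice is the
  identity on reduced words.\<close>

lemma foldr_foldr_rcons:
  assumes "distinct_adj w"
  shows "foldr rcons (foldr rcons u v) w = foldr rcons u (foldr rcons v w)"
proof -
  have "foldr rcons (rcons a v) w = rcons a (foldr rcons v w)" for a v
  proof (cases v)
    case (Cons b v')
    then show ?thesis
      using rcons_rcons[OF distinct_adj_foldr_rcons[OF assms, of v'], of a] by (auto simp: rcons_def[of a "b # v'"])
  qed (simp add: rcons_def[of a "[]"])
  then show ?thesis by (induction u) auto
qed

lemma red_rev_append: "distinct_adj v \<Longrightarrow> foldr rcons (rev w) (foldr rcons w v) = v"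
  by (induction w arbitrary: v) (auto simp: rcons_rcons distinct_adj_foldr_rcons)

lemma length_rcons_le: "length (rcons a w) \<le> Suc (length w)"
  by (auto simp: rcons_def split: list.split)

lemma length_foldr_rcons_le: "length (foldr rcons v w) \<le> length v + length w"
proof (induction v)
  case (Cons a v)
  then show ?case using length_rcons_le[of a "foldr rcons v w"] by simp
qed simp

lemma set_foldr_rcons: "set (foldr rcons v w) \<subseteq> set v \<union> set w"
proof (induction v)
  case (Cons a v)
  have "set (rcons a u) \<subseteq> insert a (set u)" for u by (auto simp: rcons_def split: list.split)
  then show ?case using Cons by fastforce
qed simp

text \<open>Elements are the reduced words. The group is written additively, since the type class
  \<^class>\<open>group_add\<close> is the library's class of (not necessarily abelian) groups.\<close>

typedef 'a ucox = "{w :: 'a list. distinct_adj w}" morphisms nf Abs_ucox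
  by (rule exI[of _ "[]"]) simp

lemma distinct_adj_nf [simp]: "distinct_adj (nf a)"
  using nf[of a] by simp

instantiation ucox :: (type) group_add
begin

definition "0 = Abs_ucox []"
definition "a + b = Abs_ucox (foldr rcons (nf a) (nf b))" for a b :: "'a ucox"
definition "- a = Abs_ucox (rev (nf a))" for a :: "'a ucox"
definition "a - b = a + - b" for a b :: "'a ucox"

lemma nf_zero [simp]: "nf 0 = []"
  by (simp add: zero_ucox_def Abs_ucox_inverse)

lemma nf_add: "nf (a + b) = foldr rcons (nf a) (nf b)"
  by (simp add: plus_ucox_def Abs_ucox_inverse distinct_adj_foldr_rcons)

lemma nf_uminus [simp]: "nf (- a) = rev (nf a)"
  by (simp add: uminus_ucox_def Abs_ucox_inverse)

instance
proof
  fix a b c :: "'a ucox"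
  show "a + b + c = a + (b + c)"
    by (simp add: nf_inject[symmetric] nf_add foldr_foldr_rcons)
  show "0 + a = a" "a + 0 = a"
    by (simp_all add: nf_inject[symmetric] nf_add red_id)
  have "nf (- a + a) = foldr rcons (rev (nf a)) (foldr rcons (nf a) [])"
    by (simp add: nf_add red_id)
  then show "- a + a = 0"
    by (simp only: red_rev_append distinct_adj_Nil) (simp flip: nf_inject)
  show "a + - b = a - b" by (simp add: minus_ucox_def)
qed

end

lemma nf_eq_Nil_iff [simp]: "nf a = [] \<longleftrightarrow> a = 0"
  by (simp flip: nf_inject)

definition gen :: "'a \<Rightarrow> 'a ucox" where
  "gen a = Abs_ucox [a]"

lemma nf_gen [simp]: "nf (gen a) = [a]"
  by (simp add: gen_def Abs_ucox_inverse)

lemma gen_eq_iff [simp]: "gen a = gen b \<longleftrightarrow> a = b"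
  by (metis nf_gen list.inject)

lemma gen_neq_0 [simp]: "gen a \<noteq> 0" "0 \<noteq> gen a"
  by (metis nf_gen nf_zero list.distinct(1))+

lemma gen_add_self [simp]: "gen a + gen a = 0"
  by (simp flip: nf_inject add: nf_add rcons_def)

lemma uminus_gen [simp]: "- gen a = gen a"
  by (simp add: minus_unique)

lemma gen_cancel [simp]: "gen a + (gen a + b) = b"
  by (simp flip: add.assoc)

lemma diff_gen: "a - gen b = a + gen b"
  by (metis add_uminus_conv_diff uminus_gen)

definition word :: "'a list \<Rightarrow> 'a ucox" where
  "word w = sum_list (map gen w)"

lemma word_simps [simp]:
  "word [] = 0" "word (a # w) = gen a + word w" "word (v @ w) = word v + word w"
  by (simp_all add: word_def)

lemma word_rev [simp]: "word (rev w) = - word w"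
  by (induction w) (simp_all add: minus_add)

lemma nf_word: "nf (word w) = red w"
  by (induction w) (simp_all add: nf_add)

lemma nf_word_id: "distinct_adj w \<Longrightarrow> nf (word w) = w"
  by (simp add: nf_word red_id)

lemma word_nf [simp]: "word (nf a) = a"
  by (simp flip: nf_inject add: nf_word red_id)

lemma nf_add_append: "distinct_adj (nf a @ nf b) \<Longrightarrow> nf (a + b) = nf a @ nf b"
  by (simp add: nf_add foldr_rcons_append)

lemma set_nf_word: "set (nf (word w)) \<subseteq> set w"
  using set_foldr_rcons[of w "[]"] by (simp add: nf_word)

lemma set_nf_add: "set (nf (a + b)) \<subseteq> set (nf a) \<union> set (nf b)"
  by (simp add: nf_add set_foldr_rcons)

definition size_of :: "'a ucox \<Rightarrow> nat" where
  "size_of a = length (nf a)"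

lemma size_of_word: "size_of (word w) \<le> length w"
  using length_foldr_rcons_le[of w "[]"] by (simp add: size_of_def nf_word)

lemma size_of_add: "size_of (a + b) \<le> size_of a + size_of b"
  by (simp add: size_of_def nf_add length_foldr_rcons_le)

lemma size_of_uminus [simp]: "size_of (- a) = size_of a"
  by (simp add: size_of_def)

lemma size_of_eq_0 [simp]: "size_of a = 0 \<longleftrightarrow> a = 0"
  by (simp add: size_of_def)

section \<open>Homomorphisms of additively written groups and the universal property of
  \<open>ucox\<close>\<close>

definition add_hom :: "('a::group_add \<Rightarrow> 'b::group_add) \<Rightarrow> bool" where
  "add_hom f \<longleftrightarrow> (\<forall>a b. f (a + b) = f a + f b)"

lemma add_hom_add: "add_hom f \<Longrightarrow> f (a + b) = f a + f b"
  by (simp add: add_hom_def)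

lemma add_hom_zero: "add_hom f \<Longrightarrow> f 0 = 0"
  by (metis add_hom_add add.right_neutral add_left_cancel)

lemma add_hom_uminus: "add_hom f \<Longrightarrow> f (- a) = - f a"
  by (metis add_hom_add add_hom_zero minus_unique add.right_inverse)

lemma add_hom_diff: "add_hom f \<Longrightarrow> f (a - b) = f a - f b"
  by (simp only: diff_conv_add_uminus add_hom_add add_hom_uminus)

lemma add_hom_sum_list: "add_hom f \<Longrightarrow> f (sum_list as) = sum_list (map f as)"
  by (induction as) (simp_all add: add_hom_zero add_hom_add)

lemmas add_hom_simps = add_hom_add add_hom_zero add_hom_uminus add_hom_diff

lemma add_hom_comp: "add_hom f \<Longrightarrow> add_hom g \<Longrightarrow> add_hom (\<lambda>a. f (g a))"
  by (simp add: add_hom_def)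

lemma add_hom_id: "add_hom (\<lambda>a. a)"
  by (simp add: add_hom_def)

lemma add_hom_conj: "add_hom f \<Longrightarrow> add_hom (\<lambda>a. k + f a - k)" for k :: "'b::group_add"
  by (simp add: add_hom_def diff_conv_add_uminus add.assoc del: add_uminus_conv_diff)

lemma add_hom_word: "add_hom f \<Longrightarrow> f (word w) = sum_list (map (\<lambda>i. f (gen i)) w)"
  by (simp add: word_def add_hom_sum_list comp_def)

lemma add_hom_nf: "add_hom f \<Longrightarrow> f a = sum_list (map (\<lambda>i. f (gen i)) (nf a))"
  using add_hom_word[of f "nf a"] by simp

text \<open>Agreement on the letters of \<open>a\<close> is enough; thus homomorphisms that agree
  only on the letters \<open>1..n\<close> can be compared on \<open>K\<close>.\<close>

lemma add_hom_eq:
  assumes "add_hom f" "add_hom g" "\<And>i. i \<in> set (nf a) \<Longrightarrow> f (gen i) = g (gen i)"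
  shows "f a = g a"
  unfolding add_hom_nf[OF assms(1), of a] add_hom_nf[OF assms(2), of a]
  by (rule arg_cong[of _ _ sum_list]) (use assms(3) in simp)

definition lift :: "('a \<Rightarrow> 'b::group_add) \<Rightarrow> 'a ucox \<Rightarrow> 'b" where
  "lift u a = sum_list (map u (nf a))"

lemma lift_gen [simp]: "lift u (gen a) = u a"
  by (simp add: lift_def)

lemma add_hom_lift:
  assumes "\<And>i. u i + u i = 0"
  shows "add_hom (lift u)"
proof -
  have 1: "sum_list (map u (rcons a w)) = u a + sum_list (map u w)" for a w
    using assms by (auto simp: rcons_def simp flip: add.assoc split: list.split)
  have "sum_list (map u (foldr rcons v w)) = sum_list (map u v) + sum_list (map u w)" for v w
    by (induction v) (simp_all add: 1 add.assoc)
  then show ?thesis by (simp add: add_hom_def lift_def nf_add)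
qed

section \<open>Reduced words\<close>

text \<open>An involution equals its inverse, so its reduced word equals its reversal. A palindrome
  of even length would have two equal letters in the middle and would not be reduced.\<close>

lemma involution_palindrome:
  assumes "a + a = 0" "a \<noteq> 0"
  obtains w i where "nf a = w @ i # rev w" "a = word w + gen i - word w"
proof -
  let ?w = "nf a"
  have "- a = a" using assms(1) by (rule minus_unique)
  then have pal: "rev ?w = ?w" by (metis nf_uminus)
  have pos: "?w \<noteq> []" using assms(2) by simp
  show ?thesis
  proof (cases "even (length ?w)")
    case True
    then obtain m where m: "length ?w = 2 * m" by (elim evenE)
    then obtain k where "m = Suc k" using pos by (cases m) auto
    then have k: "length ?w = Suc k + Suc k" using m by simp
    have "?w ! k = ?w ! Suc k"
      using rev_nth[of k ?w] k pal by simp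
    then have False using distinct_adj_nf[of a] k unfolding distinct_adj_conv_nth by simp
    then show ?thesis ..
  next
    case False
    then obtain k where "length ?w = 2 * k + 1" by (elim oddE)
    then have k: "length ?w = Suc (k + k)" by simp
    have w: "?w = take k ?w @ ?w ! k # drop (Suc k) ?w" using k by (intro id_take_nth_drop) simp
    moreover have "drop (Suc k) ?w = rev (take k ?w)"
      using rev_take[of k ?w] k pal by simp
    ultimately have "?w = take k ?w @ ?w ! k # rev (take k ?w)" by simp
    moreover from this have "a = word (take k ?w) + gen (?w ! k) - word (take k ?w)"
      by (metis word_nf word_simps(2,3) word_rev add.assoc add_uminus_conv_diff)
    ultimately show ?thesis by (rule that)
  qed
qed

text \<open>If \<open>b\<close> does not begin with \<open>y\<close>, then \<open>gen y + b\<close>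
  is one letter longer than \<open>b\<close>. By commutation nothing cancels in
  \<open>b + gen y\<close> either, and comparing first letters shows that \<open>b\<close> begins
  with \<open>y\<close> unless it is trivial. A leading \<open>y\<close> is stripped
  beforehand.\<close>

lemma centralizer_gen:
  assumes "a + gen y = gen y + a"
  shows "a = 0 \<or> a = gen y"
proof -
  have main: "b = 0" if b: "b + gen y = gen y + b" "nf b = [] \<or> hd (nf b) \<noteq> y" for b
  proof (rule ccontr)
    assume "b \<noteq> 0"
    then have ne: "nf b \<noteq> []" by simp
    have l: "nf (gen y + b) = y # nf b"
      using nf_add_append[of "gen y" b] b(2) ne by (auto simp: distinct_adj_Cons)
    show False
    proof (cases "last (nf b) = y")
      case True
      then have "nf b = butlast (nf b) @ [y]" using ne by (metis append_butlast_last_id)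
      then have "b = word (butlast (nf b)) + gen y"
        by (metis word_nf word_simps add.right_neutral)
      then have "b + gen y = word (butlast (nf b))" by (metis add.assoc gen_add_self add.right_neutral)
      then have "size_of (gen y + b) \<le> length (nf b)"
        using size_of_word[of "butlast (nf b)"] b(1) by simp
      then show False using l by (simp add: size_of_def)
    next
      case False
      then have "nf (b + gen y) = nf b @ [y]"
        using nf_add_append[of b "gen y"] ne by (auto simp: distinct_adj_append_iff)
      then have "nf b @ [y] = y # nf b" using l b(1) by simp
      then show False using ne b(2) by (metis hd_append2 list.sel(1))
    qed
  qed
  show ?thesis
  proof (cases "nf a = [] \<or> hd (nf a) \<noteq> y")
    case True
    then show ?thesis using main assms by blast
  next
    case False
    then obtain w where w: "nf a = y # w" by (metis list.collapse)
    then have a: "a = gen y + word w" by (metis word_nf word_simps(2))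
    have dw: "nf (word w) = w" using distinct_adj_nf[of a] w by (intro nf_word_id) (simp add: distinct_adj_ConsD)
    have "word w + gen y = gen y + word w"
      using assms unfolding a by (metis add.assoc add_left_cancel)
    moreover have "w = [] \<or> hd w \<noteq> y" using distinct_adj_nf[of a] w by (simp add: distinct_adj_Cons) metis
    ultimately have "word w = 0" using main[of "word w"] dw by simp
    then show ?thesis using a by simp
  qed
qed

text \<open>The blocks of \<open>D\<close>-letters between the other letters may change, but the reduction of the image
  of a reduced word cancels no letter outside \<open>D\<close>.\<close>

lemma twist_hd:
  assumes T: "add_hom T" "\<And>d. d \<in> D \<Longrightarrow> T (gen d) = gen d"
    "\<And>s. s \<notin> D \<Longrightarrow> T (gen s) = cj s + gen s - cj s"
    and cj: "\<And>s. s \<notin> D \<Longrightarrow> set (nf (cj s)) \<subseteq> D"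
    and b: "nf b = s # t" "s \<notin> D"
  shows "\<exists>r. nf (- cj s + T b) = s # r"
  using b
proof (induction "length t" arbitrary: b s t rule: less_induct)
  case less
  define d where "d = takeWhile (\<lambda>i. i \<in> D) t"
  define u where "u = dropWhile (\<lambda>i. i \<in> D) t"
  have t: "t = d @ u" by (simp add: d_def u_def)
  have dD: "set d \<subseteq> D" unfolding d_def using set_takeWhileD by fastforce
  have red: "distinct_adj (s # d @ u)" using distinct_adj_nf[of b] less.prems(1) t by simp
  have Td: "T (word d) = word d"
    using dD by (induction d) (simp_all add: add_hom_simps[OF T(1)] T(2))
  have b: "b = gen s + word d + word u" by (metis less.prems(1) t word_nf word_simps(2,3) add.assoc)
  have nf_gen_s: "\<exists>r. nf (gen s + c) = s # r" if "nf c = [] \<or> hd (nf c) \<noteq> s" for c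
    using nf_add_append[of "gen s" c] that by (auto simp: distinct_adj_Cons)
  have eq: "- cj s + T b = gen s + (- cj s + word d + T (word u))"
    by (simp add: b add_hom_simps[OF T(1)] T(3) less.prems(2) Td diff_conv_add_uminus add.assoc del: add_uminus_conv_diff)
  have "nf (- cj s + word d + T (word u)) = [] \<or> hd (nf (- cj s + word d + T (word u))) \<noteq> s"
  proof (cases u)
    case Nil
    have "set (nf (- cj s + word d)) \<subseteq> D"
      using set_nf_add[of "- cj s" "word d"] cj[OF less.prems(2)] set_nf_word[of d] dD by auto
    moreover have "T (word u) = 0" using Nil add_hom_zero[OF T(1)] by simp
    ultimately show ?thesis using less.prems(2) by (cases "nf (- cj s + word d)") auto
  next
    case (Cons s' v)
    have s': "s' \<notin> D" using Cons hd_dropWhile[of "\<lambda>i. i \<in> D" t] by (auto simp: u_def)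
    have nfu: "nf (word u) = s' # v"
      using nf_word_id[of u] red Cons by (auto dest!: distinct_adj_ConsD simp: distinct_adj_append_iff)
    have "length v < length t" using t Cons by simp
    then obtain r where r: "nf (- cj s' + T (word u)) = s' # r" using less.hyps nfu s' by blast
    \<comment> \<open>What stands between the letters \<open>s\<close> and \<open>s'\<close> in the
      image. It may vanish, but if \<open>s' = s\<close> that would force the block \<open>d\<close>
      to be empty and \<open>s s\<close> to occur in the reduced word of \<open>b\<close>.\<close>
    define e where "e = - cj s + word d + cj s'"
    have "set (nf (- cj s)) \<subseteq> D" using cj[OF less.prems(2)] by simp
    then have eD: "set (nf e) \<subseteq> D"
      unfolding e_def
      using set_nf_add[of "- cj s + word d" "cj s'"] set_nf_add[of "- cj s" "word d"] cj[OF s']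
        set_nf_word[of d] dD by blast
    have last_e: "nf e = [] \<or> last (nf e) \<noteq> s'" using eD s' last_in_set by blast
    have red_r: "distinct_adj (s' # r)" using distinct_adj_nf r by metis
    have "- cj s + word d + T (word u) = e + (- cj s' + T (word u))"
      by (simp add: e_def add.assoc)
    moreover have "nf (e + (- cj s' + T (word u))) = nf e @ s' # r"
      using nf_add_append[of e "- cj s' + T (word u)"] r last_e red_r
      by (auto simp: distinct_adj_append_iff)
    moreover have "nf e @ s' # r = [] \<or> hd (nf e @ s' # r) \<noteq> s"
    proof (cases "nf e")
      case Nil
      have "s' \<noteq> s"
      proof
        assume "s' = s"
        then have "- cj s + word d + cj s = 0" using Nil e_def by simp
        then have "word d = 0" by (metis add.assoc add_minus_cancel minus_add_cancel add.right_neutral add.left_inverse)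
        then have "d = []" using nf_word_id[of d] red by (auto dest: distinct_adj_ConsD simp: distinct_adj_append_iff)
        then show False using red Cons \<open>s' = s\<close> by simp
      qed
      then show ?thesis using Nil by simp
    next
      case (Cons x xs)
      then show ?thesis using eD less.prems(2) by auto
    qed
    ultimately show ?thesis by simp
  qed
  then show ?case unfolding eq by (rule nf_gen_s)
qed

lemma twist_last:
  assumes T: "add_hom T" "\<And>d. d \<in> D \<Longrightarrow> T (gen d) = gen d"
    "\<And>s. s \<notin> D \<Longrightarrow> T (gen s) = cj s + gen s - cj s"
    and cj: "\<And>s. s \<notin> D \<Longrightarrow> set (nf (cj s)) \<subseteq> D"
    and b: "nf b = t @ [s]" "s \<notin> D"
  shows "\<exists>r. nf (T b + cj s) = r @ [s]"
proof -
  have "nf (- b) = s # rev t" using b by simp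
  from twist_hd[OF T cj this b(2)] obtain r where "nf (- cj s + T (- b)) = s # r" by blast
  then have "rev (nf (T b + cj s)) = s # r"
    by (metis T(1) add_hom_uminus minus_add nf_uminus)
  then show ?thesis by (metis rev.simps(2) rev_rev_ident)
qed

lemma conj_sum_list_replicate:
  "sum_list (replicate N (k + a - k)) = k + sum_list (replicate N a) - k" for k :: "'a::group_add"
  by (induction N) (simp_all add: diff_conv_add_uminus add.assoc del: add_uminus_conv_diff)

lemma word_concat: "word (concat ws) = sum_list (map word ws)"
  by (induction ws) simp_all

text \<open>\<open>distinct_adj (w @ w)\<close> expresses that the word \<open>w\<close> is cyclically reduced; comparing the
  lengths of high powers shows that it is a shortest word in its conjugacy class.\<close>

lemma cyclically_reduced_length_le:
  assumes w: "distinct_adj (w @ w)" and c: "word w = k + a - k"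
  shows "length w \<le> size_of a"
proof (rule ccontr)
  assume gt: "\<not> length w \<le> size_of a"
  have red: "distinct_adj (concat (replicate N w))" for N
  proof (induction N)
    case (Suc N)
    then show ?case using w by (cases N) (auto simp: distinct_adj_append_iff)
  qed simp
  \<comment> \<open>The conjugation costs at most \<open>2 * size_of k\<close> letters in total,
    whereas each factor would gain at least one; one factor more than that gives the
    contradiction.\<close>
  let ?N = "Suc (2 * size_of k)"
  have sz: "size_of (sum_list (replicate N a)) \<le> N * size_of a" for N
  proof (induction N)
    case (Suc N)
    then show ?case using size_of_add[of a "sum_list (replicate N a)"] by simp
  qed simp
  have "?N * length w = size_of (word (concat (replicate ?N w)))"
    by (simp only: size_of_def nf_word_id[OF red] length_concat map_replicate sum_list_replicate) simp
  also have "\<dots> = size_of (k + sum_list (replicate ?N a) - k)"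
    by (simp only: word_concat map_replicate c conj_sum_list_replicate)
  also have "\<dots> \<le> size_of k + size_of (sum_list (replicate ?N a)) + size_of k"
    using size_of_add[of "k + sum_list (replicate ?N a)" "- k"] size_of_add[of k "sum_list (replicate ?N a)"]
    by (simp del: replicate_Suc sum_list_replicate)
  also have "\<dots> \<le> ?N * size_of a + 2 * size_of k" using sz[of ?N] by linarith
  finally have "?N * length w \<le> ?N * size_of a + 2 * size_of k" .
  moreover have "?N * (size_of a + 1) \<le> ?N * length w" using gt by (intro mult_le_mono) auto
  ultimately show False by (simp add: algebra_simps)
qed

text \<open>Equal first and last letters are stripped by conjugation until none remain. A single
  letter cannot be stripped, yet \<open>[i] @ [i]\<close> is not reduced; this exceptional case is
  exactly that of the involutions.\<close>

lemma ex_cyclically_reduced: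
  obtains k w where "a = k + word w - k" "distinct_adj (w @ w) \<or> (\<exists>i. w = [i])"
    "set (nf k) \<subseteq> set (nf a)" "set w \<subseteq> set (nf a)"
proof -
  have "\<exists>k w. a = k + word w - k \<and> (distinct_adj (w @ w) \<or> (\<exists>i. w = [i])) \<and>
    set (nf k) \<subseteq> set (nf a) \<and> set w \<subseteq> set (nf a)"
  proof (induction "size_of a" arbitrary: a rule: less_induct)
    case less
    show ?case
    proof (cases "distinct_adj (nf a @ nf a) \<or> (\<exists>i. nf a = [i])")
      case True
      then show ?thesis by (intro exI[of _ 0] exI[of _ "nf a"]) simp
    next
      case False
      then have ne: "nf a \<noteq> []" and hl: "last (nf a) = hd (nf a)"
        by (auto simp: distinct_adj_append_iff)
      then obtain i u where iu: "nf a = i # u" "u \<noteq> []" "last u = i"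
        using False by (cases "nf a") auto
      define v where "v = butlast u"
      have v: "nf a = i # v @ [i]" using iu by (simp add: v_def) (metis append_butlast_last_id)
      have a: "a = gen i + word v + gen i"
        by (metis v word_nf word_simps add.assoc add.right_neutral)
      have nfv: "nf (word v) = v"
        using distinct_adj_nf[of a] v by (intro nf_word_id) (auto simp: distinct_adj_append_iff dest: distinct_adj_ConsD)
      have "size_of (word v) < size_of a" using v nfv by (simp add: size_of_def)
      from less[OF this] obtain k w where kw: "word v = k + word w - k"
        "distinct_adj (w @ w) \<or> (\<exists>i. w = [i])" "set (nf k) \<subseteq> set v" "set w \<subseteq> set v"
        unfolding nfv by blast
      have "a = (gen i + k) + word w - (gen i + k)"
        unfolding a kw(1) by (simp add: diff_conv_add_uminus minus_add add.assoc del: add_uminus_conv_diff)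
      then show ?thesis
        using kw v set_nf_add[of "gen i" k] by (intro exI[of _ "gen i + k"] exI[of _ w]) auto
    qed
  qed
  then show ?thesis using that by blast
qed

section \<open>Combing\<close>

text \<open>The inductive definition of \<open>generate\<close> multiplies two arbitrary elements,
  but a normal form can be followed only along one generator at a time. The strengthening in the
  proof quantifies over a left factor that already satisfies \<open>P\<close>.\<close>

lemma (in group) generate_induct_right [consumes 2, case_names one mult mult_inv]:
  assumes T: "T \<subseteq> carrier G" and g: "g \<in> generate G T"
    and "P \<one>"
    and "\<And>g x. g \<in> generate G T \<Longrightarrow> x \<in> T \<Longrightarrow> P g \<Longrightarrow> P (g \<otimes> x)"
    and "\<And>g x. g \<in> generate G T \<Longrightarrow> x \<in> T \<Longrightarrow> P g \<Longrightarrow> P (g \<otimes> inv x)"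
  shows "P g"
proof -
  note c = generate_in_carrier[OF T]
  have "\<forall>h \<in> generate G T. P h \<longrightarrow> P (h \<otimes> g)"
    using g
  proof (induction rule: generate.induct)
    case one then show ?case using c by simp
  next
    case (incl x) then show ?case using assms(4) by blast
  next
    case (inv x) then show ?case using assms(5) by blast
  next
    case (eng g1 g2)
    then show ?case using c generate.eng[of _ G T g1] by (simp flip: m_assoc)
  qed
  then show ?thesis using assms(3) generate.one[of G T] c[OF g] by force
qed

lemma (in group) generate_conj_closed:
  assumes T: "T \<subseteq> carrier G" and x: "x \<in> carrier G"
    and conj: "\<And>t. t \<in> T \<Longrightarrow> x \<otimes> t \<otimes> inv x \<in> generate G T" and u: "u \<in> generate G T"
  shows "x \<otimes> u \<otimes> inv x \<in> generate G T"
  using u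
proof (induction rule: generate.induct)
  case one then show ?case using x by (simp add: generate.one)
next
  case (incl t) then show ?case by (rule conj)
next
  case (inv t)
  have "t \<in> carrier G" using inv T by blast
  then have "x \<otimes> inv t \<otimes> inv x = inv (x \<otimes> t \<otimes> inv x)" using x by (simp add: inv_mult_group m_assoc)
  then show ?case using generate_m_inv_closed[OF T conj[OF inv]] by simp
next
  case (eng g h)
  have "g \<in> carrier G" "h \<in> carrier G" using eng generate_in_carrier[OF T] by auto
  then have "x \<otimes> (g \<otimes> h) \<otimes> inv x = (x \<otimes> g \<otimes> inv x) \<otimes> (x \<otimes> h \<otimes> inv x)"
    using x by (simp add: m_assoc inv_solve_left flip: m_assoc[of "inv x"])
  then show ?case using eng.IH by (simp add: generate.eng)
qed

text \<open>Combing uses nothing but the braid relations, so it is carried out for arbitrary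
  elements that satisfy them; no representing words occur.\<close>

locale braid_elements = group +
  fixes n :: nat and s :: "nat \<Rightarrow> 'a"
  assumes s_closed': "i \<in> {1..<n} \<Longrightarrow> s i \<in> carrier G"
    and s_braid': "1 \<le> i \<Longrightarrow> i + 1 < n \<Longrightarrow> s i \<otimes> s (i + 1) \<otimes> s i = s (i + 1) \<otimes> s i \<otimes> s (i + 1)"
    and s_commute': "i \<in> {1..<n} \<Longrightarrow> j \<in> {1..<n} \<Longrightarrow> i + 2 \<le> j \<or> j + 2 \<le> i \<Longrightarrow> s i \<otimes> s j = s j \<otimes> s i"
begin

lemma s_closed: "1 \<le> i \<Longrightarrow> i < n \<Longrightarrow> s i \<in> carrier G"
  using s_closed' by simp

lemma s_braid: "1 \<le> i \<Longrightarrow> Suc i < n \<Longrightarrow> s i \<otimes> (s (Suc i) \<otimes> s i) = s (Suc i) \<otimes> (s i \<otimes> s (Suc i))"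
  using s_braid'[of i] s_closed[of i] s_closed[of "Suc i"] by (simp add: m_assoc Suc_eq_plus1)

lemma s_braid_left:
  "1 \<le> i \<Longrightarrow> Suc i < n \<Longrightarrow> x \<in> carrier G \<Longrightarrow>
    s i \<otimes> (s (Suc i) \<otimes> (s i \<otimes> x)) = s (Suc i) \<otimes> (s i \<otimes> (s (Suc i) \<otimes> x))"
  using arg_cong[OF s_braid[of i], of "\<lambda>y. y \<otimes> x"] s_closed[of i] s_closed[of "Suc i"] by (simp add: m_assoc)

lemma s_commute:
  "1 \<le> i \<Longrightarrow> i < n \<Longrightarrow> 1 \<le> j \<Longrightarrow> j < n \<Longrightarrow> Suc i < j \<or> Suc j < i \<Longrightarrow> s i \<otimes> s j = s j \<otimes> s i"
  using s_commute'[of i j] by auto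

lemma commute_mult:
  "x \<in> carrier G \<Longrightarrow> y \<in> carrier G \<Longrightarrow> z \<in> carrier G \<Longrightarrow> x \<otimes> y = y \<otimes> x \<Longrightarrow> x \<otimes> z = z \<otimes> x \<Longrightarrow>
    x \<otimes> (y \<otimes> z) = y \<otimes> z \<otimes> x"
  by (metis m_assoc)

lemma commute_inv:
  "x \<in> carrier G \<Longrightarrow> y \<in> carrier G \<Longrightarrow> x \<otimes> y = y \<otimes> z \<Longrightarrow> z \<in> carrier G \<Longrightarrow> z \<otimes> inv y = inv y \<otimes> x"
  by (metis inv_closed inv_solve_left inv_solve_right m_assoc m_closed)

text \<open>\<open>\<tau> m j = s\<^bsub>m-1\<^esub> \<cdots> s\<^sub>j\<close> carries the \<open>j\<close>-th strand across the strands \<open>j + 1, \<dots>, m\<close>;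
  it is \<open>\<one>\<close> for \<open>j \<ge> m\<close>.\<close>

primrec \<tau> :: "nat \<Rightarrow> nat \<Rightarrow> 'a" where
  "\<tau> 0 j = \<one>"
| "\<tau> (Suc m) j = (if j \<le> m then s m \<otimes> \<tau> m j else \<one>)"

lemma \<tau>_closed [simp]: "1 \<le> j \<Longrightarrow> m \<le> n \<Longrightarrow> \<tau> m j \<in> carrier G"
  by (induction m) (auto simp: s_closed)

lemma \<tau>_eq_one: "m \<le> j \<Longrightarrow> \<tau> m j = \<one>"
  by (cases m) auto

lemma \<tau>_unroll: "1 \<le> j \<Longrightarrow> j < m \<Longrightarrow> m \<le> n \<Longrightarrow> \<tau> m j = \<tau> m (Suc j) \<otimes> s j"
proof (induction m)
  case (Suc m)
  then show ?case by (cases "j = m") (auto simp: s_closed m_assoc \<tau>_eq_one)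
qed simp

lemma \<tau>_commute_low: "1 \<le> i \<Longrightarrow> Suc i < j \<Longrightarrow> i < n \<Longrightarrow> m \<le> n \<Longrightarrow> s i \<otimes> \<tau> m j = \<tau> m j \<otimes> s i"
proof (induction m)
  case (Suc m)
  show ?case
  proof (cases "j \<le> m")
    case True
    then show ?thesis using Suc s_commute[of i m] s_closed
      by (simp add: commute_mult)
  qed (use Suc s_closed in simp)
qed (simp add: s_closed)

lemma \<tau>_commute_high: "m < i \<Longrightarrow> i < n \<Longrightarrow> 1 \<le> j \<Longrightarrow> s i \<otimes> \<tau> m j = \<tau> m j \<otimes> s i"
proof (induction m)
  case (Suc m)
  show ?case
  proof (cases "j \<le> m")
    case True
    then show ?thesis using Suc s_commute[of i m] s_closed
      by (simp add: commute_mult)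
  qed (use Suc s_closed in simp)
qed (simp add: s_closed)

text \<open>A crossing slides along the moving strand. Every factor of \<open>\<tau> m j\<close>
  commutes with it except for one pair, where the braid relation raises the index.\<close>

lemma \<tau>_shift: "1 \<le> j \<Longrightarrow> j \<le> i \<Longrightarrow> Suc i < m \<Longrightarrow> m \<le> n \<Longrightarrow> s i \<otimes> \<tau> m j = \<tau> m j \<otimes> s (Suc i)"
proof (induction m)
  case (Suc m)
  show ?case
  proof (cases "Suc i = m")
    case True
    have t: "\<tau> m j = s i \<otimes> \<tau> i j" using Suc.prems True by auto
    have c: "s m \<otimes> \<tau> i j = \<tau> i j \<otimes> s m" using Suc.prems True by (intro \<tau>_commute_high) auto
    show ?thesis using Suc.prems True c s_braid_left[of i "\<tau> i j"] s_closed
      by (simp add: t m_assoc)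
  next
    case False
    then show ?thesis using Suc s_commute[of i m] s_closed
      by (simp add: m_assoc flip: m_assoc[of "s i" "s m"])
  qed
qed simp

text \<open>Artin's generators of the pure braid group: the strand \<open>m\<close> goes once around
  the strand \<open>j\<close> and returns.\<close>

definition A :: "nat \<Rightarrow> nat \<Rightarrow> 'a" where
  "A m j = \<tau> m (Suc j) \<otimes> s j \<otimes> s j \<otimes> inv (\<tau> m (Suc j))"

lemma A_closed [simp]: "1 \<le> j \<Longrightarrow> j < m \<Longrightarrow> m \<le> n \<Longrightarrow> A m j \<in> carrier G"
  by (simp add: A_def s_closed)

lemma \<tau>_mult_s: "1 \<le> j \<Longrightarrow> j < m \<Longrightarrow> m \<le> n \<Longrightarrow> \<tau> m j \<otimes> s j = A m j \<otimes> \<tau> m (Suc j)"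
  by (simp add: A_def s_closed \<tau>_unroll m_assoc)

lemma A_commute:
  assumes "1 \<le> i" "Suc i < m" "1 \<le> j" "j < m" "m \<le> n" "i \<noteq> j" "Suc i \<noteq> j"
  shows "s i \<otimes> A m j = A m j \<otimes> s i"
proof (cases "j < i")
  case True
  have 1: "s i \<otimes> \<tau> m (Suc j) = \<tau> m (Suc j) \<otimes> s (Suc i)" using assms True by (intro \<tau>_shift) auto
  have 2: "s (Suc i) \<otimes> s j = s j \<otimes> s (Suc i)" using assms True by (intro s_commute) auto
  have 3: "s (Suc i) \<otimes> inv (\<tau> m (Suc j)) = inv (\<tau> m (Suc j)) \<otimes> s i"
    using 1 assms True by (intro commute_inv) (auto simp: s_closed)
  have c: "s i \<in> carrier G" "s j \<in> carrier G" "s (Suc i) \<in> carrier G" "\<tau> m (Suc j) \<in> carrier G"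
    using assms True by (auto simp: s_closed)
  have "s i \<otimes> A m j = \<tau> m (Suc j) \<otimes> (s (Suc i) \<otimes> s j \<otimes> s j) \<otimes> inv (\<tau> m (Suc j))"
    using c 1 unfolding A_def by (simp flip: m_assoc)
  also have "\<dots> = \<tau> m (Suc j) \<otimes> (s j \<otimes> s j \<otimes> s (Suc i)) \<otimes> inv (\<tau> m (Suc j))"
    using c 2 by (metis m_assoc)
  also have "\<dots> = A m j \<otimes> s i"
    using c 3 unfolding A_def by (simp add: m_assoc)
  finally show ?thesis .
next
  case False
  then have ij: "Suc i < j" using assms by simp
  have 1: "s i \<otimes> \<tau> m (Suc j) = \<tau> m (Suc j) \<otimes> s i" using assms ij by (intro \<tau>_commute_low) auto
  have 2: "s i \<otimes> s j = s j \<otimes> s i" using assms ij by (intro s_commute) auto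
  have c: "s i \<in> carrier G" "s j \<in> carrier G" "\<tau> m (Suc j) \<in> carrier G"
    using assms by (auto simp: s_closed)
  have 3: "s i \<otimes> inv (\<tau> m (Suc j)) = inv (\<tau> m (Suc j)) \<otimes> s i"
    using 1 c by (intro commute_inv) auto
  show ?thesis unfolding A_def using c 1 2 3 by (simp add: m_assoc commute_mult)
qed

text \<open>The two identities determine both conjugations of \<open>A m i\<close> and
  \<open>A m (Suc i)\<close> by \<open>s i\<close>: as the product of the two commutes with
  \<open>s i\<close>, also the image that the first identity does not show is a word in
  them.\<close>

lemma A_conj:
  assumes "1 \<le> i" "Suc i < m" "m \<le> n"
  shows "s i \<otimes> A m i = A m (Suc i) \<otimes> s i"
    and "s i \<otimes> (A m i \<otimes> A m (Suc i)) = A m i \<otimes> A m (Suc i) \<otimes> s i"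
proof -
  let ?t = "\<tau> m (Suc (Suc i))"
  have c: "s i \<in> carrier G" "s (Suc i) \<in> carrier G" "?t \<in> carrier G"
    using assms by (auto simp: s_closed)
  have t: "\<tau> m (Suc i) = ?t \<otimes> s (Suc i)" using assms by (intro \<tau>_unroll) auto
  have 1: "s i \<otimes> ?t = ?t \<otimes> s i" using assms by (intro \<tau>_commute_low) auto
  have 2: "s i \<otimes> inv ?t = inv ?t \<otimes> s i" using 1 c by (intro commute_inv) auto
  have cancel: "inv x \<otimes> (x \<otimes> y) = y" "x \<otimes> (inv x \<otimes> y) = y" if "x \<in> carrier G" "y \<in> carrier G" for x y
    using that by (simp_all flip: m_assoc)
  have 3: "s i \<otimes> (s (Suc i) \<otimes> (s i \<otimes> (s i \<otimes> (inv (s (Suc i)) \<otimes> x)))) = s (Suc i) \<otimes> (s (Suc i) \<otimes> (s i \<otimes> x))"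
    if "x \<in> carrier G" for x
    using that c assms by (simp add: s_braid_left cancel)
  have "s i \<otimes> A m i = s i \<otimes> ?t \<otimes> (s (Suc i) \<otimes> (s i \<otimes> (s i \<otimes> (inv (s (Suc i)) \<otimes> inv ?t))))"
    using c unfolding A_def t by (simp add: m_assoc inv_mult_group)
  also have "\<dots> = ?t \<otimes> (s (Suc i) \<otimes> (s (Suc i) \<otimes> (s i \<otimes> inv ?t)))"
    using c unfolding 1 by (simp add: m_assoc 3)
  also have "\<dots> = A m (Suc i) \<otimes> s i"
    using c unfolding A_def 2 by (simp add: m_assoc)
  finally show "s i \<otimes> A m i = A m (Suc i) \<otimes> s i" .
  have AA: "A m i \<otimes> A m (Suc i) = ?t \<otimes> (s (Suc i) \<otimes> (s i \<otimes> (s i \<otimes> (s (Suc i) \<otimes> inv ?t))))"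
    using c unfolding A_def t by (simp add: m_assoc inv_mult_group cancel)
  have "s i \<otimes> (A m i \<otimes> A m (Suc i)) = ?t \<otimes> (s i \<otimes> (s (Suc i) \<otimes> (s i \<otimes> (s i \<otimes> (s (Suc i) \<otimes> inv ?t)))))"
    using c unfolding AA by (simp add: 1 flip: m_assoc[of "s i" ?t]) (simp add: m_assoc)
  also have "\<dots> = ?t \<otimes> (s (Suc i) \<otimes> (s i \<otimes> (s i \<otimes> (s (Suc i) \<otimes> (s i \<otimes> inv ?t)))))"
    using c assms by (simp add: s_braid_left)
  also have "\<dots> = A m i \<otimes> A m (Suc i) \<otimes> s i"
    using c unfolding AA 2 by (simp add: m_assoc)
  finally show "s i \<otimes> (A m i \<otimes> A m (Suc i)) = A m i \<otimes> A m (Suc i) \<otimes> s i" .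
qed

text \<open>\<open>H m\<close> consists of the braids on the first \<open>m\<close> strands.
  \<open>U m\<close> corresponds to the fundamental group of a disc with \<open>m - 1\<close>
  punctures, around which the strand \<open>m\<close> travels.\<close>

abbreviation H :: "nat \<Rightarrow> 'a set" where "H m \<equiv> generate G (s ` {1..<m})"
abbreviation U :: "nat \<Rightarrow> 'a set" where "U m \<equiv> generate G (A m ` {1..<m})"

lemma s_image_subset: "m \<le> n \<Longrightarrow> s ` {1..<m} \<subseteq> carrier G"
  by (auto simp: s_closed)

lemma A_image_subset: "m \<le> n \<Longrightarrow> A m ` {1..<m} \<subseteq> carrier G"
  by auto

lemma conj_A_in_U:
  assumes "1 \<le> i" "Suc i < m" "m \<le> n" "j \<in> {1..<m}"
  shows "s i \<otimes> A m j \<otimes> inv (s i) \<in> U m" "inv (s i) \<otimes> A m j \<otimes> s i \<in> U m"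
proof -
  have c: "s i \<in> carrier G" "A m j \<in> carrier G" "A m i \<in> carrier G" "A m (Suc i) \<in> carrier G"
    using assms by (auto simp: s_closed)
  note sub = generate_is_subgroup[OF A_image_subset[OF assms(3)]]
  have inU: "A m k \<in> U m" if "1 \<le> k" "k < m" for k using that by (intro generate.incl) auto
  have eqI: "x \<otimes> y \<otimes> inv x = z" "inv x \<otimes> z \<otimes> x = y"
    if "x \<otimes> y = z \<otimes> x" "x \<in> carrier G" "y \<in> carrier G" "z \<in> carrier G" for x y z
    using that by (simp_all add: m_assoc) (metis that(1) inv_solve_left' m_closed m_assoc)
  have AiU: "A m i \<in> U m" "A m (Suc i) \<in> U m" using assms inU by auto
  consider "j = i" | "j = Suc i" | "j \<noteq> i" "j \<noteq> Suc i" by blast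
  then show "s i \<otimes> A m j \<otimes> inv (s i) \<in> U m" "inv (s i) \<otimes> A m j \<otimes> s i \<in> U m"
  proof (atomize (full), cases)
    case 1
    have e1: "s i \<otimes> A m j \<otimes> inv (s i) = A m (Suc i)"
      using 1 A_conj(1)[OF assms(1-3)] c by (intro eqI) auto
    have "s i \<otimes> (A m i \<otimes> A m (Suc i) \<otimes> inv (A m i)) = A m i \<otimes> A m (Suc i) \<otimes> (s i \<otimes> inv (A m i))"
      using A_conj(2)[OF assms(1-3)] c by (metis m_assoc inv_closed m_closed)
    also have "s i \<otimes> inv (A m i) = inv (A m (Suc i)) \<otimes> s i"
      using A_conj(1)[OF assms(1-3)] c by (metis inv_solve_left inv_solve_right m_assoc m_closed inv_closed)
    also have "A m i \<otimes> A m (Suc i) \<otimes> (inv (A m (Suc i)) \<otimes> s i) = A m i \<otimes> s i"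
      using c by (simp add: m_assoc flip: m_assoc[of "A m (Suc i)"])
    finally have "inv (s i) \<otimes> A m i \<otimes> s i = A m i \<otimes> A m (Suc i) \<otimes> inv (A m i)"
      using c by (intro eqI) auto
    then have e2: "inv (s i) \<otimes> A m j \<otimes> s i \<in> U m"
      using 1 AiU subgroup.m_closed[OF sub] subgroup.m_inv_closed[OF sub] by simp
    show "s i \<otimes> A m j \<otimes> inv (s i) \<in> U m \<and> inv (s i) \<otimes> A m j \<otimes> s i \<in> U m"
      using e1 e2 AiU by simp
  next
    case 2
    have e1: "inv (s i) \<otimes> A m j \<otimes> s i = A m i"
      using 2 A_conj(1)[OF assms(1-3)] c by (intro eqI) auto
    have "s i \<otimes> A m (Suc i) = inv (A m (Suc i)) \<otimes> A m i \<otimes> A m (Suc i) \<otimes> s i"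
    proof -
      have "A m (Suc i) \<otimes> (s i \<otimes> A m (Suc i)) = A m i \<otimes> A m (Suc i) \<otimes> s i"
        using A_conj[OF assms(1-3)] c by (metis m_assoc)
      then show ?thesis using c by (metis inv_solve_left m_assoc m_closed inv_closed)
    qed
    then have "s i \<otimes> A m (Suc i) \<otimes> inv (s i) = inv (A m (Suc i)) \<otimes> A m i \<otimes> A m (Suc i)"
      using c by (intro eqI) auto
    then have e2: "s i \<otimes> A m j \<otimes> inv (s i) \<in> U m"
      using 2 AiU subgroup.m_closed[OF sub] subgroup.m_inv_closed[OF sub] by simp
    show "s i \<otimes> A m j \<otimes> inv (s i) \<in> U m \<and> inv (s i) \<otimes> A m j \<otimes> s i \<in> U m"
      using e1 e2 AiU by simp
  next
    case 3
    then have "s i \<otimes> A m j = A m j \<otimes> s i" using assms by (intro A_commute) auto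
    then show "s i \<otimes> A m j \<otimes> inv (s i) \<in> U m \<and> inv (s i) \<otimes> A m j \<otimes> s i \<in> U m"
      using eqI[of "s i" "A m j" "A m j"] c inU[of j] assms by simp
  qed
qed

lemma H_normalizes_U:
  assumes h: "h \<in> H (m - 1)" and u: "u \<in> U m" and m: "m \<le> n"
  shows "h \<otimes> u \<otimes> inv h \<in> U m"
proof -
  note sA = A_image_subset[OF m]
  have s: "s ` {1..<m - 1} \<subseteq> carrier G" using s_image_subset[of "m - 1"] m by simp
  note c = generate_in_carrier[OF s] generate_in_carrier[OF sA]
  have conj: "x \<otimes> u \<otimes> inv x \<in> U m" if "x = s i \<or> x = inv (s i)" "i \<in> {1..<m - 1}" "u \<in> U m" for x i u
  proof (rule generate_conj_closed[OF sA _ _ that(3)])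
    show "x \<in> carrier G" using that m by (auto simp: s_closed)
    fix t assume "t \<in> A m ` {1..<m}"
    then obtain j where "t = A m j" "j \<in> {1..<m}" by blast
    then show "x \<otimes> t \<otimes> inv x \<in> U m"
      using conj_A_in_U[of i m j] that m s_closed[of i] by auto
  qed
  have step: "h \<otimes> x \<otimes> v \<otimes> inv (h \<otimes> x) = h \<otimes> (x \<otimes> v \<otimes> inv x) \<otimes> inv h"
    if "h \<in> carrier G" "x \<in> carrier G" "v \<in> carrier G" for h x v
    using that by (simp add: m_assoc inv_mult_group)
  have "\<forall>u \<in> U m. h \<otimes> u \<otimes> inv h \<in> U m"
    using s h
  proof (induction rule: generate_induct_right)
    case one then show ?case using c(2) by simp
  next
    case (mult h x)
    show ?case
    proof
      fix v assume v: "v \<in> U m"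
      have "x \<otimes> v \<otimes> inv x \<in> U m" using mult(2) v conj[of x _ v] by blast
      then show "h \<otimes> x \<otimes> v \<otimes> inv (h \<otimes> x) \<in> U m"
        using step[OF c(1)[OF mult(1)] _ c(2)[OF v], of x] mult s by auto
    qed
  next
    case (mult_inv h x)
    show ?case
    proof
      fix v assume v: "v \<in> U m"
      have "inv x \<otimes> v \<otimes> inv (inv x) \<in> U m" using mult_inv(2) v conj[of "inv x" _ v] by blast
      then show "h \<otimes> inv x \<otimes> v \<otimes> inv (h \<otimes> inv x) \<in> U m"
        using step[OF c(1)[OF mult_inv(1)] _ c(2)[OF v], of "inv x"] mult_inv s by auto
    qed
  qed
  then show ?thesis using u by blast
qed

text \<open>The \<open>\<tau> m j\<close> represent the cosets of the braids that return the strand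
  \<open>m\<close> to its place. The set of all products of this form is stable under right
  multiplication by a generator: the generator either slides through \<open>\<tau> m j\<close> and
  lands in \<open>H (m - 1)\<close>, or changes \<open>j\<close> by one, possibly leaving behind a
  factor \<open>A\<close> that is moved into \<open>U m\<close> past \<open>h\<close> because
  \<open>H (m - 1)\<close> normalizes \<open>U m\<close>.\<close>

lemma comb:
  assumes g: "g \<in> H m" and m: "1 \<le> m" "m \<le> n"
  obtains u h j where "u \<in> U m" "h \<in> H (m - 1)" "1 \<le> j" "j \<le> m" "g = u \<otimes> h \<otimes> \<tau> m j"
proof -
  note sA = A_image_subset[OF m(2)]
  have s: "s ` {1..<m - 1} \<subseteq> carrier G" using s_image_subset[of "m - 1"] m by simp
  note subU = generate_is_subgroup[OF sA] and subH = generate_is_subgroup[OF s]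
  note c = generate_in_carrier[OF s] generate_in_carrier[OF sA]
  let ?P = "\<lambda>g. \<exists>u h j. u \<in> U m \<and> h \<in> H (m - 1) \<and> 1 \<le> j \<and> j \<le> m \<and> g = u \<otimes> h \<otimes> \<tau> m j"
  have P1: "?P (u \<otimes> h \<otimes> y)"
    if "u \<in> U m" "h \<in> H (m - 1)" "y = k \<otimes> \<tau> m j" "k \<in> H (m - 1)" "1 \<le> j" "j \<le> m" for u h y k j
    using that subgroup.m_closed[OF subH that(2,4)] c m
    by - (rule exI[of _ u], rule exI[of _ "h \<otimes> k"], rule exI[of _ j], simp add: m_assoc)
  have P2: "?P (u \<otimes> h \<otimes> y)"
    if "u \<in> U m" "h \<in> H (m - 1)" "y = v \<otimes> \<tau> m j" "v \<in> U m" "1 \<le> j" "j \<le> m" for u h y v j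
  proof (rule exI[of _ "u \<otimes> (h \<otimes> v \<otimes> inv h)"], rule exI[of _ h], rule exI[of _ j], intro conjI)
    show "u \<otimes> (h \<otimes> v \<otimes> inv h) \<in> U m"
      using subgroup.m_closed[OF subU that(1) H_normalizes_U[OF that(2,4) m(2)]] .
    show "u \<otimes> h \<otimes> y = u \<otimes> (h \<otimes> v \<otimes> inv h) \<otimes> h \<otimes> \<tau> m j"
      using that c m by (simp add: m_assoc inv_solve_left flip: m_assoc[of "inv h" h])
  qed (use that in auto)
  have sH: "s i \<in> H (m - 1)" "inv (s i) \<in> H (m - 1)" if "1 \<le> i" "Suc i < m" for i
    using that generate.incl[of "s i" "s ` {1..<m - 1}" G] generate.inv[of "s i" "s ` {1..<m - 1}" G] by auto
  have AU: "A m i \<in> U m" "inv (A m i) \<in> U m" if "1 \<le> i" "i < m" for i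
    using that generate.incl[of "A m i" "A m ` {1..<m}" G] generate.inv[of "A m i" "A m ` {1..<m}" G] by auto
  have oneH: "\<one> \<in> H (m - 1)" by (rule generate.one)
  have inv_eq: "x \<otimes> inv y = inv k \<otimes> z" if "z \<otimes> y = k \<otimes> x" "x \<in> carrier G" "y \<in> carrier G" "k \<in> carrier G" "z \<in> carrier G" for x y z k
    using that by (metis inv_closed inv_solve_left inv_solve_right m_assoc m_closed)
  have step: "?P (u \<otimes> h \<otimes> (\<tau> m j \<otimes> s i))" "?P (u \<otimes> h \<otimes> (\<tau> m j \<otimes> inv (s i)))"
    if uh: "u \<in> U m" "h \<in> H (m - 1)" and j: "1 \<le> j" "j \<le> m" and i: "1 \<le> i" "i < m" for u h j i
  proof -
    have ci: "s i \<in> carrier G" and cj: "\<tau> m j \<in> carrier G" using i j m by (auto simp: s_closed)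
    consider "Suc i < j" | "Suc i = j" | "i = j" | k where "i = Suc k" "j \<le> k"
      using i by (metis Suc_le_D Suc_lessI less_Suc_eq_le linorder_neqE_nat One_nat_def)
    then show "?P (u \<otimes> h \<otimes> (\<tau> m j \<otimes> s i))" "?P (u \<otimes> h \<otimes> (\<tau> m j \<otimes> inv (s i)))"
    proof (atomize (full), cases)
      case 1
      then have e: "\<tau> m j \<otimes> s i = s i \<otimes> \<tau> m j" using \<tau>_commute_low[of i j m] i m by simp
      have "\<tau> m j \<otimes> inv (s i) = inv (s i) \<otimes> \<tau> m j" using e ci cj by (intro inv_eq) auto
      then show "?P (u \<otimes> h \<otimes> (\<tau> m j \<otimes> s i)) \<and> ?P (u \<otimes> h \<otimes> (\<tau> m j \<otimes> inv (s i)))"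
        using P1[OF uh _ _ j] e sH[of i] 1 i j by simp
    next
      case 2
      have e: "\<tau> m j \<otimes> s i = \<tau> m i" using 2 \<tau>_unroll[of i m] i m by simp
      have "\<tau> m i \<otimes> s i = A m i \<otimes> \<tau> m j" using 2 \<tau>_mult_s[of i m] i m by simp
      then have e': "\<tau> m j \<otimes> inv (s i) = inv (A m i) \<otimes> \<tau> m i" using ci cj i m by (intro inv_eq) auto
      show "?P (u \<otimes> h \<otimes> (\<tau> m j \<otimes> s i)) \<and> ?P (u \<otimes> h \<otimes> (\<tau> m j \<otimes> inv (s i)))"
        using P1[OF uh _ oneH, of _ i] P2[OF uh e'] e AU[of i] i m by simp
    next
      case 3
      have e: "\<tau> m j \<otimes> s i = A m j \<otimes> \<tau> m (Suc j)" using 3 \<tau>_mult_s[of i m] i m by simp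
      have "\<tau> m (Suc j) \<otimes> s i = \<one> \<otimes> \<tau> m j" using 3 \<tau>_unroll[of i m] i m l_one[OF cj] by simp
      then have e': "\<tau> m j \<otimes> inv (s i) = inv \<one> \<otimes> \<tau> m (Suc j)" using ci cj j m by (intro inv_eq) auto
      show "?P (u \<otimes> h \<otimes> (\<tau> m j \<otimes> s i)) \<and> ?P (u \<otimes> h \<otimes> (\<tau> m j \<otimes> inv (s i)))"
        using P1[OF uh e'] P2[OF uh e] AU[of j] oneH 3 i j by simp
    next
      case 4
      have e: "\<tau> m j \<otimes> s i = s k \<otimes> \<tau> m j" using 4 \<tau>_shift[of j k m] i j m by simp
      have "s k \<in> carrier G" using 4 i j m by (intro s_closed) auto
      then have "\<tau> m j \<otimes> inv (s i) = inv (s k) \<otimes> \<tau> m j" using e ci cj by (intro inv_eq) auto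
      then show "?P (u \<otimes> h \<otimes> (\<tau> m j \<otimes> s i)) \<and> ?P (u \<otimes> h \<otimes> (\<tau> m j \<otimes> inv (s i)))"
        using P1[OF uh _ _ j] e sH[of k] 4 i j by simp
    qed
  qed
  have "?P g"
    using s_image_subset[OF m(2)] g
  proof (induction rule: generate_induct_right)
    case one
    show ?case using m generate.one[of G] \<tau>_eq_one[of m m]
      by - (rule exI[of _ \<one>], rule exI[of _ \<one>], rule exI[of _ m], simp)
  next
    case (mult g x)
    then obtain u h j i where "u \<in> U m" "h \<in> H (m - 1)" "1 \<le> j" "j \<le> m" "g = u \<otimes> h \<otimes> \<tau> m j"
      "x = s i" "1 \<le> i" "i < m" by auto
    then show ?case using step(1)[of u h j i] c m s_closed[of i] by (simp add: m_assoc)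
  next
    case (mult_inv g x)
    then obtain u h j i where "u \<in> U m" "h \<in> H (m - 1)" "1 \<le> j" "j \<le> m" "g = u \<otimes> h \<otimes> \<tau> m j"
      "x = s i" "1 \<le> i" "i < m" by auto
    then show ?case using step(2)[of u h j i] c m s_closed[of i] by (simp add: m_assoc)
  qed
  then show ?thesis using that by blast
qed

end

section \<open>Actions of the braid group\<close>

definition baction :: "nat \<Rightarrow> (nat \<Rightarrow> 'x \<Rightarrow> 'x) \<Rightarrow> nat word set \<Rightarrow> 'x \<Rightarrow> 'x" where
  "baction n f = pres_lift {1..<n} (braid_rels n) (BijGroup UNIV) f"

text \<open>Plain bijections of a type suffice; the same construction yields the action on
  \<open>ucox\<close>, the permutation of the strands and the count of crossings.\<close>

locale braid_action =
  fixes n :: nat and f :: "nat \<Rightarrow> 'x \<Rightarrow> 'x"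
  assumes bij_f: "i \<in> {1..<n} \<Longrightarrow> bij (f i)"
    and f_braid: "1 \<le> i \<Longrightarrow> i + 1 < n \<Longrightarrow> f i (f (i + 1) (f i x)) = f (i + 1) (f i (f (i + 1) x))"
    and f_commute: "i \<in> {1..<n} \<Longrightarrow> j \<in> {1..<n} \<Longrightarrow> i + 2 \<le> j \<Longrightarrow> f i (f j x) = f j (f i x)"
begin

lemma baction_hom: "baction n f \<in> hom (braid_group n) (BijGroup UNIV)"
  and baction_gen: "i \<in> {1..<n} \<Longrightarrow> baction n f (braid_gen n i) = f i"
proof -
  have 1: "f \<in> {1..<n} \<rightarrow> carrier (BijGroup UNIV)" using bij_f by (auto simp: BijGroup_def Bij_def)
  have B: "g \<in> Bij UNIV \<longleftrightarrow> bij g" for g :: "'x \<Rightarrow> 'x" by (simp add: Bij_def)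
  have m: "(g \<otimes>\<^bsub>BijGroup UNIV\<^esub> h) = (\<lambda>x. g (h x))" if "bij g" "bij h" for g h :: "'x \<Rightarrow> 'x"
    using that by (auto simp: BijGroup_def B compose_def)
  have c: "bij (\<lambda>x. g (h x))" if "bij g" "bij h" for g h :: "'x \<Rightarrow> 'x"
    using bij_comp[OF that(2,1)] by (simp add: comp_def)
  have 2: "f i \<otimes>\<^bsub>BijGroup UNIV\<^esub> (f (i + 1) \<otimes>\<^bsub>BijGroup UNIV\<^esub> f i)
      = f (i + 1) \<otimes>\<^bsub>BijGroup UNIV\<^esub> (f i \<otimes>\<^bsub>BijGroup UNIV\<^esub> f (i + 1))" if "1 \<le> i" "i + 1 < n" for i
    using that bij_f[of i] bij_f[of "i + 1"] by (simp add: m c f_braid)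
  have 3: "f i \<otimes>\<^bsub>BijGroup UNIV\<^esub> f j = f j \<otimes>\<^bsub>BijGroup UNIV\<^esub> f i"
    if "i \<in> {1..<n}" "j \<in> {1..<n}" "i + 2 \<le> j \<or> j + 2 \<le> i" for i j
    using that bij_f[of i] bij_f[of j] f_commute[of i j] f_commute[of j i] by (auto simp: m)
  note l = braid_lift[OF group_BijGroup 1 2 3]
  show "baction n f \<in> hom (braid_group n) (BijGroup UNIV)" unfolding baction_def by (rule l(1))
  show "i \<in> {1..<n} \<Longrightarrow> baction n f (braid_gen n i) = f i" unfolding baction_def by (rule l(2))
qed

lemma baction_mult:
  "g \<in> carrier (braid_group n) \<Longrightarrow> h \<in> carrier (braid_group n) \<Longrightarrow>
    baction n f (g \<otimes>\<^bsub>braid_group n\<^esub> h) x = baction n f g (baction n f h x)"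
  using hom_mult[OF baction_hom, of g h] hom_in_carrier[OF baction_hom, of g] hom_in_carrier[OF baction_hom, of h]
  by (simp add: BijGroup_def compose_def)

lemma baction_one: "baction n f \<one>\<^bsub>braid_group n\<^esub> x = x"
  using hom_one[OF baction_hom group_braid group_BijGroup] by (simp add: BijGroup_def)

lemma baction_inv:
  assumes "g \<in> carrier (braid_group n)"
  shows "baction n f (inv\<^bsub>braid_group n\<^esub> g) (baction n f g x) = x"
    and "baction n f g (baction n f (inv\<^bsub>braid_group n\<^esub> g) x) = x"
proof -
  interpret group "braid_group n" by (rule group_braid)
  show "baction n f (inv\<^bsub>braid_group n\<^esub> g) (baction n f g x) = x"
    "baction n f g (baction n f (inv\<^bsub>braid_group n\<^esub> g) x) = x"
    using assms by (simp_all add: baction_one flip: baction_mult)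
qed

end

lemma braid_elements_braid_gen: "braid_elements (braid_group n) n (braid_gen n)"
proof -
  interpret B: group "braid_group n" by (rule group_braid)
  have bc: "braid_gen n i \<in> carrier (braid_group n)" if "1 \<le> i" "i < n" for i
    using that by (simp add: braid_gen_closed)
  show ?thesis
  proof unfold_locales
    fix i assume i: "1 \<le> i" "i + 1 < n"
    have "([(i, True), (i + 1, True), (i, True)], [(i + 1, True), (i, True), (i + 1, True)]) \<in> braid_rels n"
      using i unfolding braid_rels_def by blast
    from pres_relation[OF this, of "{1..<n}"] i bc[of i] bc[of "i + 1"]
    show "braid_gen n i \<otimes>\<^bsub>braid_group n\<^esub> braid_gen n (i + 1) \<otimes>\<^bsub>braid_group n\<^esub> braid_gen n i
      = braid_gen n (i + 1) \<otimes>\<^bsub>braid_group n\<^esub> braid_gen n i \<otimes>\<^bsub>braid_group n\<^esub> braid_gen n (i + 1)"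
      by (simp add: braid_group_def[symmetric] braid_gen_def[symmetric] B.m_assoc)
  next
    fix i j assume ij: "i \<in> {1..<n}" "j \<in> {1..<n}" "i + 2 \<le> j \<or> j + 2 \<le> i"
    have "([(i, True), (j, True)], [(j, True), (i, True)]) \<in> braid_rels n"
      using ij unfolding braid_rels_def by blast
    from pres_relation[OF this, of "{1..<n}"] ij bc[of i] bc[of j]
    show "braid_gen n i \<otimes>\<^bsub>braid_group n\<^esub> braid_gen n j = braid_gen n j \<otimes>\<^bsub>braid_group n\<^esub> braid_gen n i"
      by (simp add: braid_group_def[symmetric] braid_gen_def[symmetric])
  qed (rule braid_gen_closed)
qed

lemma braid_generated: "generate (braid_group n) (braid_gen n ` {1..<n}) = carrier (braid_group n)"
  using pres_generated[of "{1..<n}" "braid_rels n"]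
  unfolding braid_group_def[symmetric] braid_gen_def[symmetric] by simp

subsection \<open>The action on the universal Coxeter group\<close>

definition bsig :: "nat \<Rightarrow> nat ucox \<Rightarrow> nat ucox" where
  "bsig i = lift (\<lambda>j. if j = i then gen (i + 1) else if j = i + 1 then gen (i + 1) + gen i + gen (i + 1) else gen j)"

lemma add_hom_bsig: "add_hom (bsig i)"
  unfolding bsig_def by (rule add_hom_lift) (simp add: add.assoc)

lemma bsig_gen: "bsig i (gen j) =
    (if j = i then gen (i + 1) else if j = i + 1 then gen (i + 1) + gen i + gen (i + 1) else gen j)"
  by (simp add: bsig_def)

lemma bij_bsig: "bij (bsig i)"
proof -
  let ?g = "lift (\<lambda>j. if j = i then gen i + gen (i + 1) + gen i else if j = i + 1 then gen i else gen j)"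
  have g: "add_hom ?g" by (rule add_hom_lift) (simp add: add.assoc)
  note s = add_hom_bsig[of i]
  have "bsig i (?g a) = a" for a
    by (rule add_hom_eq[OF add_hom_comp[OF s g] add_hom_id])
      (auto simp: add_hom_simps[OF s] bsig_gen add.assoc)
  moreover have "?g (bsig i a) = a" for a
    by (rule add_hom_eq[OF add_hom_comp[OF g s] add_hom_id])
      (auto simp: add_hom_simps[OF g] bsig_gen add.assoc)
  ultimately show ?thesis by (intro o_bij[of ?g]) auto
qed

lemma bsig_braid: "bsig i (bsig (i + 1) (bsig i a)) = bsig (i + 1) (bsig i (bsig (i + 1) a))"
  by (rule add_hom_eq[OF add_hom_comp[OF add_hom_bsig add_hom_comp[OF add_hom_bsig add_hom_bsig]]
      add_hom_comp[OF add_hom_bsig add_hom_comp[OF add_hom_bsig add_hom_bsig]]])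
    (auto simp: add_hom_simps[OF add_hom_bsig] bsig_gen add.assoc)

lemma bsig_commute: "i + 2 \<le> j \<Longrightarrow> bsig i (bsig j a) = bsig j (bsig i a)"
  by (rule add_hom_eq[OF add_hom_comp[OF add_hom_bsig add_hom_bsig] add_hom_comp[OF add_hom_bsig add_hom_bsig]])
    (auto simp: add_hom_simps[OF add_hom_bsig] bsig_gen add.assoc)

interpretation K: braid_action n bsig for n
  by unfold_locales (auto intro: bij_bsig bsig_braid bsig_commute)

abbreviation act :: "nat \<Rightarrow> nat word set \<Rightarrow> nat ucox \<Rightarrow> nat ucox" where
  "act n \<equiv> baction n bsig"

lemma add_hom_inverse:
  assumes "add_hom f" "\<And>a. f (g a) = a" "\<And>a. g (f a) = a"
  shows "add_hom g"
  unfolding add_hom_def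
proof (intro allI)
  fix a b
  have "g (f (g a + g b)) = g (a + b)" by (simp add: add_hom_add[OF assms(1)] assms(2))
  then show "g (a + b) = g a + g b" by (simp add: assms(3))
qed

lemma add_hom_act:
  assumes "g \<in> carrier (braid_group n)"
  shows "add_hom (act n g)"
proof -
  interpret B: braid_elements "braid_group n" n "braid_gen n" by (rule braid_elements_braid_gen)
  have s: "braid_gen n ` {1..<n} \<subseteq> carrier (braid_group n)" by (rule B.s_image_subset) simp
  have gen: "add_hom (act n x)" if "x \<in> braid_gen n ` {1..<n}" for x
    using that by (auto simp: K.baction_gen add_hom_bsig)
  have gen_inv: "add_hom (act n (inv\<^bsub>braid_group n\<^esub> x))" if "x \<in> braid_gen n ` {1..<n}" for x
    using that s by (intro add_hom_inverse[OF gen[OF that]]) (auto simp: K.baction_inv)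
  from s have "g \<in> generate (braid_group n) (braid_gen n ` {1..<n}) \<Longrightarrow> ?thesis"
  proof (induction rule: B.generate_induct_right)
    case one
    have "act n \<one>\<^bsub>braid_group n\<^esub> = (\<lambda>a. a)" by (auto simp: K.baction_one)
    then show ?case by (simp add: add_hom_id)
  next
    case (mult g x)
    then have "act n (g \<otimes>\<^bsub>braid_group n\<^esub> x) = (\<lambda>a. act n g (act n x a))"
      using s by (intro ext K.baction_mult) (auto simp: braid_generated)
    then show ?case using add_hom_comp[OF mult(3) gen[OF mult(2)]] by simp
  next
    case (mult_inv g x)
    then have "act n (g \<otimes>\<^bsub>braid_group n\<^esub> inv\<^bsub>braid_group n\<^esub> x) = (\<lambda>a. act n g (act n (inv\<^bsub>braid_group n\<^esub> x) a))"
      using s by (intro ext K.baction_mult) (auto simp: braid_generated)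
    then show ?case using add_hom_comp[OF mult_inv(3) gen_inv[OF mult_inv(2)]] by simp
  qed
  then show ?thesis using assms by (simp add: braid_generated)
qed

subsection \<open>Integer multiples\<close>

definition zmul :: "int \<Rightarrow> 'a::group_add \<Rightarrow> 'a" where
  "zmul k a = (if 0 \<le> k then sum_list (replicate (nat k) a) else - sum_list (replicate (nat (- k)) a))"

lemma sum_list_replicate_commute: "sum_list (replicate k a) + a = a + sum_list (replicate k a)"
  for a :: "'a::group_add"
  by (induction k) (simp_all add: add.assoc)

lemma zmul_0 [simp]: "zmul 0 a = 0"
  and zmul_1 [simp]: "zmul 1 a = a"
  by (simp_all add: zmul_def)

lemma zmul_succ: "zmul (k + 1) a = zmul k a + a"
proof -
  consider "0 \<le> k" | "k = -1" | "k < -1" by linarith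
  then show ?thesis
  proof cases
    case 1
    then have "nat (k + 1) = Suc (nat k)" by simp
    then show ?thesis using 1 by (simp add: zmul_def sum_list_replicate_commute)
  next
    case 3
    define j where "j = nat (- (k + 1))"
    have "zmul (k + 1) a = - sum_list (replicate j a)" using 3 by (simp add: zmul_def j_def)
    moreover have "nat (- k) = Suc j" using 3 by (simp add: j_def)
    then have "zmul k a = - (a + sum_list (replicate j a))" using 3 by (simp add: zmul_def)
    ultimately show ?thesis by (simp add: minus_add add.assoc)
  qed (simp add: zmul_def)
qed

lemma zmul_pred: "zmul (k - 1) a = zmul k a - a"
  using zmul_succ[of "k - 1" a] by simp

lemma zmul_add: "zmul (k + l) a = zmul k a + zmul l a"
proof (induction l rule: int_induct[where k = 0])
  case (step1 i)
  then show ?case using zmul_succ[of "k + i" a] zmul_succ[of i a] by (simp add: add.assoc)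
next
  case (step2 i)
  then show ?case using zmul_pred[of "k + i" a] zmul_pred[of i a]
    by (simp add: diff_conv_add_uminus add.assoc del: add_uminus_conv_diff)
qed simp

lemma zmul_minus: "zmul (- k) a = - zmul k a"
  using zmul_add[of k "- k" a] by (simp add: minus_unique)

lemma add_hom_zmul: "add_hom f \<Longrightarrow> f (zmul k a) = zmul k (f a)"
  by (auto simp: zmul_def add_hom_uminus add_hom_sum_list map_replicate)

lemma zmul_word: "zmul k (word w) = (if 0 \<le> k then word (concat (replicate (nat k) w)) else word (concat (replicate (nat (- k)) (rev w))))"
proof -
  have "rev (concat (replicate j w)) = concat (replicate j (rev w))" for j
    by (simp add: rev_concat map_replicate)
  then have "word (concat (replicate j (rev w))) = - word (concat (replicate j w))" for j
    by (metis word_rev)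
  then show ?thesis by (simp add: zmul_def word_concat map_replicate)
qed

lemma nf_zmul_two:
  assumes "a \<noteq> b"
  shows "nf (zmul k (gen a + gen b)) =
    (if 0 \<le> k then concat (replicate (nat k) [a, b]) else concat (replicate (nat (- k)) [b, a]))"
proof -
  have "distinct_adj (concat (replicate j [x, y]))" if "x \<noteq> y" for j and x y :: 'a
  proof (induction j)
    case (Suc j)
    then show ?case using that by (cases j) auto
  qed simp
  then have "nf (word (concat (replicate j [x, y]))) = concat (replicate j [x, y])" if "x \<noteq> y" for j and x y :: 'a
    using that by (intro nf_word_id)
  moreover have "gen a + gen b = word [a, b]" by simp
  ultimately show ?thesis using assms unfolding zmul_word \<open>gen a + gen b = word [a, b]\<close> by simp
qed

lemma set_nf_zmul_two: "a \<noteq> b \<Longrightarrow> set (nf (zmul k (gen a + gen b))) \<subseteq> {a, b}"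
  by (auto simp: nf_zmul_two split: if_splits)

lemma hd_nf_zmul_two:
  assumes "a \<noteq> b" "k \<noteq> 0"
  obtains r where "nf (zmul k (gen a + gen b)) = a # b # r" | r where "nf (zmul k (gen a + gen b)) = b # a # r"
proof (cases "0 < k")
  case True
  then obtain j where "nat k = Suc j" by (cases "nat k") auto
  then show ?thesis using True assms that(1) by (simp add: nf_zmul_two)
next
  case False
  then have "\<not> 0 \<le> k" using assms by simp
  then obtain j where "nat (- k) = Suc j" by (cases "nat (- k)") auto
  then show ?thesis using \<open>\<not> 0 \<le> k\<close> assms that(2) by (simp add: nf_zmul_two)
qed

lemma ucox_diff: "a - b = a + - b" for a b :: "'a ucox"
  by simp

subsection \<open>Pushing the last strand around\<close>

context
  fixes n :: nat
begin

interpretation B: braid_elements "braid_group n" n "braid_gen n" by (rule braid_elements_braid_gen)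

abbreviation (input) BG where "BG \<equiv> braid_group n"

lemmas act_simps = add_hom_simps[OF add_hom_act]

lemma act_gen: "1 \<le> i \<Longrightarrow> i < n \<Longrightarrow> act n (braid_gen n i) a = bsig i a"
  by (simp add: K.baction_gen)

lemma act_\<tau>:
  assumes "1 \<le> j" "j \<le> m" "m \<le> n"
  shows "act n (B.\<tau> m j) (gen k) =
    (if k = j then gen m else if j < k \<and> k \<le> m then gen m + gen (k - 1) + gen m else gen k)"
  using assms
proof (induction m)
  case (Suc m)
  show ?case
  proof (cases "j \<le> m")
    case True
    then have "act n (B.\<tau> (Suc m) j) (gen k) = bsig m (act n (B.\<tau> m j) (gen k))"
      using Suc.prems by (simp add: K.baction_mult B.s_closed act_gen)
    also have "\<dots> = bsig m (if k = j then gen m else if j < k \<and> k \<le> m then gen m + gen (k - 1) + gen m else gen k)"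
      using Suc True by simp
    finally show ?thesis using Suc.prems True
      by (auto simp: add_hom_simps[OF add_hom_bsig] bsig_gen Suc_eq_plus1[symmetric] add.assoc)
  next
    case False
    then show ?thesis using Suc.prems by (auto simp: B.\<tau>_eq_one K.baction_one)
  qed
qed simp

text \<open>Artin's formula conjugates a letter strictly between \<open>j\<close> and
  \<open>m\<close> by the commutator of the letters \<open>m\<close> and \<open>j\<close>. Both are
  involutions, so this commutator is \<open>c + c\<close>.\<close>

lemma act_A:
  assumes j: "1 \<le> j" "j < m" and m: "m \<le> n"
  shows "act n (B.A m j) (gen k) =
    (let c = gen m + gen j; q = (if k = j \<or> k = m then c else if j < k \<and> k < m then c + c else 0)
     in q + gen k - q)"
proof -
  let ?F = "act n (B.\<tau> m (Suc j))" and ?S = "\<lambda>a. bsig j (bsig j a)"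
  have c: "B.\<tau> m (Suc j) \<in> carrier BG" "braid_gen n j \<in> carrier BG" using j m by (auto simp: B.s_closed)
  \<comment> \<open>\<open>A m j\<close> is the conjugate of the square of one generator by
    \<open>\<tau> m (Suc j)\<close>. Evaluating it on images under \<open>?F\<close> avoids a
    formula for the inverse of \<open>\<tau>\<close>.\<close>
  have AF: "act n (B.A m j) (?F a) = ?F (?S a)" for a
    using c j m unfolding B.A_def
    by (simp add: B.m_assoc K.baction_mult K.baction_inv act_gen)
  have F: "?F (gen i) = (if i = Suc j then gen m else if Suc j < i \<and> i \<le> m then gen m + gen (i - 1) + gen m else gen i)" for i
    using j m by (intro act_\<tau>) auto
  note hs = add_hom_simps[OF add_hom_bsig] act_simps[OF c(1)] bsig_gen F ucox_diff minus_add
  consider "k < j \<or> m < k" | "k = j" | "k = m" | "j < k" "k < m" using j by linarith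
  then show ?thesis
  proof cases
    case 1
    then have "?F (gen k) = gen k" using F[of k] j by auto
    moreover have "?S (gen k) = gen k" using 1 j by (auto simp: hs)
    ultimately have "act n (B.A m j) (gen k) = gen k" using AF[of "gen k"] by simp
    then show ?thesis using 1 j by (auto simp: Let_def)
  next
    case 2
    then have "?F (gen k) = gen k" using F[of k] by auto
    then have "act n (B.A m j) (gen k) = ?F (?S (gen k))" using AF[of "gen k"] by simp
    also have "\<dots> = gen m + gen j + gen m" using 2 j by (simp add: hs add.assoc Suc_eq_plus1[symmetric] del: add_uminus_conv_diff)
    finally show ?thesis using 2 by (simp add: Let_def hs add.assoc del: add_uminus_conv_diff)
  next
    case 3
    have "?F (gen (Suc j)) = gen m" by (simp add: F)
    then have "act n (B.A m j) (gen k) = ?F (?S (gen (Suc j)))" using AF[of "gen (Suc j)"] 3 by simp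
    also have "\<dots> = gen m + gen j + gen m + gen j + gen m" using j by (simp add: hs add.assoc Suc_eq_plus1[symmetric] del: add_uminus_conv_diff)
    finally show ?thesis using 3 by (simp add: Let_def hs add.assoc del: add_uminus_conv_diff)
  next
    case 4
    let ?v = "gen (Suc j) + gen (Suc k) + gen (Suc j)"
    have "?F ?v = gen k" using 4 by (simp add: hs add.assoc del: add_uminus_conv_diff)
    then have "act n (B.A m j) (gen k) = ?F (?S ?v)" using AF[of ?v] by simp
    also have "\<dots> = gen m + gen j + gen m + gen j + gen k + gen j + gen m + gen j + gen m"
      using 4 j by (simp add: hs add.assoc Suc_eq_plus1[symmetric] del: add_uminus_conv_diff)
    finally show ?thesis using 4 j by (simp add: Let_def hs add.assoc del: add_uminus_conv_diff)
  qed
qed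

text \<open>The automorphism \<open>A m j\<close> (to the power \<open>e\<close>) followed by a conjugation, so that \<open>x\<^sub>m\<close> and
  \<open>x\<^sub>j\<close> are fixed.\<close>

definition twq :: "nat \<Rightarrow> nat \<Rightarrow> int \<Rightarrow> nat \<Rightarrow> nat ucox" where
  "twq m j e i = zmul (if j < i \<and> i < m then e else - e) (gen m + gen j)"

definition tw :: "nat \<Rightarrow> nat \<Rightarrow> int \<Rightarrow> nat ucox \<Rightarrow> nat ucox" where
  "tw m j e = lift (\<lambda>i. if i = m \<or> i = j then gen i else twq m j e i + gen i - twq m j e i)"

lemma add_hom_tw: "add_hom (tw m j e)"
  unfolding tw_def
  by (rule add_hom_lift) (simp add: ucox_diff add.assoc del: add_uminus_conv_diff)

lemma tw_gen: "tw m j e (gen i) = (if i = m \<or> i = j then gen i else twq m j e i + gen i - twq m j e i)"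
  by (simp add: tw_def)

lemma tw_zmul: "tw m j e (zmul k (gen m + gen j)) = zmul k (gen m + gen j)"
  by (simp add: add_hom_zmul[OF add_hom_tw] add_hom_add[OF add_hom_tw] tw_gen)

text \<open>All conjugators are powers of \<open>gen m + gen j\<close>, and these are fixed by every
  \<open>tw m j d\<close>; hence exponents add up.\<close>

lemma tw_tw: "tw m j d (tw m j e a) = tw m j (d + e) a"
proof (rule add_hom_eq[OF add_hom_comp[OF add_hom_tw add_hom_tw] add_hom_tw])
  fix i
  have q: "twq m j (d + e) i = twq m j e i + twq m j d i"
    using zmul_add[of e d] zmul_add[of "- e" "- d"] by (auto simp: twq_def add.commute[of d e])
  have "tw m j d (twq m j e i) = twq m j e i" by (simp add: twq_def tw_zmul)
  then show "tw m j d (tw m j e (gen i)) = tw m j (d + e) (gen i)"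
    by (simp add: tw_gen add_hom_simps[OF add_hom_tw] q ucox_diff minus_add add.assoc del: add_uminus_conv_diff)
qed

lemma tw_0: "tw m j 0 a = a"
  by (rule add_hom_eq[OF add_hom_tw add_hom_id]) (simp add: tw_gen twq_def)

lemma act_A_power:
  assumes j: "1 \<le> j" "j < m" and m: "m \<le> n"
  shows "act n (B.A m j [^]\<^bsub>BG\<^esub> (e::int)) a =
    zmul e (gen m + gen j) + tw m j e a - zmul e (gen m + gen j)"
proof -
  let ?c = "gen m + gen j :: nat ucox"
  have Ac: "B.A m j \<in> carrier BG" using j m by simp
  have one: "act n (B.A m j) a = ?c + tw m j 1 a - ?c" for a
  proof (rule add_hom_eq[OF add_hom_act[OF Ac] add_hom_conj[OF add_hom_tw]])
    fix i
    consider "i = j \<or> i = m" | "j < i" "i < m" | "i < j \<or> m < i" using j by linarith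
    then show "act n (B.A m j) (gen i) = ?c + tw m j 1 (gen i) - ?c"
    proof cases
      case 1
      then show ?thesis using j by (auto simp: act_A[OF j m] tw_gen Let_def)
    next
      case 2
      then show ?thesis
        by (simp add: act_A[OF j m] tw_gen twq_def Let_def ucox_diff minus_add add.assoc del: add_uminus_conv_diff)
    next
      case 3
      then show ?thesis using j
        by (auto simp: act_A[OF j m] tw_gen twq_def Let_def zmul_minus ucox_diff minus_add add.assoc simp del: add_uminus_conv_diff)
    qed
  qed
  have tc: "tw m j d (?c + b - ?c) = ?c + tw m j d b - ?c" for d b
    by (simp add: add_hom_simps[OF add_hom_tw] tw_gen)
  show ?thesis
  proof (induction e arbitrary: a rule: int_induct[where k = 0])
    case base
    then show ?case by (simp add: K.baction_one tw_0)
  next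
    case (step1 e)
    have "B.A m j [^]\<^bsub>BG\<^esub> (e + 1) = B.A m j [^]\<^bsub>BG\<^esub> e \<otimes>\<^bsub>BG\<^esub> B.A m j"
      using Ac B.int_pow_mult[OF Ac, of e 1] by simp
    then have "act n (B.A m j [^]\<^bsub>BG\<^esub> (e + 1)) a = zmul e ?c + tw m j e (?c + tw m j 1 a - ?c) - zmul e ?c"
      using Ac by (simp add: K.baction_mult step1(2) one)
    then show ?case
      unfolding tc tw_tw by (simp add: zmul_succ ucox_diff minus_add add.assoc del: add_uminus_conv_diff)
  next
    case (step2 e)
    obtain b where b: "a = act n (B.A m j) b" using K.baction_inv(2)[OF Ac] by metis
    have "B.A m j [^]\<^bsub>BG\<^esub> (e - 1) \<otimes>\<^bsub>BG\<^esub> B.A m j = B.A m j [^]\<^bsub>BG\<^esub> e"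
      using Ac B.int_pow_mult[OF Ac, of "e - 1" 1] by simp
    then have "act n (B.A m j [^]\<^bsub>BG\<^esub> (e - 1)) a = act n (B.A m j [^]\<^bsub>BG\<^esub> e) b"
      unfolding b using Ac by (simp flip: K.baction_mult)
    also have "\<dots> = zmul e ?c + tw m j e b - zmul e ?c" by (rule step2(2))
    also have "\<dots> = zmul (e - 1) ?c + tw m j (e - 1) a - zmul (e - 1) ?c"
    proof -
      have "tw m j (e - 1) a = ?c + tw m j e b - ?c" unfolding b one tc by (simp add: tw_tw)
      moreover have "zmul e ?c = zmul (e - 1) ?c + ?c" using zmul_succ[of "e - 1" ?c] by simp
      ultimately show ?thesis
        by (simp add: ucox_diff minus_add add.assoc del: add_uminus_conv_diff)
    qed
    finally show ?case .
  qed
qed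

text \<open>Syllable words: \<open>[(j\<^sub>1, e\<^sub>1), \<dots>]\<close> stands for the product of the \<open>A m j\<^sub>i ^ e\<^sub>i\<close>.\<close>

definition syl :: "nat \<Rightarrow> (nat \<times> int) list \<Rightarrow> bool" where
  "syl m w \<longleftrightarrow> (\<forall>(j, e) \<in> set w. 1 \<le> j \<and> j < m \<and> e \<noteq> 0) \<and> distinct_adj (map fst w)"

primrec ev :: "nat \<Rightarrow> (nat \<times> int) list \<Rightarrow> nat word set" where
  "ev m [] = \<one>\<^bsub>BG\<^esub>"
| "ev m (p # w) = B.A m (fst p) [^]\<^bsub>BG\<^esub> snd p \<otimes>\<^bsub>BG\<^esub> ev m w"

primrec tws :: "nat \<Rightarrow> (nat \<times> int) list \<Rightarrow> nat ucox \<Rightarrow> nat ucox" where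
  "tws m [] a = a"
| "tws m (p # w) a = tw m (fst p) (snd p) (tws m w a)"

lemma syl_Cons: "syl m (p # w) \<longleftrightarrow>
    1 \<le> fst p \<and> fst p < m \<and> snd p \<noteq> 0 \<and> syl m w \<and> (w = [] \<or> fst p \<noteq> fst (hd w))"
  by (cases w) (auto simp: syl_def split: prod.splits)

lemma syl_append: "syl m (v @ w) \<longleftrightarrow>
    syl m v \<and> syl m w \<and> (v = [] \<or> w = [] \<or> fst (last v) \<noteq> fst (hd w))"
  by (auto simp: syl_def distinct_adj_append_iff last_map hd_map)

lemma ev_closed: "m \<le> n \<Longrightarrow> syl m w \<Longrightarrow> ev m w \<in> carrier BG"
  by (induction w) (auto simp: syl_Cons)

lemma ev_append: "m \<le> n \<Longrightarrow> syl m v \<Longrightarrow> syl m w \<Longrightarrow> ev m (v @ w) = ev m v \<otimes>\<^bsub>BG\<^esub> ev m w"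
  by (induction v) (auto simp: syl_Cons ev_closed B.m_assoc)

text \<open>The conjugations contributed by the syllables are pushed outwards through the
  homomorphisms \<open>tw\<close> and collected in one element \<open>k\<close>. What is left fixes
  the letter \<open>m\<close>, so \<open>k\<close> can be recovered from the image of that
  letter.\<close>

lemma act_ev:
  assumes "m \<le> n" "syl m w"
  shows "\<exists>k. \<forall>a. act n (ev m w) a = k + tws m w a - k"
  using assms(2)
proof (induction w)
  case Nil
  show ?case by (intro exI[of _ 0]) (simp add: K.baction_one)
next
  case (Cons p w)
  then obtain k where k: "\<And>a. act n (ev m w) a = k + tws m w a - k" by (auto simp: syl_Cons)
  let ?z = "zmul (snd p) (gen m + gen (fst p))" and ?k = "tw m (fst p) (snd p) k"
  have "act n (ev m (p # w)) a = (?z + ?k) + tws m (p # w) a - (?z + ?k)" for a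
    using Cons.prems assms(1)
    by (simp add: syl_Cons K.baction_mult ev_closed act_A_power k add_hom_simps[OF add_hom_tw]
      ucox_diff minus_add add.assoc del: add_uminus_conv_diff)
  then show ?case by blast
qed

lemma tws_gen: "tws m w (gen m) = gen m"
  by (induction w) (simp_all add: tw_gen)

text \<open>The index of the first syllable can be read off from the image of the letter 0, up to a
  leading \<open>m\<close>. A further syllable \<open>(j, e)\<close> with a different index meets a
  letter other than \<open>m\<close> and \<open>j\<close>, and \<open>twist_hd\<close> ensures that
  a nontrivial power of \<open>gen m + gen j\<close> survives in front of it.\<close>

lemma tws_ping_pong:
  assumes "syl m w" "w \<noteq> []"
  shows "\<exists>p \<in> {[], [m]}. \<exists>r. nf (tws m w (gen 0)) = p @ fst (hd w) # r"
  using assms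
proof (induction w)
  case (Cons q w)
  obtain j e where q: "q = (j, e)" by (cases q)
  then have j: "1 \<le> j" "j < m" "e \<noteq> 0" "syl m w" "w = [] \<or> j \<noteq> fst (hd w)"
    using Cons.prems by (auto simp: syl_Cons)
  define a where "a = tws m w (gen 0)"
  have "\<exists>p \<in> {[], [m]}. \<exists>i r. nf a = p @ i # r \<and> i \<noteq> m \<and> i \<noteq> j"
  proof (cases w)
    case Nil
    then show ?thesis using j by (intro bexI[of _ "[]"]) (auto simp: a_def)
  next
    case (Cons q' w')
    then obtain p r where "p \<in> {[], [m]}" "nf a = p @ fst (hd w) # r"
      using Cons.IH j(4) unfolding a_def by blast
    moreover have "fst (hd w) \<noteq> m" using Cons j(4) by (auto simp: syl_Cons)
    ultimately show ?thesis using j(5) Cons by blast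
  qed
  then obtain p i t where p: "p \<in> {[], [m]}" "nf a = p @ i # t" "i \<noteq> m" "i \<noteq> j" by blast
  have dt: "distinct_adj (i # t)" using distinct_adj_nf[of a] p(2) by (auto simp: distinct_adj_append_iff)
  let ?b = "word (i # t)"
  have "\<exists>r. nf (- twq m j e i + tw m j e ?b) = i # r"
  proof (rule twist_hd[where D = "{m, j}" and T = "tw m j e" and cj = "twq m j e" and b = ?b and s = i and t = t])
    show "nf ?b = i # t" using dt by (rule nf_word_id)
    show "set (nf (twq m j e s)) \<subseteq> {m, j}" for s
      unfolding twq_def using j by (intro set_nf_zmul_two) simp
  qed (use p j in \<open>auto simp: add_hom_tw tw_gen\<close>)
  then obtain r where r: "nf (- twq m j e i + tw m j e ?b) = i # r" by blast
  have a: "a = word p + ?b" by (metis p(2) word_nf word_simps(3))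
  have "tw m j e (word p) = word p" using p(1) by (auto simp: add_hom_simps[OF add_hom_tw] tw_gen)
  then have twa: "tw m j e a = (word p + twq m j e i) + (- twq m j e i + tw m j e ?b)"
    unfolding a add_hom_add[OF add_hom_tw] by (simp add: add.assoc)
  \<comment> \<open>The alternating word has at least two letters, and \<open>p\<close> contributes
    or cancels at most one \<open>m\<close>, so \<open>j\<close> ends up in the first or the second
    place.\<close>
  have hd_c: "\<exists>p' \<in> {[], [m]}. \<exists>r'. nf (word p + twq m j e i) = p' @ j # r'"
  proof -
    obtain k where k: "twq m j e i = zmul k (gen m + gen j)" "k \<noteq> 0" using j by (auto simp: twq_def)
    have mj: "m \<noteq> j" using j by simp
    show ?thesis
    proof (cases "p = []")
      case True
      then show ?thesis using k(1) by (auto intro: hd_nf_zmul_two[OF mj k(2)])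
    next
      case False
      then have w: "word p = gen m" using p(1) by auto
      show ?thesis
      proof (rule hd_nf_zmul_two[OF mj k(2)])
        fix r' assume z: "nf (zmul k (gen m + gen j)) = m # j # r'"
        then have "distinct_adj (j # r')" by (metis distinct_adj_nf distinct_adj_ConsD)
        moreover have "zmul k (gen m + gen j) = gen m + word (j # r')" by (metis z word_nf word_simps(2))
        ultimately have "nf (word p + twq m j e i) = j # r'"
          unfolding w k(1) by (simp only: gen_cancel nf_word_id)
        then show ?thesis by auto
      next
        fix r' assume z: "nf (zmul k (gen m + gen j)) = j # m # r'"
        then have "nf (word p + twq m j e i) = m # j # m # r'"
          unfolding w k(1) using nf_add_append[of "gen m" "zmul k (gen m + gen j)"] mj
            distinct_adj_nf[of "zmul k (gen m + gen j)"] by simp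
        then show ?thesis by auto
      qed
    qed
  qed
  have "set (nf (word p)) \<subseteq> {m, j}" using p(1) by auto
  moreover have "set (nf (twq m j e i)) \<subseteq> {m, j}" unfolding twq_def using j by (intro set_nf_zmul_two) simp
  ultimately have D: "set (nf (word p + twq m j e i)) \<subseteq> {m, j}" using set_nf_add by fast
  have "nf (tw m j e a) = nf (word p + twq m j e i) @ i # r"
  proof -
    have "i \<notin> set (nf (word p + twq m j e i))" using D p(3,4) by blast
    then have "nf (word p + twq m j e i) = [] \<or> last (nf (word p + twq m j e i)) \<noteq> i"
      using last_in_set by metis
    moreover have "distinct_adj (i # r)" by (metis r distinct_adj_nf)
    ultimately show ?thesis
      unfolding twa using nf_add_append[of "word p + twq m j e i" "- twq m j e i + tw m j e ?b"] r
      by (auto simp: distinct_adj_append_iff)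
  qed
  then show ?case using hd_c by (auto simp: q a_def)
qed simp

text \<open>If the letter \<open>m\<close> is fixed, the collected conjugator commutes with it and
  is \<open>0\<close> or \<open>gen m\<close>. The letter 0 is fixed by the whole braid, so
  \<open>tws\<close> maps it to \<open>0\<close> or to \<open>m 0 m\<close>; ping-pong instead
  demands an index between 1 and \<open>m - 1\<close> at the front.\<close>

lemma ev_faithful:
  assumes "m \<le> n" "syl m w" "w \<noteq> []"
  shows "act n (ev m w) (gen m) \<noteq> gen m"
proof
  assume fix_m: "act n (ev m w) (gen m) = gen m"
  from act_ev[OF assms(1,2)] obtain k where k': "\<forall>a. act n (ev m w) a = k + tws m w a - k" ..
  have k: "act n (ev m w) a = k + tws m w a - k" for a using k' ..
  have "k + gen m = gen m + k"
    using fix_m unfolding k tws_gen by (simp add: diff_eq_eq)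
  then have km: "k = 0 \<or> k = gen m" by (rule centralizer_gen)
  have fix_0: "act n (ev m w) (gen 0) = gen 0"
    using assms(2)
  proof (induction w)
    case (Cons p w)
    then show ?case using assms(1)
      by (auto simp: syl_Cons K.baction_mult ev_closed act_A_power tw_gen twq_def zmul_minus
        ucox_diff minus_add add.assoc simp del: add_uminus_conv_diff)
  qed (simp add: K.baction_one)
  have "tws m w (gen 0) = - k + gen 0 + k"
    using fix_0 unfolding k by (simp add: diff_eq_eq add.assoc flip: minus_add_cancel)
       (metis add.assoc minus_add_cancel)
  moreover have "1 \<le> fst (hd w)" "fst (hd w) < m" using assms(2,3) by (cases w; auto simp: syl_Cons)+
  moreover have "nf (word [m, 0, m]) = [m, 0, m]" if "0 < m" using that by (intro nf_word_id) auto
  ultimately show False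
    using km tws_ping_pong[OF assms(2,3)] by (auto simp: add.assoc)
qed

lemma ex_syl_Cons:
  assumes "syl m w" "1 \<le> j" "j < m" "m \<le> n"
  shows "\<exists>w'. syl m w' \<and> B.A m j [^]\<^bsub>BG\<^esub> (e::int) \<otimes>\<^bsub>BG\<^esub> ev m w = ev m w'"
proof -
  have Ac: "B.A m j \<in> carrier BG" using assms by simp
  consider "e = 0" | "e \<noteq> 0" "w = [] \<or> fst (hd w) \<noteq> j"
    | d v where "w = (j, d) # v" "d + e = 0" | d v where "w = (j, d) # v" "d + e \<noteq> 0"
    by (cases w; force)
  then show ?thesis
  proof cases
    case 1
    then show ?thesis using assms by (intro exI[of _ w]) (simp add: ev_closed)
  next
    case 2
    then show ?thesis using assms by (intro exI[of _ "(j, e) # w"]) (auto simp: syl_Cons)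
  next
    case 3
    then have "syl m v" using assms by (simp add: syl_Cons)
    moreover have "B.A m j [^]\<^bsub>BG\<^esub> e \<otimes>\<^bsub>BG\<^esub> ev m w = ev m v"
      using 3 Ac \<open>syl m v\<close> assms(4) B.int_pow_mult[OF Ac, of e d]
      by (simp add: ev_closed add.commute flip: B.m_assoc)
    ultimately show ?thesis by blast
  next
    case 4
    then have v: "syl m v" using assms by (simp add: syl_Cons)
    have "B.A m j [^]\<^bsub>BG\<^esub> e \<otimes>\<^bsub>BG\<^esub> ev m w = ev m ((j, e + d) # v)"
      using 4 Ac v assms(4) B.int_pow_mult[OF Ac, of e d]
      by (simp add: ev_closed flip: B.m_assoc)
    moreover have "syl m ((j, e + d) # v)" using 4 assms by (auto simp: syl_Cons add.commute)
    ultimately show ?thesis by blast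
  qed
qed

lemma ex_syl:
  assumes u: "u \<in> B.U m" and m: "m \<le> n"
  obtains w where "syl m w" "u = ev m w"
proof -
  have "\<forall>w. syl m w \<longrightarrow> (\<exists>w'. syl m w' \<and> u \<otimes>\<^bsub>BG\<^esub> ev m w = ev m w')"
    using u
  proof (induction rule: generate.induct)
    case one
    then show ?case using m by (auto simp: ev_closed)
  next
    case (incl x)
    then obtain j where j: "x = B.A m j" "1 \<le> j" "j < m" by auto
    then show ?case using ex_syl_Cons[OF _ j(2,3) m, of _ 1] m by (auto simp: B.int_pow_1)
  next
    case (inv x)
    then obtain j where j: "x = B.A m j" "1 \<le> j" "j < m" by auto
    then show ?case using ex_syl_Cons[OF _ j(2,3) m, of _ "-1"] m by (auto simp: B.int_pow_neg)
  next
    case (eng x y)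
    have "x \<in> carrier BG" "y \<in> carrier BG"
      using eng B.generate_in_carrier[OF B.A_image_subset[OF m]] by auto
    then show ?case using eng.IH m by (metis B.m_assoc ev_closed)
  qed
  moreover have "syl m []" by (simp add: syl_def)
  moreover have "u \<in> carrier BG" using u B.generate_in_carrier[OF B.A_image_subset[OF m]] by auto
  ultimately show ?thesis using that by fastforce
qed

lemma U_faithful:
  assumes "u \<in> B.U m" "m \<le> n" "act n u (gen m) = gen m"
  shows "u = \<one>\<^bsub>BG\<^esub>"
proof -
  obtain w where "syl m w" "u = ev m w" using ex_syl[OF assms(1,2)] .
  then show ?thesis using ev_faithful[OF assms(2), of w] assms(3) by (cases "w = []") auto
qed

lemma syl_cyclically_reduced:
  assumes "syl m w" "m \<le> n"
  shows "\<exists>v w'. v \<in> carrier BG \<and> syl m w' \<and> ev m w = v \<otimes>\<^bsub>BG\<^esub> ev m w' \<otimes>\<^bsub>BG\<^esub> inv\<^bsub>BG\<^esub> v \<and>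
    (w' = [] \<or> length w' = 1 \<or> fst (hd w') \<noteq> fst (last w'))"
  using assms(1)
proof (induction "length w" arbitrary: w rule: less_induct)
  case less
  show ?case
  proof (cases "w = [] \<or> length w = 1 \<or> fst (hd w) \<noteq> fst (last w)")
    case True
    then show ?thesis using less.prems assms(2)
      by (intro exI[of _ "\<one>\<^bsub>BG\<^esub>"] exI[of _ w]) (simp add: ev_closed)
  next
    case False
    then obtain j d x where w: "w = (j, d) # x" "x \<noteq> []" "fst (last x) = j"
      by (cases w) auto
    define y where "y = butlast x"
    obtain e where x: "x = y @ [(j, e)]" using w by (metis y_def append_butlast_last_id prod.collapse)
    have j: "1 \<le> j" "j < m" "syl m y" "e \<noteq> 0" and y: "y \<noteq> []" "fst (last y) \<noteq> j"
      using less.prems by (auto simp: w(1) x syl_Cons syl_append)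
    have Ac: "B.A m j \<in> carrier BG" using j assms(2) by simp
    let ?a = "B.A m j [^]\<^bsub>BG\<^esub> d" and ?b = "B.A m j [^]\<^bsub>BG\<^esub> e"
    have yc: "ev m y \<in> carrier BG" using j assms by (simp add: ev_closed)
    define w' where "w' = (if e + d = 0 then y else y @ [(j, e + d)])"
    have sw': "syl m w'" using j y by (auto simp: w'_def syl_append) (auto simp: syl_def)
    have "ev m w' = ev m y \<otimes>\<^bsub>BG\<^esub> B.A m j [^]\<^bsub>BG\<^esub> (e + d)"
      using j assms Ac sw' yc by (auto simp: w'_def syl_append ev_append)
    then have ew': "ev m w' = ev m y \<otimes>\<^bsub>BG\<^esub> (?b \<otimes>\<^bsub>BG\<^esub> ?a)" using Ac by (simp add: B.int_pow_mult)
    have "ev m w = ?a \<otimes>\<^bsub>BG\<^esub> (ev m y \<otimes>\<^bsub>BG\<^esub> ?b)"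
      using less.prems j assms Ac by (simp add: w(1) x syl_Cons syl_append ev_append)
    also have "\<dots> = ?a \<otimes>\<^bsub>BG\<^esub> ev m w' \<otimes>\<^bsub>BG\<^esub> inv\<^bsub>BG\<^esub> ?a"
      using yc Ac unfolding ew' by (simp add: B.m_assoc)
    finally have 1: "ev m w = ?a \<otimes>\<^bsub>BG\<^esub> ev m w' \<otimes>\<^bsub>BG\<^esub> inv\<^bsub>BG\<^esub> ?a" .
    have "length w' < length w" by (simp add: w'_def w(1) x)
    from less.hyps[OF this sw'] obtain v w'' where v: "v \<in> carrier BG" "syl m w''"
      "ev m w' = v \<otimes>\<^bsub>BG\<^esub> ev m w'' \<otimes>\<^bsub>BG\<^esub> inv\<^bsub>BG\<^esub> v"
      "w'' = [] \<or> length w'' = 1 \<or> fst (hd w'') \<noteq> fst (last w'')" by blast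
    have "ev m w = (?a \<otimes>\<^bsub>BG\<^esub> v) \<otimes>\<^bsub>BG\<^esub> ev m w'' \<otimes>\<^bsub>BG\<^esub> inv\<^bsub>BG\<^esub> (?a \<otimes>\<^bsub>BG\<^esub> v)"
      using v Ac ev_closed[OF assms(2) v(2)] unfolding 1 v(3) by (simp add: B.m_assoc B.inv_mult_group)
    then show ?thesis using v Ac by (intro exI[of _ "?a \<otimes>\<^bsub>BG\<^esub> v"] exI[of _ w'']) simp
  qed
qed

text \<open>The argument for free groups: a conjugate has a syllable word whose square is again a
  nonempty syllable word, obtained by repeating it or, for a single syllable, by doubling the
  exponent. Such a word acts nontrivially.\<close>

lemma U_no_involution:
  assumes "u \<in> B.U m" "m \<le> n" "u \<otimes>\<^bsub>BG\<^esub> u = \<one>\<^bsub>BG\<^esub>"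
  shows "u = \<one>\<^bsub>BG\<^esub>"
proof -
  obtain w0 where w0: "syl m w0" "u = ev m w0" using ex_syl[OF assms(1,2)] .
  obtain v w where v: "v \<in> carrier BG" "syl m w" "u = v \<otimes>\<^bsub>BG\<^esub> ev m w \<otimes>\<^bsub>BG\<^esub> inv\<^bsub>BG\<^esub> v"
    "w = [] \<or> length w = 1 \<or> fst (hd w) \<noteq> fst (last w)"
    using syl_cyclically_reduced[OF w0(1) assms(2)] w0(2) by blast
  have wc: "ev m w \<in> carrier BG" using v assms by (simp add: ev_closed)
  have "v \<otimes>\<^bsub>BG\<^esub> (ev m w \<otimes>\<^bsub>BG\<^esub> ev m w) \<otimes>\<^bsub>BG\<^esub> inv\<^bsub>BG\<^esub> v = \<one>\<^bsub>BG\<^esub>"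
    using assms(3) v(1) wc unfolding v(3) by (simp add: B.m_assoc B.inv_solve_left flip: B.m_assoc[of "inv\<^bsub>BG\<^esub> v" v])
  moreover have "ev m w \<otimes>\<^bsub>BG\<^esub> ev m w = inv\<^bsub>BG\<^esub> v \<otimes>\<^bsub>BG\<^esub>
      (v \<otimes>\<^bsub>BG\<^esub> (ev m w \<otimes>\<^bsub>BG\<^esub> ev m w) \<otimes>\<^bsub>BG\<^esub> inv\<^bsub>BG\<^esub> v) \<otimes>\<^bsub>BG\<^esub> v"
    using v(1) wc by (simp add: B.m_assoc flip: B.m_assoc[of "inv\<^bsub>BG\<^esub> v" v])
  ultimately have sq: "ev m w \<otimes>\<^bsub>BG\<^esub> ev m w = \<one>\<^bsub>BG\<^esub>" using v(1) by simp
  have "w = []"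
  proof (rule ccontr)
    assume ne: "w \<noteq> []"
    define x where "x = (if length w = 1 then [(fst (hd w), 2 * snd (hd w))] else w @ w)"
    have "syl m x"
      using v(2,4) ne by (cases w) (auto simp: x_def syl_append syl_Cons)
    moreover have "ev m x = \<one>\<^bsub>BG\<^esub>"
    proof (cases "length w = 1")
      case True
      then obtain j e where w: "w = [(j, e)]" by (cases w) auto
      then have "B.A m j \<in> carrier BG" using v(2) assms(2) by (simp add: syl_Cons)
      then show ?thesis using sq by (simp add: x_def w flip: B.int_pow_mult mult_2)
    next
      case False
      then show ?thesis using sq v(2) assms(2) by (simp add: x_def ev_append)
    qed
    moreover have "x \<noteq> []" using ne by (simp add: x_def)
    ultimately show False using ev_faithful[OF assms(2), of x] by (simp add: K.baction_one)
  qed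
  then show ?thesis using v(1,3) by simp
qed

end

subsection \<open>Winding numbers of pairs of strands\<close>

definition swp :: "nat \<Rightarrow> nat \<Rightarrow> nat" where
  "swp i a = (if a = i then i + 1 else if a = i + 1 then i else a)"

definition prm :: "nat \<Rightarrow> nat word set \<Rightarrow> nat \<Rightarrow> nat" where
  "prm n = baction n swp"

text \<open>The third component counts the crossings of the strands starting at the first two.\<close>

definition cross :: "nat \<Rightarrow> nat \<times> nat \<times> int \<Rightarrow> nat \<times> nat \<times> int" where
  "cross i = (\<lambda>(a, b, t).
    (swp i a, swp i b,
     t + (if a = i \<and> b = i + 1 \<or> a = i + 1 \<and> b = i then 1 else 0)))"

definition cross_inv :: "nat \<Rightarrow> nat \<times> nat \<times> int \<Rightarrow> nat \<times> nat \<times> int" where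
  "cross_inv i = (\<lambda>(a, b, t).
    (swp i a, swp i b,
     t - (if a = i \<and> b = i + 1 \<or> a = i + 1 \<and> b = i then 1 else 0)))"

lemma cross_cross_inv: "cross i (cross_inv i x) = x" "cross_inv i (cross i x) = x"
  by (auto simp: cross_def cross_inv_def swp_def split: prod.splits)

interpretation Prm: braid_action n swp for n
proof
  show "bij (swp i)" for i by (rule o_bij[of "swp i"]) (auto simp: swp_def)
qed (auto simp: swp_def)

lemmas prm_mult = Prm.baction_mult[folded prm_def]
  and prm_one = Prm.baction_one[folded prm_def]
  and prm_inv = Prm.baction_inv[folded prm_def]
  and prm_gen = Prm.baction_gen[folded prm_def]

interpretation W: braid_action n cross for n
proof
  fix i show "bij (cross i)"
    by (rule o_bij[of "cross_inv i"]) (auto simp: cross_cross_inv)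
next
  fix i :: nat and x :: "nat \<times> nat \<times> int"
  obtain a b t where x: "x = (a, b, t)" by (cases x)
  have "a = i \<or> a = i + 1 \<or> a = i + 2 \<or> a \<notin> {i, i + 1, i + 2}"
    "b = i \<or> b = i + 1 \<or> b = i + 2 \<or> b \<notin> {i, i + 1, i + 2}" by blast+
  then show "cross i (cross (i + 1) (cross i x)) = cross (i + 1) (cross i (cross (i + 1) x))"
    unfolding x by (elim disjE) (simp_all add: cross_def swp_def)
next
  fix i j :: nat and x :: "nat \<times> nat \<times> int"
  assume ij: "i + 2 \<le> j"
  obtain a b t where x: "x = (a, b, t)" by (cases x)
  consider "a = i" | "a = i + 1" | "a = j" | "a = j + 1" | "a \<notin> {i, i + 1, j, j + 1}" by blast
  then show "cross i (cross j x) = cross j (cross i x)"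
    unfolding x using ij by cases (auto simp: cross_def swp_def)
qed

lemma swp_swp [simp]: "swp i (swp i a) = a"
  by (simp add: swp_def)

text \<open>The signed number of crossings of two strands. The same \<open>w\<close> for both orders
  of the pair allows adding the counts when a braid exchanges the strands, and the parity clause
  ties the count to the permutation.\<close>

definition winding :: "nat \<Rightarrow> nat word set \<Rightarrow> nat \<Rightarrow> nat \<Rightarrow> int \<Rightarrow> bool" where
  "winding n g a b w \<longleftrightarrow>
    (\<forall>t. baction n cross g (a, b, t) = (prm n g a, prm n g b, t + w)) \<and>
    (\<forall>t. baction n cross g (b, a, t) = (prm n g b, prm n g a, t + w)) \<and>
    (even w \<longleftrightarrow> (a < b \<longleftrightarrow> prm n g a < prm n g b)) \<and> prm n g a \<noteq> prm n g b"

lemma winding_mult: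
  assumes "g \<in> carrier (braid_group n)" "h \<in> carrier (braid_group n)"
    and "winding n h a b v" "winding n g (prm n h a) (prm n h b) w"
  shows "winding n (g \<otimes>\<^bsub>braid_group n\<^esub> h) a b (v + w)"
  unfolding winding_def W.baction_mult[OF assms(1,2)] prm_mult[OF assms(1,2)]
proof (intro conjI)
  have "(even v \<longleftrightarrow> (a < b \<longleftrightarrow> prm n h a < prm n h b)) \<and>
      (even w \<longleftrightarrow> (prm n h a < prm n h b \<longleftrightarrow> prm n g (prm n h a) < prm n g (prm n h b)))"
    using assms(3,4) unfolding winding_def by blast
  then show "even (v + w) \<longleftrightarrow> (a < b \<longleftrightarrow> prm n g (prm n h a) < prm n g (prm n h b))"
    unfolding even_add by blast
qed (use assms(3,4) in \<open>simp_all add: winding_def add.assoc\<close>)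

lemma ex_winding:
  assumes "g \<in> carrier (braid_group n)" "a \<noteq> b"
  shows "\<exists>w. winding n g a b w"
proof -
  interpret B: braid_elements "braid_group n" n "braid_gen n" by (rule braid_elements_braid_gen)
  have s: "braid_gen n ` {1..<n} \<subseteq> carrier (braid_group n)" by (rule B.s_image_subset) simp
  have gen: "\<exists>w. winding n x a b w" "\<exists>w. winding n (inv\<^bsub>braid_group n\<^esub> x) a b w"
    if x: "x \<in> braid_gen n ` {1..<n}" and ab: "a \<noteq> b" for x a b
  proof -
    obtain i where i: "x = braid_gen n i" "i \<in> {1..<n}" using x by blast
    have xc: "x \<in> carrier (braid_group n)" using x s by blast
    have p: "prm n x c = (if c = i then i + 1 else if c = i + 1 then i else c)" for c
      using i by (simp add: prm_gen swp_def)
    then have "prm n x (prm n x c) = c" for c by simp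
    then have p': "prm n (inv\<^bsub>braid_group n\<^esub> x) c = prm n x c" for c
      by (metis prm_inv(1)[OF xc])
    have c: "baction n cross x y = cross i y" for y using i by (simp add: W.baction_gen)
    then have c': "baction n cross (inv\<^bsub>braid_group n\<^esub> x) y = cross_inv i y" for y
      by (metis W.baction_inv(1)[OF xc] cross_cross_inv(1))
    let ?d = "if a = i \<and> b = i + 1 \<or> a = i + 1 \<and> b = i then 1 else 0 :: int"
    show "\<exists>w. winding n x a b w"
      by (rule exI[of _ ?d]) (use ab in \<open>auto simp: winding_def c p cross_def swp_def\<close>)
    show "\<exists>w. winding n (inv\<^bsub>braid_group n\<^esub> x) a b w"
      by (rule exI[of _ "- ?d"]) (use ab in \<open>auto simp: winding_def c' p' p cross_inv_def swp_def\<close>)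
  qed
  from s have "g \<in> generate (braid_group n) (braid_gen n ` {1..<n}) \<Longrightarrow> \<forall>a b. a \<noteq> b \<longrightarrow> (\<exists>w. winding n g a b w)"
  proof (induction rule: B.generate_induct_right)
    case one
    then show ?case by (auto simp: winding_def W.baction_one prm_one intro!: exI[of _ 0])
  next
    case (mult g x)
    show ?case
    proof (intro allI impI)
      fix a b :: nat assume ab: "a \<noteq> b"
      obtain v where v: "winding n x a b v" using gen(1)[OF mult(2) ab] by blast
      then have "prm n x a \<noteq> prm n x b" by (simp add: winding_def)
      then obtain w where "winding n g (prm n x a) (prm n x b) w" using mult(3) by blast
      moreover have "x \<in> carrier (braid_group n)" using mult(2) s by blast
      ultimately show "\<exists>w. winding n (g \<otimes>\<^bsub>braid_group n\<^esub> x) a b w"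
        using winding_mult[OF _ _ v] mult(1) by (auto simp: braid_generated)
    qed
  next
    case (mult_inv g x)
    show ?case
    proof (intro allI impI)
      fix a b :: nat assume ab: "a \<noteq> b"
      obtain v where v: "winding n (inv\<^bsub>braid_group n\<^esub> x) a b v" using gen(2)[OF mult_inv(2) ab] by blast
      then have "prm n (inv\<^bsub>braid_group n\<^esub> x) a \<noteq> prm n (inv\<^bsub>braid_group n\<^esub> x) b" by (simp add: winding_def)
      then obtain w where "winding n g (prm n (inv\<^bsub>braid_group n\<^esub> x) a) (prm n (inv\<^bsub>braid_group n\<^esub> x) b) w"
        using mult_inv(3) by blast
      moreover have "inv\<^bsub>braid_group n\<^esub> x \<in> carrier (braid_group n)" using mult_inv(2) s by auto
      ultimately show "\<exists>w. winding n (g \<otimes>\<^bsub>braid_group n\<^esub> inv\<^bsub>braid_group n\<^esub> x) a b w"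
        using winding_mult[OF _ _ v] mult_inv(1) by (auto simp: braid_generated)
    qed
  qed
  then show ?thesis using assms by (simp add: braid_generated)
qed

text \<open>If \<open>a\<close> is moved to \<open>b\<close>, then \<open>g\<close> exchanges
  \<open>a\<close> and \<open>b\<close>, and \<open>g g\<close> counts the crossings of this pair
  twice. Hence the count is 0, which is even, although the order of the pair was reversed.\<close>

lemma prm_involution:
  assumes g: "g \<in> carrier (braid_group n)" "g \<otimes>\<^bsub>braid_group n\<^esub> g = \<one>\<^bsub>braid_group n\<^esub>"
  shows "prm n g a = a"
proof (rule ccontr)
  assume ne: "prm n g a \<noteq> a"
  let ?b = "prm n g a"
  have ba: "prm n g ?b = a"
    using prm_mult[OF g(1) g(1), of a] by (simp add: g(2) prm_one)
  obtain w where w: "winding n g a ?b w" using ex_winding[OF g(1)] ne by metis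
  have "baction n cross (g \<otimes>\<^bsub>braid_group n\<^esub> g) (a, ?b, 0) = (a, ?b, w + w)"
    using w ba by (simp add: W.baction_mult[OF g(1) g(1)] winding_def)
  then have "w = 0" by (simp add: g(2) W.baction_one)
  then show False using w ba ne by (auto simp: winding_def)
qed

subsection \<open>The braid group acts faithfully and contains no involution\<close>

context
  fixes n :: nat
begin

interpretation B: braid_elements "braid_group n" n "braid_gen n" by (rule braid_elements_braid_gen)

abbreviation (input) BG' where "BG' \<equiv> braid_group n"

lemma prm_\<tau>: "1 \<le> j \<Longrightarrow> j \<le> m \<Longrightarrow> m \<le> n \<Longrightarrow> prm n (B.\<tau> m j) j = m"
proof (induction m)
  case (Suc m)
  then show ?case
    by (cases "j \<le> m") (auto simp: prm_mult B.s_closed prm_gen prm_one swp_def le_Suc_eq)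
qed simp

text \<open>On the level of \<open>K\<close> this is the effect of forgetting the strand
  \<open>m\<close>; the braids in \<open>U m\<close> become trivial after it.\<close>

definition kill :: "nat \<Rightarrow> nat ucox \<Rightarrow> nat ucox" where
  "kill m = lift (\<lambda>i. if i = m then 0 else gen i)"

lemma add_hom_kill: "add_hom (kill m)"
  unfolding kill_def by (rule add_hom_lift) simp

lemma kill_gen: "kill m (gen i) = (if i = m then 0 else gen i)"
  by (simp add: kill_def)

lemma U_pure:
  assumes "u \<in> B.U m" "m \<le> n"
  shows "kill m (act n u a) = kill m a" "prm n u c = c"
proof -
  have A: "kill m (act n (B.A m j) a) = kill m a" "prm n (B.A m j) c = c" if j: "1 \<le> j" "j < m" for j a c
  proof -
    have Ac: "B.A m j \<in> carrier BG'" using j assms(2) by simp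
    show "kill m (act n (B.A m j) a) = kill m a"
      by (rule add_hom_eq[OF add_hom_comp[OF add_hom_kill add_hom_act[OF Ac]] add_hom_kill])
        (use j assms(2) in \<open>auto simp: act_A add_hom_simps[OF add_hom_kill] kill_gen Let_def\<close>)
    show "prm n (B.A m j) c = c"
      using j assms(2) unfolding B.A_def by (simp add: prm_mult B.s_closed prm_gen prm_inv)
  qed
  have "(\<forall>a. kill m (act n u a) = kill m a) \<and> (\<forall>c. prm n u c = c)"
    using assms(1)
  proof (induction rule: generate.induct)
    case one
    then show ?case by (simp add: K.baction_one prm_one)
  next
    case (incl x)
    then show ?case using A by auto
  next
    case (inv x)
    then obtain j where j: "x = B.A m j" "1 \<le> j" "j < m" by auto
    then have xc: "x \<in> carrier BG'" using assms(2) by simp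
    show ?case
      using A(1)[OF j(2,3), of "act n (inv\<^bsub>BG'\<^esub> x) _"] A(2)[OF j(2,3), of "prm n (inv\<^bsub>BG'\<^esub> x) _"]
      by (simp add: K.baction_inv[OF xc] prm_inv[OF xc] flip: j(1))
  next
    case (eng x y)
    then show ?case using B.generate_in_carrier[OF B.A_image_subset[OF assms(2)]]
      by (simp add: K.baction_mult prm_mult)
  qed
  then show "kill m (act n u a) = kill m a" "prm n u c = c" by auto
qed

lemma H_fixes:
  assumes "h \<in> B.H m" "Suc m \<le> n"
  shows "kill (Suc m) (act n h a) = act n h (kill (Suc m) a)" "prm n h (Suc m) = Suc m"
proof -
  have s: "braid_gen n ` {1..<m} \<subseteq> carrier BG'" by (rule B.s_image_subset) (use assms in simp)
  have gen: "kill (Suc m) (act n x a) = act n x (kill (Suc m) a)" "prm n x (Suc m) = Suc m"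
    if x: "x \<in> braid_gen n ` {1..<m}" for x a
  proof -
    obtain i where i: "x = braid_gen n i" "1 \<le> i" "i < m" using x by auto
    then have e: "act n x = bsig i" using assms(2) by (simp add: K.baction_gen)
    show "kill (Suc m) (act n x a) = act n x (kill (Suc m) a)"
      unfolding e
      by (rule add_hom_eq[OF add_hom_comp[OF add_hom_kill add_hom_bsig] add_hom_comp[OF add_hom_bsig add_hom_kill]])
        (use i in \<open>auto simp: kill_gen add_hom_simps[OF add_hom_bsig] add_hom_simps[OF add_hom_kill] bsig_gen\<close>)
    show "prm n x (Suc m) = Suc m" using i assms(2) by (simp add: prm_gen swp_def)
  qed
  have "(\<forall>a. kill (Suc m) (act n h a) = act n h (kill (Suc m) a)) \<and> prm n h (Suc m) = Suc m"
    using assms(1)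
  proof (induction rule: generate.induct)
    case one
    then show ?case by (simp add: K.baction_one prm_one)
  next
    case (incl x)
    then show ?case using gen by blast
  next
    case (inv x)
    then have xc: "x \<in> carrier BG'" using s by blast
    have "kill (Suc m) (act n (inv\<^bsub>BG'\<^esub> x) a) = act n (inv\<^bsub>BG'\<^esub> x) (kill (Suc m) a)" for a
      using gen(1)[OF inv, of "act n (inv\<^bsub>BG'\<^esub> x) a"] by (metis K.baction_inv[OF xc])
    moreover have "prm n (inv\<^bsub>BG'\<^esub> x) (Suc m) = Suc m"
      using gen(2)[OF inv] by (metis prm_inv(1)[OF xc])
    ultimately show ?case by blast
  next
    case (eng x y)
    then show ?case using B.generate_in_carrier[OF s] by (simp add: K.baction_mult prm_mult)
  qed
  then show "kill (Suc m) (act n h a) = act n h (kill (Suc m) a)" "prm n h (Suc m) = Suc m" by auto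
qed

text \<open>In the combed form the strand \<open>?M\<close> must return: for faithfulness because
  forgetting it kills only its own letter, for involutions because their permutation is trivial.
  Forgetting it then passes the hypothesis on to \<open>h\<close>, and what remains lies in
  \<open>U ?M\<close>. The two claims are proved together since only the action of
  \<open>h h\<close> is seen to be trivial after forgetting the strand, so the second claim uses the
  first one.\<close>

lemma H_faithful_no_involution:
  assumes "m \<le> n" "g \<in> B.H m"
  shows "((\<forall>i \<in> {1..m}. act n g (gen i) = gen i) \<longrightarrow> g = \<one>\<^bsub>BG'\<^esub>) \<and>
    (g \<otimes>\<^bsub>BG'\<^esub> g = \<one>\<^bsub>BG'\<^esub> \<longrightarrow> g = \<one>\<^bsub>BG'\<^esub>)"
  using assms
proof (induction m arbitrary: g)
  case 0
  then show ?case by (simp add: B.generate_empty)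
next
  case (Suc m)
  let ?M = "Suc m"
  have "1 \<le> ?M" by simp
  from B.comb[OF Suc.prems(2) this Suc.prems(1)] obtain u h j
    where u: "u \<in> B.U ?M" and h: "h \<in> B.H m" and j: "1 \<le> j" "j \<le> ?M" and g: "g = u \<otimes>\<^bsub>BG'\<^esub> h \<otimes>\<^bsub>BG'\<^esub> B.\<tau> ?M j"
    by auto
  have uc: "u \<in> carrier BG'" using u B.generate_in_carrier[OF B.A_image_subset] Suc.prems(1) by blast
  have hc: "h \<in> carrier BG'" using h B.generate_in_carrier[OF B.s_image_subset[of m]] Suc.prems(1) by simp
  have tc: "B.\<tau> ?M j \<in> carrier BG'" using j Suc.prems(1) by (intro B.\<tau>_closed)
  note IH = Suc.IH[OF _ h, THEN conjunct1, THEN mp]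
  have 1: "g = \<one>\<^bsub>BG'\<^esub>" if fix_i: "\<forall>i \<in> {1..?M}. act n g (gen i) = gen i"
  proof -
    have "j = ?M"
    proof (rule ccontr)
      assume "j \<noteq> ?M"
      have "act n g (gen j) = gen j" using fix_i j by simp
      then have "gen j = act n u (act n h (gen ?M))"
        using j Suc.prems(1) uc hc tc by (simp add: g K.baction_mult act_\<tau> del: B.\<tau>.simps)
      then have "kill ?M (gen j) = kill ?M (act n u (act n h (gen ?M)))" by simp
      also have "\<dots> = act n h (kill ?M (gen ?M))" using U_pure[OF u] H_fixes[OF h] Suc.prems(1) by simp
      finally show False
        using \<open>j \<noteq> ?M\<close> by (simp add: kill_gen add_hom_zero[OF add_hom_act[OF hc]])
    qed
    then have g': "g = u \<otimes>\<^bsub>BG'\<^esub> h" using uc hc by (simp add: g B.\<tau>_eq_one del: B.\<tau>.simps)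
    have "act n h (gen i) = gen i" if i: "i \<in> {1..m}" for i
    proof -
      have "act n g (gen i) = gen i" using fix_i i by simp
      then have "act n u (act n h (gen i)) = gen i" using uc hc by (simp add: g' K.baction_mult)
      then have "kill ?M (act n h (gen i)) = kill ?M (gen i)" using U_pure[OF u] Suc.prems(1) by metis
      then show ?thesis using i H_fixes[OF h] Suc.prems(1) by (simp add: kill_gen)
    qed
    then have "h = \<one>\<^bsub>BG'\<^esub>" using Suc.IH[OF _ h] Suc.prems(1) by simp
    then have gu: "g = u" using uc by (simp add: g')
    have "act n u (gen ?M) = gen ?M" using fix_i gu by simp
    then show ?thesis unfolding gu by (rule U_faithful[OF u Suc.prems(1)])
  qed
  have 2: "g = \<one>\<^bsub>BG'\<^esub>" if gg: "g \<otimes>\<^bsub>BG'\<^esub> g = \<one>\<^bsub>BG'\<^esub>"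
  proof -
    have gc: "g \<in> carrier BG'" using uc hc tc by (simp add: g del: B.\<tau>.simps)
    have "prm n g j = ?M"
      using j Suc.prems(1) uc hc tc U_pure(2)[OF u] H_fixes(2)[OF h]
      by (simp add: g prm_mult prm_\<tau> del: B.\<tau>.simps)
    then have "j = ?M" using prm_involution[OF gc gg] by simp
    then have g': "g = u \<otimes>\<^bsub>BG'\<^esub> h" using uc hc by (simp add: g B.\<tau>_eq_one del: B.\<tau>.simps)
    have "act n (h \<otimes>\<^bsub>BG'\<^esub> h) (gen i) = gen i" if i: "i \<in> {1..m}" for i
    proof -
      have "gen i = kill ?M (act n (g \<otimes>\<^bsub>BG'\<^esub> g) (gen i))" using i by (simp add: gg K.baction_one kill_gen)
      also have "\<dots> = act n h (act n h (kill ?M (gen i)))"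
        using U_pure(1)[OF u] H_fixes(1)[OF h] Suc.prems(1) uc hc by (simp add: g' K.baction_mult)
      also have "\<dots> = act n (h \<otimes>\<^bsub>BG'\<^esub> h) (gen i)" using i hc by (simp add: K.baction_mult kill_gen)
      finally show ?thesis by simp
    qed
    moreover have "h \<otimes>\<^bsub>BG'\<^esub> h \<in> B.H m" using h by (rule generate.eng[OF h])
    ultimately have "h \<otimes>\<^bsub>BG'\<^esub> h = \<one>\<^bsub>BG'\<^esub>" using Suc.IH[of "h \<otimes>\<^bsub>BG'\<^esub> h"] Suc.prems(1) by simp
    then have "h = \<one>\<^bsub>BG'\<^esub>" using Suc.IH[OF _ h] Suc.prems(1) by simp
    then have "g = u" using uc by (simp add: g')
    then show ?thesis using U_no_involution[OF u Suc.prems(1)] gg by simp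
  qed
  show ?case using 1 2 by blast
qed

end

theorem braid_faithful:
  assumes "g \<in> carrier (braid_group n)" "\<And>i. i \<in> {1..n} \<Longrightarrow> act n g (gen i) = gen i"
  shows "g = \<one>\<^bsub>braid_group n\<^esub>"
  using H_faithful_no_involution[of n n g] assms by (simp add: braid_generated)

theorem braid_no_involution:
  assumes "g \<in> carrier (braid_group n)" "g \<otimes>\<^bsub>braid_group n\<^esub> g = \<one>\<^bsub>braid_group n\<^esub>"
  shows "g = \<one>\<^bsub>braid_group n\<^esub>"
  using H_faithful_no_involution[of n n g] assms by (simp add: braid_generated)

section \<open>Automorphisms fixing the boundary word\<close>

text \<open>The copy of \<open>K\<close> in the Coxeter group on all natural numbers;
  \<open>kemb_image\<close> identifies it with the presented group.\<close>

definition Kset :: "nat \<Rightarrow> nat ucox set" where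
  "Kset n = {a. set (nf a) \<subseteq> {1..n}}"

definition boundary :: "nat \<Rightarrow> nat ucox" where
  "boundary n = word [1..<Suc n]"

lemma Kset_simps [simp]:
  "0 \<in> Kset n" "- a \<in> Kset n \<longleftrightarrow> a \<in> Kset n" "gen i \<in> Kset n \<longleftrightarrow> i \<in> {1..n}"
  by (simp_all add: Kset_def)

lemma Kset_add: "a \<in> Kset n \<Longrightarrow> b \<in> Kset n \<Longrightarrow> a + b \<in> Kset n"
  using set_nf_add[of a b] by (auto simp: Kset_def)

lemma Kset_word: "set w \<subseteq> {1..n} \<Longrightarrow> word w \<in> Kset n"
  using set_nf_word[of w] by (auto simp: Kset_def)

lemma boundary_in_Kset: "boundary n \<in> Kset n"
  unfolding boundary_def by (rule Kset_word) auto

lemma nf_boundary: "nf (boundary n) = [1..<Suc n]"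
proof -
  have "distinct_adj [1..<Suc n]" by (simp add: distinct_adj_conv_nth del: upt_Suc)
  then show ?thesis unfolding boundary_def by (rule nf_word_id)
qed

lemma add_hom_Kset:
  assumes "add_hom f" "\<And>i. i \<in> {1..n} \<Longrightarrow> f (gen i) \<in> Kset n" "a \<in> Kset n"
  shows "f a \<in> Kset n"
proof -
  have "set w \<subseteq> {1..n} \<Longrightarrow> f (word w) \<in> Kset n" for w
    by (induction w) (auto simp: add_hom_simps[OF assms(1)] intro!: Kset_add assms(2))
  from this[of "nf a"] show ?thesis using assms(3) by (simp add: Kset_def)
qed

lemma act_inv_gen:
  assumes "i \<in> {1..<n}"
  shows "act n (inv\<^bsub>braid_group n\<^esub> braid_gen n i) (gen j) =
    (if j = i then gen i + gen (i + 1) + gen i else if j = i + 1 then gen i else gen j)"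
proof -
  let ?v = "if j = i then gen i + gen (i + 1) + gen i else if j = i + 1 then gen i else gen j"
  have "act n (braid_gen n i) ?v = gen j"
    using assms by (simp add: K.baction_gen add_hom_simps[OF add_hom_bsig] bsig_gen add.assoc)
  then show ?thesis using K.baction_inv(1)[OF braid_gen_closed[OF assms], of ?v] by simp
qed

text \<open>For the boundary word: \<open>bsig i\<close> maps \<open>gen i + gen (i + 1)\<close> to
  itself, since the two middle copies of \<open>gen (i + 1)\<close> cancel, and it fixes all other
  letters.\<close>

lemma act_invariant:
  assumes g: "g \<in> carrier (braid_group n)"
  shows "act n g (boundary n) = boundary n" and "a \<in> Kset n \<Longrightarrow> act n g a \<in> Kset n"
proof -
  interpret B: braid_elements "braid_group n" n "braid_gen n" by (rule braid_elements_braid_gen)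
  have s: "braid_gen n ` {1..<n} \<subseteq> carrier (braid_group n)" by (rule B.s_image_subset) simp
  have gen: "act n x (boundary n) = boundary n"
    "act n x a \<in> Kset n" "act n (inv\<^bsub>braid_group n\<^esub> x) a \<in> Kset n"
    if x: "x \<in> braid_gen n ` {1..<n}" and a: "a \<in> Kset n" for x a
  proof -
    obtain i where i: "x = braid_gen n i" "i \<in> {1..<n}" using x by blast
    have e: "act n x = bsig i" using i by (simp add: K.baction_gen)
    have "[1..<Suc n] = [1..<i] @ [i, Suc i] @ [Suc (Suc i)..<Suc n]"
      using i upt_add_eq_append[of 1 i "Suc n - i"] by (simp add: upt_conv_Cons)
    moreover have fixed: "bsig i (word w) = word w" if "i \<notin> set w" "Suc i \<notin> set w" for w
      using that by (induction w) (auto simp: add_hom_simps[OF add_hom_bsig] bsig_gen)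
    ultimately show "act n x (boundary n) = boundary n"
      by (simp add: boundary_def e add_hom_simps[OF add_hom_bsig] bsig_gen fixed add.assoc)
    show "act n x a \<in> Kset n"
      unfolding e by (rule add_hom_Kset[OF add_hom_bsig _ a]) (use i in \<open>auto simp: bsig_gen intro!: Kset_add\<close>)
    have "inv\<^bsub>braid_group n\<^esub> x \<in> carrier (braid_group n)" using x s by auto
    then show "act n (inv\<^bsub>braid_group n\<^esub> x) a \<in> Kset n"
      by (rule add_hom_Kset[OF add_hom_act _ a]) (use i in \<open>auto simp: act_inv_gen intro!: Kset_add\<close>)
  qed
  have "act n g (boundary n) = boundary n \<and> (\<forall>a \<in> Kset n. act n g a \<in> Kset n)"
    using g unfolding braid_generated[symmetric]
  proof (induction rule: generate.induct)
    case one
    then show ?case by (simp add: K.baction_one)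
  next
    case (incl x)
    then show ?case using gen boundary_in_Kset by blast
  next
    case (inv x)
    then have xc: "x \<in> carrier (braid_group n)" using s by blast
    have "act n (inv\<^bsub>braid_group n\<^esub> x) (boundary n) = boundary n"
      using gen(1)[OF inv boundary_in_Kset] by (metis K.baction_inv(1)[OF xc])
    then show ?case using gen(3)[OF inv] by blast
  next
    case (eng x y)
    then show ?case using B.generate_in_carrier[OF s] by (simp add: K.baction_mult)
  qed
  then show "act n g (boundary n) = boundary n" "a \<in> Kset n \<Longrightarrow> act n g a \<in> Kset n" by auto
qed

lemma inj_act: "g \<in> carrier (braid_group n) \<Longrightarrow> inj (act n g)"
  by (metis injI K.baction_inv(1))

section \<open>Products of palindromes and Artin's shortening argument\<close>

lemma foldr_rcons_length_eq:
  "length (foldr rcons v w) = length v + length w \<Longrightarrow> foldr rcons v w = v @ w"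
proof (induction v)
  case (Cons a v)
  have "length (foldr rcons v w) = length v + length w"
    using Cons.prems length_rcons_le[of a "foldr rcons v w"] length_foldr_rcons_le[of v w] by simp
  then have v: "foldr rcons v w = v @ w" by (rule Cons.IH)
  have "rcons a u = a # u" if "length (rcons a u) = Suc (length u)" for u
    using that by (cases u) (auto simp: rcons_def split: if_splits)
  from this[of "v @ w"] show ?case using v Cons.prems by simp
qed simp

text \<open>A reduced word representing an involution is a palindrome of odd length; \<open>pal h\<close> is the
  one with first half \<open>h\<close>, where the middle letter counts as the last letter of \<open>h\<close>.\<close>

definition pal :: "'a list \<Rightarrow> 'a list" where
  "pal h = h @ rev (butlast h)"

lemma pal_append: "t \<noteq> [] \<Longrightarrow> pal (h @ t) = h @ pal t @ rev h"
  by (simp add: pal_def butlast_append)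

lemma word_pal_append: "t \<noteq> [] \<Longrightarrow> word (pal (h @ t)) = word h + word (pal t) - word h"
  by (simp add: pal_append ucox_diff add.assoc del: add_uminus_conv_diff)

lemma word_pal_snoc: "word (pal (w @ [p])) = word w + gen p - word w"
  by (simp add: word_pal_append) (simp add: pal_def)

definition diverging :: "'a list \<Rightarrow> 'a list \<Rightarrow> bool" where
  "diverging v w \<longleftrightarrow> (\<exists>z a s b t. a \<noteq> b \<and> v = z @ a # s \<and> w = z @ b # t)"

lemma diverging_Cons: "diverging v w \<Longrightarrow> diverging (x # v) (x # w)"
  unfolding diverging_def by (metis append_Cons)

lemma not_diverging: "\<not> diverging v w \<Longrightarrow> (\<exists>t. w = v @ t) \<or> (\<exists>t. v = w @ t)"
proof (induction v arbitrary: w)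
  case (Cons x v)
  show ?case
  proof (cases w)
    case w: (Cons y u)
    have "x = y"
    proof (rule ccontr)
      assume "x \<noteq> y"
      then have "diverging (x # v) w" unfolding diverging_def w by (intro exI[of _ "[]"]) auto
      then show False using Cons.prems by simp
    qed
    have "\<not> diverging v u"
      using Cons.prems diverging_Cons[of v u x] unfolding w \<open>x = y\<close> by auto
    then show ?thesis using Cons.IH[of u] \<open>x = y\<close> w by auto
  qed simp
qed simp

text \<open>No middle letter is cancelled in a product of palindromes none of whose first halves is a prefix
  of a neighbouring one.\<close>

lemma sum_list_pal:
  assumes "hs \<noteq> []" "\<forall>h \<in> set hs. h \<noteq> [] \<and> distinct_adj (pal h)"
    "successively diverging hs"
  shows "\<exists>r. nf (sum_list (map (\<lambda>h. word (pal h)) hs)) = hd hs @ r \<and> length hs \<le> Suc (length r) \<and>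
    (length (hd hs @ r) = length hs \<longrightarrow> (\<forall>h \<in> set hs. length h = 1))"
  using assms
proof (induction hs)
  case (Cons h hs)
  show ?case
  proof (cases hs)
    case Nil
    have "nf (word (pal h)) = h @ rev (butlast h)"
      using Cons.prems(2) nf_word_id[of "pal h"] by (simp add: pal_def)
    moreover have "h \<noteq> []" using Cons.prems(2) by simp
    then have "length (h @ rev (butlast h)) = 1 \<longrightarrow> length h = 1" by (cases h) auto
    ultimately show ?thesis using Nil by (intro exI[of _ "rev (butlast h)"]) simp
  next
    case (Cons h' hs')
    let ?S = "sum_list (map (\<lambda>h. word (pal h)) hs)"
    have "\<exists>r. nf ?S = hd hs @ r \<and> length hs \<le> Suc (length r) \<and>
      (length (hd hs @ r) = length hs \<longrightarrow> (\<forall>h \<in> set hs. length h = 1))"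
      using Cons.prems Cons by (intro Cons.IH) auto
    then obtain r' where r0: "nf ?S = hd hs @ r' \<and> length hs \<le> Suc (length r') \<and>
      (length (hd hs @ r') = length hs \<longrightarrow> (\<forall>h \<in> set hs. length h = 1))" ..
    have "hd hs = h'" using Cons by simp
    note r1 = r0[unfolded this]
    then have r': "nf ?S = h' @ r'" "length hs \<le> Suc (length r')"
      "length (h' @ r') = length hs \<Longrightarrow> \<forall>h \<in> set hs. length h = 1"
      by blast+
    have "diverging h h'" using Cons.prems(3) Cons by simp
    then obtain z a s b s' where ab: "a \<noteq> b" "h = z @ a # s" "h' = z @ b # s'"
      unfolding diverging_def by blast
    \<comment> \<open>The part of \<open>pal h\<close> between \<open>h\<close> and the final
      \<open>rev z\<close>. Whether or not \<open>s\<close> is empty, \<open>h @ x\<close> ends with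
      \<open>a\<close>, which differs from the \<open>b\<close> that follows once \<open>z\<close>
      has cancelled.\<close>
    define x where "x = (if s = [] then [] else rev (butlast s) @ [a])"
    have px: "pal h = h @ x @ rev z" by (simp add: pal_def ab(2) x_def butlast_append)
    have lx: "last (h @ x) = a" by (simp add: x_def ab(2))
    have "distinct_adj (h @ x)" using Cons.prems(2) px by (metis append.assoc distinct_adj_appendD1 list.set_intros(1))
    moreover have "distinct_adj (b # s' @ r')"
      using distinct_adj_nf[of ?S] by (simp add: r'(1) ab(3)) (metis distinct_adj_appendD2)
    ultimately have red: "distinct_adj ((h @ x) @ b # s' @ r')"
      using lx ab(1) unfolding distinct_adj_append_iff[of "h @ x"] by simp
    have S: "?S = word z + word (b # s' @ r')"
      using r'(1) by (metis ab(3) append.assoc append_Cons word_nf word_simps(3))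
    have "sum_list (map (\<lambda>h. word (pal h)) (h # hs)) = word (h @ x) - word z + ?S"
      by (simp add: px ucox_diff add.assoc del: add_uminus_conv_diff)
    also have "\<dots> = word ((h @ x) @ b # s' @ r')"
      unfolding S by (simp add: ucox_diff add.assoc del: add_uminus_conv_diff)
    finally have nf: "nf (sum_list (map (\<lambda>h. word (pal h)) (h # hs))) = h @ x @ b # s' @ r'"
      using nf_word_id[OF red] by simp
    show ?thesis
    proof (intro exI[of _ "x @ b # s' @ r'"] conjI impI)
      show "nf (sum_list (map (\<lambda>h. word (pal h)) (h # hs))) = hd (h # hs) @ x @ b # s' @ r'"
        using nf by simp
      show "length (h # hs) \<le> Suc (length (x @ b # s' @ r'))" using r'(2) by simp
      assume "length (hd (h # hs) @ x @ b # s' @ r') = length (h # hs)"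
      then have "length h + (length x + (Suc (length s') + length r')) = Suc (length hs)" by simp
      moreover have "length h = length z + Suc (length s)" unfolding ab(2) by simp
      ultimately have "length z + length s + length x + length s' + length r' + 1 = length hs" by linarith
      then have l: "length z = 0" "length s = 0" "length s' = 0" "length r' + 1 = length hs"
        using r'(2) by linarith+
      moreover have "length h' = length z + Suc (length s')" unfolding ab(3) by simp
      ultimately have "length (h' @ r') = length hs" by simp
      then have "\<forall>h \<in> set hs. length h = 1" by (rule r'(3))
      moreover have "length h = 1" using l \<open>length h = length z + Suc (length s)\<close> by simp
      ultimately show "\<forall>h \<in> set (h # hs). length h = 1" by simp
    qed
  qed
qed simp

text \<open>Write \<open>h = w @ [p]\<close>. Then \<open>pal h'\<close> is \<open>pal t\<close>
  conjugated by \<open>w\<close> followed by \<open>p\<close>, and conjugation with the involution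
  \<open>pal h\<close> removes this \<open>p\<close> on both sides, which saves two letters.\<close>

lemma size_of_pal_conj:
  assumes "h' = h @ t" "t \<noteq> []" "h \<noteq> []"
  shows "size_of (word (pal h) + word (pal h') + word (pal h)) < length (pal h')"
proof -
  obtain w p where h: "h = w @ [p]" using assms(3) by (metis append_butlast_last_id)
  have "word (pal h) + word (pal h') + word (pal h) = word w + word (pal t) - word w"
    unfolding assms(1) word_pal_append[OF assms(2)] unfolding h word_pal_snoc
    by (simp add: ucox_diff minus_add add.assoc del: add_uminus_conv_diff)
  also have "\<dots> = word (w @ pal t @ rev w)"
    by (simp add: ucox_diff add.assoc del: add_uminus_conv_diff)
  finally have "size_of (word (pal h) + word (pal h') + word (pal h)) \<le> length (w @ pal t @ rev w)"
    by (simp only: size_of_word)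
  also have "\<dots> < length (pal h')" unfolding assms(1) pal_append[OF assms(2)] h by simp
  finally show ?thesis .
qed

lemma sum_less_of_two:
  fixes F F' :: "'a \<Rightarrow> nat"
  assumes "finite I" "i \<in> I" "j \<in> I" "i \<noteq> j" "\<And>k. k \<in> I \<Longrightarrow> k \<noteq> i \<Longrightarrow> k \<noteq> j \<Longrightarrow> F' k = F k"
    "F' i + F' j < F i + F j"
  shows "sum F' I < sum F I"
proof -
  have e: "sum G I = G i + G j + sum G (I - {i, j})" for G :: "'a \<Rightarrow> nat"
    using assms(1-4) sum.subset_diff[of "{i, j}" I G] by simp
  have "sum F' (I - {i, j}) = sum F (I - {i, j})" using assms(5) by (intro sum.cong) auto
  then show ?thesis using assms(6) by (simp add: e)
qed

text \<open>Artin's argument: unless all images of the generators are letters, a braid generator or its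
  inverse shortens them.\<close>

theorem boundary_fixing_is_braid:
  assumes "add_hom f" "inj_on f (Kset n)" "f (boundary n) = boundary n"
  shows "\<exists>g \<in> carrier (braid_group n). \<forall>i \<in> {1..n}. f (act n g (gen i)) = gen i"
  using assms
proof (induction "\<Sum>i = 1..n. size_of (f (gen i))" arbitrary: f rule: less_induct)
  case less
  interpret B: braid_elements "braid_group n" n "braid_gen n" by (rule braid_elements_braid_gen)
  note f = less.prems(1)
  have "\<exists>h. h \<noteq> [] \<and> nf (f (gen i)) = pal h" if i: "i \<in> {1..n}" for i
  proof -
    have "f (gen i) + f (gen i) = 0" by (simp add: add_hom_zero[OF f] flip: add_hom_add[OF f])
    moreover have "f (gen i) \<noteq> 0"
    proof
      assume "f (gen i) = 0"
      then have "f (gen i) = f 0" by (simp add: add_hom_zero[OF f])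
      then show False using inj_onD[OF less.prems(2)] i by fastforce
    qed
    ultimately show ?thesis
      by (rule involution_palindrome) (auto simp: pal_def intro!: exI[of _ "_ @ [_]"])
  qed
  then obtain h where h: "\<And>i. i \<in> {1..n} \<Longrightarrow> h i \<noteq> []" "\<And>i. i \<in> {1..n} \<Longrightarrow> nf (f (gen i)) = pal (h i)"
    by metis
  have fh: "f (gen i) = word (pal (h i))" if "i \<in> {1..n}" for i
    using h(2)[OF that] by (metis word_nf)
  have sz: "size_of (f (gen i)) = length (pal (h i))" if "i \<in> {1..n}" for i
    using h(2)[OF that] by (simp add: size_of_def)
  have rec: ?case
    if g: "g \<in> carrier (braid_group n)" and i: "i \<in> {1..n}" "j \<in> {1..n}" "i \<noteq> j"
      and same: "\<And>k. k \<noteq> i \<Longrightarrow> k \<noteq> j \<Longrightarrow> act n g (gen k) = gen k"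
      and less': "size_of (f (act n g (gen i))) + size_of (f (act n g (gen j)))
        < size_of (f (gen i)) + size_of (f (gen j))" for g i j
  proof -
    let ?f = "\<lambda>a. f (act n g a)"
    have "(\<Sum>i = 1..n. size_of (?f (gen i))) < (\<Sum>i = 1..n. size_of (f (gen i)))"
      using i same less' by (intro sum_less_of_two[of _ i j]) auto
    moreover have "add_hom ?f" by (rule add_hom_comp[OF f add_hom_act[OF g]])
    moreover have "inj_on ?f (Kset n)"
      using inj_act[OF g] less.prems(2) act_invariant(2)[OF g] by (auto simp: inj_on_def)
    moreover have "?f (boundary n) = boundary n" by (simp add: act_invariant(1)[OF g] less.prems(3))
    ultimately obtain g' where g': "g' \<in> carrier (braid_group n)"
      "\<forall>i \<in> {1..n}. f (act n g (act n g' (gen i))) = gen i"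
      using less.hyps[of ?f] by blast
    then show ?thesis using g
      by (intro bexI[of _ "g \<otimes>\<^bsub>braid_group n\<^esub> g'"]) (simp_all add: K.baction_mult)
  qed
  show ?case
  proof (cases "\<forall>i. 1 \<le> i \<and> Suc i \<le> n \<longrightarrow> diverging (h i) (h (Suc i))")
    case True
    let ?hs = "map h [1..<Suc n]"
    have "\<forall>i \<in> {1..n}. f (gen i) = gen i"
    proof (cases "n = 0")
      case False
      have succ: "successively diverging ?hs"
        using True by (simp add: successively_conv_nth del: upt_Suc)
      have "sum_list (map (\<lambda>h. word (pal h)) ?hs) = f (boundary n)"
        unfolding boundary_def add_hom_word[OF f] map_map
        by (intro arg_cong[of _ _ sum_list] map_cong) (auto simp: fh simp del: upt_Suc)
      then have nf: "nf (sum_list (map (\<lambda>h. word (pal h)) ?hs)) = [1..<Suc n]"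
        by (simp add: less.prems(3) nf_boundary del: upt_Suc)
      have red: "\<forall>h \<in> set ?hs. h \<noteq> [] \<and> distinct_adj (pal h)"
        using h by (auto simp del: upt_Suc simp flip: h(2))
      have "?hs \<noteq> []" using False by simp
      \<comment> \<open>The image of the boundary word has only \<open>n\<close> letters, as many as
        there are palindromes, so every palindrome is a single letter. Equality of lengths further
        on excludes any cancellation, and \<open>p\<close> is the identity.\<close>
      from sum_list_pal[OF this red succ] nf
      have len: "\<forall>h \<in> set ?hs. length h = 1" by (metis length_map length_upt)
      define p where "p i = hd (h i)" for i
      have hp: "h i = [p i]" if "i \<in> {1..n}" for i
      proof -
        have "length (h i) = 1" using len that by (simp del: upt_Suc)
        then show ?thesis unfolding p_def by (cases "h i") auto
      qed
      have fp: "f (gen i) = gen (p i)" if "i \<in> {1..n}" for i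
        using fh[OF that] hp[OF that] by (simp add: pal_def)
      have "f (boundary n) = sum_list (map (\<lambda>i. gen (p i)) [1..<Suc n])"
        unfolding boundary_def add_hom_word[OF f]
        by (intro arg_cong[of _ _ sum_list] map_cong) (auto simp: fp simp del: upt_Suc)
      also have "\<dots> = word (map p [1..<Suc n])" by (simp add: word_def comp_def del: upt_Suc)
      finally have "f (boundary n) = word (map p [1..<Suc n])" .
      then have "red (map p [1..<Suc n]) = [1..<Suc n]"
        using nf_boundary[of n] nf_word[of "map p [1..<Suc n]"] less.prems(3) by simp
      then have "map p [1..<Suc n] = [1..<Suc n]"
        using foldr_rcons_length_eq[of "map p [1..<Suc n]" "[]"] by (simp del: upt_Suc foldr_map)
      then have "p i = i" if "i \<in> {1..n}" for i
        using that by (metis atLeastAtMost_iff atLeastLessThan_iff less_Suc_eq_le map_eq_conv map_ident set_upt)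
      then show ?thesis using fp by simp
    qed simp
    then show ?thesis by (intro bexI[of _ "\<one>\<^bsub>braid_group n\<^esub>"]) (simp_all add: K.baction_one)
  next
    case False
    then obtain i where i: "1 \<le> i" "Suc i \<le> n" "\<not> diverging (h i) (h (Suc i))" by blast
    then have i1: "i \<in> {1..n}" "Suc i \<in> {1..n}" and i2: "i \<in> {1..<n}" by auto
    have "h i \<noteq> h (Suc i)"
    proof
      assume "h i = h (Suc i)"
      then have "f (gen i) = f (gen (Suc i))" using fh i1 by simp
      then show False using inj_onD[OF less.prems(2)] i1 by fastforce
    qed
    \<comment> \<open>The first halves are comparable and distinct, so one is a proper prefix of the
      other. Conjugating the longer palindrome by the shorter one is what \<open>bsig i\<close> or
      its inverse does.\<close>
    then consider t where "h (Suc i) = h i @ t" "t \<noteq> []" | t where "h i = h (Suc i) @ t" "t \<noteq> []"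
      using not_diverging[OF i(3)] by auto
    then show ?thesis
    proof cases
      case 1
      have "size_of (f (gen i) + f (gen (Suc i)) + f (gen i)) < size_of (f (gen (Suc i)))"
        using size_of_pal_conj[OF 1 h(1)[OF i1(1)]]
        by (simp only: fh[OF i1(1), symmetric] fh[OF i1(2), symmetric] sz[OF i1(2)])
      then show ?thesis
        using i1 i2 by (intro rec[of "inv\<^bsub>braid_group n\<^esub> braid_gen n i" i "Suc i"])
          (auto simp: braid_gen_closed act_inv_gen add_hom_add[OF f] simp flip: Suc_eq_plus1)
    next
      case 2
      have "size_of (f (gen (Suc i)) + f (gen i) + f (gen (Suc i))) < size_of (f (gen i))"
        using size_of_pal_conj[OF 2 h(1)[OF i1(2)]]
        by (simp only: fh[OF i1(1), symmetric] fh[OF i1(2), symmetric] sz[OF i1(1)])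
      then show ?thesis
        using i1 i2 by (intro rec[of "braid_gen n i" i "Suc i"])
          (auto simp: braid_gen_closed K.baction_gen bsig_gen add_hom_add[OF f] simp flip: Suc_eq_plus1)
    qed
  qed
qed

section \<open>Conjugacy classes invariant under the braid group\<close>

lemma distinct_adj_concat_replicate:
  assumes "distinct_adj (w @ w)"
  shows "distinct_adj (concat (replicate j w))"
proof (induction j)
  case (Suc j)
  then show ?case using assms by (cases j) (auto simp: distinct_adj_append_iff)
qed simp

lemma distinct_adj_boundary2: "n \<ge> 2 \<Longrightarrow> distinct_adj ([1..<Suc n] @ [1..<Suc n])"
  using distinct_adj_nf[of "boundary n"]
  unfolding nf_boundary distinct_adj_append_iff by (simp add: hd_upt last_upt del: upt_Suc)

lemma distinct_adj_rev_boundary2: "n \<ge> 2 \<Longrightarrow> distinct_adj (rev [1..<Suc n] @ rev [1..<Suc n])"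
  by (metis distinct_adj_boundary2 distinct_adj_rev rev_append)

lemma nf_zmul_boundary:
  assumes "n \<ge> 2"
  shows "nf (zmul m (boundary n)) =
    (if 0 \<le> m then concat (replicate (nat m) [1..<Suc n]) else concat (replicate (nat (- m)) (rev [1..<Suc n])))"
proof -
  note d = distinct_adj_boundary2[OF assms]
  have "nf (word (concat (replicate j (rev [1..<Suc n])))) = concat (replicate j (rev [1..<Suc n]))" for j
    using distinct_adj_rev_boundary2[OF assms] by (intro nf_word_id distinct_adj_concat_replicate)
  moreover have "nf (word (concat (replicate j [1..<Suc n]))) = concat (replicate j [1..<Suc n])" for j
    using d by (intro nf_word_id distinct_adj_concat_replicate)
  ultimately show ?thesis unfolding boundary_def zmul_word by presburger
qed

lemma size_of_zmul_boundary: "n \<ge> 2 \<Longrightarrow> size_of (zmul m (boundary n)) = nat \<bar>m\<bar> * n"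
  by (simp add: size_of_def nf_zmul_boundary length_concat sum_list_replicate del: upt_Suc)

text \<open>Powers of the boundary word are cyclically reduced, so their length, \<open>n\<close>
  times the absolute exponent, depends only on the conjugacy class.\<close>

lemma boundary_power_conj:
  assumes n: "n \<ge> 2" and c: "zmul m (boundary n) = k + zmul m' (boundary n) - k"
  shows "\<bar>m\<bar> = \<bar>m'\<bar>"
proof -
  have cyc: "distinct_adj (nf (zmul m (boundary n)) @ nf (zmul m (boundary n)))" for m
  proof -
    obtain j w where "nf (zmul m (boundary n)) = concat (replicate j w)" "distinct_adj (w @ w)"
      using nf_zmul_boundary[OF n, of m] distinct_adj_boundary2[OF n] distinct_adj_rev_boundary2[OF n] by metis
    moreover from this have "distinct_adj (concat (replicate (j + j) w))"
      by (intro distinct_adj_concat_replicate)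
    ultimately show ?thesis by (simp add: replicate_add)
  qed
  have "nat \<bar>m\<bar> * n \<le> nat \<bar>m'\<bar> * n" if "zmul m (boundary n) = k + zmul m' (boundary n) - k" for m m' k
  proof -
    have "length (nf (zmul m (boundary n))) \<le> size_of (zmul m' (boundary n))"
      by (rule cyclically_reduced_length_le[OF cyc[of m], of k]) (simp only: word_nf that)
    then show ?thesis by (simp only: size_of_zmul_boundary[OF n] flip: size_of_def)
  qed
  moreover have "zmul m' (boundary n) = - k + zmul m (boundary n) - (- k)"
    unfolding c by (simp add: ucox_diff minus_add add.assoc del: add_uminus_conv_diff)
  ultimately have "nat \<bar>m\<bar> * n = nat \<bar>m'\<bar> * n" using c by (metis antisym)
  then show ?thesis using n by simp
qed

text \<open>Without cancellation, commuting means that two words commute under concatenation, so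
  both are powers of a common word; this word is the boundary word because the latter has distinct
  letters. Lengths detect cancellation: as the two products agree, it happens on both sides of
  \<open>a\<close> or on neither, and in the former case \<open>- a\<close> has no
  cancellation.\<close>

lemma centralizer_boundary:
  assumes n: "n \<ge> 2" and c: "a + boundary n = boundary n + a"
  shows "\<exists>m. a = zmul m (boundary n)"
proof -
  let ?d = "boundary n" and ?D = "[1..<Suc n]"
  have hl: "hd ?D = 1" "last ?D = n" "?D \<noteq> []" using n by (simp_all add: upt_conv_Cons)
  have main: "\<exists>m. b = zmul m ?d"
    if b: "b + ?d = ?d + b" "nf b = [] \<or> last (nf b) \<noteq> 1" "nf b = [] \<or> hd (nf b) \<noteq> n" for b
  proof -
    have "nf (b + ?d) = nf b @ ?D"
      using nf_add_append[of b ?d] b(2) hl distinct_adj_nf[of ?d]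
      by (auto simp: nf_boundary distinct_adj_append_iff simp del: upt_Suc)
    moreover have "nf (?d + b) = ?D @ nf b"
      using nf_add_append[of ?d b] b(3) hl distinct_adj_nf[of ?d]
      by (auto simp: nf_boundary distinct_adj_append_iff simp del: upt_Suc)
    ultimately have "nf b @ ?D = ?D @ nf b" using b(1) by simp
    from comm_append_are_replicate[OF this] obtain p q zs
      where z: "concat (replicate p zs) = nf b" "concat (replicate q zs) = ?D" by blast
    have "q = 1"
    proof (rule ccontr)
      assume "q \<noteq> 1"
      moreover have "q \<noteq> 0" using z(2) hl(3) by (cases q) (simp_all del: upt_Suc)
      ultimately obtain q' where "q = Suc (Suc q')" by (cases q; cases "q - 1") auto
      then have "distinct (zs @ zs @ concat (replicate q' zs))" using z(2) by (metis append.assoc concat.simps(2) distinct_upt replicate_Suc)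
      then have "zs = []" by (cases zs) auto
      then show False using z(2) hl(3) by (simp del: upt_Suc)
    qed
    then have "zs = ?D" using z(2) by (simp add: One_nat_def del: upt_Suc)
    then have "nf b = concat (replicate p ?D)" using z(1) by simp
    then have "b = word (concat (replicate p ?D))" by (metis word_nf)
    then have "b = zmul (int p) ?d" by (simp add: boundary_def zmul_word del: upt_Suc)
    then show ?thesis ..
  qed
  show ?thesis
  proof (cases "(nf a = [] \<or> last (nf a) \<noteq> 1) \<and> (nf a = [] \<or> hd (nf a) \<noteq> n)")
    case True
    then show ?thesis using main c by blast
  next
    case False
    then have ne: "nf a \<noteq> []" by auto
    have sz1: "size_of (a + ?d) = size_of a + n \<longleftrightarrow> last (nf a) \<noteq> 1"
    proof
      assume "last (nf a) \<noteq> 1"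
      then have "nf (a + ?d) = nf a @ ?D"
        using nf_add_append[of a ?d] hl distinct_adj_nf[of ?d]
        by (auto simp: nf_boundary distinct_adj_append_iff simp del: upt_Suc)
      then show "size_of (a + ?d) = size_of a + n" by (simp add: size_of_def)
    next
      assume "size_of (a + ?d) = size_of a + n"
      then have "nf (a + ?d) = nf a @ ?D"
        using foldr_rcons_length_eq[of "nf a" ?D] by (simp add: nf_add nf_boundary size_of_def del: upt_Suc)
      then have "distinct_adj (nf a @ ?D)" by (metis distinct_adj_nf)
      then show "last (nf a) \<noteq> 1" using hl ne by (auto simp: distinct_adj_append_iff simp del: upt_Suc)
    qed
    have sz2: "size_of (?d + a) = size_of a + n \<longleftrightarrow> hd (nf a) \<noteq> n"
    proof
      assume "hd (nf a) \<noteq> n"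
      then have "nf (?d + a) = ?D @ nf a"
        using nf_add_append[of ?d a] hl distinct_adj_nf[of ?d]
        by (auto simp: nf_boundary distinct_adj_append_iff simp del: upt_Suc)
      then show "size_of (?d + a) = size_of a + n" by (simp add: size_of_def)
    next
      assume "size_of (?d + a) = size_of a + n"
      then have "nf (?d + a) = ?D @ nf a"
        using foldr_rcons_length_eq[of ?D "nf a"] by (simp add: nf_add nf_boundary size_of_def del: upt_Suc)
      then have "distinct_adj (?D @ nf a)" by (metis distinct_adj_nf)
      then show "hd (nf a) \<noteq> n" using hl ne by (auto simp: distinct_adj_append_iff simp del: upt_Suc)
    qed
    have "last (nf a) = 1" "hd (nf a) = n" using False sz1 sz2 c ne by auto
    then have "last (nf (- a)) = n" "hd (nf (- a)) = 1" using ne by (simp_all add: last_rev hd_rev)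
    moreover have "- a + ?d = ?d + - a"
      using c by (metis add.assoc add.right_inverse add.right_neutral minus_add_cancel)
    ultimately obtain m where "- a = zmul m ?d" using main[of "- a"] n by auto
    then have "a = zmul (- m) ?d" by (metis zmul_minus minus_minus)
    then show ?thesis ..
  qed
qed

definition braid_invariant :: "nat \<Rightarrow> nat ucox \<Rightarrow> bool" where
  "braid_invariant n a \<longleftrightarrow> (\<forall>g \<in> carrier (braid_group n). \<exists>k. act n g a = k + a - k)"

lemma braid_invariant_conj:
  assumes "braid_invariant n (k + a - k)"
  shows "braid_invariant n a"
  unfolding braid_invariant_def
proof
  fix g assume g: "g \<in> carrier (braid_group n)"
  then obtain l where "act n g (k + a - k) = l + (k + a - k) - l"
    using assms unfolding braid_invariant_def by blast
  then have "act n g k + act n g a - act n g k = l + (k + a - k) - l"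
    by (simp add: add_hom_simps[OF add_hom_act[OF g]])
  note eq = this
  have "act n g a = - act n g k + (act n g k + act n g a - act n g k) + act n g k"
    by (simp add: ucox_diff add.assoc del: add_uminus_conv_diff)
  also have "\<dots> = (- act n g k + l + k) + a - (- act n g k + l + k)"
    unfolding eq by (simp add: ucox_diff minus_add add.assoc del: add_uminus_conv_diff)
  finally have "act n g a = (- act n g k + l + k) + a - (- act n g k + l + k)" .
  then show "\<exists>k. act n g a = k + a - k" ..
qed

lemma zmul_uminus: "zmul k (- a) = zmul (- k) a"
proof (induction k rule: int_induct[where k = 0])
  case (step1 i)
  then show ?case using zmul_succ[of i "- a"] zmul_pred[of "- i" a] by simp
next
  case (step2 i)
  then show ?case using zmul_pred[of i "- a"] zmul_succ[of "- i" a] by (simp add: add.commute)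
qed simp

text \<open>In the infinite dihedral group of two letters each letter is a reflection, which inverts
  the rotation \<open>gen a + gen b\<close>.\<close>

lemma dihedral_flip:
  assumes "set x \<subseteq> {a, b}"
  shows "word x + zmul k (gen a + gen b) = zmul (if even (length x) then k else - k) (gen a + gen b) + word x"
  using assms
proof (induction x)
  case (Cons i x)
  have flip: "gen i + zmul k (gen a + gen b) = zmul (- k) (gen a + gen b) + gen i" for k
  proof -
    have h: "add_hom (\<lambda>c. gen i + c - gen i)" by (rule add_hom_conj[OF add_hom_id])
    have "gen i + (gen a + gen b) - gen i = - (gen a + gen b)"
      using Cons.prems by (auto simp: minus_add diff_gen add.assoc)
    then have "gen i + zmul k (gen a + gen b) - gen i = zmul (- k) (gen a + gen b)"
      using add_hom_zmul[OF h, of k "gen a + gen b"] by (simp only: zmul_uminus)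
    then show ?thesis by (simp add: diff_eq_eq)
  qed
  have "word (i # x) + zmul k (gen a + gen b)
      = gen i + zmul (if even (length x) then k else - k) (gen a + gen b) + word x"
    using Cons by (simp add: add.assoc)
  then show ?case unfolding flip by (simp add: add.assoc)
qed simp

lemma act_square_power:
  assumes i: "i \<in> {1..<n}"
  defines "g \<equiv> braid_gen n i \<otimes>\<^bsub>braid_group n\<^esub> braid_gen n i" and "c \<equiv> gen (i + 1) + gen i"
  shows "act n (g [^]\<^bsub>braid_group n\<^esub> (N::nat)) (gen j) =
    (if j = i \<or> j = i + 1 then zmul (int N) c + gen j - zmul (int N) c else gen j)"
proof (induction N arbitrary: j)
  case 0
  interpret B: group "braid_group n" by (rule group_braid)
  show ?case by (simp add: K.baction_one)
next
  case (Suc N)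
  interpret B: group "braid_group n" by (rule group_braid)
  have gc: "g \<in> carrier (braid_group n)" "g [^]\<^bsub>braid_group n\<^esub> N \<in> carrier (braid_group n)"
    using braid_gen_closed[OF i] by (simp_all add: g_def)
  let ?h = "act n (g [^]\<^bsub>braid_group n\<^esub> N)" and ?z = "zmul (int N) c"
  note hh = add_hom_simps[OF add_hom_act[OF gc(2)]]
  have zc: "?z + c = c + ?z" using zmul_add[of 1 "int N" c] zmul_add[of "int N" 1 c] by (simp add: add.commute)
  have "?h c = ?z + c - ?z"
    by (simp add: c_def hh Suc ucox_diff add.assoc del: add_uminus_conv_diff)
  then have hc: "?h c = c" unfolding zc by simp
  have "zmul (int (Suc N)) c = c + ?z" using zmul_add[of 1 "int N" c] by simp
  moreover have "act n g (gen j) = (if j = i \<or> j = i + 1 then c + gen j - c else gen j)"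
    using braid_gen_closed[OF i] i
    by (simp add: g_def K.baction_mult K.baction_gen bsig_gen add_hom_simps[OF add_hom_bsig] c_def
      ucox_diff minus_add add.assoc del: add_uminus_conv_diff)
  moreover have "act n (g [^]\<^bsub>braid_group n\<^esub> Suc N) (gen j) = ?h (act n g (gen j))"
    using gc by (simp add: K.baction_mult)
  ultimately show ?case
    by (simp add: hh hc Suc ucox_diff minus_add add.assoc del: add_uminus_conv_diff)
qed

text \<open>Iterating the full twist of two neighbouring strands lengthens every syllable in the letters
  \<open>x\<^sub>i, x\<^bsub>i+1\<^esub>\<close> that does not commute with \<open>x\<^bsub>i+1\<^esub> x\<^sub>i\<close>, that is, every syllable of odd length.\<close>

lemma no_odd_run:
  assumes i: "i \<in> {1..<n}" and inv: "braid_invariant n (word (x @ y))"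
    and cyc: "distinct_adj ((x @ y) @ (x @ y))" and x: "set x \<subseteq> {i, i + 1}" "odd (length x)"
    and y: "y \<noteq> []" "hd y \<notin> {i, i + 1}" "last y \<notin> {i, i + 1}"
  shows False
proof -
  interpret B: group "braid_group n" by (rule group_braid)
  \<comment> \<open>With \<open>N\<close> twists the run \<open>x\<close> grows to at least
    \<open>4 * N - length x\<close>, hence \<open>3 * N\<close> letters, while an invariant
    cyclically reduced class of a word of length \<open>N\<close> leaves room for only
    \<open>N\<close>.\<close>
  define N where "N = length (x @ y)"
  define c where "c = (gen (i + 1) + gen i :: nat ucox)"
  define g where "g = braid_gen n i \<otimes>\<^bsub>braid_group n\<^esub> braid_gen n i"
  define z where "z = zmul (int N) c"
  let ?D = "{i, i + 1}"
  \<comment> \<open>The iterated twist stripped of the conjugation by \<open>z\<close>, so that the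
    letters in \<open>?D\<close> are fixed as \<open>twist_hd\<close> and \<open>twist_last\<close>
    require.\<close>
  let ?T = "lift (\<lambda>j. if j = i \<or> j = i + 1 then gen j else - z + gen j + z)"
  have g: "g [^]\<^bsub>braid_group n\<^esub> N \<in> carrier (braid_group n)"
    using braid_gen_closed[OF i] by (simp add: g_def)
  have T: "add_hom ?T" by (rule add_hom_lift) (simp add: add.assoc)
  have Tx: "?T (word v) = word v" if "set v \<subseteq> ?D" for v
    using that by (induction v) (auto simp: add_hom_simps[OF T])
  have zD: "set (nf z) \<subseteq> ?D" unfolding z_def c_def using set_nf_zmul_two[of "i + 1" i] by auto
  have "z = word (nf z)" by simp
  then have Tz: "?T z = z" using Tx[OF zD] by simp
  have act: "act n (g [^]\<^bsub>braid_group n\<^esub> N) a = z + ?T a - z" for a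
    by (rule add_hom_eq[OF add_hom_act[OF g] add_hom_conj[OF T]])
      (simp add: g_def act_square_power[OF i] z_def c_def ucox_diff add.assoc del: add_uminus_conv_diff)
  define a where "a = z + word x - z"
  define b where "b = z + ?T (word y) - z"
  have ab: "act n (g [^]\<^bsub>braid_group n\<^esub> N) (word (x @ y)) = a + b"
    unfolding act a_def b_def word_simps add_hom_add[OF T] Tx[OF x(1)]
    by (simp add: ucox_diff add.assoc del: add_uminus_conv_diff)
  have ry: "distinct_adj y" using cyc by (auto simp: distinct_adj_append_iff)
  have neg_zD: "set (nf (- z)) \<subseteq> ?D" using zD by simp
  have ex_hd: "\<exists>r. nf b = hd y # r"
  proof -
    have "last y \<noteq> hd (nf (- z))" if "nf (- z) \<noteq> []" using subsetD[OF neg_zD hd_in_set[OF that]] y(3) by metis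
    then have "nf (word y + - z) = y @ nf (- z)"
      using nf_add_append[of "word y" "- z"] ry distinct_adj_nf[of "- z"] nf_word_id[OF ry]
      by (auto simp only: distinct_adj_append_iff)
    then have nfy: "nf (word y + - z) = hd y # tl y @ nf (- z)" using y(1) by simp
    have "\<exists>r. nf (- (- z) + ?T (word y + - z)) = hd y # r"
      by (rule twist_hd[where D = "?D" and cj = "\<lambda>_. - z", OF T _ _ _ nfy y(2)])
        (use zD in auto)
    then show ?thesis
      by (simp add: b_def add_hom_simps[OF T] Tz ucox_diff add.assoc del: add_uminus_conv_diff)
  qed
  have ex_last: "\<exists>r. nf b = r @ [last y]"
  proof -
    have "last (nf z) \<noteq> hd y" if "nf z \<noteq> []" using subsetD[OF zD last_in_set[OF that]] y(2) by metis
    then have "nf (z + word y) = nf z @ y"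
      using nf_add_append[of z "word y"] ry distinct_adj_nf[of z] nf_word_id[OF ry]
      by (auto simp only: distinct_adj_append_iff)
    then have nfy: "nf (z + word y) = (nf z @ butlast y) @ [last y]" using y(1) by simp
    have "\<exists>r. nf (?T (z + word y) + - z) = r @ [last y]"
      by (rule twist_last[where D = "?D" and cj = "\<lambda>_. - z", OF T _ _ _ nfy y(3)])
        (use zD in auto)
    then show ?thesis
      by (simp add: b_def add_hom_simps[OF T] Tz ucox_diff add.assoc del: add_uminus_conv_diff)
  qed
  \<comment> \<open>Oddness enters here: the reflection \<open>word x\<close> inverts the rotation
    \<open>z\<close>, so conjugation by \<open>z\<close> doubles it instead of cancelling
    it.\<close>
  have "word x + zmul (- int N) c = z + word x"
    using dihedral_flip[of x "i + 1" i "- int N"] x by (auto simp: c_def z_def)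
  then have a2: "a = zmul (int (N + N)) c + word x"
    using zmul_add[of "int N" "int N" c]
    by (simp add: a_def z_def zmul_minus ucox_diff add.assoc del: add_uminus_conv_diff)
  have aD: "set (nf a) \<subseteq> ?D"
  proof -
    have "set (nf (word x)) \<subseteq> ?D" using set_nf_word[of x] x(1) by blast
    moreover have "set (nf (zmul (int (N + N)) c)) \<subseteq> ?D"
      unfolding c_def using set_nf_zmul_two[of "i + 1" i "int (N + N)"] by auto
    ultimately show ?thesis unfolding a2 using set_nf_add by fast
  qed
  have "size_of (zmul (int (N + N)) c) \<le> size_of a + size_of (word x)"
    using size_of_add[of a "- word x"] by (simp add: a2)
  moreover have "size_of (zmul (int (N + N)) c) = 4 * N"
  proof -
    have "nf (zmul (int (N + N)) c) = concat (replicate (N + N) [i + 1, i])"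
      using nf_zmul_two[of "i + 1" i "int (N + N)"] unfolding c_def nat_int by simp
    then show ?thesis by (simp add: size_of_def length_concat sum_list_replicate)
  qed
  ultimately have size_a: "4 * N \<le> size_of a + length x" using size_of_word[of x] by linarith
  have Npos: "0 < N" "length x \<le> N" using y(1) by (simp_all add: N_def)
  have ane: "nf a \<noteq> []"
  proof
    assume "nf a = []"
    then have "size_of a = 0" by (simp add: size_of_def)
    then show False using size_a Npos by linarith
  qed
  have bne: "nf b \<noteq> []" "hd (nf b) = hd y" using ex_hd by auto
  have bla: "last (nf b) = last y" using ex_last by auto
  have hl: "last (nf a) \<noteq> hd (nf b)" "last (nf b) \<noteq> hd (nf a)"
    using aD last_in_set[OF ane] hd_in_set[OF ane] y(2,3) bne bla by auto
  have nfab: "nf (a + b) = nf a @ nf b"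
    using hl by (intro nf_add_append) (simp add: distinct_adj_append_iff)
  have cyc_ab: "distinct_adj (nf (a + b) @ nf (a + b))"
    unfolding nfab using hl ane bne(1) by (simp add: distinct_adj_append_iff)
  obtain k where "act n (g [^]\<^bsub>braid_group n\<^esub> N) (word (x @ y)) = k + word (x @ y) - k"
    using inv g unfolding braid_invariant_def by blast
  then have "word (nf (a + b)) = k + word (x @ y) - k" using ab by simp
  from cyclically_reduced_length_le[OF cyc_ab this] have "size_of a \<le> N"
    using size_of_word[of "x @ y"] by (simp add: nfab N_def flip: size_of_def)
  then show False using size_a Npos by linarith
qed

section \<open>Cyclic words that run through the letters in order\<close>

definition cyc_succ :: "nat \<Rightarrow> nat \<Rightarrow> nat" where
  "cyc_succ n a = (if a = n then 1 else a + 1)"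

lemma rotate_conj:
  assumes "set w \<subseteq> {1..n}"
  shows "\<exists>k \<in> Kset n. word w = k + word (rotate t w) - k"
proof
  let ?k = "word (take (t mod length w) w)"
  have "word w = ?k + word (drop (t mod length w) w)" by (simp flip: word_simps(3))
  then show "word w = ?k + word (rotate t w) - ?k"
    by (simp add: rotate_drop_take ucox_diff add.assoc del: add_uminus_conv_diff)
  show "?k \<in> Kset n" using assms set_take_subset by (intro Kset_word) fast
qed

lemma map_mod_concat: "map (\<lambda>j. 1 + j mod n) [0..<q * n] = concat (replicate q [1..<Suc n])"
proof (induction q)
  case (Suc q)
  have "[0..<Suc q * n] = [0..<n] @ map (\<lambda>j. j + n) [0..<q * n]"
    using upt_add_eq_append[of 0 n "q * n"] map_add_upt[of n "q * n"] by (simp add: add.commute)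
  moreover have "map (\<lambda>j. 1 + j mod n) [0..<n] = [1..<Suc n]"
    by (intro nth_equalityI) (simp_all del: upt_Suc)
  ultimately show ?case using Suc by (simp add: comp_def)
qed simp

text \<open>Rotated so as to begin with the letter 1, the word repeats \<open>1, ..., n\<close>, and
  its periodicity makes the length a multiple of \<open>n\<close>.\<close>

lemma cyclic_word_power:
  assumes w: "set w \<subseteq> {1..n}" "w \<noteq> []"
    and succ: "\<And>t. w ! (Suc t mod length w) = cyc_succ n (w ! (t mod length w))"
  shows "\<exists>k \<in> Kset n. \<exists>m. word w = k + zmul m (boundary n) - k"
proof -
  define f where "f t = w ! (t mod length w)" for t
  have L: "0 < length w" using w(2) by simp
  have fS: "f (Suc t) = cyc_succ n (f t)" for t using succ by (simp add: f_def)
  have f: "1 \<le> f t" "f t \<le> n" for t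
  proof -
    have "f t \<in> set w" using L by (simp add: f_def)
    then show "1 \<le> f t" "f t \<le> n" using w(1) by auto
  qed
  have up: "f 0 + j \<le> n \<Longrightarrow> f j = f 0 + j" for j
    by (induction j) (simp_all add: fS cyc_succ_def)
  define t0 where "t0 = Suc (n - f 0)"
  have "f (n - f 0) = n" using up[of "n - f 0"] f(2)[of 0] by simp
  then have t0: "f t0 = 1" by (simp add: t0_def fS cyc_succ_def)
  have ft: "f (t0 + j) = 1 + j mod n" for j
  proof (induction j)
    case (Suc j)
    then show ?case using f(1)[of 0] f(2)[of 0] by (simp add: fS cyc_succ_def mod_Suc)
  qed (simp add: t0)
  have "f (t0 + length w) = f t0" by (simp add: f_def)
  then have "length w mod n = 0" using ft[of "length w"] t0 by simp
  then obtain q where q: "length w = q * n" by (metis mod_0_imp_dvd dvd_def mult.commute)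
  have "rotate t0 w = map (\<lambda>j. f (t0 + j)) [0..<length w]"
    by (intro nth_equalityI) (simp_all add: nth_rotate f_def)
  also have "\<dots> = concat (replicate q [1..<Suc n])"
    unfolding ft q by (rule map_mod_concat)
  finally have "word (rotate t0 w) = zmul (int q) (boundary n)"
    by (simp add: boundary_def zmul_word del: upt_Suc)
  then show ?thesis using rotate_conj[OF w(1), of t0] by auto
qed

text \<open>In a cyclically reduced representative no maximal cyclic run in two neighbouring letters
  \<open>i, i + 1\<close> has odd length. Excluding runs of length 1 gives every letter strictly
  between 1 and \<open>n\<close> its two neighbours \<open>p - 1\<close> and \<open>p + 1\<close>,
  one on each side, so the word is monotone until it reaches 1 or \<open>n\<close>. Excluding runs
  of length 3 forbids turning round at \<open>n\<close>, so the word jumps from \<open>n\<close> to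
  1. It therefore winds through all letters in one direction, and so does its inverse.\<close>

theorem braid_invariant_conj_boundary_power:
  assumes n: "n \<ge> 2" and V: "a \<in> Kset n" "a + a \<noteq> 0" "braid_invariant n a"
  shows "\<exists>k \<in> Kset n. \<exists>m. a = k + zmul m (boundary n) - k"
proof -
  obtain k w where kw: "a = k + word w - k" "distinct_adj (w @ w) \<or> (\<exists>i. w = [i])"
    "set (nf k) \<subseteq> set (nf a)" "set w \<subseteq> set (nf a)"
    by (rule ex_cyclically_reduced)
  have sw: "set w \<subseteq> {1..n}" and k: "k \<in> Kset n" using kw V(1) by (auto simp: Kset_def)
  have ww: "word w + word w \<noteq> 0"
  proof
    assume "word w + word w = 0"
    moreover have "a + a = k + (word w + word w) - k"
      by (simp add: kw(1) ucox_diff add.assoc del: add_uminus_conv_diff)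
    ultimately show False using V(2) by simp
  qed
  then have cyc: "distinct_adj (w @ w)" and wne: "w \<noteq> []" using kw(2) by auto
  define L where "L = length w"
  define s where "s t = w ! (t mod L)" for t
  have L2: "2 \<le> L"
  proof (rule ccontr)
    assume "\<not> 2 \<le> L"
    then obtain i where "w = [i]" using wne by (cases w; cases "tl w") (auto simp: L_def)
    then show False using cyc by simp
  qed
  have per: "s (t + L) = s t" for t by (simp add: s_def)
  have per_mult: "s (t + j * L) = s t" for t j by (simp add: s_def)
  have s_range: "1 \<le> s t" "s t \<le> n" for t
  proof -
    have "t mod length w < length w" using wne by simp
    then have "s t \<in> set w" by (simp add: s_def L_def)
    then show "1 \<le> s t" "s t \<le> n" using sw by auto
  qed
  have rot: "rotate t w = map (\<lambda>j. s (t + j)) [0..<L]" for t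
    by (intro nth_equalityI) (simp_all add: nth_rotate s_def L_def)
  have inv_rot: "braid_invariant n (word (rotate t w))" for t
    using rotate_conj[OF sw, of t] braid_invariant_conj[of n k "word w"] V(3) kw(1) braid_invariant_conj by metis
  have cyc_rot: "distinct_adj (rotate t w @ rotate t w)" for t
  proof -
    obtain u v where uv: "w = u @ v" "rotate t w = v @ u"
      by (metis append_take_drop_id rotate_drop_take)
    show ?thesis using cyc unfolding uv(2) unfolding uv(1)
      by (cases "u = []"; cases "v = []") (auto simp: distinct_adj_append_iff)
  qed
  have adj: "s (Suc t) \<noteq> s t" for t
  proof -
    have "[0..<L] = 0 # Suc 0 # [Suc (Suc 0)..<L]" using L2 by (simp add: upt_conv_Cons)
    then show ?thesis using cyc_rot[of t] unfolding rot by simp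
  qed
  \<comment> \<open>Otherwise the letter at \<open>Suc t\<close> would be a run of length 1.\<close>
  have near: "s t \<in> {i, i + 1} \<or> s (Suc (Suc t)) \<in> {i, i + 1}"
    if i: "i \<in> {1..<n}" and t: "s (Suc t) \<in> {i, i + 1}" for t i
  proof (rule ccontr)
    assume far: "\<not> (s t \<in> {i, i + 1} \<or> s (Suc (Suc t)) \<in> {i, i + 1})"
    define y where "y = map (\<lambda>j. s (Suc (t + j))) [Suc 0..<L]"
    have y: "rotate (Suc t) w = [s (Suc t)] @ y"
      using L2 by (simp add: rot y_def upt_conv_Cons[of 0])
    have yne: "y \<noteq> []" using L2 by (simp add: y_def)
    have "hd y = s (Suc (Suc t))" using L2 by (simp add: y_def hd_map)
    moreover have "last y = s (t + L)" using L2 by (simp add: y_def last_map)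
    ultimately show False
      using no_odd_run[OF i, of "[s (Suc t)]" y] inv_rot[of "Suc t"] cyc_rot[of "Suc t"] far t yne
      unfolding y by (simp add: per)
  qed
  have no_three: False
    if i: "i \<in> {1..<n}" and t: "s (Suc t) \<in> {i, i + 1}" "s (Suc (Suc t)) \<in> {i, i + 1}" "s (Suc (Suc (Suc t))) \<in> {i, i + 1}"
      and far: "s t \<notin> {i, i + 1}" "s (Suc (Suc (Suc (Suc t)))) \<notin> {i, i + 1}" for t i
  proof -
    have "s t = s (Suc (Suc t))" if "L = 2" using per[of t] that by simp
    then have "L \<noteq> 2" using t far by auto
    moreover have "s t = s (Suc (Suc (Suc t)))" if "L = 3" using per[of t] that by (simp add: numeral_3_eq_3)
    then have "L \<noteq> 3" using t far by auto
    ultimately have L4: "4 \<le> L" using L2 by linarith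
    define y where "y = map (\<lambda>j. s (Suc (t + j))) [Suc (Suc (Suc 0))..<L]"
    have "[0..<L] = [0, Suc 0, Suc (Suc 0)] @ [Suc (Suc (Suc 0))..<L]" using L4 by (simp add: upt_conv_Cons)
    then have y: "rotate (Suc t) w = [s (Suc t), s (Suc (Suc t)), s (Suc (Suc (Suc t)))] @ y"
      by (simp add: rot y_def)
    have yne: "y \<noteq> []" using L4 by (simp add: y_def)
    have "hd y = s (Suc (Suc (Suc (Suc t))))" using L4 by (simp add: y_def hd_map)
    moreover have "last y = s (t + L)" using L4 by (simp add: y_def last_map)
    ultimately show False
      using no_odd_run[OF i, of "[s (Suc t), s (Suc (Suc t)), s (Suc (Suc (Suc t)))]" y] inv_rot[of "Suc t"] cyc_rot[of "Suc t"] far t yne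
      unfolding y by (simp add: per)
  qed
  have adj1: "s (Suc t) \<noteq> s t" "s (Suc (Suc t)) \<noteq> s (Suc t)" for t
    using adj by blast+
  have interior: "s t + 1 = s (Suc t) \<and> s (Suc (Suc t)) = s (Suc t) + 1 \<or> s t = s (Suc t) + 1 \<and> s (Suc (Suc t)) + 1 = s (Suc t)"
    if st: "1 < s (Suc t)" "s (Suc t) < n" for t
  proof -
    have 1: "s t = s (Suc t) + 1 \<or> s (Suc (Suc t)) = s (Suc t) + 1"
      using near[of "s (Suc t)" t] st adj1[of t] by auto
    obtain p where "s (Suc t) = p + 1" "1 \<le> p" "p < n"
      using st by (intro that[of "s (Suc t) - 1"]) linarith+
    then have 2: "s t + 1 = s (Suc t) \<or> s (Suc (Suc t)) + 1 = s (Suc t)"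
      using near[of p t] adj1[of t] by auto
    from 1 2 show ?thesis by linarith
  qed
  have cyc_adj: "s (Suc t) = cyc_succ n (s t) \<or> s t = cyc_succ n (s (Suc t))" for t
  proof -
    \<comment> \<open>The position cyclically before \<open>t\<close>. Adding the period avoids
      subtraction below 0, and \<open>interior\<close> at \<open>T\<close> speaks about the letter
      at \<open>t\<close>.\<close>
    define T where "T = t + L - 1"
    have T: "s (Suc T) = s t" "s (Suc (Suc T)) = s (Suc t)"
      using L2 per[of t] per[of "Suc t"] by (simp_all add: T_def)
    consider "1 < s (Suc t) \<and> s (Suc t) < n" | "1 < s t \<and> s t < n"
      | "s t = 1 \<or> s t = n" "s (Suc t) = 1 \<or> s (Suc t) = n"
      using s_range[of t] s_range[of "Suc t"] by linarith
    then show ?thesis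
    proof cases
      case 1
      then show ?thesis using interior[of t] s_range[of t] by (auto simp: cyc_succ_def)
    next
      case 2
      then show ?thesis using interior[of T] s_range[of "Suc t"] unfolding T by (auto simp: cyc_succ_def)
    next
      case 3
      then show ?thesis using adj1(1)[of t] by (auto simp: cyc_succ_def)
    qed
  qed
  have step: "s (Suc (Suc t)) = cyc_succ n (s (Suc t))" if asc: "s (Suc t) = cyc_succ n (s t)" for t
  proof (cases "n = 2")
    case True
    have "s (Suc t) = 1 \<or> s (Suc t) = 2" "s (Suc (Suc t)) = 1 \<or> s (Suc (Suc t)) = 2"
      using s_range[of "Suc t"] s_range[of "Suc (Suc t)"] True by linarith+
    then show ?thesis using adj1(2)[of t] True by (auto simp: cyc_succ_def)
  next
    case False
    then have n3: "3 \<le> n" using n by simp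
    consider "1 < s (Suc t)" "s (Suc t) < n" | "s (Suc t) = 1" | "s (Suc t) = n"
      using s_range[of "Suc t"] by linarith
    then show ?thesis
    proof cases
      case 1
      then show ?thesis using interior[of t] asc s_range[of t] by (auto simp: cyc_succ_def split: if_splits)
    next
      case 2
      then have "s t = n" using asc s_range[of t] by (auto simp: cyc_succ_def split: if_splits)
      then show ?thesis using near[of 1 t] 2 n3 adj1(2)[of t] by (auto simp: cyc_succ_def)
    next
      case 3
      then have st: "s t + 1 = n" using asc n3 by (auto simp: cyc_succ_def split: if_splits)
      define T where "T = t + L - 1"
      have T: "s (Suc T) = s t" "s (Suc (Suc T)) = s (Suc t)" "s (Suc (Suc (Suc T))) = s (Suc (Suc t))" "s (Suc (Suc (Suc (Suc T)))) = s (Suc (Suc (Suc t)))"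
        using L2 per[of t] per[of "Suc t"] per[of "Suc (Suc t)"] per[of "Suc (Suc (Suc t))"] by (simp_all add: T_def)
      \<comment> \<open>Turning round at \<open>n\<close> would produce the letters
        \<open>n - 2, n - 1, n, n - 1, n - 2\<close>, with a run of length 3 in the middle.\<close>
      have "s (Suc (Suc t)) + 1 \<noteq> n"
      proof
        assume e: "s (Suc (Suc t)) + 1 = n"
        have "s T + 2 = n" using interior[of T] T st 3 n3 by auto
        moreover have "s (Suc (Suc (Suc t))) + 2 = n" using interior[of "Suc t"] e 3 n3 by (auto simp: numeral_eq_Suc)
        ultimately show False using no_three[of "n - 1" T] T st e 3 n3 by auto
      qed
      moreover have "\<not> (1 < s (Suc (Suc t)) \<and> s (Suc (Suc t)) < n)"
        using interior[of "Suc t"] 3 calculation s_range[of "Suc (Suc (Suc t))"] by (auto simp: numeral_eq_Suc)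
      ultimately have "s (Suc (Suc t)) = 1" using s_range[of "Suc (Suc t)"] adj1(2)[of t] 3 by linarith
      then show ?thesis using 3 by (simp add: cyc_succ_def)
    qed
  qed
  have "(\<forall>t. s (Suc t) = cyc_succ n (s t)) \<or> (\<forall>t. s t = cyc_succ n (s (Suc t)))"
  proof (cases "\<exists>t. s (Suc t) = cyc_succ n (s t)")
    case True
    then obtain t0 where t0: "s (Suc t0) = cyc_succ n (s t0)" by blast
    have ge: "s (Suc t) = cyc_succ n (s t)" if "t0 \<le> t" for t
      using that
    proof (induction t rule: dec_induct)
      case base show ?case by (rule t0)
    next
      case (step t) then show ?case using \<open>\<And>t. s (Suc t) = cyc_succ n (s t) \<Longrightarrow> s (Suc (Suc t)) = cyc_succ n (s (Suc t))\<close>[of t] by simp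
    qed
    have "s (Suc t) = cyc_succ n (s t)" for t
    proof -
      \<comment> \<open>Full periods move any position beyond \<open>t0\<close> without changing its
        letter.\<close>
      have "t0 \<le> t + t0 * L" using L2 by (cases L) auto
      from ge[OF this] show ?thesis using per_mult[of t t0] per_mult[of "Suc t" t0] by simp
    qed
    then show ?thesis by blast
  next
    case False
    then have "s t = cyc_succ n (s (Suc t))" for t using cyc_adj[of t] by blast
    then show ?thesis by blast
  qed
  then have "\<exists>l \<in> Kset n. \<exists>m. word w = l + zmul m (boundary n) - l"
  proof
    assume "\<forall>t. s (Suc t) = cyc_succ n (s t)"
    then show ?thesis using cyclic_word_power[OF sw wne] by (simp add: s_def L_def)
  next
    \<comment> \<open>A descending word becomes ascending when reversed, that is, when its inverse
      is considered; this yields the negative exponents.\<close>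
    assume desc: "\<forall>t. s t = cyc_succ n (s (Suc t))"
    have "rev w ! (Suc t mod length (rev w)) = cyc_succ n (rev w ! (t mod length (rev w)))" for t
    proof -
      define r where "r = t mod L"
      have r: "r < L" and r': "Suc t mod L < L" using L2 by (simp_all add: r_def)
      have "rev w ! (Suc t mod L) = s (L - Suc (Suc t mod L))" "rev w ! r = s (L - Suc r)"
        using r r' L2 by (simp_all add: rev_nth s_def L_def)
      moreover have "s (L - Suc (Suc t mod L)) = cyc_succ n (s (L - Suc r))"
      proof (cases "Suc r = L")
        case True
        then have "Suc t mod L = 0" by (simp add: mod_Suc r_def)
        then show ?thesis using desc[rule_format, of "L - Suc 0"] True per[of 0] L2 by simp
      next
        case False
        then have "Suc t mod L = Suc r" by (simp add: mod_Suc r_def)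
        moreover have "Suc (L - Suc (Suc r)) = L - Suc r" using False r by linarith
        ultimately show ?thesis using desc[rule_format, of "L - Suc (Suc r)"] by simp
      qed
      ultimately show ?thesis by (simp add: r_def L_def)
    qed
    moreover have "set (rev w) \<subseteq> {1..n}" "rev w \<noteq> []" using sw wne by simp_all
    ultimately obtain l m where l: "l \<in> Kset n" "word (rev w) = l + zmul m (boundary n) - l"
      using cyclic_word_power[of "rev w" n] by blast
    have "word w = - word (rev w)" by simp
    also have "\<dots> = l + zmul (- m) (boundary n) - l"
      unfolding l(2) zmul_minus by (simp add: ucox_diff minus_add add.assoc del: add_uminus_conv_diff)
    finally show ?thesis using l(1) by blast
  qed
  then obtain l m where l: "l \<in> Kset n" "word w = l + zmul m (boundary n) - l" by blast
  have "a = (k + l) + zmul m (boundary n) - (k + l)"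
    unfolding kw(1) l(2) by (simp add: ucox_diff minus_add add.assoc del: add_uminus_conv_diff)
  then show ?thesis using Kset_add[OF k l(1)] by blast
qed

section \<open>The semidirect product\<close>

definition ugrp :: "'a ucox monoid" where
  "ugrp = \<lparr>carrier = UNIV, monoid.mult = (+), one = 0\<rparr>"

lemma ugrp_simps [simp]: "carrier ugrp = UNIV" "a \<otimes>\<^bsub>ugrp\<^esub> b = a + b" "\<one>\<^bsub>ugrp\<^esub> = 0"
  by (simp_all add: ugrp_def)

lemma group_ugrp: "group ugrp"
  by (rule groupI) (auto simp: add.assoc intro: left_minus)

definition kemb :: "nat \<Rightarrow> nat word set \<Rightarrow> nat ucox" where
  "kemb n = pres_lift {1..n} (K_rels n) ugrp gen"

lemma kemb_hom: "kemb n \<in> hom (K_group n) ugrp"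
  and kemb_gen: "i \<in> {1..n} \<Longrightarrow> kemb n (K_gen n i) = gen i"
  unfolding kemb_def by (rule K_lift[OF group_ugrp]; simp)+

lemma kemb_mult: "k \<in> carrier (K_group n) \<Longrightarrow> l \<in> carrier (K_group n) \<Longrightarrow>
    kemb n (k \<otimes>\<^bsub>K_group n\<^esub> l) = kemb n k + kemb n l"
  using hom_mult[OF kemb_hom] by simp

lemma kemb_one: "kemb n \<one>\<^bsub>K_group n\<^esub> = 0"
  using hom_one[OF kemb_hom group_K group_ugrp] by simp

lemma kemb_inv: "k \<in> carrier (K_group n) \<Longrightarrow> kemb n (inv\<^bsub>K_group n\<^esub> k) = - kemb n k"
proof -
  assume k: "k \<in> carrier (K_group n)"
  interpret K: group "K_group n" by (rule group_K)
  have "kemb n k + kemb n (inv\<^bsub>K_group n\<^esub> k) = 0"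
    using k by (simp add: kemb_one flip: kemb_mult)
  then show ?thesis by (metis minus_unique)
qed

definition kword :: "nat \<Rightarrow> nat list \<Rightarrow> nat word set" where
  "kword n w = foldr (\<lambda>i k. K_gen n i \<otimes>\<^bsub>K_group n\<^esub> k) w \<one>\<^bsub>K_group n\<^esub>"

lemma kword_simps [simp]:
  "kword n [] = \<one>\<^bsub>K_group n\<^esub>" "kword n (i # w) = K_gen n i \<otimes>\<^bsub>K_group n\<^esub> kword n w"
  by (simp_all add: kword_def)

lemma kword_closed: "set w \<subseteq> {1..n} \<Longrightarrow> kword n w \<in> carrier (K_group n)"
proof -
  interpret K: group "K_group n" by (rule group_K)
  show "set w \<subseteq> {1..n} \<Longrightarrow> kword n w \<in> carrier (K_group n)"
    by (induction w) (auto simp: K_gen_closed)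
qed

lemma kword_append:
  "set v \<subseteq> {1..n} \<Longrightarrow> set w \<subseteq> {1..n} \<Longrightarrow> kword n (v @ w) = kword n v \<otimes>\<^bsub>K_group n\<^esub> kword n w"
proof -
  interpret K: group "K_group n" by (rule group_K)
  show "set v \<subseteq> {1..n} \<Longrightarrow> set w \<subseteq> {1..n} \<Longrightarrow> kword n (v @ w) = kword n v \<otimes>\<^bsub>K_group n\<^esub> kword n w"
    by (induction v) (auto simp: K_gen_closed kword_closed K.m_assoc)
qed

lemma kemb_kword: "set w \<subseteq> {1..n} \<Longrightarrow> kemb n (kword n w) = word w"
  by (induction w) (auto simp: kemb_one kemb_mult kword_closed K_gen_closed kemb_gen)

lemma kword_rcons:
  assumes "i \<in> {1..n}" "set w \<subseteq> {1..n}"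
  shows "kword n (rcons i w) = kword n (i # w)"
  using assms by (cases w) (auto simp: rcons_def K_gen_cancel kword_closed)

lemma kword_red: "set w \<subseteq> {1..n} \<Longrightarrow> kword n (red w) = kword n w"
proof (induction w)
  case (Cons i w)
  have "set (red w) \<subseteq> {1..n}" using set_foldr_rcons[of w "[]"] Cons.prems by auto
  then show ?case using Cons kword_rcons[of i n "red w"] by simp
qed simp

lemma ex_kword: "k \<in> carrier (K_group n) \<Longrightarrow> \<exists>w. set w \<subseteq> {1..n} \<and> k = kword n w"
proof -
  interpret K: group "K_group n" by (rule group_K)
  have one: "K_gen n i = kword n [i]" if "i \<in> {1..n}" for i using that by (simp add: K_gen_closed)
  assume "k \<in> carrier (K_group n)"
  then have "k \<in> generate (K_group n) (K_gen n ` {1..n})"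
    using pres_generated[of "{1..n}" "K_rels n"]
    unfolding K_group_def[symmetric] K_gen_def[symmetric] by simp
  then show ?thesis
  proof (induction rule: generate.induct)
    case one then show ?case by (intro exI[of _ "[]"]) simp
  next
    case (incl x)
    then obtain i where "x = K_gen n i" "i \<in> {1..n}" by blast
    then show ?case using one by (intro exI[of _ "[i]"]) simp
  next
    case (inv x)
    then obtain i where i: "x = K_gen n i" "i \<in> {1..n}" by blast
    then have "inv\<^bsub>K_group n\<^esub> x = x" using K_gen_sq[of i n] by (intro K.inv_equality) (auto simp: K_gen_closed)
    then show ?case using i one by (intro exI[of _ "[i]"]) simp
  next
    case (eng x y)
    then obtain v w where "set v \<subseteq> {1..n}" "x = kword n v" "set w \<subseteq> {1..n}" "y = kword n w" by blast
    then show ?case by (intro exI[of _ "v @ w"]) (simp add: kword_append)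
  qed
qed

text \<open>Every element of \<open>K\<close> is a word in the generators, and each reduction step
  of \<open>rcons\<close> is also valid in the presented group. The reduced word of the image
  therefore determines the element.\<close>

lemma kemb_inj:
  assumes "k \<in> carrier (K_group n)" "l \<in> carrier (K_group n)" "kemb n k = kemb n l"
  shows "k = l"
proof -
  obtain v w where v: "set v \<subseteq> {1..n}" "k = kword n v" and w: "set w \<subseteq> {1..n}" "l = kword n w"
    using ex_kword[OF assms(1)] ex_kword[OF assms(2)] by blast
  have "red v = red w" using assms(3) v w by (metis kemb_kword nf_word)
  then show ?thesis using v w kword_red by metis
qed

lemma kemb_image: "kemb n ` carrier (K_group n) = Kset n"
proof
  show "kemb n ` carrier (K_group n) \<subseteq> Kset n"
    using ex_kword[of _ n] kemb_kword Kset_word by fastforce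
  show "Kset n \<subseteq> kemb n ` carrier (K_group n)"
  proof
    fix a assume "a \<in> Kset n"
    then have "set (nf a) \<subseteq> {1..n}" by (simp add: Kset_def)
    then show "a \<in> kemb n ` carrier (K_group n)"
      using kemb_kword[of "nf a" n] kword_closed[of "nf a" n] by (metis image_eqI word_nf)
  qed
qed

lemma kemb_in_Kset: "k \<in> carrier (K_group n) \<Longrightarrow> kemb n k \<in> Kset n"
  using kemb_image[of n] by blast

lemma kemb_rho:
  assumes "g \<in> carrier (braid_group n)" "k \<in> carrier (K_group n)"
  shows "kemb n (rho_plus n g k) = act n g (kemb n k)"
proof -
  interpret B: braid_elements "braid_group n" n "braid_gen n" by (rule braid_elements_braid_gen)
  have s: "braid_gen n ` {1..<n} \<subseteq> carrier (braid_group n)" by (rule B.s_image_subset) simp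
  have gen: "kemb n (rho_plus n x k) = act n x (kemb n k)"
    if x: "x \<in> braid_gen n ` {1..<n}" and k: "k \<in> carrier (K_group n)" for x k
  proof -
    obtain i where i: "x = braid_gen n i" "i \<in> {1..<n}" using x by blast
    have h: "(\<lambda>k. bsig i (kemb n k)) \<in> hom (K_group n) ugrp"
      by (rule homI) (simp_all add: kemb_mult add_hom_add[OF add_hom_bsig])
    have "kemb n (braid_act n i k) = bsig i (kemb n k)"
      by (rule K_hom_eq[OF group_ugrp hom_compose[OF braid_act_hom[OF i(2)] kemb_hom, unfolded comp_def] h _ k])
        (use i in \<open>auto simp: braid_act_gen[OF i(2)] kemb_gen kemb_mult K_gen_closed bsig_gen
          group.is_monoid[OF group_K] monoid.m_closed[OF group.is_monoid[OF group_K]]\<close>)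
    then show ?thesis using i by (simp add: rho_plus_gen K.baction_gen)
  qed
  have "\<forall>k \<in> carrier (K_group n). kemb n (rho_plus n g k) = act n g (kemb n k)"
    using assms(1) unfolding braid_generated[symmetric]
  proof (induction rule: generate.induct)
    case one then show ?case by (simp add: rho_plus_one K.baction_one)
  next
    case (incl x) then show ?case using gen by blast
  next
    case (inv x)
    then have xc: "x \<in> carrier (braid_group n)" using s by blast
    show ?case
    proof
      fix k assume k: "k \<in> carrier (K_group n)"
      have "act n x (kemb n (rho_plus n (inv\<^bsub>braid_group n\<^esub> x) k)) = kemb n (rho_plus n x (rho_plus n (inv\<^bsub>braid_group n\<^esub> x) k))"
        using gen[OF inv] k xc by (simp add: rho_plus_closed)
      also have "\<dots> = kemb n k" using k xc by (simp add: rho_plus_one flip: rho_plus_mult)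
      finally show "kemb n (rho_plus n (inv\<^bsub>braid_group n\<^esub> x) k) = act n (inv\<^bsub>braid_group n\<^esub> x) (kemb n k)"
        by (metis K.baction_inv(1)[OF xc])
    qed
  next
    case (eng x y)
    then show ?case using B.generate_in_carrier[OF s]
      by (simp add: rho_plus_mult K.baction_mult rho_plus_closed)
  qed
  then show ?thesis using assms(2) by blast
qed

section \<open>Involutions of the semidirect product\<close>

lemma KB_carrier: "carrier (KB_group n) = carrier (K_group n) \<times> carrier (braid_group n)"
  by (simp add: KB_group_def semidirect_carrier)

lemma KB_mult: "(k, g) \<otimes>\<^bsub>KB_group n\<^esub> (l, h) = (k \<otimes>\<^bsub>K_group n\<^esub> rho_plus n g l, g \<otimes>\<^bsub>braid_group n\<^esub> h)"
  by (simp add: KB_group_def semidirect_mult)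

lemma KB_one: "\<one>\<^bsub>KB_group n\<^esub> = (\<one>\<^bsub>K_group n\<^esub>, \<one>\<^bsub>braid_group n\<^esub>)"
  by (simp add: KB_group_def semidirect_def)

abbreviation embK :: "nat \<Rightarrow> nat word set \<Rightarrow> nat word set \<times> nat word set" where
  "embK n k \<equiv> (k, \<one>\<^bsub>braid_group n\<^esub>)"

lemma embK_group_hom: "group_hom (K_group n) (KB_group n) (embK n)"
  using emb_K_hom by (simp add: group_hom_def group_hom_axioms_def group_K group_KB)

lemma xgen_conj_xgen_one:
  assumes "1 \<le> i" "i \<le> n"
  shows "\<exists>h \<in> carrier (KB_group n). xgen n i = h \<otimes>\<^bsub>KB_group n\<^esub> xgen n 1 \<otimes>\<^bsub>KB_group n\<^esub> inv\<^bsub>KB_group n\<^esub> h"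
  using assms
proof (induction i rule: dec_induct)
  case base
  interpret G: group "KB_group n" by (rule group_KB)
  show ?case using base by (intro bexI[of _ "\<one>\<^bsub>KB_group n\<^esub>"]) (simp_all add: xgen_closed)
next
  case (step i)
  interpret G: group "KB_group n" by (rule group_KB)
  obtain h where h: "h \<in> carrier (KB_group n)"
    "xgen n i = h \<otimes>\<^bsub>KB_group n\<^esub> xgen n 1 \<otimes>\<^bsub>KB_group n\<^esub> inv\<^bsub>KB_group n\<^esub> h"
    using step by auto
  have a: "agen n i \<in> carrier (KB_group n)" and x: "xgen n 1 \<in> carrier (KB_group n)"
    using step by (simp_all add: agen_closed xgen_closed)
  have "xgen n (Suc i) = agen n i \<otimes>\<^bsub>KB_group n\<^esub> xgen n i \<otimes>\<^bsub>KB_group n\<^esub> inv\<^bsub>KB_group n\<^esub> agen n i"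
    using step agen_conj[of i n "K_gen n i"] by (simp add: xgen_def K_gen_closed braid_act_gen Suc_eq_plus1)
  also have "\<dots> = (agen n i \<otimes>\<^bsub>KB_group n\<^esub> h) \<otimes>\<^bsub>KB_group n\<^esub> xgen n 1 \<otimes>\<^bsub>KB_group n\<^esub> inv\<^bsub>KB_group n\<^esub> (agen n i \<otimes>\<^bsub>KB_group n\<^esub> h)"
    unfolding h(2) using a h(1) x by (simp add: G.m_assoc G.inv_mult_group)
  finally show ?case using a h(1) by blast
qed

text \<open>The braid component squares to the identity, hence is trivial. In \<open>K\<close> a
  palindrome is a conjugate of its middle letter, and the braid generators make all
  \<open>xgen n i\<close> conjugate to \<open>xgen n 1\<close>.\<close>

lemma KB_involution_conj:
  assumes z: "z \<in> carrier (KB_group n)" "z \<otimes>\<^bsub>KB_group n\<^esub> z = \<one>\<^bsub>KB_group n\<^esub>" "z \<noteq> \<one>\<^bsub>KB_group n\<^esub>"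
  shows "snd z = \<one>\<^bsub>braid_group n\<^esub>"
    and "\<exists>h \<in> carrier (KB_group n). z = h \<otimes>\<^bsub>KB_group n\<^esub> xgen n 1 \<otimes>\<^bsub>KB_group n\<^esub> inv\<^bsub>KB_group n\<^esub> h"
proof -
  interpret G: group "KB_group n" by (rule group_KB)
  interpret K: group "K_group n" by (rule group_K)
  interpret E: group_hom "K_group n" "KB_group n" "embK n" by (rule embK_group_hom)
  obtain k g where kg: "z = (k, g)" "k \<in> carrier (K_group n)" "g \<in> carrier (braid_group n)"
    using z(1) by (auto simp: KB_carrier)
  have kg2: "k \<otimes>\<^bsub>K_group n\<^esub> rho_plus n g k = \<one>\<^bsub>K_group n\<^esub>" "g \<otimes>\<^bsub>braid_group n\<^esub> g = \<one>\<^bsub>braid_group n\<^esub>"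
    using z(2) unfolding kg(1) KB_mult KB_one prod.inject by blast+
  have g1: "g = \<one>\<^bsub>braid_group n\<^esub>" by (rule braid_no_involution[OF kg(3) kg2(2)])
  then have zk: "z = embK n k" using kg by simp
  then show "snd z = \<one>\<^bsub>braid_group n\<^esub>" by simp
  have "k \<otimes>\<^bsub>K_group n\<^esub> k = \<one>\<^bsub>K_group n\<^esub>" using kg2(1) kg(2) by (simp add: g1 rho_plus_one)
  moreover have "k \<noteq> \<one>\<^bsub>K_group n\<^esub>" using z(3) unfolding zk KB_one by blast
  ultimately have "kemb n k + kemb n k = 0" "kemb n k \<noteq> 0"
    using kg(2) kemb_inj[OF kg(2) K.one_closed] by (auto simp: kemb_one simp flip: kemb_mult)
  then obtain w i where w: "nf (kemb n k) = w @ i # rev w" "kemb n k = word w + gen i - word w"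
    by (rule involution_palindrome) simp
  have wi: "set w \<subseteq> {1..n}" "i \<in> {1..n}" using kemb_in_Kset[OF kg(2)] w(1) by (auto simp: Kset_def)
  have wc: "kword n w \<in> carrier (K_group n)" "K_gen n i \<in> carrier (K_group n)"
    using wi by (simp_all add: kword_closed K_gen_closed)
  have "k = kword n w \<otimes>\<^bsub>K_group n\<^esub> K_gen n i \<otimes>\<^bsub>K_group n\<^esub> inv\<^bsub>K_group n\<^esub> kword n w"
    using wc wi kg(2) w(2) by (intro kemb_inj) (auto simp: kemb_mult kemb_inv kemb_kword kemb_gen)
  then have z': "z = embK n (kword n w) \<otimes>\<^bsub>KB_group n\<^esub> xgen n i \<otimes>\<^bsub>KB_group n\<^esub> inv\<^bsub>KB_group n\<^esub> embK n (kword n w)"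
    unfolding zk xgen_def using wc by (simp only: E.hom_mult E.hom_inv K.m_closed K.inv_closed)
  obtain h where h: "h \<in> carrier (KB_group n)"
    "xgen n i = h \<otimes>\<^bsub>KB_group n\<^esub> xgen n 1 \<otimes>\<^bsub>KB_group n\<^esub> inv\<^bsub>KB_group n\<^esub> h"
    using xgen_conj_xgen_one[of i n] wi by auto
  have c: "embK n (kword n w) \<in> carrier (KB_group n)" "xgen n 1 \<in> carrier (KB_group n)"
    using wc(1) E.hom_closed xgen_closed[of 1 n] wi by auto
  have "z = (embK n (kword n w) \<otimes>\<^bsub>KB_group n\<^esub> h) \<otimes>\<^bsub>KB_group n\<^esub> xgen n 1 \<otimes>\<^bsub>KB_group n\<^esub>
      inv\<^bsub>KB_group n\<^esub> (embK n (kword n w) \<otimes>\<^bsub>KB_group n\<^esub> h)"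
    unfolding z' h(2) using c h(1) by (simp add: G.m_assoc G.inv_mult_group)
  then show "\<exists>h \<in> carrier (KB_group n). z = h \<otimes>\<^bsub>KB_group n\<^esub> xgen n 1 \<otimes>\<^bsub>KB_group n\<^esub> inv\<^bsub>KB_group n\<^esub> h"
    using c h(1) by blast
qed

subsection \<open>The exponent sum and the centralizer of \<open>K\<close>\<close>

definition bexp :: "nat \<Rightarrow> nat word set \<Rightarrow> int" where
  "bexp n = pres_lift {1..<n} (braid_rels n) integer_group (\<lambda>_. 1)"

lemma bexp_hom: "bexp n \<in> hom (braid_group n) integer_group"
  and bexp_gen: "i \<in> {1..<n} \<Longrightarrow> bexp n (braid_gen n i) = 1"
  unfolding bexp_def by (rule braid_lift[OF group_integer_group]; simp)+

lemma bexp_mult: "g \<in> carrier (braid_group n) \<Longrightarrow> h \<in> carrier (braid_group n) \<Longrightarrow>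
    bexp n (g \<otimes>\<^bsub>braid_group n\<^esub> h) = bexp n g + bexp n h"
  using hom_mult[OF bexp_hom] by simp

lemma bexp_one: "bexp n \<one>\<^bsub>braid_group n\<^esub> = 0"
  using hom_one[OF bexp_hom group_braid group_integer_group] by simp

lemma KB_exp_hom: "(\<lambda>z. bexp n (snd z)) \<in> hom (KB_group n) integer_group"
  by (rule homI) (auto simp: KB_carrier KB_mult bexp_mult)

context
  fixes n :: nat
begin

interpretation B: braid_elements "braid_group n" n "braid_gen n" by (rule braid_elements_braid_gen)

text \<open>\<open>\<tau> n 1\<close> is \<open>s\<^bsub>n-1\<^esub> \<cdots> s\<^sub>1\<close>, so this is the full twist.\<close>

definition full_twist :: "nat word set" where
  "full_twist = B.\<tau> n 1 [^]\<^bsub>braid_group n\<^esub> n"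

lemma bexp_\<tau>: "1 \<le> m \<Longrightarrow> m \<le> n \<Longrightarrow> bexp n (B.\<tau> m 1) = int m - 1"
proof (induction m)
  case (Suc m)
  then show ?case
    by (cases "m = 0") (simp_all add: bexp_mult bexp_one bexp_gen B.s_closed)
qed simp

lemma bexp_power: "g \<in> carrier (braid_group n) \<Longrightarrow> bexp n (g [^]\<^bsub>braid_group n\<^esub> (m::nat)) = int m * bexp n g"
  by (induction m) (simp_all add: bexp_one bexp_mult algebra_simps)

lemma full_twist_closed: "full_twist \<in> carrier (braid_group n)"
  by (simp add: full_twist_def)

lemma bexp_full_twist: "1 \<le> n \<Longrightarrow> bexp n full_twist = int n * (int n - 1)"
  by (simp add: full_twist_def bexp_power bexp_\<tau>)

lemma act_\<tau>_word:
  assumes "set w \<subseteq> {2..n}" "1 \<le> n"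
  shows "act n (B.\<tau> n 1) (word w) = gen n + word (map (\<lambda>i. i - 1) w) + gen n"
  using assms(1)
proof (induction w)
  case Nil
  show ?case by (simp add: add_hom_zero[OF add_hom_act])
next
  case (Cons i w)
  then show ?case using assms(2) by (simp add: add_hom_add[OF add_hom_act] act_\<tau> add.assoc)
qed

text \<open>\<open>\<tau> n 1\<close> rotates the letters cyclically by one place, up to conjugation
  by the letter \<open>n\<close>. The conjugators accumulate to the product of the last
  \<open>j\<close> letters; for \<open>j = n\<close> this is the boundary word and the rotation is
  trivial.\<close>

lemma act_\<tau>_power:
  assumes "j \<le> n" "i \<in> {1..n}"
  shows "act n (B.\<tau> n 1 [^]\<^bsub>braid_group n\<^esub> j) (gen i) =
    - word [Suc (n - j)..<Suc n] + gen (if j < i then i - j else i + n - j) + word [Suc (n - j)..<Suc n]"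
  using assms(1)
proof (induction j)
  case 0
  then show ?case using assms(2) by (simp add: K.baction_one)
next
  case (Suc j)
  let ?t = "B.\<tau> n 1"
  have n: "1 \<le> n" using Suc.prems by simp
  have tc: "?t \<in> carrier (braid_group n)" "?t [^]\<^bsub>braid_group n\<^esub> j \<in> carrier (braid_group n)" by simp_all
  let ?P = "word [Suc (n - j)..<Suc n]" and ?i = "if j < i then i - j else i + n - j"
  have eq: "?t [^]\<^bsub>braid_group n\<^esub> Suc j = ?t \<otimes>\<^bsub>braid_group n\<^esub> ?t [^]\<^bsub>braid_group n\<^esub> j"
    using tc(1) B.nat_pow_Suc2 by simp
  have "map (\<lambda>i. i - 1) [Suc (n - j)..<Suc n] = [n - j..<n]"
    by (intro nth_equalityI) (simp_all del: upt_Suc)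
  moreover have "set [Suc (n - j)..<Suc n] \<subseteq> {2..n}" using Suc.prems by auto
  ultimately have tP: "act n ?t ?P = gen n + (word [n - j..<n] + gen n)"
    using act_\<tau>_word[of "[Suc (n - j)..<Suc n]"] n by (simp add: add.assoc)
  have "[Suc (n - Suc j)..<Suc n] = [n - j..<n] @ [n]"
    using Suc.prems by (simp add: Suc_diff_Suc)
  then have P': "word [Suc (n - Suc j)..<Suc n] = word [n - j..<n] + gen n" by (simp del: upt_Suc)
  have ti: "act n ?t (gen ?i) = gen n + gen (if Suc j < i then i - Suc j else i + n - Suc j) + gen n"
  proof -
    have "?i \<in> {1..n}" using assms(2) Suc.prems by auto
    moreover have "(if ?i = 1 then n else ?i - 1) = (if Suc j < i then i - Suc j else i + n - Suc j)"
      using assms(2) Suc.prems by auto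
    ultimately show ?thesis using n by (auto simp: act_\<tau> add.assoc)
  qed
  have "act n (?t [^]\<^bsub>braid_group n\<^esub> Suc j) (gen i) = act n ?t (- ?P + gen ?i + ?P)"
    unfolding eq K.baction_mult[OF tc] using Suc by simp
  also have "\<dots> = - act n ?t ?P + act n ?t (gen ?i) + act n ?t ?P"
    by (simp only: add_hom_simps[OF add_hom_act[OF tc(1)]])
  also have "\<dots> = - (word [n - j..<n] + gen n) + gen (if Suc j < i then i - Suc j else i + n - Suc j) + (word [n - j..<n] + gen n)"
    unfolding tP ti by (simp add: ucox_diff minus_add add.assoc del: add_uminus_conv_diff)
  finally show ?case unfolding P' .
qed

lemma act_full_twist:
  assumes "a \<in> Kset n"
  shows "act n full_twist a = - boundary n + a + boundary n"
proof -
  have "add_hom (\<lambda>a. - boundary n + a - (- boundary n))"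
    by (rule add_hom_conj[OF add_hom_id])
  then have h: "add_hom (\<lambda>a. - boundary n + a + boundary n)" by simp
  show ?thesis
  proof (rule add_hom_eq[OF add_hom_act[OF full_twist_closed] h])
    fix i assume "i \<in> set (nf a)"
    then have "i \<in> {1..n}" using assms by (auto simp: Kset_def)
    then show "act n full_twist (gen i) = - boundary n + gen i + boundary n"
      using act_\<tau>_power[of n i] by (simp add: full_twist_def boundary_def One_nat_def del: upt_Suc)
  qed
qed

lemma act_full_twist_power:
  assumes "a \<in> Kset n"
  shows "act n (full_twist [^]\<^bsub>braid_group n\<^esub> (m::nat)) a = - zmul (int m) (boundary n) + a + zmul (int m) (boundary n)"
  using assms
proof (induction m arbitrary: a)
  case 0
  then show ?case by (simp add: K.baction_one)
next
  case (Suc m)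
  have "act n (full_twist [^]\<^bsub>braid_group n\<^esub> Suc m) a =
      act n (full_twist [^]\<^bsub>braid_group n\<^esub> m) (- boundary n + a + boundary n)"
    using full_twist_closed Suc.prems by (simp add: K.baction_mult act_full_twist)
  also have "\<dots> = - zmul (int m) (boundary n) + (- boundary n + a + boundary n) + zmul (int m) (boundary n)"
    using Suc.prems boundary_in_Kset by (intro Suc.IH Kset_add) auto
  also have "\<dots> = - zmul (int (Suc m)) (boundary n) + a + zmul (int (Suc m)) (boundary n)"
    using zmul_add[of 1 "int m" "boundary n"] by (simp add: ucox_diff minus_add add.assoc del: add_uminus_conv_diff)
  finally show ?case .
qed

lemma braid_faithful_Kset:
  assumes "g \<in> carrier (braid_group n)" "\<And>a. a \<in> Kset n \<Longrightarrow> act n g a = a"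
  shows "g = \<one>\<^bsub>braid_group n\<^esub>"
  using assms by (intro braid_faithful) auto

text \<open>Commuting with \<open>K\<close> means that the braid component acts as conjugation by
  \<open>- a\<close>, where \<open>a\<close> is the component in \<open>K\<close>. As braids fix the
  boundary word, \<open>a\<close> commutes with it and is its \<open>m\<close>-th power; by
  faithfulness the braid is the \<open>m\<close>-th power of the full twist, whose exponent sum is
  \<open>n * (n - 1)\<close>.\<close>

lemma centralizer_K:
  assumes n: "n \<ge> 2" and z: "z \<in> carrier (KB_group n)"
    and comm: "\<And>j. j \<in> {1..n} \<Longrightarrow> z \<otimes>\<^bsub>KB_group n\<^esub> xgen n j = xgen n j \<otimes>\<^bsub>KB_group n\<^esub> z"
  shows "\<exists>m. bexp n (snd z) = m * (int n * (int n - 1)) \<and> (m = 0 \<longrightarrow> z = \<one>\<^bsub>KB_group n\<^esub>)"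
proof -
  interpret K: group "K_group n" by (rule group_K)
  obtain k g where kg: "z = (k, g)" "k \<in> carrier (K_group n)" "g \<in> carrier (braid_group n)"
    using z by (auto simp: KB_carrier)
  define a where "a = kemb n k"
  have ag: "act n g (gen j) = - a + gen j + a" if j: "j \<in> {1..n}" for j
  proof -
    have "k \<otimes>\<^bsub>K_group n\<^esub> rho_plus n g (K_gen n j) = K_gen n j \<otimes>\<^bsub>K_group n\<^esub> k"
      using comm[OF j] kg by (simp add: xgen_def KB_mult rho_plus_one)
    then have "a + act n g (gen j) = gen j + a"
      using kg j kemb_mult[of k n "rho_plus n g (K_gen n j)"] kemb_mult[of "K_gen n j" n k]
      by (simp add: a_def K_gen_closed rho_plus_closed kemb_rho kemb_gen)
    then have "- a + (a + act n g (gen j)) = - a + (gen j + a)" by simp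
    then show ?thesis by (simp add: add.assoc)
  qed
  have "add_hom (\<lambda>b. - a + b - (- a))" by (rule add_hom_conj[OF add_hom_id])
  then have h: "add_hom (\<lambda>b. - a + b + a)" by simp
  have act: "act n g b = - a + b + a" if "b \<in> Kset n" for b
    by (rule add_hom_eq[OF add_hom_act[OF kg(3)] h]) (use that ag in \<open>auto simp: Kset_def\<close>)
  have "boundary n = - a + boundary n + a"
    using act[OF boundary_in_Kset] act_invariant(1)[OF kg(3)] by simp
  then have "a + boundary n = boundary n + a" by (metis add.assoc add_minus_cancel)
  then obtain m where m: "a = zmul m (boundary n)" using centralizer_boundary[OF n] by blast
  have "bexp n g = m * (int n * (int n - 1))"
  proof (cases "0 \<le> m")
    case True
    let ?t = "full_twist [^]\<^bsub>braid_group n\<^esub> nat m"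
    have tc: "?t \<in> carrier (braid_group n)" using full_twist_closed by simp
    have "inv\<^bsub>braid_group n\<^esub> ?t \<otimes>\<^bsub>braid_group n\<^esub> g = \<one>\<^bsub>braid_group n\<^esub>"
    proof (rule braid_faithful_Kset)
      show "act n (inv\<^bsub>braid_group n\<^esub> ?t \<otimes>\<^bsub>braid_group n\<^esub> g) b = b" if "b \<in> Kset n" for b
      proof -
        have "act n g b = act n ?t b" using act[OF that] act_full_twist_power[OF that, of "nat m"] True by (simp add: m)
        then show ?thesis using tc kg(3) by (simp add: K.baction_mult K.baction_inv)
      qed
    qed (use tc kg(3) in simp)
    then have "g = ?t" using tc kg(3) by (metis B.inv_equality B.inv_inv B.inv_closed)
    then have "bexp n g = int (nat m) * bexp n full_twist" using bexp_power[OF full_twist_closed] by metis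
    then show ?thesis using True n bexp_full_twist by simp
  next
    case False
    let ?t = "full_twist [^]\<^bsub>braid_group n\<^esub> nat (- m)"
    have tc: "?t \<in> carrier (braid_group n)" using full_twist_closed by simp
    have "?t \<otimes>\<^bsub>braid_group n\<^esub> g = \<one>\<^bsub>braid_group n\<^esub>"
    proof (rule braid_faithful_Kset)
      show "act n (?t \<otimes>\<^bsub>braid_group n\<^esub> g) b = b" if "b \<in> Kset n" for b
      proof -
        have "act n g b \<in> Kset n" using act_invariant(2)[OF kg(3) that] .
        then have "act n ?t (act n g b) = - zmul (- m) (boundary n) + (- a + b + a) + zmul (- m) (boundary n)"
          using act_full_twist_power[of "act n g b" "nat (- m)"] act[OF that] False by simp
        also have "\<dots> = b" unfolding m zmul_minus by (simp add: ucox_diff minus_add add.assoc del: add_uminus_conv_diff)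
        finally show ?thesis using tc kg(3) by (simp add: K.baction_mult)
      qed
    qed (use tc kg(3) in simp)
    then have "bexp n ?t + bexp n g = 0" using tc kg(3) bexp_one[of n] bexp_mult[of ?t n g] by metis
    moreover have "bexp n ?t = int (nat (- m)) * bexp n full_twist" by (rule bexp_power[OF full_twist_closed])
    ultimately show ?thesis using False n bexp_full_twist by simp
  qed
  moreover have "z = \<one>\<^bsub>KB_group n\<^esub>" if "m = 0"
  proof -
    have a0: "a = 0" using that m by simp
    then have "k = \<one>\<^bsub>K_group n\<^esub>" using kemb_inj[OF kg(2) K.one_closed] by (simp add: a_def kemb_one)
    moreover have "g = \<one>\<^bsub>braid_group n\<^esub>" using act a0 by (intro braid_faithful_Kset[OF kg(3)]) simp
    ultimately show ?thesis by (simp add: kg(1) KB_one)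
  qed
  ultimately show ?thesis using kg(1) by auto
qed

end

section \<open>Automorphism groups generated by inner automorphisms and an outer involution\<close>

definition inner_aut :: "('a, 'm) monoid_scheme \<Rightarrow> 'a \<Rightarrow> 'a \<Rightarrow> 'a" where
  "inner_aut G g = (\<lambda>x\<in>carrier G. g \<otimes>\<^bsub>G\<^esub> x \<otimes>\<^bsub>G\<^esub> inv\<^bsub>G\<^esub> g)"

lemma inner_auts_eq: "inner_auts G = inner_aut G ` carrier G"
  by (auto simp: inner_auts_def inner_aut_def)

lemma auto_eqI:
  assumes "f \<in> auto G" "g \<in> auto G" "\<And>x. x \<in> carrier G \<Longrightarrow> f x = g x"
  shows "f = g"
  using extensionalityI[OF auto_ext[OF assms(1)] auto_ext[OF assms(2)] assms(3)] .

lemma auto_closed: "f \<in> auto G \<Longrightarrow> x \<in> carrier G \<Longrightarrow> f x \<in> carrier G"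
  using auto_hom hom_in_carrier by metis

context group
begin

abbreviation (input) AG where "AG \<equiv> AutoGroup G"

lemma auto_mult: "f \<in> auto G \<Longrightarrow> g \<in> auto G \<Longrightarrow> f \<otimes>\<^bsub>AG\<^esub> g \<in> auto G"
  by (rule auto_mult_closed[OF is_group])

lemma auto_one: "\<one>\<^bsub>AG\<^esub> \<in> auto G"
  using group.is_monoid[OF AutoGroup] monoid.one_closed by (metis AutoGroup_carrier)

lemma auto_hom_mult: "f \<in> auto G \<Longrightarrow> x \<in> carrier G \<Longrightarrow> y \<in> carrier G \<Longrightarrow> f (x \<otimes> y) = f x \<otimes> f y"
  using auto_hom hom_mult by metis

lemma auto_hom_inv: "f \<in> auto G \<Longrightarrow> x \<in> carrier G \<Longrightarrow> f (inv x) = inv (f x)"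
  using group_hom.hom_inv[of G G f x] auto_hom[of f G]
  by (simp add: group_hom_def group_hom_axioms_def is_group)

lemma inner_aut_apply: "x \<in> carrier G \<Longrightarrow> inner_aut G g x = g \<otimes> x \<otimes> inv g"
  by (simp add: inner_aut_def)

lemma inner_aut_mult_apply:
  "g \<in> carrier G \<Longrightarrow> h \<in> carrier G \<Longrightarrow> x \<in> carrier G \<Longrightarrow>
    inner_aut G (g \<otimes> h) x = inner_aut G g (inner_aut G h x)"
  by (simp add: inner_aut_def m_assoc inv_mult_group)

lemma inner_aut_auto:
  assumes "g \<in> carrier G"
  shows "inner_aut G g \<in> auto G"
proof -
  have h: "inner_aut G g \<in> hom G G" if "g \<in> carrier G" for g
  proof (rule homI)
    fix x y assume "x \<in> carrier G" "y \<in> carrier G"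
    then show "inner_aut G g (x \<otimes> y) = inner_aut G g x \<otimes> inner_aut G g y"
      using that by (simp add: inner_aut_def m_assoc inv_solve_left flip: m_assoc[of "inv g" g])
  qed (use that in \<open>simp add: inner_aut_def\<close>)
  show ?thesis
  proof (rule autoI[OF h h])
    show "inner_aut G g \<in> extensional (carrier G)" by (simp add: inner_aut_def)
    fix x assume x: "x \<in> carrier G"
    show "inner_aut G g (inner_aut G (inv g) x) = x" "inner_aut G (inv g) (inner_aut G g x) = x"
      using x assms inner_aut_mult_apply[of g "inv g" x] inner_aut_mult_apply[of "inv g" g x]
      by (simp_all add: inner_aut_apply)
  qed (use assms in simp_all)
qed

lemma inner_aut_mult: "g \<in> carrier G \<Longrightarrow> h \<in> carrier G \<Longrightarrow>
    inner_aut G (g \<otimes> h) = inner_aut G g \<otimes>\<^bsub>AG\<^esub> inner_aut G h"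
  by (rule auto_eqI[where G = G]) (simp_all add: inner_aut_auto auto_mult auto_mult_apply inner_aut_mult_apply)

lemma inner_aut_conj:
  assumes "f \<in> auto G" "g \<in> carrier G"
  shows "f \<otimes>\<^bsub>AG\<^esub> inner_aut G g = inner_aut G (f g) \<otimes>\<^bsub>AG\<^esub> f"
proof (rule auto_eqI[where G = G])
  fix x assume x: "x \<in> carrier G"
  show "(f \<otimes>\<^bsub>AG\<^esub> inner_aut G g) x = (inner_aut G (f g) \<otimes>\<^bsub>AG\<^esub> f) x"
    using assms x
    by (simp add: auto_mult_apply inner_aut_auto auto_closed inner_aut_apply auto_hom_mult auto_hom_inv)
qed (use assms in \<open>simp_all add: auto_mult inner_aut_auto auto_closed\<close>)

lemma inner_aut_group_hom: "group_hom G AG (inner_aut G)"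
  using inner_aut_auto inner_aut_mult
  by (auto simp: group_hom_def group_hom_axioms_def is_group AutoGroup AutoGroup_carrier intro!: homI)

lemma kernel_inner_aut: "kernel G AG (inner_aut G) = centre G"
proof -
  have "inner_aut G z = \<one>\<^bsub>AG\<^esub> \<longleftrightarrow> (\<forall>g\<in>carrier G. z \<otimes> g = g \<otimes> z)" if z: "z \<in> carrier G" for z
  proof -
    have "inner_aut G z = \<one>\<^bsub>AG\<^esub> \<longleftrightarrow> (\<forall>g\<in>carrier G. inner_aut G z g = g)"
      using auto_eqI[OF inner_aut_auto[OF z] auto_one] by (auto simp: auto_one_apply)
    moreover have "inner_aut G z g = g \<longleftrightarrow> z \<otimes> g = g \<otimes> z" if "g \<in> carrier G" for g
      using that z inv_solve_right'[of g "z \<otimes> g" z] by (auto simp: inner_aut_apply)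
    ultimately show ?thesis by simp
  qed
  then show ?thesis by (auto simp: kernel_def centre_def)
qed

lemma inner_auts_subset: "inner_auts G \<subseteq> carrier AG"
  using inner_aut_auto by (auto simp: inner_auts_eq AutoGroup_carrier)

lemma inner_auts_normal: "inner_auts G \<lhd> AG"
proof -
  interpret A: group AG by (rule AutoGroup)
  interpret I: group_hom G AG "inner_aut G" by (rule inner_aut_group_hom)
  have "subgroup (inner_auts G) AG" unfolding inner_auts_eq by (rule I.img_is_subgroup)
  moreover have "f \<otimes>\<^bsub>AG\<^esub> i \<otimes>\<^bsub>AG\<^esub> inv\<^bsub>AG\<^esub> f \<in> inner_auts G" if f: "f \<in> carrier AG" and i: "i \<in> inner_auts G" for f i
  proof -
    obtain g where g: "i = inner_aut G g" "g \<in> carrier G" using i by (auto simp: inner_auts_eq)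
    have fa: "f \<in> auto G" using f by (simp add: AutoGroup_carrier)
    have "f \<otimes>\<^bsub>AG\<^esub> i \<otimes>\<^bsub>AG\<^esub> inv\<^bsub>AG\<^esub> f = inner_aut G (f g)"
      using f g auto_closed[OF fa g(2)] by (simp add: inner_aut_conj[OF fa g(2)] A.m_assoc)
    then show ?thesis using auto_closed[OF fa g(2)] by (simp add: inner_auts_eq)
  qed
  ultimately show ?thesis by (simp add: A.normal_inv_iff)
qed

end

text \<open>Once these facts are established, the structure of the automorphism group is formal and
  is derived for an arbitrary group.\<close>

locale outer_involution = group G for G (structure) +
  fixes e :: "'a \<Rightarrow> 'a"
  assumes e_auto: "e \<in> auto G" and e_e: "x \<in> carrier G \<Longrightarrow> e (e x) = x"
    and e_outer: "e \<notin> inner_auts G"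
    and generated: "generate (AutoGroup G) (inner_auts G \<union> {e}) = carrier (AutoGroup G)"
begin

abbreviation (input) A where "A \<equiv> AutoGroup G"
abbreviation (input) Z where "Z \<equiv> centre G"

interpretation A: group "AutoGroup G" by (rule AutoGroup)
interpretation I: group_hom G "AutoGroup G" "inner_aut G" by (rule inner_aut_group_hom)

lemma e_closed: "x \<in> carrier G \<Longrightarrow> e x \<in> carrier G"
  by (rule auto_closed[OF e_auto])

lemma eA: "e \<in> carrier A"
  by (simp add: AutoGroup_carrier e_auto)

lemma ee: "e \<otimes>\<^bsub>A\<^esub> e = \<one>\<^bsub>A\<^esub>"
  by (rule auto_eqI[where G = G]) (simp_all add: auto_mult auto_one e_auto auto_mult_apply auto_one_apply e_e)

lemma inv_e: "inv\<^bsub>A\<^esub> e = e"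
  using ee eA by (intro A.inv_equality)

text \<open>Powers of \<open>e\<close> indexed by the representatives 0 and 1 of the integers modulo
  2. Every automorphism is an inner one times some \<open>epow k\<close>, where \<open>k\<close> and
  the inner factor are unique.\<close>

definition epow :: "int \<Rightarrow> 'a \<Rightarrow> 'a" where
  "epow k = (if k = 0 then \<one>\<^bsub>A\<^esub> else e)"

lemma epow_A: "epow k \<in> carrier A"
  using eA by (simp add: epow_def)

lemma epow_inner: "epow k \<otimes>\<^bsub>A\<^esub> inner_aut G g = inner_aut G (if k = 0 then g else e g) \<otimes>\<^bsub>A\<^esub> epow k"
  if "g \<in> carrier G"
  using that inner_aut_conj[OF e_auto that] by (simp add: epow_def)

lemma epow_mult: "j \<in> {0, 1} \<Longrightarrow> k \<in> {0, 1} \<Longrightarrow> epow j \<otimes>\<^bsub>A\<^esub> epow k = epow ((j + k) mod 2)"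
  using eA ee by (auto simp: epow_def)

lemma inner_epow_mult:
  assumes "g \<in> carrier G" "h \<in> carrier G" "j \<in> {0, 1}" "k \<in> {0, 1}"
  shows "inner_aut G g \<otimes>\<^bsub>A\<^esub> epow j \<otimes>\<^bsub>A\<^esub> (inner_aut G h \<otimes>\<^bsub>A\<^esub> epow k) =
    inner_aut G (g \<otimes> (if j = 0 then h else e h)) \<otimes>\<^bsub>A\<^esub> epow ((j + k) mod 2)"
proof -
  let ?h = "if j = 0 then h else e h"
  have hc: "?h \<in> carrier G" using assms(2) e_closed by simp
  note c = I.hom_closed[OF assms(1)] I.hom_closed[OF assms(2)] I.hom_closed[OF hc] epow_A
  have "inner_aut G g \<otimes>\<^bsub>A\<^esub> epow j \<otimes>\<^bsub>A\<^esub> (inner_aut G h \<otimes>\<^bsub>A\<^esub> epow k) =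
      inner_aut G g \<otimes>\<^bsub>A\<^esub> (epow j \<otimes>\<^bsub>A\<^esub> inner_aut G h) \<otimes>\<^bsub>A\<^esub> epow k"
    using c by (simp only: A.m_assoc A.m_closed)
  also have "\<dots> = inner_aut G g \<otimes>\<^bsub>A\<^esub> inner_aut G ?h \<otimes>\<^bsub>A\<^esub> (epow j \<otimes>\<^bsub>A\<^esub> epow k)"
    unfolding epow_inner[OF assms(2)] using c by (simp only: A.m_assoc A.m_closed)
  also have "\<dots> = inner_aut G (g \<otimes> ?h) \<otimes>\<^bsub>A\<^esub> epow ((j + k) mod 2)"
    using I.hom_mult[OF assms(1) hc] epow_mult[OF assms(3,4)] by simp
  finally show ?thesis .
qed

lemma inner_epow_eq:
  assumes "g \<in> carrier G" "h \<in> carrier G" "j \<in> {0, 1}" "k \<in> {0, 1}"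
    and "inner_aut G g \<otimes>\<^bsub>A\<^esub> epow j = inner_aut G h \<otimes>\<^bsub>A\<^esub> epow k"
  shows "inner_aut G g = inner_aut G h" "j = k"
proof -
  note c = I.hom_closed[OF assms(1)] I.hom_closed[OF assms(2)]
  have out: False if "x \<in> carrier G" "y \<in> carrier G" "inner_aut G x = inner_aut G y \<otimes>\<^bsub>A\<^esub> e" for x y
  proof -
    have "e = inv\<^bsub>A\<^esub> inner_aut G y \<otimes>\<^bsub>A\<^esub> inner_aut G x"
      using that eA by (simp flip: A.m_assoc)
    also have "\<dots> = inner_aut G (inv y \<otimes> x)" using that by simp
    finally have "e \<in> inner_auts G"
      unfolding inner_auts_eq by (rule image_eqI) (use that in simp)
    then show False using e_outer by simp
  qed
  show "j = k"
    using assms(3-5) out[OF assms(1,2)] out[OF assms(2,1)] c by (auto simp: epow_def)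
  then show "inner_aut G g = inner_aut G h"
    using assms(5) c epow_A[of k] by simp
qed

lemma ex_inner_epow:
  assumes "f \<in> carrier A"
  shows "\<exists>g\<in>carrier G. \<exists>k\<in>{0, 1}. f = inner_aut G g \<otimes>\<^bsub>A\<^esub> epow k"
  using assms unfolding generated[symmetric]
proof (induction rule: generate.induct)
  case one
  then show ?case by (intro bexI[of _ \<one>] bexI[of _ 0]) (simp_all add: epow_def)
next
  case (incl f)
  then consider "f \<in> inner_auts G" | "f = e" by blast
  then show ?case
  proof cases
    case 1
    then obtain g where "f = inner_aut G g" "g \<in> carrier G" by (auto simp: inner_auts_eq)
    then show ?thesis by (intro bexI[of _ g] bexI[of _ 0]) (simp_all add: epow_def)
  next
    case 2
    then show ?thesis using eA by (intro bexI[of _ \<one>] bexI[of _ 1]) (simp_all add: epow_def)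
  qed
next
  case (inv f)
  then consider "f \<in> inner_auts G" | "f = e" by blast
  then show ?case
  proof cases
    case 1
    then obtain g where "f = inner_aut G g" "g \<in> carrier G" by (auto simp: inner_auts_eq)
    then show ?thesis by (intro bexI[of _ "inv g"] bexI[of _ 0]) (simp_all add: epow_def)
  next
    case 2
    then show ?thesis using eA inv_e by (intro bexI[of _ \<one>] bexI[of _ 1]) (simp_all add: epow_def)
  qed
next
  case (eng f f')
  then obtain g h j k where "g \<in> carrier G" "h \<in> carrier G" "j \<in> {0, 1}" "k \<in> {0, 1}"
    "f = inner_aut G g \<otimes>\<^bsub>A\<^esub> epow j" "f' = inner_aut G h \<otimes>\<^bsub>A\<^esub> epow k" by blast
  then show ?case using inner_epow_mult[of g h j k] e_closed[of h]
    by (intro bexI[of _ "g \<otimes> (if j = 0 then h else e h)"] bexI[of _ "(j + k) mod 2"]) auto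
qed

lemma generate_e: "generate A {e} = {\<one>\<^bsub>A\<^esub>, e}"
proof
  show "{\<one>\<^bsub>A\<^esub>, e} \<subseteq> generate A {e}" using generate.one[of A "{e}"] generate.incl[of e "{e}" A] by simp
  have "f \<in> {\<one>\<^bsub>A\<^esub>, e}" if "f \<in> generate A {e}" for f
    using that
  proof (induction rule: generate.induct)
    case (eng f g)
    then show ?case using eA ee by auto
  qed (use inv_e in auto)
  then show "generate A {e} \<subseteq> {\<one>\<^bsub>A\<^esub>, e}" by blast
qed

lemma semidirect_internal: "is_semidirect A (inner_auts G) (generate A {e})"
  unfolding is_semidirect_def
proof (intro conjI)
  show "inner_auts G \<lhd> A" by (rule inner_auts_normal)
  then interpret N: normal "inner_auts G" A .
  show "subgroup (generate A {e}) A" using eA by (intro A.generate_is_subgroup) simp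
  show "inner_auts G \<inter> generate A {e} = {\<one>\<^bsub>A\<^esub>}"
    using e_outer N.one_closed by (auto simp: generate_e)
  show "inner_auts G <#>\<^bsub>A\<^esub> generate A {e} = carrier A"
  proof
    show "inner_auts G <#>\<^bsub>A\<^esub> generate A {e} \<subseteq> carrier A"
      using inner_auts_subset eA by (auto simp: set_mult_def generate_e)
    show "carrier A \<subseteq> inner_auts G <#>\<^bsub>A\<^esub> generate A {e}"
    proof
      fix f assume "f \<in> carrier A"
      then obtain g k where "g \<in> carrier G" "f = inner_aut G g \<otimes>\<^bsub>A\<^esub> epow k" using ex_inner_epow by blast
      then show "f \<in> inner_auts G <#>\<^bsub>A\<^esub> generate A {e}"
        by (auto simp: set_mult_def generate_e inner_auts_eq epow_def)
    qed
  qed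
qed

lemma Z2: "k \<in> carrier (integer_mod_group 2) \<longleftrightarrow> k \<in> {0, 1}"
  by (auto simp: carrier_integer_mod_group)

text \<open>The inner automorphisms have index two, so telling inner from outer is a homomorphism
  onto the group of order 2 with kernel \<open>inner_auts G\<close>.\<close>

lemma Out_iso: "OutGroup G \<cong> integer_mod_group 2"
proof -
  let ?s = "\<lambda>f. if f \<in> inner_auts G then 0 else 1 :: int"
  have s: "?s (inner_aut G g \<otimes>\<^bsub>A\<^esub> epow k) = k" if g: "g \<in> carrier G" and k: "k \<in> {0, 1}" for g k
  proof (cases "k = 0")
    case True
    then show ?thesis using g by (simp add: epow_def inner_auts_eq)
  next
    case False
    then have "k = 1" using k by simp
    moreover have "inner_aut G g \<otimes>\<^bsub>A\<^esub> epow 1 \<noteq> inner_aut G h" if "h \<in> carrier G" for h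
      using inner_epow_eq(2)[OF g that, of 1 0] that by (auto simp: epow_def)
    ultimately show ?thesis by (auto simp: inner_auts_eq)
  qed
  have hom: "?s \<in> hom A (integer_mod_group 2)"
  proof (rule homI)
    fix f f' assume "f \<in> carrier A" "f' \<in> carrier A"
    then obtain g h j k where gh: "g \<in> carrier G" "h \<in> carrier G" and jk: "j \<in> {0, 1}" "k \<in> {0, 1}"
      and f: "f = inner_aut G g \<otimes>\<^bsub>A\<^esub> epow j" "f' = inner_aut G h \<otimes>\<^bsub>A\<^esub> epow k"
      using ex_inner_epow by metis
    have c: "g \<otimes> (if j = 0 then h else e h) \<in> carrier G" using gh e_closed[of h] by simp
    have "(j + k) mod 2 = 0 \<or> (j + k) mod 2 = 1" by presburger
    then have m: "(j + k) mod 2 \<in> {0, 1}" by simp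
    have "?s (f \<otimes>\<^bsub>A\<^esub> f') = (j + k) mod 2"
      unfolding f inner_epow_mult[OF gh jk] by (rule s[OF c m])
    then show "?s (f \<otimes>\<^bsub>A\<^esub> f') = ?s f \<otimes>\<^bsub>integer_mod_group 2\<^esub> ?s f'"
      unfolding f s[OF gh(1) jk(1)] s[OF gh(2) jk(2)] by (simp add: mult_integer_mod_group)
  qed (simp add: carrier_integer_mod_group)
  then interpret S: group_hom A "integer_mod_group 2" ?s
    by (simp add: group_hom_def group_hom_axioms_def A.is_group group_integer_mod_group)
  have "kernel A (integer_mod_group 2) ?s = inner_auts G"
    using inner_auts_subset by (auto simp: kernel_def)
  moreover have "?s ` carrier A = carrier (integer_mod_group 2)"
  proof
    show "?s ` carrier A \<subseteq> carrier (integer_mod_group 2)" by (auto simp: Z2)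
    have "0 \<in> ?s ` carrier A" "1 \<in> ?s ` carrier A"
      using inner_auts_eq inner_auts_subset e_outer eA by (auto intro!: image_eqI[of _ _ "inner_aut G \<one>"])
    then have "{0, 1} \<subseteq> ?s ` carrier A" by (intro insert_subsetI empty_subsetI)
    then show "carrier (integer_mod_group 2) \<subseteq> ?s ` carrier A" using Z2 by blast
  qed
  ultimately show ?thesis using S.FactGroup_iso by (simp add: OutGroup_def)
qed

lemma centre_normal: "Z \<lhd> G"
  using I.normal_kernel by (simp add: kernel_inner_aut)

interpretation N: normal "centre G" G by (rule centre_normal)
interpretation Q: group "G Mod centre G" by (rule N.factorgroup_is_group)

lemma coset_eq_iff:
  "g \<in> carrier G \<Longrightarrow> h \<in> carrier G \<Longrightarrow> Z #> g = Z #> h \<longleftrightarrow> inner_aut G g = inner_aut G h"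
proof -
  assume g: "g \<in> carrier G" and h: "h \<in> carrier G"
  have "Z #> g = Z #> h \<longleftrightarrow> g \<otimes> inv h \<in> Z"
    using g h N.rcos_module[OF is_group, of h g] repr_independence[of g Z h] N.subgroup_axioms rcos_self[OF g N.subgroup_axioms]
    by metis
  also have "\<dots> \<longleftrightarrow> inner_aut G (g \<otimes> inv h) = \<one>\<^bsub>A\<^esub>"
    unfolding kernel_inner_aut[symmetric] kernel_def using g h by simp
  also have "\<dots> \<longleftrightarrow> inner_aut G g \<otimes>\<^bsub>A\<^esub> inv\<^bsub>A\<^esub> inner_aut G h = \<one>\<^bsub>A\<^esub>" using g h by simp
  also have "\<dots> \<longleftrightarrow> inner_aut G g = inner_aut G h"
    using I.hom_closed[OF g] I.hom_closed[OF h] by (metis A.inv_closed A.inv_equality A.inv_inv A.r_inv)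
  finally show ?thesis .
qed

lemma Mod_carrier: "carrier (G Mod Z) = (\<lambda>g. Z #> g) ` carrier G"
  by (auto simp: FactGroup_def RCOSETS_def)

lemma Mod_mult: "g \<in> carrier G \<Longrightarrow> h \<in> carrier G \<Longrightarrow> (Z #> g) \<otimes>\<^bsub>G Mod Z\<^esub> (Z #> h) = Z #> (g \<otimes> h)"
  by (simp add: FactGroup_def N.rcos_sum)

lemma centre_closed: "z \<in> Z \<Longrightarrow> z \<in> carrier G"
  unfolding centre_def by blast

lemma e_centre: "e ` Z = Z"
proof -
  have sub: "e z \<in> Z" if "z \<in> Z" for z
  proof -
    have z: "z \<in> carrier G" "\<And>g. g \<in> carrier G \<Longrightarrow> z \<otimes> g = g \<otimes> z"
      using that unfolding centre_def by blast+
    have "e z \<otimes> g = g \<otimes> e z" if g: "g \<in> carrier G" for g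
    proof -
      have "e (z \<otimes> e g) = e (e g \<otimes> z)" using z(2)[OF e_closed[OF g]] by simp
      then show ?thesis
        unfolding auto_hom_mult[OF e_auto z(1) e_closed[OF g]] auto_hom_mult[OF e_auto e_closed[OF g] z(1)]
        by (simp only: e_e[OF g])
    qed
    then show ?thesis using e_closed[OF z(1)] unfolding centre_def by blast
  qed
  moreover have "z \<in> e ` Z" if "z \<in> Z" for z
    by (rule image_eqI[OF _ sub[OF that]]) (simp only: e_e[OF centre_closed[OF that]])
  ultimately show ?thesis by blast
qed

lemma e_coset: "g \<in> carrier G \<Longrightarrow> e ` (Z #> g) = Z #> e g"
proof -
  assume g: "g \<in> carrier G"
  have r: "Z #> x = (\<lambda>z. z \<otimes> x) ` Z" for x by (auto simp: r_coset_def)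
  have "e ` (Z #> g) = (\<lambda>z. e z \<otimes> e g) ` Z"
    unfolding r image_image
    by (rule image_cong[OF HOL.refl]) (simp only: auto_hom_mult[OF e_auto centre_closed g])
  also have "\<dots> = (\<lambda>z. z \<otimes> e g) ` (e ` Z)" by (simp add: image_image)
  also have "\<dots> = Z #> e g" unfolding e_centre r ..
  finally show ?thesis .
qed

definition e_action :: "int \<Rightarrow> 'a set \<Rightarrow> 'a set" where
  "e_action = (\<lambda>k\<in>carrier (integer_mod_group 2). \<lambda>W\<in>carrier (G Mod Z). if k = 0 then W else e ` W)"

lemma e_action_coset:
  "k \<in> {0, 1} \<Longrightarrow> g \<in> carrier G \<Longrightarrow> e_action k (Z #> g) = Z #> (if k = 0 then g else e g)"
  by (auto simp: e_action_def Z2 Mod_carrier e_coset)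

lemma e_action_hom: "e_action \<in> hom (integer_mod_group 2) (AutoGroup (G Mod Z))"
proof -
  have ho: "e_action k \<in> hom (G Mod Z) (G Mod Z)" if k: "k \<in> {0, 1}" for k
  proof (rule homI)
    fix W assume "W \<in> carrier (G Mod Z)"
    then obtain g where g: "W = Z #> g" "g \<in> carrier G" by (auto simp: Mod_carrier)
    then show "e_action k W \<in> carrier (G Mod Z)"
      using k e_closed[OF g(2)] by (auto simp: e_action_coset Mod_carrier)
  next
    fix W Y assume "W \<in> carrier (G Mod Z)" "Y \<in> carrier (G Mod Z)"
    then obtain g h where g: "W = Z #> g" "g \<in> carrier G" and h: "Y = Z #> h" "h \<in> carrier G"
      by (auto simp: Mod_carrier)
    show "e_action k (W \<otimes>\<^bsub>G Mod Z\<^esub> Y) = e_action k W \<otimes>\<^bsub>G Mod Z\<^esub> e_action k Y"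
      unfolding g(1) h(1) Mod_mult[OF g(2) h(2)]
      using k g h e_closed by (simp add: e_action_coset N.rcos_sum auto_hom_mult[OF e_auto])
  qed
  have inv: "e_action k (e_action k W) = W" if "k \<in> {0, 1}" "W \<in> carrier (G Mod Z)" for k W
    using that e_closed e_e by (auto simp: Mod_carrier e_action_coset)
  have au: "e_action k \<in> auto (G Mod Z)" if k: "k \<in> {0, 1}" for k
    by (rule autoI[OF ho[OF k] ho[OF k]]) (use k inv in \<open>auto simp: e_action_def Z2\<close>)
  show ?thesis
  proof (rule homI)
    fix j k assume "j \<in> carrier (integer_mod_group 2)" "k \<in> carrier (integer_mod_group 2)"
    then have jk: "j \<in> {0, 1}" "k \<in> {0, 1}" by (simp_all add: Z2)
    then have jk': "(j + k) mod 2 \<in> {0, 1}" by auto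
    have "e_action ((j + k) mod 2) = e_action j \<otimes>\<^bsub>AutoGroup (G Mod Z)\<^esub> e_action k"
    proof (rule auto_eqI[where G = "G Mod Z"])
      show "e_action j \<otimes>\<^bsub>AutoGroup (G Mod Z)\<^esub> e_action k \<in> auto (G Mod Z)"
        using au jk by (intro Q.auto_mult) auto
      fix W assume "W \<in> carrier (G Mod Z)"
      then obtain g where g: "W = Z #> g" "g \<in> carrier G" by (auto simp: Mod_carrier)
      then have "W \<in> carrier (G Mod Z)" by (auto simp: Mod_carrier)
      then have "(e_action j \<otimes>\<^bsub>AutoGroup (G Mod Z)\<^esub> e_action k) W = e_action j (e_action k W)"
        using au jk by (intro auto_mult_apply) auto
      then show "e_action ((j + k) mod 2) W = (e_action j \<otimes>\<^bsub>AutoGroup (G Mod Z)\<^esub> e_action k) W"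
        using jk jk' g e_closed[OF g(2)] e_e[OF g(2)] by (auto simp: e_action_coset)
    qed (use au jk' in auto)
    then show "e_action (j \<otimes>\<^bsub>integer_mod_group 2\<^esub> k) = e_action j \<otimes>\<^bsub>AutoGroup (G Mod Z)\<^esub> e_action k"
      by (simp add: mult_integer_mod_group)
  qed (use au in \<open>simp add: AutoGroup_carrier Z2\<close>)
qed

lemma AutoGroup_iso: "A \<cong> semidirect (G Mod Z) (integer_mod_group 2) e_action"
proof -
  let ?S = "semidirect (G Mod Z) (integer_mod_group 2) e_action"
  \<comment> \<open>\<open>inner_aut G\<close> is constant on each coset of the centre, so its image
    of a coset is a singleton and \<open>the_elem\<close> is meaningful.\<close>
  let ?f = "\<lambda>(W, k). the_elem (inner_aut G ` W) \<otimes>\<^bsub>A\<^esub> epow k"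
  have S: "group ?S" by (intro group_semidirect Q.is_group group_integer_mod_group e_action_hom)
  have te: "the_elem (inner_aut G ` (Z #> g)) = inner_aut G g" if g: "g \<in> carrier G" for g
  proof -
    have 1: "inner_aut G h = inner_aut G g" if "h \<in> Z #> g" for h
    proof -
      have "h \<in> carrier G" using that g N.subset r_coset_subset_G by blast
      moreover have "Z #> h = Z #> g" using repr_independence[OF that g N.subgroup_axioms] by simp
      ultimately show ?thesis using coset_eq_iff g by blast
    qed
    have 2: "g \<in> Z #> g" by (rule rcos_self[OF g N.subgroup_axioms])
    have "inner_aut G ` (Z #> g) = {inner_aut G g}"
    proof
      show "inner_aut G ` (Z #> g) \<subseteq> {inner_aut G g}" using 1 by (intro image_subsetI) simp
      show "{inner_aut G g} \<subseteq> inner_aut G ` (Z #> g)" using imageI[OF 2] by (intro insert_subsetI empty_subsetI)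
    qed
    then show ?thesis by simp
  qed
  have f: "?f (Z #> g, k) = inner_aut G g \<otimes>\<^bsub>A\<^esub> epow k" if "g \<in> carrier G" for g k
    using te[OF that] by simp
  have carr: "x \<in> carrier ?S \<longleftrightarrow> (\<exists>g\<in>carrier G. \<exists>k\<in>{0, 1}. x = (Z #> g, k))" for x
    by (cases x) (auto simp: semidirect_carrier Mod_carrier Z2)
  have "?f \<in> iso ?S A"
    unfolding iso_def
  proof (intro CollectI conjI)
    show "?f \<in> hom ?S A"
    proof (rule homI)
      fix x assume "x \<in> carrier ?S"
      then obtain g k where "g \<in> carrier G" "x = (Z #> g, k)" using carr by blast
      then show "?f x \<in> carrier A" using f epow_A by simp
    next
      fix x y assume "x \<in> carrier ?S" "y \<in> carrier ?S"
      then obtain g h j k where gh: "g \<in> carrier G" "h \<in> carrier G" and jk: "j \<in> {0, 1}" "k \<in> {0, 1}"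
        and xy: "x = (Z #> g, j)" "y = (Z #> h, k)" unfolding carr by blast
      have "x \<otimes>\<^bsub>?S\<^esub> y = (Z #> (g \<otimes> (if j = 0 then h else e h)), (j + k) mod 2)"
        using gh jk e_closed by (simp add: xy semidirect_mult e_action_coset N.rcos_sum mult_integer_mod_group)
      then show "?f (x \<otimes>\<^bsub>?S\<^esub> y) = ?f x \<otimes>\<^bsub>A\<^esub> ?f y"
        using gh e_closed f inner_epow_mult[OF gh jk] unfolding xy by simp
    qed
    show "bij_betw ?f (carrier ?S) (carrier A)"
      unfolding bij_betw_def
    proof
      show "inj_on ?f (carrier ?S)"
      proof (rule inj_onI)
        fix x y assume xy': "x \<in> carrier ?S" "y \<in> carrier ?S" and eq: "?f x = ?f y"
        obtain g h j k where gh: "g \<in> carrier G" "h \<in> carrier G" and jk: "j \<in> {0, 1}" "k \<in> {0, 1}"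
          and xy: "x = (Z #> g, j)" "y = (Z #> h, k)" using xy' unfolding carr by blast
        have "inner_aut G g \<otimes>\<^bsub>A\<^esub> epow j = inner_aut G h \<otimes>\<^bsub>A\<^esub> epow k"
          using eq f[OF gh(1)] f[OF gh(2)] unfolding xy by simp
        from inner_epow_eq[OF gh jk this] show "x = y" using coset_eq_iff[OF gh] by (simp add: xy)
      qed
      show "?f ` carrier ?S = carrier A"
      proof
        show "?f ` carrier ?S \<subseteq> carrier A" using carr f epow_A by fastforce
        show "carrier A \<subseteq> ?f ` carrier ?S"
        proof
          fix a assume "a \<in> carrier A"
          then obtain g k where gk: "g \<in> carrier G" "k \<in> {0, 1}" "a = inner_aut G g \<otimes>\<^bsub>A\<^esub> epow k"
            using ex_inner_epow by blast
          then show "a \<in> ?f ` carrier ?S"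
            using f[OF gk(1), of k] carr[of "(Z #> g, k)"] by (intro image_eqI[of _ _ "(Z #> g, k)"]) auto
        qed
      qed
    qed
  qed
  then have "?S \<cong> A" by (auto simp: is_iso_def)
  then show ?thesis using group.iso_sym[OF S] by blast
qed

end

section \<open>Automorphisms of the semidirect product\<close>

lemma zmul_zmul: "zmul j (zmul k a) = zmul (j * k) a"
proof (induction j rule: int_induct[where k = 0])
  case (step1 i)
  then show ?case using zmul_succ[of i "zmul k a"] zmul_add[of "i * k" k a] by (simp add: algebra_simps)
next
  case (step2 i)
  have "zmul (i - 1) (zmul k a) + zmul k a = zmul (i * k) a"
    using zmul_succ[of "i - 1" "zmul k a"] step2 by simp
  moreover have "zmul ((i - 1) * k) a + zmul k a = zmul (i * k) a"
    using zmul_add[of "(i - 1) * k" k a] by (simp add: algebra_simps)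
  ultimately show ?case by (metis add_right_cancel)
qed simp

context
  fixes n :: nat
  assumes n: "n \<ge> 2"
begin

abbreviation (input) KBn where "KBn \<equiv> KB_group n"
abbreviation (input) "mulG" (infixl "\<odot>" 70) where "x \<odot> y \<equiv> x \<otimes>\<^bsub>KB_group n\<^esub> y"
abbreviation (input) "invG \<equiv> m_inv (KB_group n)"

interpretation G: group "KB_group n" by (rule group_KB)
interpretation K: group "K_group n" by (rule group_K)
interpretation B: braid_elements "braid_group n" n "braid_gen n" by (rule braid_elements_braid_gen)
interpretation A: group "AutoGroup (KB_group n)" by (rule G.AutoGroup)
interpretation EK: group_hom "K_group n" "KB_group n" "embK n" by (rule embK_group_hom)

abbreviation embB where "embB g \<equiv> (\<one>\<^bsub>K_group n\<^esub>, g)"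

lemma embB_closed: "g \<in> carrier (braid_group n) \<Longrightarrow> embB g \<in> carrier KBn"
  by (simp add: KB_carrier)

lemma embK_closed: "k \<in> carrier (K_group n) \<Longrightarrow> embK n k \<in> carrier KBn"
  by (simp add: KB_carrier)

lemma embB_embK:
  assumes "g \<in> carrier (braid_group n)" "k \<in> carrier (K_group n)"
  shows "embB g \<odot> embK n k = embK n (rho_plus n g k) \<odot> embB g"
  using assms by (simp add: KB_mult rho_plus_closed rho_plus_one del: EK.hom_one)

section \<open>Restriction of automorphisms to \<open>K\<close>\<close>

definition onK :: "(nat word set \<times> nat word set \<Rightarrow> nat word set \<times> nat word set) \<Rightarrow> nat word set \<Rightarrow> nat word set" where
  "onK f k = fst (f (embK n k))"

text \<open>The generators of \<open>K\<close> are involutions, so their images square to the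
  identity and have a trivial braid component. The homomorphism from \<open>K\<close> to the braid
  group obtained by projection is therefore trivial.\<close>

lemma auto_embK:
  assumes f: "f \<in> auto KBn" and k: "k \<in> carrier (K_group n)"
  shows "f (embK n k) = embK n (onK f k)" "onK f k \<in> carrier (K_group n)"
proof -
  have "snd \<in> hom KBn (braid_group n)" by (rule homI) (auto simp: KB_carrier KB_mult)
  then have h: "(\<lambda>k. snd (f (embK n k))) \<in> hom (K_group n) (braid_group n)"
    using hom_compose[OF hom_compose[OF emb_K_hom auto_hom[OF f]]] by (simp add: comp_def)
  have o: "(\<lambda>k. \<one>\<^bsub>braid_group n\<^esub>) \<in> hom (K_group n) (braid_group n)" by (rule homI) simp_all
  have "snd (f (embK n k)) = \<one>\<^bsub>braid_group n\<^esub>"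
  proof (rule K_hom_eq[OF group_braid h o _ k])
    fix j assume j: "j \<in> {1..n}"
    have xc: "xgen n j \<in> carrier KBn" by (rule xgen_closed[OF j])
    have "xgen n j \<odot> xgen n j = \<one>\<^bsub>KBn\<^esub>"
      using j by (simp add: xgen_def K_gen_closed K_gen_sq flip: EK.hom_mult)
    then have "f (xgen n j) \<odot> f (xgen n j) = f \<one>\<^bsub>KBn\<^esub>" using xc by (simp flip: G.auto_hom_mult[OF f])
    also have "\<dots> = \<one>\<^bsub>KBn\<^esub>" by (rule hom_one[OF auto_hom[OF f] group_KB group_KB])
    finally have sq: "f (xgen n j) \<odot> f (xgen n j) = \<one>\<^bsub>KBn\<^esub>" .
    show "snd (f (embK n (K_gen n j))) = \<one>\<^bsub>braid_group n\<^esub>"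
    proof (cases "f (xgen n j) = \<one>\<^bsub>KBn\<^esub>")
      case True
      then show ?thesis unfolding xgen_def KB_one by (simp del: EK.hom_one)
    next
      case False
      from KB_involution_conj(1)[OF auto_closed[OF f xc] sq this] show ?thesis by (simp only: xgen_def)
    qed
  qed
  moreover have "f (embK n k) \<in> carrier KBn" using auto_closed[OF f embK_closed[OF k]] .
  ultimately show "f (embK n k) = embK n (onK f k)" "onK f k \<in> carrier (K_group n)"
    by (auto simp: KB_carrier onK_def prod_eq_iff)
qed

text \<open>The restriction of an automorphism to \<open>K\<close>, transported to the universal Coxeter group on all
  natural numbers.\<close>

definition Fmap :: "(nat word set \<times> nat word set \<Rightarrow> nat word set \<times> nat word set) \<Rightarrow> nat ucox \<Rightarrow> nat ucox" where
  "Fmap f = lift (\<lambda>i. if i \<in> {1..n} then kemb n (onK f (K_gen n i)) else gen i)"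

lemma onK_hom:
  assumes f: "f \<in> auto KBn"
  shows "onK f \<in> hom (K_group n) (K_group n)"
proof (rule homI)
  fix k l assume kl: "k \<in> carrier (K_group n)" "l \<in> carrier (K_group n)"
  have "embK n (onK f (k \<otimes>\<^bsub>K_group n\<^esub> l)) = embK n (onK f k \<otimes>\<^bsub>K_group n\<^esub> onK f l)"
    using kl auto_embK[OF f] embK_closed by (simp add: G.auto_hom_mult[OF f] flip: auto_embK(1)[OF f])
  then show "onK f (k \<otimes>\<^bsub>K_group n\<^esub> l) = onK f k \<otimes>\<^bsub>K_group n\<^esub> onK f l" by simp
qed (rule auto_embK(2)[OF f])

lemma add_hom_Fmap:
  assumes f: "f \<in> auto KBn"
  shows "add_hom (Fmap f)"
  unfolding Fmap_def
proof (rule add_hom_lift)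
  fix i
  have "kemb n (onK f (K_gen n i)) + kemb n (onK f (K_gen n i)) = 0" if i: "i \<in> {1..n}"
  proof -
    have "onK f (K_gen n i) \<otimes>\<^bsub>K_group n\<^esub> onK f (K_gen n i) = onK f \<one>\<^bsub>K_group n\<^esub>"
      using i by (simp add: K_gen_closed K_gen_sq flip: hom_mult[OF onK_hom[OF f]])
    then show ?thesis
      using auto_embK(2)[OF f K_gen_closed[OF i]] hom_one[OF onK_hom[OF f] group_K group_K]
      by (simp add: kemb_one flip: kemb_mult)
  qed
  then show "(if i \<in> {1..n} then kemb n (onK f (K_gen n i)) else gen i) +
      (if i \<in> {1..n} then kemb n (onK f (K_gen n i)) else gen i) = 0" by simp
qed

lemma Fmap_kemb:
  assumes f: "f \<in> auto KBn" and k: "k \<in> carrier (K_group n)"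
  shows "Fmap f (kemb n k) = kemb n (onK f k)"
proof (rule K_hom_eq[OF group_ugrp _ _ _ k])
  show "(\<lambda>k. Fmap f (kemb n k)) \<in> hom (K_group n) ugrp"
    by (rule homI) (simp_all add: kemb_mult add_hom_add[OF add_hom_Fmap[OF f]])
  show "(\<lambda>k. kemb n (onK f k)) \<in> hom (K_group n) ugrp"
    using hom_compose[OF onK_hom[OF f] kemb_hom] by (simp add: comp_def)
  show "Fmap f (kemb n (K_gen n j)) = kemb n (onK f (K_gen n j))" if "j \<in> {1..n}" for j
    using that by (simp add: kemb_gen Fmap_def)
qed

lemma ex_kemb:
  assumes "a \<in> Kset n"
  obtains k where "k \<in> carrier (K_group n)" "kemb n k = a"
proof -
  have "a \<in> kemb n ` carrier (K_group n)" unfolding kemb_image by (rule assms)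
  then show ?thesis by (elim imageE) (rule that; simp)
qed

lemma Fmap_Kset: "f \<in> auto KBn \<Longrightarrow> a \<in> Kset n \<Longrightarrow> Fmap f a \<in> Kset n"
  by (metis Fmap_kemb auto_embK(2) ex_kemb kemb_in_Kset)

lemma Fmap_comp:
  assumes "f \<in> auto KBn" "g \<in> auto KBn" "a \<in> Kset n"
  shows "Fmap (f \<otimes>\<^bsub>AutoGroup KBn\<^esub> g) a = Fmap f (Fmap g a)"
proof -
  obtain k where k: "k \<in> carrier (K_group n)" "kemb n k = a" using ex_kemb[OF assms(3)] .
  have "onK (f \<otimes>\<^bsub>AutoGroup KBn\<^esub> g) k = onK f (onK g k)"
    unfolding onK_def[of "f \<otimes>\<^bsub>AutoGroup KBn\<^esub> g"]
    using auto_mult_apply[OF assms(1,2) embK_closed[OF k(1)]] auto_embK[OF assms(2) k(1)]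
      auto_embK(1)[OF assms(1), of "onK g k"] by simp
  then show ?thesis
    using k assms auto_embK(2)[OF assms(2) k(1)] by (simp add: Fmap_kemb G.auto_mult flip: k(2))
qed

lemma auto_inverse:
  assumes "f \<in> auto KBn"
  shows "\<exists>f'. f' \<in> auto KBn \<and> (\<forall>x \<in> carrier KBn. f (f' x) = x) \<and> (\<forall>x \<in> carrier KBn. f' (f x) = x)"
proof (intro exI conjI ballI)
  let ?f = "inv\<^bsub>AutoGroup KBn\<^esub> f"
  have fA: "f \<in> carrier (AutoGroup KBn)" using assms by (simp add: AutoGroup_carrier)
  show f': "?f \<in> auto KBn" using A.inv_closed[OF fA] by (simp add: AutoGroup_carrier)
  show "f (?f x) = x" if "x \<in> carrier KBn" for x
    using auto_mult_apply[OF assms f' that] A.r_inv[OF fA] auto_one_apply[OF that] by simp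
  show "?f (f x) = x" if "x \<in> carrier KBn" for x
    using auto_mult_apply[OF f' assms that] A.l_inv[OF fA] auto_one_apply[OF that] by simp
qed

lemma Fmap_inverse:
  assumes "f \<in> auto KBn" "f' \<in> auto KBn" "\<And>x. x \<in> carrier KBn \<Longrightarrow> f (f' x) = x" "a \<in> Kset n"
  shows "Fmap f (Fmap f' a) = a"
proof -
  obtain k where k: "k \<in> carrier (K_group n)" "kemb n k = a" using ex_kemb[OF assms(4)] .
  have "onK f (onK f' k) = k"
    unfolding onK_def[of f] using auto_embK(1)[OF assms(2) k(1)] assms(3)[OF embK_closed[OF k(1)]]
    by (metis fst_conv)
  then show ?thesis using k assms auto_embK(2)[OF assms(2) k(1)] by (simp add: Fmap_kemb flip: k(2))
qed

lemma inj_on_Fmap: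
  assumes "f \<in> auto KBn"
  shows "inj_on (Fmap f) (Kset n)"
proof -
  obtain f' where "f' \<in> auto KBn" "\<And>x. x \<in> carrier KBn \<Longrightarrow> f (f' x) = x" "\<And>x. x \<in> carrier KBn \<Longrightarrow> f' (f x) = x"
    using auto_inverse[OF assms] by blast
  then have "Fmap f' (Fmap f a) = a" if "a \<in> Kset n" for a using Fmap_inverse assms that by blast
  then show ?thesis by (rule inj_on_inverseI)
qed

text \<open>An automorphism normalizes the image of the whole group in \<open>Aut K\<close>, and the braid group fixes the
  boundary word.\<close>

lemma Fmap_boundary_invariant:
  assumes f: "f \<in> auto KBn"
  shows "braid_invariant n (Fmap f (boundary n))"
  unfolding braid_invariant_def
proof
  fix g assume g: "g \<in> carrier (braid_group n)"
  obtain d where d: "d \<in> carrier (K_group n)" "kemb n d = boundary n" using ex_kemb[OF boundary_in_Kset] .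
  obtain f' where f': "f' \<in> auto KBn" "\<And>x. x \<in> carrier KBn \<Longrightarrow> f (f' x) = x"
    "\<And>x. x \<in> carrier KBn \<Longrightarrow> f' (f x) = x" using auto_inverse[OF f] by blast
  \<comment> \<open>The preimage of the braid \<open>g\<close> under \<open>f\<close>. Its braid
    part \<open>h\<close> fixes the boundary element \<open>d\<close>, so it conjugates
    \<open>d\<close> as \<open>k\<close> does; applying \<open>f\<close> gives the conjugacy wanted
    for \<open>g\<close>.\<close>
  obtain k h where kh: "f' (embB g) = (k, h)" "k \<in> carrier (K_group n)" "h \<in> carrier (braid_group n)"
    using auto_closed[OF f'(1) embB_closed[OF g]] by (cases "f' (embB g)") (auto simp: KB_carrier)
  have fkh: "f (k, h) = embB g" using f'(2)[OF embB_closed[OF g]] kh(1) by simp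
  have khc: "(k, h) \<in> carrier KBn" using kh by (simp add: KB_carrier)
  have "kemb n (rho_plus n h d) = kemb n d" using d kh(3) by (simp add: kemb_rho act_invariant(1))
  then have rd: "rho_plus n h d = d" using kemb_inj[OF rho_plus_closed[OF kh(3) d(1)] d(1)] by simp
  have "(k, h) \<odot> embK n d = embK n (k \<otimes>\<^bsub>K_group n\<^esub> d \<otimes>\<^bsub>K_group n\<^esub> inv\<^bsub>K_group n\<^esub> k) \<odot> (k, h)"
    using kh d rd by (simp add: KB_mult rho_plus_one K.m_assoc del: EK.hom_mult)
  then have "f ((k, h) \<odot> embK n d) = f (embK n (k \<otimes>\<^bsub>K_group n\<^esub> d \<otimes>\<^bsub>K_group n\<^esub> inv\<^bsub>K_group n\<^esub> k) \<odot> (k, h))"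
    by simp
  then have "embB g \<odot> embK n (onK f d) = embK n (onK f (k \<otimes>\<^bsub>K_group n\<^esub> d \<otimes>\<^bsub>K_group n\<^esub> inv\<^bsub>K_group n\<^esub> k)) \<odot> embB g"
    using kh d khc embK_closed by (simp only: G.auto_hom_mult[OF f] fkh auto_embK(1)[OF f] K.m_closed K.inv_closed)
  then have "rho_plus n g (onK f d) = onK f (k \<otimes>\<^bsub>K_group n\<^esub> d \<otimes>\<^bsub>K_group n\<^esub> inv\<^bsub>K_group n\<^esub> k)"
    using g kh d auto_embK(2)[OF f] by (simp add: embB_embK KB_mult rho_plus_one rho_plus_closed del: EK.hom_mult)
  then have "kemb n (rho_plus n g (onK f d)) = kemb n (onK f (k \<otimes>\<^bsub>K_group n\<^esub> d \<otimes>\<^bsub>K_group n\<^esub> inv\<^bsub>K_group n\<^esub> k))" by simp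
  then have "act n g (Fmap f (kemb n d)) = Fmap f (kemb n (k \<otimes>\<^bsub>K_group n\<^esub> d \<otimes>\<^bsub>K_group n\<^esub> inv\<^bsub>K_group n\<^esub> k))"
    using g kh(2,3) d(1) auto_embK(2)[OF f] by (simp add: kemb_rho Fmap_kemb[OF f])
  also have "\<dots> = Fmap f (kemb n k) + Fmap f (kemb n d) - Fmap f (kemb n k)"
    using kh(2,3) d(1) by (simp add: kemb_mult kemb_inv add_hom_simps[OF add_hom_Fmap[OF f]])
  finally show "\<exists>l. act n g (Fmap f (boundary n)) = l + Fmap f (boundary n) - l" using d(2) by metis
qed

lemma boundary_double: "boundary n + boundary n \<noteq> 0"
proof
  assume "boundary n + boundary n = 0"
  moreover have "boundary n + boundary n = zmul 2 (boundary n)" using zmul_add[of 1 1 "boundary n"] by simp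
  ultimately have "size_of (zmul 2 (boundary n)) = 0" by simp
  then show False using n by (simp add: size_of_zmul_boundary)
qed

lemma Fmap_boundary_power:
  assumes f: "f \<in> auto KBn"
  shows "\<exists>k \<in> Kset n. \<exists>m. Fmap f (boundary n) = k + zmul m (boundary n) - k"
proof (rule braid_invariant_conj_boundary_power[OF n _ _ Fmap_boundary_invariant[OF f]])
  show "Fmap f (boundary n) \<in> Kset n" using Fmap_Kset[OF f boundary_in_Kset] .
  have "Fmap f (boundary n + boundary n) \<noteq> Fmap f 0"
    using inj_onD[OF inj_on_Fmap[OF f], of "boundary n + boundary n" 0] boundary_double Kset_add[OF boundary_in_Kset boundary_in_Kset]
    by auto
  then show "Fmap f (boundary n) + Fmap f (boundary n) \<noteq> 0"
    by (simp add: add_hom_simps[OF add_hom_Fmap[OF f]])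
qed

text \<open>Composing the formulas for \<open>f\<close> and its inverse exhibits the boundary word
  as a conjugate of its power with exponent \<open>m' * m\<close>. So this product is 1 or -1, and
  both exponents are units.\<close>

lemma Fmap_boundary:
  assumes f: "f \<in> auto KBn"
  shows "\<exists>k \<in> Kset n. Fmap f (boundary n) = k + boundary n - k \<or> Fmap f (boundary n) = k - boundary n - k"
proof -
  obtain f' where f': "f' \<in> auto KBn" "\<And>x. x \<in> carrier KBn \<Longrightarrow> f (f' x) = x"
    "\<And>x. x \<in> carrier KBn \<Longrightarrow> f' (f x) = x" using auto_inverse[OF f] by blast
  obtain k m where k: "k \<in> Kset n" "Fmap f (boundary n) = k + zmul m (boundary n) - k"
    using Fmap_boundary_power[OF f] by blast
  obtain k' m' where k': "k' \<in> Kset n" "Fmap f' (boundary n) = k' + zmul m' (boundary n) - k'"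
    using Fmap_boundary_power[OF f'(1)] by blast
  note h = add_hom_simps[OF add_hom_Fmap[OF f]] add_hom_zmul[OF add_hom_Fmap[OF f]]
  have "boundary n = Fmap f (Fmap f' (boundary n))" using Fmap_inverse[OF f f'(1,2) boundary_in_Kset] by simp
  also have "\<dots> = Fmap f k' + zmul m' (k + zmul m (boundary n) - k) - Fmap f k'" by (simp add: h k'(2) k(2))
  also have "zmul m' (k + zmul m (boundary n) - k) = k + zmul (m' * m) (boundary n) - k"
  proof -
    have "add_hom (\<lambda>b. k + b - k)" by (rule add_hom_conj[OF add_hom_id])
    from add_hom_zmul[OF this, of m' "zmul m (boundary n)"] show ?thesis by (simp add: zmul_zmul)
  qed
  also have "Fmap f k' + (k + zmul (m' * m) (boundary n) - k) - Fmap f k' =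
      (Fmap f k' + k) + zmul (m' * m) (boundary n) - (Fmap f k' + k)"
    by (simp add: ucox_diff minus_add add.assoc del: add_uminus_conv_diff)
  finally have "zmul 1 (boundary n) = (Fmap f k' + k) + zmul (m' * m) (boundary n) - (Fmap f k' + k)" by simp
  from boundary_power_conj[OF n this] have "\<bar>m * m'\<bar> = 1" by (simp add: mult.commute)
  from abs_zmult_eq_1[OF this] have "m = 1 \<or> m = -1" by linarith
  then show ?thesis using k by (auto simp: zmul_minus)
qed

text \<open>\<open>eps n\<close> inverts \<open>agen n j\<close>. Applied to the relation that makes
  \<open>xgen n (Suc j)\<close> the conjugate of \<open>xgen n j\<close> by \<open>agen n j\<close>,
  it yields the image of the former from that of the latter by the inverse braid generator.\<close>

lemma eps_onK:
  assumes "1 \<le> j" "j \<le> n"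
  shows "kemb n (onK (eps n) (K_gen n j)) = word [1..<j] + gen j - word [1..<j]"
  using assms
proof (induction j rule: dec_induct)
  case base
  then have "onK (eps n) (K_gen n 1) = K_gen n 1"
    using eps_xgen[OF n] by (simp add: onK_def xgen_def)
  then show ?case using base by (simp add: kemb_gen)
next
  case (step j)
  let ?e = "eps n" and ?s = "braid_gen n j"
  note e = eps_auto[OF n]
  have j: "j \<in> {1..<n}" "j \<in> {1..n}" "Suc j \<in> {1..n}" using step by auto
  have sc: "?s \<in> carrier (braid_group n)" using braid_gen_closed[OF j(1)] .
  have ac: "agen n j \<in> carrier KBn" "xgen n j \<in> carrier KBn" "xgen n (Suc j) \<in> carrier KBn"
    using j by (simp_all only: agen_closed xgen_closed)
  have "agen n j \<odot> xgen n j = xgen n (Suc j) \<odot> agen n j"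
    using embB_embK[OF sc K_gen_closed[OF j(2)]] j
    by (simp add: agen_def xgen_def rho_plus_gen braid_act_gen[OF j(1)] Suc_eq_plus1)
  then have "?e (agen n j) \<odot> ?e (xgen n j) = ?e (xgen n (Suc j)) \<odot> ?e (agen n j)"
    using ac by (simp flip: G.auto_hom_mult[OF e])
  then have "invG (agen n j) \<odot> ?e (xgen n j) = ?e (xgen n (Suc j)) \<odot> invG (agen n j)"
    using eps_agen[OF n j(1)] by simp
  then have eq: "?e (xgen n j) \<odot> agen n j = agen n j \<odot> ?e (xgen n (Suc j))"
    using ac auto_closed[OF e ac(2)] auto_closed[OF e ac(3)]
    by (metis G.inv_solve_left G.inv_solve_right' G.m_assoc G.m_closed G.inv_closed)
  let ?a = "onK ?e (K_gen n j)" and ?b = "onK ?e (K_gen n (Suc j))"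
  have abc: "?a \<in> carrier (K_group n)" "?b \<in> carrier (K_group n)"
    using auto_embK(2)[OF e] j K_gen_closed by blast+
  have "embK n ?a \<odot> embB ?s = embB ?s \<odot> embK n ?b"
    using eq auto_embK(1)[OF e K_gen_closed[OF j(2)]] auto_embK(1)[OF e K_gen_closed[OF j(3)]]
    unfolding xgen_def agen_def by simp
  then have "?a = rho_plus n ?s ?b"
    using sc abc unfolding embB_embK[OF sc abc(2)] by (simp add: KB_mult rho_plus_closed rho_plus_one)
  then have "kemb n ?a = act n ?s (kemb n ?b)" using sc abc by (simp add: kemb_rho)
  then have "kemb n ?b = act n (inv\<^bsub>braid_group n\<^esub> ?s) (word [1..<j] + gen j - word [1..<j])"
    using K.baction_inv(1)[OF sc] step by simp
  moreover have "act n (inv\<^bsub>braid_group n\<^esub> ?s) (word [1..<j]) = word [1..<j]"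
  proof -
    have "act n (inv\<^bsub>braid_group n\<^esub> ?s) (word w) = word w" if "set w \<subseteq> {1..<j}" for w
      using that j sc by (induction w) (auto simp: add_hom_simps[OF add_hom_act] act_inv_gen)
    then show ?thesis by simp
  qed
  ultimately show ?case
    using j sc by (simp add: add_hom_simps[OF add_hom_act] act_inv_gen ucox_diff minus_add add.assoc
      flip: Suc_eq_plus1 del: add_uminus_conv_diff)
qed

text \<open>The product telescopes: the image of the letter \<open>Suc m\<close> begins with
  \<open>word [1..<Suc m]\<close>, which cancels the inverse contributed by the letters before
  it.\<close>

lemma eps_boundary: "Fmap (eps n) (boundary n) = - boundary n"
proof -
  note h = add_hom_simps[OF add_hom_Fmap[OF eps_auto[OF n]]]
  have "Fmap (eps n) (word [1..<Suc m]) = - word [1..<Suc m]" if "m \<le> n" for m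
    using that
  proof (induction m)
    case 0
    then show ?case by (simp add: h One_nat_def)
  next
    case (Suc m)
    have "[1..<Suc (Suc m)] = [1..<Suc m] @ [Suc m]" by simp
    moreover have "Fmap (eps n) (gen (Suc m)) = word [1..<Suc m] + gen (Suc m) - word [1..<Suc m]"
      using Suc.prems eps_onK[of "Suc m"] by (simp add: Fmap_def del: upt_Suc)
    ultimately show ?case
      using Suc by (simp add: h ucox_diff minus_add add.assoc del: add_uminus_conv_diff upt_Suc)
  qed
  then show ?thesis by (simp add: boundary_def del: upt_Suc)
qed

text \<open>An automorphism which is the identity on \<open>K\<close> moves each \<open>\<alpha>\<^sub>i\<close> by an element of the centralizer
  of \<open>K\<close>, which is determined by its exponent sum.\<close>

definition fixK where
  "fixK f \<longleftrightarrow> f \<in> auto KBn \<and> (\<forall>j \<in> {1..n}. f (xgen n j) = xgen n j)"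

lemma fixK_embK:
  assumes "fixK f" "k \<in> carrier (K_group n)"
  shows "f (embK n k) = embK n k"
proof -
  have f: "f \<in> auto KBn" using assms by (simp add: fixK_def)
  have "(\<lambda>k. f (embK n k)) \<in> hom (K_group n) KBn"
    using hom_compose[OF emb_K_hom auto_hom[OF f]] by (simp add: comp_def)
  from K_hom_eq[OF group_KB this emb_K_hom _ assms(2)] show ?thesis
    using assms(1) by (simp add: fixK_def xgen_def)
qed

abbreviation eG where "eG z \<equiv> bexp n (snd z)"

lemma eG_mult: "x \<in> carrier KBn \<Longrightarrow> y \<in> carrier KBn \<Longrightarrow> eG (x \<odot> y) = eG x + eG y"
  using hom_mult[OF KB_exp_hom] by simp

lemma eG_inv: "x \<in> carrier KBn \<Longrightarrow> eG (invG x) = - eG x"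
proof -
  assume x: "x \<in> carrier KBn"
  have "eG x + eG (invG x) = eG \<one>\<^bsub>KBn\<^esub>"
    unfolding eG_mult[OF x G.inv_closed[OF x], symmetric] G.r_inv[OF x] ..
  also have "\<dots> = 0" by (simp only: KB_one snd_conv bexp_one)
  finally show ?thesis by simp
qed

lemma eG_xgen: "eG (xgen n j) = 0"
  by (simp add: xgen_def bexp_one)

lemma eG_agen: "i \<in> {1..<n} \<Longrightarrow> eG (agen n i) = 1"
  by (simp add: agen_def bexp_gen)

lemma fixK_difference:
  assumes f: "fixK f" and g: "fixK g" and i: "i \<in> {1..<n}"
  shows "\<exists>m. eG (f (agen n i)) = eG (g (agen n i)) + m * (int n * (int n - 1)) \<and>
    (m = 0 \<longrightarrow> f (agen n i) = g (agen n i))"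
proof -
  have fa: "f \<in> auto KBn" and ga: "g \<in> auto KBn" using f g by (simp_all add: fixK_def)
  have ac: "agen n i \<in> carrier KBn" using agen_closed[OF i] .
  let ?x = "f (agen n i)" and ?y = "g (agen n i)"
  have xy: "?x \<in> carrier KBn" "?y \<in> carrier KBn" using auto_closed[OF fa ac] auto_closed[OF ga ac] by auto
  let ?z = "invG ?y \<odot> ?x"
  have zc: "?z \<in> carrier KBn" using xy by simp
  have "?z \<odot> xgen n j = xgen n j \<odot> ?z" if j: "j \<in> {1..n}" for j
  proof -
    let ?k = "braid_act n i (K_gen n j)"
    have kc: "?k \<in> carrier (K_group n)" using hom_in_carrier[OF braid_act_hom[OF i] K_gen_closed[OF j]] .
    have c: "xgen n j \<in> carrier KBn" "embK n ?k \<in> carrier KBn" using xgen_closed[OF j] embK_closed[OF kc] .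
    have rel: "agen n i \<odot> xgen n j = embK n ?k \<odot> agen n i"
      using embB_embK[OF braid_gen_closed[OF i] K_gen_closed[OF j]] i unfolding agen_def xgen_def by (simp add: rho_plus_gen)
    have 1: "?x \<odot> xgen n j = embK n ?k \<odot> ?x"
      using arg_cong[OF rel, of f] c ac f j fixK_embK[OF f kc] by (simp add: G.auto_hom_mult[OF fa] fixK_def del: EK.hom_closed)
    have 2: "?y \<odot> xgen n j = embK n ?k \<odot> ?y"
      using arg_cong[OF rel, of g] c ac g j fixK_embK[OF g kc] by (simp add: G.auto_hom_mult[OF ga] fixK_def del: EK.hom_closed)
    have "invG ?y \<odot> embK n ?k = xgen n j \<odot> invG ?y"
      using 2 c xy by (metis G.inv_solve_left G.inv_solve_right' G.m_assoc G.m_closed G.inv_closed)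
    then have "invG ?y \<odot> (?x \<odot> xgen n j) = xgen n j \<odot> invG ?y \<odot> ?x"
      unfolding 1 using c xy by (simp flip: G.m_assoc)
    then show ?thesis using c xy by (simp add: G.m_assoc)
  qed
  from centralizer_K[OF n zc this] obtain m where
    m: "eG ?z = m * (int n * (int n - 1))" "m = 0 \<longrightarrow> ?z = \<one>\<^bsub>KBn\<^esub>" by blast
  have "eG ?x = eG ?y + m * (int n * (int n - 1))"
    using m(1) xy by (simp add: eG_mult eG_inv)
  moreover have "?x = ?y" if "m = 0"
    using m(2) that xy by (metis G.inv_equality G.inv_inv G.inv_closed)
  ultimately show ?thesis by blast
qed

lemma auto_eq_on_gens:
  assumes "f \<in> auto KBn" "g \<in> auto KBn" "f (xgen n 1) = g (xgen n 1)"
    and "\<And>i. i \<in> {1..<n} \<Longrightarrow> f (agen n i) = g (agen n i)"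
  shows "f = g"
  by (rule auto_eqI[OF assms(1,2)])
    (rule KB_hom_eq[OF n group_KB auto_hom[OF assms(1)] auto_hom[OF assms(2)] assms(3,4)])

lemma fixK_eqI:
  assumes f: "fixK f" and g: "fixK g" and e: "\<And>i. i \<in> {1..<n} \<Longrightarrow> eG (f (agen n i)) = eG (g (agen n i))"
  shows "f = g"
proof (rule auto_eq_on_gens)
  show "f \<in> auto KBn" "g \<in> auto KBn" using f g by (simp_all add: fixK_def)
  show "f (xgen n 1) = g (xgen n 1)" using f g n by (simp add: fixK_def)
  fix i assume i: "i \<in> {1..<n}"
  obtain m where m: "eG (f (agen n i)) = eG (g (agen n i)) + m * (int n * (int n - 1))"
    "m = 0 \<longrightarrow> f (agen n i) = g (agen n i)" using fixK_difference[OF f g i] by blast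
  have "m = 0" using m(1) e[OF i] n by simp
  then show "f (agen n i) = g (agen n i)" using m(2) by blast
qed

text \<open>The exponent sum turns the image of a braid relation into
  \<open>2 * a + b = 2 * b + a\<close> for the values \<open>a, b\<close> at neighbouring
  generators.\<close>

lemma auto_exponent:
  assumes f: "f \<in> auto KBn"
  shows "\<exists>c. \<forall>i \<in> {1..<n}. eG (f (agen n i)) = c"
proof -
  have adj: "eG (f (agen n (i + 1))) = eG (f (agen n i))" if i: "1 \<le> i" "i + 1 < n" for i
  proof -
    have ac: "agen n i \<in> carrier KBn" "agen n (i + 1) \<in> carrier KBn" using i by (auto intro: agen_closed)
    have sc: "braid_gen n i \<in> carrier (braid_group n)" "braid_gen n (i + 1) \<in> carrier (braid_group n)"
      using i by (auto intro: braid_gen_closed)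
    interpret EB: group_hom "braid_group n" KBn embB
      using emb_B_hom by (simp add: group_hom_def group_hom_axioms_def group_braid group_KB)
    have "agen n i \<odot> agen n (i + 1) \<odot> agen n i = agen n (i + 1) \<odot> agen n i \<odot> agen n (i + 1)"
      using B.s_braid'[OF i] sc unfolding agen_def by (simp flip: EB.hom_mult)
    from arg_cong[OF this, of "\<lambda>z. eG (f z)"] show ?thesis
      using ac auto_closed[OF f] by (simp add: G.auto_hom_mult[OF f] eG_mult)
  qed
  have const: "eG (f (agen n i)) = eG (f (agen n 1))" if "1 \<le> i" "i < n" for i
    using that
  proof (induction i rule: dec_induct)
    case (step i)
    then show ?case using adj[of i] by (simp add: Suc_eq_plus1)
  qed simp
  show ?thesis
  proof (intro exI ballI)
    show "eG (f (agen n i)) = eG (f (agen n 1))" if "i \<in> {1..<n}" for i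
      using that by (intro const) auto
  qed
qed

text \<open>Both sides are homomorphisms to the integers. They agree on \<open>xgen n 1\<close>,
  which \<open>f\<close> fixes and which has exponent 0, and on the braid generators by
  assumption.\<close>

lemma auto_exponent_all:
  assumes f: "fixK f" and c: "\<And>i. i \<in> {1..<n} \<Longrightarrow> eG (f (agen n i)) = c" and z: "z \<in> carrier KBn"
  shows "eG (f z) = c * eG z"
proof -
  have fa: "f \<in> auto KBn" using f by (simp add: fixK_def)
  show ?thesis
  proof (rule KB_hom_eq[OF n group_integer_group _ _ _ _ z])
    show "(\<lambda>z. eG (f z)) \<in> hom KBn integer_group"
      using hom_compose[OF auto_hom[OF fa] KB_exp_hom] by (simp add: comp_def)
    show "(\<lambda>z. c * eG z) \<in> hom KBn integer_group"
      by (rule homI) (simp_all add: eG_mult algebra_simps)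
    show "eG (f (xgen n 1)) = c * eG (xgen n 1)" using f n by (simp add: fixK_def eG_xgen)
  qed (simp add: c eG_agen)
qed

text \<open>The exponents of \<open>f\<close> and its inverse multiply to 1, so the common value is
  1 or -1. Comparison with the identity shows that it is congruent to 1 modulo
  \<open>n * (n - 1)\<close>; the value -1 makes this number a divisor of 2.\<close>

lemma fixK_exponent:
  assumes f: "fixK f"
  shows "(\<forall>i \<in> {1..<n}. eG (f (agen n i)) = 1) \<or> n = 2 \<and> (\<forall>i \<in> {1..<n}. eG (f (agen n i)) = -1)"
proof -
  have fa: "f \<in> auto KBn" using f by (simp add: fixK_def)
  obtain f' where f': "f' \<in> auto KBn" "\<And>x. x \<in> carrier KBn \<Longrightarrow> f (f' x) = x" "\<And>x. x \<in> carrier KBn \<Longrightarrow> f' (f x) = x"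
    using auto_inverse[OF fa] by blast
  have fix': "fixK f'"
    unfolding fixK_def
  proof (intro conjI ballI)
    show "f' (xgen n j) = xgen n j" if "j \<in> {1..n}" for j
      using f'(3)[OF xgen_closed[OF that]] f that by (simp add: fixK_def)
  qed (rule f'(1))
  from auto_exponent[OF fa] obtain c where c: "\<forall>i \<in> {1..<n}. eG (f (agen n i)) = c" ..
  from auto_exponent[OF f'(1)] obtain c' where c': "\<forall>i \<in> {1..<n}. eG (f' (agen n i)) = c'" ..
  have i1: "1 \<in> {1..<n}" using n by simp
  have ac: "agen n 1 \<in> carrier KBn" using agen_closed[OF i1] .
  have "1 = eG (f (f' (agen n 1)))" using f'(2)[OF ac] eG_agen[OF i1] by simp
  also have "\<dots> = c * eG (f' (agen n 1))" using c auto_closed[OF f'(1) ac] by (intro auto_exponent_all[OF f]) auto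
  also have "\<dots> = c * c'" using c' i1 by simp
  finally have "c * c' = 1" by simp
  then have cc: "c = 1 \<or> c = -1" by (auto simp: zmult_eq_1_iff)
  have idK: "fixK \<one>\<^bsub>AutoGroup KBn\<^esub>" using G.auto_one xgen_closed by (simp add: fixK_def auto_one_apply)
  obtain m where m: "c = 1 + m * (int n * (int n - 1))"
    using fixK_difference[OF f idK i1] c i1 ac eG_agen[OF i1] by (auto simp: auto_one_apply)
  have "n = 2" if "c = -1"
  proof (rule ccontr)
    assume "n \<noteq> 2"
    then have n3: "3 \<le> int n" using n by simp
    have "6 \<le> int n * (int n - 1)" using mult_mono[of 3 "int n" 2 "int n - 1"] n3 by simp
    moreover have "m * (int n * (int n - 1)) = -2" using m that by simp
    then have "int n * (int n - 1) dvd 2" by (metis dvd_minus_iff dvd_triv_right)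
    then have "int n * (int n - 1) \<le> 2" by (rule zdvd_imp_le) simp
    ultimately show False by simp
  qed
  then show ?thesis using cc c by blast
qed

lemma fixK_cases:
  assumes f: "fixK f"
  shows "f = \<one>\<^bsub>AutoGroup KBn\<^esub> \<or> f = inner_aut KBn (xgen n 1) \<otimes>\<^bsub>AutoGroup KBn\<^esub> eps n"
  using fixK_exponent[OF f]
proof (elim disjE conjE)
  assume e: "\<forall>i \<in> {1..<n}. eG (f (agen n i)) = 1"
  have "fixK \<one>\<^bsub>AutoGroup KBn\<^esub>" using G.auto_one xgen_closed by (simp add: fixK_def auto_one_apply)
  from fixK_eqI[OF f this] have "f = \<one>\<^bsub>AutoGroup KBn\<^esub>"
    using e eG_agen agen_closed by (simp add: auto_one_apply)
  then show ?thesis ..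
next
  assume n2: "n = 2" and e: "\<forall>i \<in> {1..<n}. eG (f (agen n i)) = -1"
  let ?x = "xgen n 1"
  let ?g = "inner_aut KBn ?x \<otimes>\<^bsub>AutoGroup KBn\<^esub> eps n"
  note ea = eps_auto[OF n]
  have x: "?x \<in> carrier KBn" using n by (intro xgen_closed) simp
  have ia: "inner_aut KBn ?x \<in> auto KBn" by (rule G.inner_aut_auto[OF x])
  have g_apply: "?g z = ?x \<odot> eps n z \<odot> invG ?x" if "z \<in> carrier KBn" for z
    using that auto_closed[OF ea that] by (simp add: auto_mult_apply[OF ia ea] G.inner_aut_apply)
  have "?g (xgen n j) = xgen n j" if j: "j \<in> {1..n}" for j
  proof -
    have jc: "K_gen n j \<in> carrier (K_group n)" "K_gen n 1 \<in> carrier (K_group n)"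
      using j n by (auto intro: K_gen_closed)
    have oc: "onK (eps n) (K_gen n j) \<in> carrier (K_group n)" by (rule auto_embK(2)[OF ea jc(1)])
    have "j = 1 \<or> j = 2" using j n2 by auto
    \<comment> \<open>For \<open>n = 2\<close> the restriction of \<open>eps n\<close> to
      \<open>K\<close> fixes the first letter and conjugates the second one by it, so it is itself a
      conjugation, which \<open>xgen n 1\<close> undoes.\<close>
    then have h1: "gen 1 + (word [1..<j] + gen j - word [1..<j]) - gen 1 = gen j"
      by (auto simp: diff_gen add.assoc minus_add upt_conv_Cons numeral_2_eq_2 One_nat_def)
    have h2: "kemb n (K_gen n 1 \<otimes>\<^bsub>K_group n\<^esub> onK (eps n) (K_gen n j) \<otimes>\<^bsub>K_group n\<^esub> inv\<^bsub>K_group n\<^esub> K_gen n 1) =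
        gen 1 + (word [1..<j] + gen j - word [1..<j]) - gen 1"
      using jc oc n eps_onK[of j] j by (simp add: kemb_mult kemb_inv kemb_gen diff_gen)
    have h3: "kemb n (K_gen n j) = gen j" using j by (simp add: kemb_gen)
    have "K_gen n 1 \<otimes>\<^bsub>K_group n\<^esub> onK (eps n) (K_gen n j) \<otimes>\<^bsub>K_group n\<^esub> inv\<^bsub>K_group n\<^esub> K_gen n 1 = K_gen n j"
    proof (rule kemb_inj)
      show "kemb n (K_gen n 1 \<otimes>\<^bsub>K_group n\<^esub> onK (eps n) (K_gen n j) \<otimes>\<^bsub>K_group n\<^esub> inv\<^bsub>K_group n\<^esub> K_gen n 1) = kemb n (K_gen n j)"
        unfolding h2 h1 h3 ..
    qed (use jc oc in auto)
    then have "xgen n j = embK n (K_gen n 1 \<otimes>\<^bsub>K_group n\<^esub> onK (eps n) (K_gen n j) \<otimes>\<^bsub>K_group n\<^esub> inv\<^bsub>K_group n\<^esub> K_gen n 1)"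
      by (simp add: xgen_def)
    also have "\<dots> = embK n (K_gen n 1) \<odot> embK n (onK (eps n) (K_gen n j)) \<odot> invG (embK n (K_gen n 1))"
      using jc oc by (simp only: EK.hom_mult EK.hom_inv K.m_closed K.inv_closed)
    also have "\<dots> = ?g (xgen n j)"
      using g_apply[OF xgen_closed[OF j]] auto_embK(1)[OF ea jc(1)] by (simp add: xgen_def)
    finally show ?thesis by simp
  qed
  then have fg: "fixK ?g" using G.auto_mult[OF ia ea] by (simp add: fixK_def)
  have "eG (?g (agen n i)) = -1" if i: "i \<in> {1..<n}" for i
    using g_apply[OF agen_closed[OF i]] eps_agen[OF n i] x agen_closed[OF i] eG_agen[OF i]
    by (simp add: eG_mult eG_inv eG_xgen)
  then have "f = ?g" using e by (intro fixK_eqI[OF f fg]) simp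
  then show ?thesis ..
qed

lemma eps_eps:
  assumes "z \<in> carrier KBn"
  shows "eps n (eps n z) = z"
proof -
  note ea = eps_auto[OF n]
  have "eps n \<otimes>\<^bsub>AutoGroup KBn\<^esub> eps n = \<one>\<^bsub>AutoGroup KBn\<^esub>"
  proof (rule auto_eq_on_gens[OF G.auto_mult[OF ea ea] G.auto_one])
    show "(eps n \<otimes>\<^bsub>AutoGroup KBn\<^esub> eps n) (xgen n 1) = \<one>\<^bsub>AutoGroup KBn\<^esub> (xgen n 1)"
      using n xgen_closed[of 1 n] by (simp add: auto_mult_apply[OF ea ea] auto_one_apply eps_xgen)
    show "(eps n \<otimes>\<^bsub>AutoGroup KBn\<^esub> eps n) (agen n i) = \<one>\<^bsub>AutoGroup KBn\<^esub> (agen n i)" if "i \<in> {1..<n}" for i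
      using that n agen_closed[OF that] by (simp add: auto_mult_apply[OF ea ea] auto_one_apply eps_agen G.auto_hom_inv[OF ea])
  qed
  then show ?thesis using auto_mult_apply[OF ea ea assms] auto_one_apply[OF assms] by simp
qed

text \<open>Conjugation preserves the exponent sum, whereas \<open>eps n\<close> changes it from 1
  to -1 on a braid generator.\<close>

lemma eps_not_inner: "eps n \<notin> inner_auts KBn"
proof
  assume "eps n \<in> inner_auts KBn"
  then obtain g where g: "g \<in> carrier KBn" "eps n = inner_aut KBn g" by (auto simp: inner_auts_eq)
  have i: "1 \<in> {1..<n}" using n by simp
  have ac: "agen n 1 \<in> carrier KBn" using agen_closed[OF i] .
  have "invG (agen n 1) = g \<odot> agen n 1 \<odot> invG g" using eps_agen[OF n i] g ac by (simp add: G.inner_aut_apply)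
  then have "eG (invG (agen n 1)) = eG (g \<odot> agen n 1 \<odot> invG g)" by simp
  then show False using g(1) ac eG_agen[OF i] by (simp add: eG_mult eG_inv)
qed

lemma auto_generated: "generate (AutoGroup KBn) (inner_auts KBn \<union> {eps n}) = carrier (AutoGroup KBn)"
proof
  let ?A = "AutoGroup KBn"
  let ?S = "generate ?A (inner_auts KBn \<union> {eps n})"
  note ea = eps_auto[OF n]
  have sub: "inner_auts KBn \<union> {eps n} \<subseteq> carrier ?A"
    using G.inner_auts_subset ea by (simp add: AutoGroup_carrier)
  show "?S \<subseteq> carrier ?A" using A.generate_incl[OF sub] .
  have S: "subgroup ?S ?A" by (rule A.generate_is_subgroup[OF sub])
  have inS: "inner_aut KBn g \<in> ?S" if "g \<in> carrier KBn" for g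
    using that by (intro generate.incl) (simp add: inner_auts_eq)
  have eS: "eps n \<in> ?S" by (rule generate.incl) simp
  show "carrier ?A \<subseteq> ?S"
  proof
    fix f assume "f \<in> carrier ?A"
    then have f: "f \<in> auto KBn" by (simp add: AutoGroup_carrier)
    obtain k where k: "k \<in> Kset n" "Fmap f (boundary n) = k + boundary n - k \<or> Fmap f (boundary n) = k - boundary n - k"
      using Fmap_boundary[OF f] by blast
    \<comment> \<open>Since \<open>eps n\<close> inverts the boundary word, composing with it
      corrects the sign, and afterwards the image is a conjugate of the boundary word
      itself.\<close>
    define t where "t = (if Fmap f (boundary n) = k + boundary n - k then \<one>\<^bsub>?A\<^esub> else eps n)"
    have t: "t \<in> auto KBn" "t \<in> ?S" using G.auto_one ea eS generate.one[of ?A] by (auto simp: t_def)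
    define f1 where "f1 = f \<otimes>\<^bsub>?A\<^esub> t"
    have f1: "f1 \<in> auto KBn" using G.auto_mult[OF f t(1)] by (simp add: f1_def)
    have one: "f \<otimes>\<^bsub>?A\<^esub> \<one>\<^bsub>?A\<^esub> = f" using f by (simp add: AutoGroup_carrier)
    have F1: "Fmap f1 (boundary n) = k + boundary n - k"
    proof (cases "Fmap f (boundary n) = k + boundary n - k")
      case True
      then show ?thesis by (simp add: f1_def t_def one)
    next
      case False
      then have "Fmap f1 (boundary n) = Fmap f (- boundary n)"
        by (simp add: f1_def t_def Fmap_comp[OF f ea boundary_in_Kset] eps_boundary)
      also have "\<dots> = - (k - boundary n - k)" using False k(2) by (simp add: add_hom_simps[OF add_hom_Fmap[OF f]])
      finally show ?thesis by (simp add: ucox_diff minus_add add.assoc del: add_uminus_conv_diff)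
    qed
    obtain l where l: "l \<in> carrier (K_group n)" "kemb n l = k" using ex_kemb[OF k(1)] .
    \<comment> \<open>Conjugation by this element undoes the conjugation by \<open>k\<close>, so
      that \<open>f2\<close> fixes the boundary word.\<close>
    define h where "h = embK n (inv\<^bsub>K_group n\<^esub> l)"
    have h: "h \<in> carrier KBn" using l(1) by (simp only: h_def embK_closed K.inv_closed)
    have ih: "inner_aut KBn h \<in> auto KBn" by (rule G.inner_aut_auto[OF h])
    define f2 where "f2 = inner_aut KBn h \<otimes>\<^bsub>?A\<^esub> f1"
    have f2: "f2 \<in> auto KBn" using G.auto_mult[OF ih f1] by (simp add: f2_def)
    have Fh: "Fmap (inner_aut KBn h) a = - k + a + k" if a: "a \<in> Kset n" for a
    proof -
      obtain p where p: "p \<in> carrier (K_group n)" "kemb n p = a" using ex_kemb[OF a] .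
      have "inner_aut KBn h (embK n p) = embK n (inv\<^bsub>K_group n\<^esub> l \<otimes>\<^bsub>K_group n\<^esub> p \<otimes>\<^bsub>K_group n\<^esub> inv\<^bsub>K_group n\<^esub> (inv\<^bsub>K_group n\<^esub> l))"
        using l p embK_closed[OF p(1)] unfolding h_def
        by (simp only: G.inner_aut_apply EK.hom_mult EK.hom_inv K.m_closed K.inv_closed)
      then have "onK (inner_aut KBn h) p = inv\<^bsub>K_group n\<^esub> l \<otimes>\<^bsub>K_group n\<^esub> p \<otimes>\<^bsub>K_group n\<^esub> l" using l by (simp add: onK_def)
      then show ?thesis using p l Fmap_kemb[OF ih p(1)] by (simp add: kemb_mult kemb_inv)
    qed
    have "k + boundary n - k \<in> Kset n" using Fmap_Kset[OF f1 boundary_in_Kset] unfolding F1 .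
    then have F2: "Fmap f2 (boundary n) = boundary n"
      unfolding f2_def Fmap_comp[OF ih f1 boundary_in_Kset] F1 by (subst Fh)
        (simp_all add: ucox_diff add.assoc del: add_uminus_conv_diff)
    obtain g where g: "g \<in> carrier (braid_group n)" "\<forall>i\<in>{1..n}. Fmap f2 (act n g (gen i)) = gen i"
      using boundary_fixing_is_braid[OF add_hom_Fmap[OF f2] inj_on_Fmap[OF f2] F2] by blast
    have gc: "embB g \<in> carrier KBn" by (rule embB_closed[OF g(1)])
    have ig: "inner_aut KBn (embB g) \<in> auto KBn" by (rule G.inner_aut_auto[OF gc])
    \<comment> \<open>On \<open>K\<close> conjugation by \<open>embB g\<close> is the action of
      \<open>g\<close>, so by the choice of \<open>g\<close> the composite fixes every generator of
      \<open>K\<close>.\<close>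
    define f3 where "f3 = f2 \<otimes>\<^bsub>?A\<^esub> inner_aut KBn (embB g)"
    have f3: "f3 \<in> auto KBn" using G.auto_mult[OF f2 ig] by (simp add: f3_def)
    have "f3 (xgen n j) = xgen n j" if j: "j \<in> {1..n}" for j
    proof -
      have kc: "K_gen n j \<in> carrier (K_group n)" "rho_plus n g (K_gen n j) \<in> carrier (K_group n)"
        using K_gen_closed[OF j] rho_plus_closed[OF g(1)] by auto
      have "inner_aut KBn (embB g) (embK n (K_gen n j)) = embK n (rho_plus n g (K_gen n j))"
        using embB_embK[OF g(1) kc(1)] gc embK_closed[OF kc(1)] embK_closed[OF kc(2)]
        by (simp add: G.inner_aut_apply G.m_assoc)
      then have "f3 (embK n (K_gen n j)) = embK n (onK f2 (rho_plus n g (K_gen n j)))"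
        using auto_mult_apply[OF f2 ig embK_closed[OF kc(1)]] auto_embK(1)[OF f2 kc(2)] by (simp add: f3_def)
      moreover have "kemb n (onK f2 (rho_plus n g (K_gen n j))) = kemb n (K_gen n j)"
        using Fmap_kemb[OF f2 kc(2)] g j by (simp add: kemb_rho kc kemb_gen)
      then have "onK f2 (rho_plus n g (K_gen n j)) = K_gen n j"
        using auto_embK(2)[OF f2 kc(2)] kc(1) by (intro kemb_inj)
      ultimately show ?thesis by (simp add: xgen_def)
    qed
    then have "fixK f3" using f3 by (simp add: fixK_def)
    from fixK_cases[OF this] have f3S: "f3 \<in> ?S"
    proof
      have "xgen n 1 \<in> carrier KBn" using n by (intro xgen_closed) simp
      then show "f3 \<in> ?S" if "f3 = inner_aut KBn (xgen n 1) \<otimes>\<^bsub>?A\<^esub> eps n"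
        unfolding that by (intro subgroup.m_closed[OF S] inS eS)
      show "f3 \<in> ?S" if "f3 = \<one>\<^bsub>?A\<^esub>"
        unfolding that by (rule subgroup.one_closed[OF S])
    qed
    have cA: "f \<in> carrier ?A" "t \<in> carrier ?A" "inner_aut KBn h \<in> carrier ?A" "inner_aut KBn (embB g) \<in> carrier ?A"
      using f t ih ig by (simp_all add: AutoGroup_carrier)
    have "f3 = inner_aut KBn h \<otimes>\<^bsub>?A\<^esub> (f \<otimes>\<^bsub>?A\<^esub> t) \<otimes>\<^bsub>?A\<^esub> inner_aut KBn (embB g)"
      by (simp add: f3_def f2_def f1_def)
    then have "f = inv\<^bsub>?A\<^esub> inner_aut KBn h \<otimes>\<^bsub>?A\<^esub> f3 \<otimes>\<^bsub>?A\<^esub> inv\<^bsub>?A\<^esub> inner_aut KBn (embB g) \<otimes>\<^bsub>?A\<^esub> inv\<^bsub>?A\<^esub> t"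
      using cA by (simp add: A.m_assoc A.inv_solve_left flip: A.m_assoc[of "inv\<^bsub>?A\<^esub> inner_aut KBn h" "inner_aut KBn h"])
    then show "f \<in> ?S"
      using f3S t(2) inS[OF h] inS[OF gc] subgroup.m_closed[OF S] subgroup.m_inv_closed[OF S] by metis
  qed
qed

lemma outer_involution_eps: "outer_involution KBn (eps n)"
  by unfold_locales (simp_all add: eps_auto[OF n] eps_eps eps_not_inner auto_generated[simplified])

end

theorem theorem4p11:
  fixes n :: nat
  assumes "n \<ge> 2"
  defines "G \<equiv> KB_group n"
  shows "generate (AutoGroup G) (inner_auts G \<union> {eps n}) = carrier (AutoGroup G)
    \<and> is_semidirect (AutoGroup G) (inner_auts G) (generate (AutoGroup G) {eps n})
    \<and> eps_action n \<in> hom (integer_mod_group 2) (AutoGroup (G Mod centre G))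
    \<and> AutoGroup G \<cong> semidirect (G Mod centre G) (integer_mod_group 2) (eps_action n)
    \<and> OutGroup G \<cong> integer_mod_group 2"
proof -
  interpret outer_involution G "eps n" unfolding G_def by (rule outer_involution_eps[OF assms(1)])
  have "eps_action n = e_action" unfolding e_action_def unfolding eps_action_def G_def ..
  then show ?thesis
    using generated semidirect_internal e_action_hom AutoGroup_iso Out_iso by simp
qed

end
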